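(* Let $g:[0,\infty)\to[0,1]$ satisfy: $g|_{[0,1]}$ is $C^1$-smooth, $g(\xi)=0$ for all $\xi>1$, $g(0)=g'(0)=0$, $g(1)=1$, and $g'(\xi)>g(\xi)/\xi$ for all $\xi\in(0,1]$ ($g'(1)$ is the left-hand derivative). Let $c>0$, and for $d>c$ consider $$x'(t)=-cx(t)+d\,g(x(t-1))\qquad (E_g)$$ with semiflow $\Gamma$ on $C^+$, the stationary point $\hat\xi_1$, the sets $W^{u,\pm}(\hat\xi_1)$, the solution $x^+:\mathbb R\to\mathbb R$ and the time $t_2$ as defined in the context (all depending on $d$). (A) If $d>c$, then $W^{u,-}(\hat\xi_1)$ connects $\hat\xi_1$ to $\hat 0$. (B) There exists a unique $d^*=d^*(c)>c$ with the following properties. (i) If $d\in(c,d^* )$, then $W^{u,+}(\hat\xi_1)$ connects $\hat\xi_1$ to $\hat 0$. (ii) If $d>d^*$, then there exist $m_0,m_1$ with $0<m_0<1<m_1\le d/c$ and a $\sigma>0$ such that $W^{u,+}(\hat\xi_1)\subset C^{2d}_{m_0,m_1}$, and for all $T\ge t_2$ the interval $[T,T+\sigma]$ contains at least one $t$ with $x^+(t)=1$. The $\omega$-limit set $\mathcal A=\omega_\Gamma(x^+_{t_2+1})$ is a nonempty compact subset of $C^{2d}_{m_0,m_1}$ with $x^+_t\to\mathcal A$ (i.e. $\mathrm{dist}(x_t^+,\mathcal A)\to0$) as $t\to\infty$, and $\hat 0\notin\mathcal A$, $\hat\xi_1\notin\mathcal A$. (iii) If $d>d^*$ and, in addition, $(E_g)$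 admits a periodic solution $p:\mathbb R\to(0,\infty)$ with minimal period $\omega_p$ such that $p(0)=1$, $p(t)>1$ for all $t\in[-1,0)$, and $(p(t),p(t-1))\ne(1,g^{-1}(c/d))$ for all $t\in(0,\omega_p]$ (where $g^{-1}$ is the inverse of $g|_{[0,1]}$), then $x^+_t\in\mathcal O=\{p_t:t\in[0,\omega_p]\}$ for all $t\ge t_2+1$, and $\mathcal A=\mathcal O$.
   Context: Notation. $C=C([-1,0],\mathbb R)$ with the maximum norm; $C^+=\{\psi\in C:\psi\ge0\}$. For a continuous $u$ defined on an interval containing $[t-1,t]$, $u_t\in C$ is $u_t(s)=u(t+s)$, $s\in[-1,0]$. For $\xi\ge0$, $\hat\xi\in C$ is the constant function with value $\xi$. $\phi\ll\psi$ means $\phi(s)<\psi(s)$ for all $s\in[-1,0]$. $C_{\kappa_1,\kappa_2}=\{\psi\in C^+:\kappa_1\le\psi(s)\le\kappa_2,\ s\in[-1,0]\}$ and $C^L_{\kappa_1,\kappa_2}=\{\psi\in C_{\kappa_1,\kappa_2}:|\psi(s_1)-\psi(s_2)|\le L|s_1-s_2|,\ s_1,s_2\in[-1,0]\}$. Solutions. A continuous $x:[T_1-1,T_2)\to[0,\infty)$ is a solution of $(E_g)$ on $[T_1-1,T_2)$ if $x(t)=e^{-c(t-\tau)}x(\tau)+d\int_\tau^te^{-c(t-s)}g(x(s-1))\,ds$ for all $T_1\le\tau<t<T_2$; a function on $\mathbb R$ is a solution if it is one on every $[T_1-1,\infty)$. For each $\phi\in C^+$ there is a unique solution $x^\phi:[-1,\infty)\to[0,\infty)$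 with $x_0^\phi=\phi$; $\Gamma(t,\phi)=x^\phi_t$ is the (not necessarily continuous) solution semiflow. $\omega_\Gamma(\phi)=\{\chi\in C^+:\Gamma(s_k,\phi)\to\chi\text{ for some }s_k\to\infty\}$. Stationary points. For $d>c$, the function $\xi\mapsto-c\xi+dg(\xi)$ has exactly two zeros in $[0,1]$: $0$ and $\xi_1=\xi_1(d)\in(0,1)$; moreover $dg'(\xi_1)>c$. Leading unstable set of $\hat\xi_1$. The characteristic function $\lambda\mapsto\lambda+c-dg'(\xi_1)e^{-\lambda}$ has a unique positive real zero $\lambda_0$; all other zeros form complex conjugate pairs $\lambda_j,\overline{\lambda_j}$, $j\ge1$, with $\lambda_0>\mathrm{Re}\,\lambda_1>\mathrm{Re}\,\lambda_2>\dots$. Let $P=\mathbb R\chi_0$, $\chi_0(s)=e^{\lambda_0s}$, and let $Q$ be the real generalized eigenspace of the rest of the spectrum, so $C=P\oplus Q$. Fix $\beta>1$ with $e^{\mathrm{Re}\lambda_1}<\beta<e^{\lambda_0}$. For suitable small open convex neighbourhoods $N_P\subset P$, $N_Q\subset Q$ of $0$, the local leading unstable manifold is $W^u_{\rm loc}(\hat\xi_1)=\hat\xi_1+\{\phi\in N_P+N_Q:\exists(\phi^k)_{k\le0},\ \phi^0=\phi,\ \hat\xi_1+\phi^{k+1}=\Gamma(1,\hat\xi_1+\phi^k)\ (k<0),\ \beta^{-k}\phi^k\in N_P+N_Q\ (k\le 0),\ \beta^{-k}\phi^k\to0\ (k\to-\infty)\}$; it is $\hat\xi_1$ plus the graph of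 a $C^1$ map $w:N_P\to N_Q$ with $w(0)=0$, $Dw(0)=0$, and (after shrinking) each of its points $\psi\neq\hat\xi_1$ satisfies $\psi\ll\hat\xi_1$ or $\hat\xi_1\ll\psi$. $W^{u,-}(\hat\xi_1)$ and $W^{u,+}(\hat\xi_1)$ are the forward extensions under $\Gamma$ of the points $\ll\hat\xi_1$, resp. $\gg\hat\xi_1$, of $W^u_{\rm loc}(\hat\xi_1)$. Each is a single entire orbit: $W^{u,\pm}(\hat\xi_1)=\{x^\pm_t:t\in\mathbb R\}$, where $x^\pm:\mathbb R\to\mathbb R$ are solutions of $(E_g)$ with $x^\pm(t)\to\xi_1$ as $t\to-\infty$, made unique by $x^\pm(0)=\xi_1+\kappa^\pm$ for fixed $\kappa^+\in(0,1-\xi_1)$, $\kappa^-\in(-\xi_1,0)$. Times $t_1,t_2$. There exist unique $t_1,t_2$ with $t_2>t_1+1>0$ such that $x^+(t_1)=x^+(t_2)=1$, $x^+$ strictly increases on $(-\infty,t_1+1]$, $x^+(t)>1$ for $t\in(t_1,t_2)$, and $x^+(t_2+s)=e^{-cs}$ for $s\in[0,1]$. Connecting orbits. For a solution $x:\mathbb R\to\mathbb R$, the orbit $\{x_t:t\in\mathbb R\}$ connects $S_-\subset C^+$ to $S_+\subset C^+$ if $\mathrm{dist}(x_t,S_-)\to0$ as $t\to-\infty$ and $\mathrm{dist}(x_t,S_+)\to0$ as $t\to\infty$ (a point is identified with the singleton). *)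

theory Defs
  imports "HOL-Complex_Analysis.Complex_Analysis"
begin

section \<open>The phase space\<close>

text \<open>The interval $[-1,0]$ is made a compact metric type, so that the library's type of bounded
  continuous functions over it is the Banach space $C([-1,0],\cdot)$ with the maximum norm.\<close>

typedef hist = "{-1..0::real}" morphisms of_hist to_hist
  by auto

declare [[coercion of_hist]]

instantiation hist :: metric_space
begin

definition dist_hist :: "hist \<Rightarrow> hist \<Rightarrow> real"
  where "dist_hist s r = dist (of_hist s) (of_hist r)"

definition uniformity_hist :: "(hist \<times> hist) filter"
  where "uniformity_hist = (INF e\<in>{0<..}. principal {(x, y). dist x y < e})"

definition open_hist :: "hist set \<Rightarrow> bool"
  where "open_hist U = (\<forall>x\<in>U. \<forall>\<^sub>F (x', y) in uniformity. x' = x \<longrightarrow> y \<in> U)"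

instance
proof
  fix x y z :: hist
  show "dist x y = 0 \<longleftrightarrow> x = y"
    by (simp add: dist_hist_def of_hist_inject)
  show "dist x y \<le> dist x z + dist y z"
    by (simp add: dist_hist_def dist_triangle2)
qed (rule uniformity_hist_def open_hist_def)+

end

type_synonym C = "hist \<Rightarrow>\<^sub>C real"

definition seg :: "(real \<Rightarrow> 'b::metric_space) \<Rightarrow> real \<Rightarrow> (hist \<Rightarrow>\<^sub>C 'b)"
  where "seg u t = Bcontfun (\<lambda>s. u (t + of_hist s))"

lemma seg_apply:
  assumes "continuous_on {t - 1..t} u"
  shows "apply_bcontfun (seg u t) s = u (t + of_hist s)"
proof -
  have mem: "t + of_hist s \<in> {t - 1..t}" for s
    using of_hist[of s] by auto
  have "continuous_on UNIV of_hist"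
    unfolding continuous_on_iff by (auto simp: dist_hist_def)
  then have "continuous_on UNIV (\<lambda>s. t + of_hist s)"
    by (intro continuous_intros)
  then have cont: "continuous_on UNIV (\<lambda>s. u (t + of_hist s))"
    using continuous_on_compose2[OF assms, of UNIV "\<lambda>s. t + of_hist s"] mem by blast
  have "bounded (u ` {t - 1..t})"
    using assms compact_continuous_image compact_imp_bounded by blast
  then have "bounded (range (\<lambda>s. u (t + of_hist s)))"
    by (rule bounded_subset) (use mem in auto)
  with cont show ?thesis
    unfolding seg_def by (simp add: Bcontfun_inverse bcontfun_def)
qed

definition Cplus :: "C set"
  where "Cplus = {\<psi> :: C. \<forall>s. 0 \<le> \<psi> s}"

definition strictly_below :: "C \<Rightarrow> C \<Rightarrow> bool"  (infix \<open>\<lless>\<close> 50)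
  where "\<phi> \<lless> \<psi> \<longleftrightarrow> (\<forall>s. \<phi> s < \<psi> s)"

definition Cbetween :: "real \<Rightarrow> real \<Rightarrow> C set"
  where "Cbetween \<kappa>1 \<kappa>2 = {\<psi> \<in> Cplus. \<forall>s. \<kappa>1 \<le> \<psi> s \<and> \<psi> s \<le> \<kappa>2}"

definition CLip :: "real \<Rightarrow> real \<Rightarrow> real \<Rightarrow> C set"
  where "CLip L \<kappa>1 \<kappa>2 =
    {\<psi> \<in> Cbetween \<kappa>1 \<kappa>2. \<forall>s1 s2. \<bar>\<psi> s1 - \<psi> s2\<bar> \<le> L * \<bar>of_hist s1 - of_hist s2\<bar>}"

section \<open>The nonlinearity and the equation\<close>

text \<open>Only the values of \<open>g\<close> on $[0,\infty)$ matter.  At $0$ and $1$ the derivative is one-sided: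
  \<open>g\<close> jumps from $1$ to $0$ at $1$.\<close>

definition nonlinearity :: "(real \<Rightarrow> real) \<Rightarrow> (real \<Rightarrow> real) \<Rightarrow> bool"
  where "nonlinearity g g' \<longleftrightarrow>
    (\<forall>\<xi>\<ge>0. 0 \<le> g \<xi> \<and> g \<xi> \<le> 1) \<and>
    (\<forall>\<xi>\<in>{0..1}. (g has_real_derivative g' \<xi>) (at \<xi> within {0..1})) \<and>
    continuous_on {0..1} g' \<and>
    (\<forall>\<xi>>1. g \<xi> = 0) \<and>
    g 0 = 0 \<and> g' 0 = 0 \<and> g 1 = 1 \<and>
    (\<forall>\<xi>\<in>{0<..1}. g' \<xi> > g \<xi> / \<xi>)"

definition solution_from ::
    "(real \<Rightarrow> real) \<Rightarrow> real \<Rightarrow> real \<Rightarrow> real \<Rightarrow> (real \<Rightarrow> real) \<Rightarrow> bool"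
  where "solution_from g c d T x \<longleftrightarrow>
    continuous_on {T - 1..} x \<and> (\<forall>t\<ge>T - 1. 0 \<le> x t) \<and>
    (\<forall>\<tau> t. T \<le> \<tau> \<and> \<tau> < t \<longrightarrow>
      x t = exp (- c * (t - \<tau>)) * x \<tau>
            + d * integral {\<tau>..t} (\<lambda>s. exp (- c * (t - s)) * g (x (s - 1))))"

definition entire_solution :: "(real \<Rightarrow> real) \<Rightarrow> real \<Rightarrow> real \<Rightarrow> (real \<Rightarrow> real) \<Rightarrow> bool"
  where "entire_solution g c d x \<longleftrightarrow> (\<forall>T. solution_from g c d T x)"

text \<open>A solution is determined only on $[-1,\infty)$ as a HOL function, so the description below
  picks the segment rather than the solution.\<close>

definition semiflow :: "(real \<Rightarrow> real) \<Rightarrow> real \<Rightarrow> real \<Rightarrow> real \<Rightarrow> C \<Rightarrow> C"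
  where "semiflow g c d t \<phi> =
    (THE \<psi>. \<exists>x. solution_from g c d 0 x \<and> seg x 0 = \<phi> \<and> \<psi> = seg x t)"

definition omega_limit :: "(real \<Rightarrow> real) \<Rightarrow> real \<Rightarrow> real \<Rightarrow> C \<Rightarrow> C set"
  where "omega_limit g c d \<phi> = {\<zeta> \<in> Cplus. \<exists>s :: nat \<Rightarrow> real.
    filterlim s at_top sequentially \<and> (\<lambda>k. semiflow g c d (s k) \<phi>) \<longlonglongrightarrow> \<zeta>}"

definition orbit :: "(real \<Rightarrow> real) \<Rightarrow> C set"
  where "orbit x = range (seg x)"

definition orbit_connects :: "(real \<Rightarrow> real) \<Rightarrow> C set \<Rightarrow> C set \<Rightarrow> bool"
  where "orbit_connects x S_minus S_plus \<longleftrightarrow>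
    ((\<lambda>t. infdist (seg x t) S_minus) \<longlongrightarrow> 0) at_bot \<and>
    ((\<lambda>t. infdist (seg x t) S_plus) \<longlongrightarrow> 0) at_top"

definition connects ::
    "(real \<Rightarrow> real) \<Rightarrow> real \<Rightarrow> real \<Rightarrow> C set \<Rightarrow> C set \<Rightarrow> C set \<Rightarrow> bool"
  where "connects g c d W S_minus S_plus \<longleftrightarrow>
    (\<exists>x. entire_solution g c d x \<and> W = orbit x \<and> orbit_connects x S_minus S_plus)"

section \<open>The stationary point and the linearization\<close>

definition xi1 :: "(real \<Rightarrow> real) \<Rightarrow> real \<Rightarrow> real \<Rightarrow> real"
  where "xi1 g c d = (THE \<xi>. 0 < \<xi> \<and> \<xi> < 1 \<and> - c * \<xi> + d * g \<xi> = 0)"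

definition char_fun :: "real \<Rightarrow> real \<Rightarrow> complex \<Rightarrow> complex"
  where "char_fun c a z = z + of_real c - of_real a * exp (- z)"

definition lambda0 :: "real \<Rightarrow> real \<Rightarrow> real"
  where "lambda0 c a = (THE l. 0 < l \<and> char_fun c a (of_real l) = 0)"

definition chi0 :: "real \<Rightarrow> real \<Rightarrow> C"
  where "chi0 c a = seg (\<lambda>s. exp (lambda0 c a * s)) 0"

definition P_space :: "real \<Rightarrow> real \<Rightarrow> C set"
  where "P_space c a = {r *\<^sub>R chi0 c a | r. True}"

text \<open>The graph of the generator $A\zeta=\zeta'$ of the complexified linear semigroup of
  $y'(t)=-cy(t)+ay(t-1)$; its domain consists of the $C^1$ functions with
  $\zeta'(0)=-c\zeta(0)+a\zeta(-1)$ and its spectrum is the zero set of \<open>char_fun c a\<close>.\<close>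

definition generator :: "real \<Rightarrow> real \<Rightarrow> (hist \<Rightarrow>\<^sub>C complex) \<Rightarrow> (hist \<Rightarrow>\<^sub>C complex) \<Rightarrow> bool"
  where "generator c a \<zeta> \<eta> \<longleftrightarrow>
    (\<forall>s. ((\<lambda>u. \<zeta> (to_hist u)) has_vector_derivative \<eta> s) (at (of_hist s) within {-1..0})) \<and>
    \<eta> (to_hist 0) = - of_real c * \<zeta> (to_hist 0) + of_real a * \<zeta> (to_hist (-1))"

definition complexify :: "C \<Rightarrow> (hist \<Rightarrow>\<^sub>C complex)"
  where "complexify \<phi> = Bcontfun (\<lambda>s. of_real (\<phi> s))"

definition resolvent :: "real \<Rightarrow> real \<Rightarrow> complex \<Rightarrow> (hist \<Rightarrow>\<^sub>C complex) \<Rightarrow> (hist \<Rightarrow>\<^sub>C complex)"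
  where "resolvent c a z \<phi> =
    (THE \<zeta>. \<exists>\<eta>. generator c a \<zeta> \<eta> \<and> (\<forall>s. z * \<zeta> s - \<eta> s = \<phi> s))"

text \<open>The Riesz spectral projection $\frac{1}{2\pi i}\oint (z-A)^{-1}\varphi\,dz$ over the circle of
  radius \<open>r\<close> about $\lambda_0$, evaluated at \<open>s\<close>.\<close>

definition spectral_proj :: "real \<Rightarrow> real \<Rightarrow> real \<Rightarrow> (hist \<Rightarrow>\<^sub>C complex) \<Rightarrow> hist \<Rightarrow> complex"
  where "spectral_proj c a r \<phi> s =
    contour_integral (circlepath (of_real (lambda0 c a)) r) (\<lambda>z. resolvent c a z \<phi> s)
      / (2 * of_real pi * \<i>)"

text \<open>The (realified) spectral subspace of the part of the spectrum other than $\lambda_0$ is the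
  kernel of the spectral projection belonging to $\lambda_0$, where the circle must not
  enclose any other point of the spectrum.\<close>

definition Q_space :: "real \<Rightarrow> real \<Rightarrow> C set"
  where "Q_space c a = {\<phi> :: C. \<exists>r>0.
    (\<forall>z \<in> cball (of_real (lambda0 c a)) r. char_fun c a z = 0 \<longrightarrow> z = of_real (lambda0 c a)) \<and>
    (\<forall>s. spectral_proj c a r (complexify \<phi>) s = 0)}"

section \<open>The leading unstable set\<close>

definition sum_set :: "C set \<Rightarrow> C set \<Rightarrow> C set"
  where "sum_set M N = {p + q | p q. p \<in> M \<and> q \<in> N}"

text \<open>Points outside $C^+$ are excluded from the backward sequences, since $\Gamma$ is defined on
  $C^+$ only.\<close>

definition Wu_loc ::
    "(real \<Rightarrow> real) \<Rightarrow> real \<Rightarrow> real \<Rightarrow> real \<Rightarrow> C set \<Rightarrow> C set \<Rightarrow> C set"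
  where "Wu_loc g c d \<beta> NP NQ =
    (let e = const_bcontfun (xi1 g c d) :: C in
     (+) e ` {\<phi> \<in> sum_set NP NQ. \<exists>\<Phi> :: int \<Rightarrow> C.
        \<Phi> 0 = \<phi> \<and>
        (\<forall>k<0. e + \<Phi> k \<in> Cplus \<and> e + \<Phi> (k + 1) = semiflow g c d 1 (e + \<Phi> k)) \<and>
        (\<forall>k\<le>0. (\<beta> powi (- k)) *\<^sub>R \<Phi> k \<in> sum_set NP NQ) \<and>
        ((\<lambda>k. (\<beta> powi (- k)) *\<^sub>R \<Phi> k) \<longlongrightarrow> 0) at_bot})"

text \<open>The admissible choices of $\beta$, $N_P$, $N_Q$.  Since $\lambda_1$ has the largest real part
  among the zeros other than $\lambda_0$, the bound $e^{\mathrm{Re}\lambda_1}<\beta$ is required of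
  all of them.  The derivative of \<open>w\<close> at a point of $N_P\subset P$ is meaningful on the line $P$
  only; \<open>Dw\<close> consists of continuous linear extensions to the whole space.\<close>

definition leading_setup ::
    "(real \<Rightarrow> real) \<Rightarrow> (real \<Rightarrow> real) \<Rightarrow> real \<Rightarrow> real \<Rightarrow> real \<Rightarrow> C set \<Rightarrow> C set \<Rightarrow> bool"
  where "leading_setup g g' c d \<beta> NP NQ \<longleftrightarrow>
    (let e = const_bcontfun (xi1 g c d) :: C;
         a = d * g' (xi1 g c d);
         W = Wu_loc g c d \<beta> NP NQ in
     1 < \<beta> \<and> \<beta> < exp (lambda0 c a) \<and>
     (\<forall>z. char_fun c a z = 0 \<and> z \<noteq> of_real (lambda0 c a) \<longrightarrow> exp (Re z) < \<beta>) \<and>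
     openin (top_of_set (P_space c a)) NP \<and> convex NP \<and> 0 \<in> NP \<and>
     openin (top_of_set (Q_space c a)) NQ \<and> convex NQ \<and> 0 \<in> NQ \<and>
     (\<exists>(w :: C \<Rightarrow> C) (Dw :: C \<Rightarrow> C \<Rightarrow>\<^sub>L C).
        w ` NP \<subseteq> NQ \<and>
        (\<forall>\<phi>\<in>NP. (w has_derivative blinfun_apply (Dw \<phi>)) (at \<phi> within NP)) \<and>
        continuous_on NP Dw \<and>
        w 0 = 0 \<and> (\<forall>p \<in> P_space c a. blinfun_apply (Dw 0) p = 0) \<and>
        W = {e + (\<phi> + w \<phi>) | \<phi>. \<phi> \<in> NP}) \<and>
     (\<forall>\<psi>\<in>W. \<psi> \<noteq> e \<longrightarrow> \<psi> \<lless> e \<or> e \<lless> \<psi>))"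

definition Wu_minus ::
    "(real \<Rightarrow> real) \<Rightarrow> real \<Rightarrow> real \<Rightarrow> real \<Rightarrow> C set \<Rightarrow> C set \<Rightarrow> C set"
  where "Wu_minus g c d \<beta> NP NQ =
    {semiflow g c d t \<psi> | t \<psi>.
       0 \<le> t \<and> \<psi> \<in> Wu_loc g c d \<beta> NP NQ \<and> \<psi> \<lless> const_bcontfun (xi1 g c d)}"

definition Wu_plus ::
    "(real \<Rightarrow> real) \<Rightarrow> real \<Rightarrow> real \<Rightarrow> real \<Rightarrow> C set \<Rightarrow> C set \<Rightarrow> C set"
  where "Wu_plus g c d \<beta> NP NQ =
    {semiflow g c d t \<psi> | t \<psi>.
       0 \<le> t \<and> \<psi> \<in> Wu_loc g c d \<beta> NP NQ \<and> const_bcontfun (xi1 g c d) \<lless> \<psi>}"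

text \<open>The solution $x^+$ with its times $t_1,t_2$.  The value at $0$ alone does not fix the
  phase, because $x^+$ may return to $\xi_1+\kappa^+$ after $t_2$; together with $t_1+1>0$ it does.\<close>

definition plus_solution ::
    "(real \<Rightarrow> real) \<Rightarrow> real \<Rightarrow> real \<Rightarrow> C set \<Rightarrow> real \<Rightarrow> (real \<Rightarrow> real) \<Rightarrow> real \<Rightarrow> real \<Rightarrow> bool"
  where "plus_solution g c d W \<kappa> x t1 t2 \<longleftrightarrow>
    entire_solution g c d x \<and> W = orbit x \<and> (x \<longlongrightarrow> xi1 g c d) at_bot \<and>
    x 0 = xi1 g c d + \<kappa> \<and>
    t2 > t1 + 1 \<and> t1 + 1 > 0 \<and> x t1 = 1 \<and> x t2 = 1 \<and>
    strict_mono_on {..t1 + 1} x \<and>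
    (\<forall>t\<in>{t1<..<t2}. x t > 1) \<and>
    (\<forall>s\<in>{0..1}. x (t2 + s) = exp (- c * s))"

definition minimal_period :: "(real \<Rightarrow> real) \<Rightarrow> real \<Rightarrow> bool"
  where "minimal_period p \<omega> \<longleftrightarrow> 0 < \<omega> \<and> (\<forall>t. p (t + \<omega>) = p t) \<and>
    (\<forall>\<omega>'. 0 < \<omega>' \<and> \<omega>' < \<omega> \<longrightarrow> (\<exists>t. p (t + \<omega>') \<noteq> p t))"

end

theory Submission
  imports Defs
begin

text \<open>As long as a solution stays in $[0,1]$ the delayed feedback is monotone, so on
  $W^{u,-}(\hat\xi_1)$ comparison with constants below $\xi_1$ gives extinction.  On
  $W^{u,+}(\hat\xi_1)$ the orbit rises above $1$, the feedback is switched off, and after its next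
  passage through $1$ it equals $e^{-cs}$ for one unit of time; hence the future of $x^+$ is that of
  the single solution \<open>Y d\<close> starting from this decaying exponential.  Either \<open>Y d\<close> stays below $1$
  forever or it returns to $1$ after a time \<open>\<tau>\<close>.  Returning is monotone in \<open>d\<close>, which defines the
  threshold $d^*$ as an infimum.  Above it, every hit of $1$ is followed by another one within a
  uniform time.  Below it, \<open>Y d\<close> tends to $0$: otherwise a larger parameter would multiply \<open>Y\<close> by
  arbitrarily large factors and push it above $1$.

  Uniqueness of $d^*$ needs the leading unstable set to exist for every \<open>d\<close>.  Its two
  branches are monotone orbits obtained as limits of solutions starting from small constant
  deviations; after division by the leading exponential such an orbit solves a relaxation equation,
  whose positive solutions are asymptotically constant and whose fast decaying solutions with zero
  leading coordinate vanish.  The former makes the branches a $C^1$ curve tangent to $\chi_0$, the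
  latter shows that nothing else belongs to the set.\<close>

section \<open>Segments\<close>

text \<open>The jump of \<open>g\<close> at 1 shapes the proof. The equation is used in integrated
  form, solutions need not depend continuously on their histories, and comparison may fail once the
  larger solution has exceeded 1 one unit earlier. So every comparison keeps the larger solution in
  [0,1] up to that time, and limit sets are studied through compactness alone. The manifold does not
  come from a fixed point theorem. Put b = \<Lambda> + c. In the variable h = exp (- \<Lambda> t) u
  the linearization at \<open>\<xi>\<^sub>1\<close> reads h'(t) = b (h (t - 1) - h t). Its
  oscillation over a unit interval shrinks by the factor \<theta> = 1 - exp (- b) per unit of time,
  and h t plus b times the integral of h over [t - 1, t] is conserved. The conserved quantity is, up
  to normalization, the spectral coordinate belonging to \<Lambda>. The contraction factor shows exp
  (Re z) \<le> exp \<Lambda> \<theta> for every other characteristic root z, so each \<beta>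
  strictly between max 1 (exp \<Lambda> \<theta>) and exp \<Lambda> can be taken. Both facts survive
  small perturbations of h', and near \<open>\<xi>\<^sub>1\<close> the nonlinear equation adds
  nothing worse.\<close>

lemma of_hist_bounds: "-1 \<le> of_hist s" "of_hist s \<le> 0"
  using of_hist[of s] by auto

lemma of_hist_to_hist: "-1 \<le> u \<Longrightarrow> u \<le> 0 \<Longrightarrow> of_hist (to_hist u) = u"
  by (simp add: to_hist_inverse)

lemma to_hist_of_hist: "to_hist (of_hist s) = s"
  by (rule of_hist_inverse)

lemma continuous_on_to_hist: "continuous_on {-1..0} to_hist"
  unfolding continuous_on_iff by (auto simp: dist_hist_def to_hist_inverse)

text \<open>Clamping the argument turns a history into a continuous function on the whole line,
  usable as an initial function and as an integrand.\<close>

definition extend :: "(hist \<Rightarrow>\<^sub>C 'b::metric_space) \<Rightarrow> real \<Rightarrow> 'b"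
  where "extend \<phi> u = \<phi> (to_hist (max (-1) (min 0 u)))"

lemma continuous_on_extend: "continuous_on S (extend \<phi>)"
proof -
  have "continuous_on S (\<lambda>u. to_hist (max (-1) (min 0 u)))"
    by (rule continuous_on_compose2[OF continuous_on_to_hist])
       (auto intro!: continuous_intros)
  then show ?thesis
    unfolding extend_def
    by (rule continuous_on_compose2[OF continuous_on_apply_bcontfun[of UNIV \<phi>]]) auto
qed

lemma extend_apply: "-1 \<le> u \<Longrightarrow> u \<le> 0 \<Longrightarrow> extend \<phi> u = \<phi> (to_hist u)"
  by (simp add: extend_def)

lemma extend_of_hist [simp]: "extend \<phi> (of_hist s) = \<phi> s"
  using of_hist_bounds[of s] by (simp add: extend_apply to_hist_of_hist)

lemma seg_extend: "seg (extend \<phi>) 0 = \<phi>"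
  by (rule bcontfun_eqI) (simp add: seg_apply[OF continuous_on_extend])

lemma seg_shift: "seg (\<lambda>t. u (t + h)) t = seg u (t + h)"
  unfolding seg_def by (simp add: algebra_simps)

lemma seg_cong: "(\<And>s. t - 1 \<le> s \<Longrightarrow> s \<le> t \<Longrightarrow> u s = v s) \<Longrightarrow> seg u t = seg v t"
proof -
  assume eq: "\<And>s. t - 1 \<le> s \<Longrightarrow> s \<le> t \<Longrightarrow> u s = v s"
  have "u (t + of_hist s) = v (t + of_hist s)" for s
    using of_hist_bounds[of s] by (intro eq) auto
  then show ?thesis by (simp add: seg_def)
qed

lemma seg_eqD:
  assumes "continuous_on {t - 1..t} u" "continuous_on {r - 1..r} v" "seg u t = seg v r"
    and "-1 \<le> s" "s \<le> 0"
  shows "u (t + s) = v (r + s)"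
proof -
  have "apply_bcontfun (seg u t) (to_hist s) = apply_bcontfun (seg v r) (to_hist s)"
    using assms(3) by simp
  then show ?thesis
    unfolding seg_apply[OF assms(1)] seg_apply[OF assms(2)] using assms by (simp add: of_hist_to_hist)
qed

lemma seg_eqI:
  assumes "\<And>s. -1 \<le> s \<Longrightarrow> s \<le> 0 \<Longrightarrow> u (t + s) = v (r + s)"
  shows "seg u t = seg v r"
proof -
  have "(\<lambda>s. u (t + of_hist s)) = (\<lambda>s. v (r + of_hist s))"
    using of_hist_bounds by (intro ext assms) auto
  then show ?thesis by (simp add: seg_def)
qed

lemma norm_seg_le:
  fixes u :: "real \<Rightarrow> 'b::real_normed_vector"
  assumes "continuous_on {t - 1..t} u" "\<And>s. t - 1 \<le> s \<Longrightarrow> s \<le> t \<Longrightarrow> norm (u s) \<le> B"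
  shows "norm (seg u t) \<le> B"
proof (rule norm_bound)
  fix s show "norm (apply_bcontfun (seg u t) s) \<le> B"
    using of_hist_bounds[of s] assms by (simp add: seg_apply)
qed

lemma norm_le_seg:
  fixes u :: "real \<Rightarrow> 'b::real_normed_vector"
  assumes "continuous_on {t - 1..t} u" "t - 1 \<le> s" "s \<le> t"
  shows "norm (u s) \<le> norm (seg u t)"
proof -
  have "norm (apply_bcontfun (seg u t) (to_hist (s - t))) \<le> norm (seg u t)"
    by (rule norm_bounded)
  then show ?thesis
    using assms by (simp add: seg_apply of_hist_to_hist)
qed

lemma seg_diff:
  fixes u v :: "real \<Rightarrow> 'b::real_normed_vector"
  assumes "continuous_on {t - 1..t} u" "continuous_on {r - 1..r} v"
  shows "seg u t - seg v r = seg (\<lambda>s. u (t + s) - v (r + s)) 0"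
proof (rule bcontfun_eqI)
  fix s
  have "continuous_on {0 - 1..0} (\<lambda>s. u (t + s) - v (r + s))"
    by (intro continuous_intros continuous_on_compose2[OF assms(1)] continuous_on_compose2[OF assms(2)]) auto
  then show "apply_bcontfun (seg u t - seg v r) s = apply_bcontfun (seg (\<lambda>s. u (t + s) - v (r + s)) 0) s"
    using assms by (simp add: seg_apply)
qed

lemma seg_minus_const:
  fixes u :: "real \<Rightarrow> 'b::real_normed_vector"
  assumes "continuous_on {t - 1..t} u"
  shows "seg u t - const_bcontfun k = seg (\<lambda>s. u s - k) t"
proof (rule bcontfun_eqI)
  fix s
  have "continuous_on {t - 1..t} (\<lambda>s. u s - k)"
    by (intro continuous_intros assms)
  then show "apply_bcontfun (seg u t - const_bcontfun k) s = apply_bcontfun (seg (\<lambda>s. u s - k) t) s"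
    using assms by (simp add: seg_apply const_bcontfun.rep_eq)
qed

lemma norm_seg_diff_le:
  fixes u v :: "real \<Rightarrow> 'b::real_normed_vector"
  assumes "continuous_on {t - 1..t} u" "continuous_on {r - 1..r} v"
    "\<And>s. -1 \<le> s \<Longrightarrow> s \<le> 0 \<Longrightarrow> norm (u (t + s) - v (r + s)) \<le> B"
  shows "norm (seg u t - seg v r) \<le> B"
proof (rule norm_bound)
  fix s show "norm (apply_bcontfun (seg u t - seg v r) s) \<le> B"
    using of_hist_bounds[of s] assms by (simp add: seg_apply)
qed

lemma continuous_on_seg:
  fixes u :: "real \<Rightarrow> 'b::real_normed_vector"
  assumes cont: "continuous_on {a - 1..b} u"
  shows "continuous_on {a..b} (seg u)"
  unfolding continuous_on_iff
proof (intro ballI allI impI)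
  fix t e :: real assume t: "t \<in> {a..b}" and e: "0 < e"
  have "uniformly_continuous_on {a - 1..b} u"
    using cont by (intro compact_uniformly_continuous) auto
  then obtain \<delta> where \<delta>: "\<delta> > 0"
    and d: "\<And>s s'. s \<in> {a - 1..b} \<Longrightarrow> s' \<in> {a - 1..b} \<Longrightarrow> dist s' s < \<delta> \<Longrightarrow> dist (u s') (u s) < e / 2"
    unfolding uniformly_continuous_on_def using e by (metis half_gt_zero)
  show "\<exists>\<delta>>0. \<forall>t'\<in>{a..b}. dist t' t < \<delta> \<longrightarrow> dist (seg u t') (seg u t) < e"
  proof (intro exI[of _ \<delta>] conjI ballI impI \<delta>)
    fix t' assume t': "t' \<in> {a..b}" and dd: "dist t' t < \<delta>"
    have "norm (seg u t' - seg u t) \<le> e / 2"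
    proof (rule norm_seg_diff_le)
      show "continuous_on {t' - 1..t'} u" "continuous_on {t - 1..t} u"
        using t t' by (auto intro!: continuous_on_subset[OF cont])
      fix s :: real assume s: "-1 \<le> s" "s \<le> 0"
      have "dist (u (t' + s)) (u (t + s)) < e / 2"
        using s t t' dd by (intro d) (auto simp: dist_real_def)
      then show "norm (u (t' + s) - u (t + s)) \<le> e / 2"
        by (simp add: dist_norm)
    qed
    then show "dist (seg u t') (seg u t) < e"
      using e by (simp add: dist_norm)
  qed
qed

lemma continuous_on_seg_UNIV:
  fixes u :: "real \<Rightarrow> 'b::real_normed_vector"
  assumes "continuous_on UNIV u"
  shows "continuous_on UNIV (seg u)"
proof -
  have "isCont (seg u) t" for t
  proof -
    have "continuous_on {t - 1<..<t + 1} (seg u)"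
      by (rule continuous_on_subset[OF continuous_on_seg[of "t - 1" "t + 1"]])
         (auto intro: continuous_on_subset[OF assms])
    then show ?thesis
      by (simp add: continuous_on_eq_continuous_at)
  qed
  then show ?thesis
    by (simp add: continuous_at_imp_continuous_on)
qed

section \<open>The nonlinearity\<close>

locale pulse =
  fixes g g' :: "real \<Rightarrow> real" and c :: real
  assumes nonlin: "nonlinearity g g'" and c_pos: "c > 0"
begin

lemma g_nonneg: "0 \<le> \<xi> \<Longrightarrow> 0 \<le> g \<xi>"
  and g_le_1: "0 \<le> \<xi> \<Longrightarrow> g \<xi> \<le> 1"
  and g_0: "g 0 = 0" and g'_0: "g' 0 = 0" and g_1: "g 1 = 1"
  and g_beyond: "1 < \<xi> \<Longrightarrow> g \<xi> = 0"
  and g_deriv: "0 \<le> \<xi> \<Longrightarrow> \<xi> \<le> 1 \<Longrightarrow> (g has_real_derivative g' \<xi>) (at \<xi> within {0..1})"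
  and g'_cont: "continuous_on {0..1} g'"
  and g'_gt: "0 < \<xi> \<Longrightarrow> \<xi> \<le> 1 \<Longrightarrow> g' \<xi> > g \<xi> / \<xi>"
  using nonlin unfolding nonlinearity_def by auto

lemma g_cont: "continuous_on {0..1} g"
  using g_deriv by (intro DERIV_continuous_on) auto

lemma g_deriv_at: "0 < \<xi> \<Longrightarrow> \<xi> < 1 \<Longrightarrow> (g has_real_derivative g' \<xi>) (at \<xi>)"
  using g_deriv[of \<xi>] at_within_interior[of \<xi> "{0..1}"] by simp

lemma g'_pos: "0 < \<xi> \<Longrightarrow> \<xi> \<le> 1 \<Longrightarrow> 0 < g' \<xi>"
  using g'_gt[of \<xi>] g_nonneg[of \<xi>] by (smt (verit) divide_nonneg_pos)

lemma g_strict_mono: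
  assumes a: "0 \<le> \<xi>" "\<xi> < \<eta>" "\<eta> \<le> 1"
  shows "g \<xi> < g \<eta>"
proof (rule DERIV_pos_imp_increasing_open[where f = g and a = \<xi> and b = \<eta>])
  show "\<xi> < \<eta>" by fact
  show "\<exists>y. (g has_real_derivative y) (at x) \<and> 0 < y" if "\<xi> < x" "x < \<eta>" for x
    using a that g_deriv_at[of x] g'_pos[of x] by auto
  show "continuous_on {\<xi>..\<eta>} g"
    using a by (intro continuous_on_subset[OF g_cont]) auto
qed

lemma g_mono: "0 \<le> \<xi> \<Longrightarrow> \<xi> \<le> \<eta> \<Longrightarrow> \<eta> \<le> 1 \<Longrightarrow> g \<xi> \<le> g \<eta>"
  using g_strict_mono[of \<xi> \<eta>] by (cases "\<xi> = \<eta>") auto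

lemma g_pos: "0 < \<xi> \<Longrightarrow> \<xi> \<le> 1 \<Longrightarrow> 0 < g \<xi>"
  using g_strict_mono[of 0 \<xi>] g_0 by simp

text \<open>The derivative of g x / x is (g' x * x - g x) / (x * x), so the hypothesis on
  \<open>g'\<close> is what makes this quotient increase. Uniqueness of \<xi>1, the sign of d g
  \<xi> - c \<xi> on either side of it and superlinear growth all rest on this.\<close>

lemma g_ratio_mono:
  assumes a: "0 < \<xi>" "\<xi> < \<eta>" "\<eta> \<le> 1"
  shows "g \<xi> / \<xi> < g \<eta> / \<eta>"
proof (rule DERIV_pos_imp_increasing_open[where f = "\<lambda>x. g x / x" and a = \<xi> and b = \<eta>])
  show "\<xi> < \<eta>" by fact
  show "\<exists>y. ((\<lambda>x. g x / x) has_real_derivative y) (at x) \<and> 0 < y" if "\<xi> < x" "x < \<eta>" for x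
  proof (intro exI conjI)
    show "((\<lambda>x. g x / x) has_real_derivative (g' x * x - g x) / (x * x)) (at x)"
      using a that by (auto intro!: derivative_eq_intros g_deriv_at)
    have "g x < g' x * x"
      using g'_gt[of x] a that by (simp add: field_simps)
    then show "0 < (g' x * x - g x) / (x * x)"
      using a that by simp
  qed
  show "continuous_on {\<xi>..\<eta>} (\<lambda>x. g x / x)"
    using a by (auto intro!: continuous_intros continuous_on_subset[OF g_cont])
qed

text \<open>Used in two ways: to carry a lower bound r on the ratio of two solutions over to their
  feedbacks, and, with r = B / b, to bound \<open>g\<close> linearly below a level B, which produces
  geometric decay.\<close>

lemma g_superlinear:
  assumes "0 \<le> \<xi>" "1 \<le> r" "r * \<xi> \<le> 1"
  shows "r * g \<xi> \<le> g (r * \<xi>)"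
proof (cases "\<xi> = 0 \<or> r = 1")
  case True then show ?thesis using g_0 by auto
next
  case False
  then have *: "0 < \<xi>" "1 < r" using assms by auto
  then have "g \<xi> / \<xi> < g (r * \<xi>) / (r * \<xi>)"
    using assms by (intro g_ratio_mono) auto
  with * have "r * g \<xi> < g (r * \<xi>)"
    by (simp add: field_simps)
  then show ?thesis by simp
qed

lemma g_lipschitz: "\<exists>K\<ge>0. \<forall>\<xi>\<in>{0..1}. \<forall>\<eta>\<in>{0..1}. \<bar>g \<xi> - g \<eta>\<bar> \<le> K * \<bar>\<xi> - \<eta>\<bar>"
proof -
  have "compact (g' ` {0..1})"
    using g'_cont by (intro compact_continuous_image) auto
  then obtain K where K: "\<And>\<xi>. \<xi> \<in> {0..1} \<Longrightarrow> \<bar>g' \<xi>\<bar> \<le> K"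
    using compact_imp_bounded bounded_iff by (metis image_eqI real_norm_def)
  have "norm (g \<xi> - g \<eta>) \<le> K * norm (\<xi> - \<eta>)" if "\<xi> \<in> {0..1}" "\<eta> \<in> {0..1}" for \<xi> \<eta>
    using that K g_deriv
    by (intro field_differentiable_bound[where S = "{0..1}" and f = g and f' = g']) auto
  moreover have "0 \<le> K" using K[of 0] by auto
  ultimately show ?thesis by (metis real_norm_def)
qed

end

section \<open>The unstable stationary point\<close>

locale pulse_super = pulse + fixes d :: real assumes d_gt: "d > c"
begin

lemma d_pos: "d > 0" using c_pos d_gt by simp

text \<open>Positive zeros are the solutions of g \<xi> / \<xi> = c / d. This quotient is small near
  0 because g 0 = g' 0 = 0, equals 1 > c / d at 1, and increases strictly.\<close>

lemma ex1_xi1: "\<exists>!\<xi>. 0 < \<xi> \<and> \<xi> < 1 \<and> - c * \<xi> + d * g \<xi> = 0"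
proof -
  have "(g has_real_derivative 0) (at 0 within {0..1})"
    using g_deriv[of 0] g'_0 by simp
  then have "((\<lambda>y. (g y - g 0) / (y - 0)) \<longlongrightarrow> 0) (at 0 within {0..1})"
    by (simp add: has_field_derivative_iff)
  then have "\<forall>\<^sub>F y in at 0 within {0..1}. (g y - g 0) / (y - 0) < c / d"
    using c_pos d_pos by (intro order_tendstoD) auto
  then obtain e where e: "e > 0" "\<And>y. y \<in> {0..1} \<Longrightarrow> y \<noteq> 0 \<Longrightarrow> dist y 0 < e \<Longrightarrow> g y / y < c / d"
    by (auto simp: eventually_at g_0)
  define y where "y = min (e / 2) (1 / 2)"
  have y: "0 < y" "y < 1" "g y / y < c / d"
    using e(1) e(2)[of y] by (auto simp: y_def)
  have "\<exists>\<xi>\<ge>y. \<xi> \<le> 1 \<and> g \<xi> / \<xi> = c / d"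
  proof (rule IVT')
    show "g y / y \<le> c / d" "c / d \<le> g 1 / 1" "y \<le> 1"
      using y d_gt d_pos by (auto simp: g_1)
    show "continuous_on {y..1} (\<lambda>\<xi>. g \<xi> / \<xi>)"
      using y by (auto intro!: continuous_intros continuous_on_subset[OF g_cont])
  qed
  then obtain \<xi> where \<xi>: "y \<le> \<xi>" "\<xi> \<le> 1" "g \<xi> / \<xi> = c / d" by auto
  have "\<xi> \<noteq> 1" using \<xi>(3) g_1 d_gt d_pos by (auto simp: field_simps)
  then have "0 < \<xi> \<and> \<xi> < 1 \<and> - c * \<xi> + d * g \<xi> = 0"
    using \<xi> y d_pos by (auto simp: field_simps)
  moreover have "\<xi> = \<eta>" if "0 < \<xi> \<and> \<xi> < 1 \<and> - c * \<xi> + d * g \<xi> = 0"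
      "0 < \<eta> \<and> \<eta> < 1 \<and> - c * \<eta> + d * g \<eta> = 0" for \<xi> \<eta>
  proof -
    have "g \<xi> / \<xi> = g \<eta> / \<eta>"
    proof -
      have "g \<xi> / \<xi> = c / d" "g \<eta> / \<eta> = c / d" using that d_pos by (auto simp: field_simps)
      then show ?thesis by simp
    qed
    then show ?thesis
      using g_ratio_mono[of \<xi> \<eta>] g_ratio_mono[of \<eta> \<xi>] that by (metis less_irrefl linorder_less_linear less_imp_le)
  qed
  ultimately show ?thesis by blast
qed

abbreviation "\<xi>\<^sub>1 \<equiv> xi1 g c d"
abbreviation "a \<equiv> d * g' \<xi>\<^sub>1"
abbreviation "e\<^sub>1 \<equiv> const_bcontfun \<xi>\<^sub>1 :: C"

lemma xi1_pos: "0 < \<xi>\<^sub>1" and xi1_lt_1: "\<xi>\<^sub>1 < 1" and xi1_eq: "d * g \<xi>\<^sub>1 = c * \<xi>\<^sub>1"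
  using theI'[OF ex1_xi1] unfolding xi1_def[symmetric] by auto

lemma g_below_xi1: "0 < \<xi> \<Longrightarrow> \<xi> < \<xi>\<^sub>1 \<Longrightarrow> d * g \<xi> < c * \<xi>"
  using g_ratio_mono[of \<xi> \<xi>\<^sub>1] xi1_pos xi1_lt_1 xi1_eq d_pos
  by (smt (verit) divide_less_eq mult.commute mult_less_cancel_right_pos nonzero_mult_div_cancel_left times_divide_eq_right)

lemma g_above_xi1: "\<xi>\<^sub>1 < \<xi> \<Longrightarrow> \<xi> \<le> 1 \<Longrightarrow> d * g \<xi> > c * \<xi>"
  using g_ratio_mono[of \<xi>\<^sub>1 \<xi>] xi1_pos xi1_lt_1 xi1_eq d_pos
  by (smt (verit) divide_less_eq mult.commute mult_less_cancel_right_pos nonzero_mult_div_cancel_left times_divide_eq_right)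

text \<open>Instability of the stationary point: the characteristic function takes the negative
  value c - a at 0, which forces a positive root.\<close>

lemma a_gt: "a > c"
proof -
  have "g' \<xi>\<^sub>1 > g \<xi>\<^sub>1 / \<xi>\<^sub>1" using g'_gt xi1_pos xi1_lt_1 by simp
  then have "d * g' \<xi>\<^sub>1 > d * (g \<xi>\<^sub>1 / \<xi>\<^sub>1)" using d_pos by (rule mult_strict_left_mono)
  then show ?thesis using xi1_eq xi1_pos by simp
qed

end

section \<open>Scalar delay equations\<close>

text \<open>The integrated equation multiplied by exp (c t), with a feedback on the whole line and
  no sign condition on \<open>x\<close>. One theory then serves both the original equation and the
  equation for deviations from the stationary point.\<close>

definition delay_solution :: "(real \<Rightarrow> real) \<Rightarrow> real \<Rightarrow> real \<Rightarrow> (real \<Rightarrow> real) \<Rightarrow> bool"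
  where "delay_solution F c T x \<longleftrightarrow> continuous_on {T - 1..} x \<and>
    (\<forall>t\<ge>T. exp (c * t) * x t = exp (c * T) * x T + integral {T..t} (\<lambda>s. exp (c * s) * F (x (s - 1))))"

lemma delay_solutionD:
  assumes "delay_solution F c T x"
  shows "continuous_on {T - 1..} x"
    and "T \<le> t \<Longrightarrow> exp (c * t) * x t = exp (c * T) * x T + integral {T..t} (\<lambda>s. exp (c * s) * F (x (s - 1)))"
  using assms unfolding delay_solution_def by blast+

text \<open>Measurability stands in for continuity because the feedback jumps at 1. Boundedness
  dominates the integrand.\<close>

definition admissible :: "(real \<Rightarrow> real) \<Rightarrow> bool"
  where "admissible F \<longleftrightarrow> F \<in> borel_measurable borel \<and> bounded (range F)"

lemma delay_integrable:
  assumes F: "admissible F" and x: "continuous_on {T - 1..} x" and T: "T \<le> \<tau>"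
  shows "(\<lambda>s. exp (c * s) * F (x (s - 1))) integrable_on {\<tau>..t}"
proof -
  obtain B where B: "\<And>\<xi>. \<bar>F \<xi>\<bar> \<le> B"
    using F unfolding admissible_def bounded_iff by auto
  \<comment> \<open>Clamping at T - 1 gives a function continuous on the whole line, hence Borel,
    which agrees with \<open>x\<close> wherever the integrand evaluates it.\<close>
  define x' where "x' s = x (max (T - 1) s)" for s
  have "continuous_on UNIV x'"
    unfolding x'_def by (rule continuous_on_compose2[OF x]) (auto intro!: continuous_intros)
  then have [measurable]: "x' \<in> borel_measurable borel"
    by (rule borel_measurable_continuous_onI)
  have [measurable]: "F \<in> borel_measurable borel"
    using F by (simp add: admissible_def)
  have "(\<lambda>s. exp (c * s) * F (x' (s - 1))) \<in> borel_measurable borel"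
    by measurable
  then have "(\<lambda>s. exp (c * s) * F (x' (s - 1))) \<in> borel_measurable (lebesgue_on {\<tau>..t})"
    by (simp add: measurable_completion measurable_restrict_space1)
  moreover have "(\<lambda>s. exp (c * s) * B) integrable_on {\<tau>..t}"
    by (intro integrable_continuous_real continuous_intros)
  ultimately have "(\<lambda>s. exp (c * s) * F (x' (s - 1))) integrable_on {\<tau>..t}"
    by (rule measurable_bounded_by_integrable_imp_integrable) (auto simp: abs_mult B)
  then show ?thesis
    by (rule integrable_eq) (use T in \<open>auto simp: x'_def max_def\<close>)
qed

lemma delay_solution_from:
  assumes F: "admissible F" and x: "delay_solution F c T x" and T: "T \<le> \<tau>" "\<tau> \<le> t"
  shows "exp (c * t) * x t = exp (c * \<tau>) * x \<tau> + integral {\<tau>..t} (\<lambda>s. exp (c * s) * F (x (s - 1)))"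
proof -
  let ?k = "\<lambda>s. exp (c * s) * F (x (s - 1))"
  have "?k integrable_on {T..t}"
    using delay_solutionD(1)[OF x] by (rule delay_integrable[OF F]) simp
  then have "integral {T..\<tau>} ?k + integral {\<tau>..t} ?k = integral {T..t} ?k"
    using T by (intro Henstock_Kurzweil_Integration.integral_combine)
  moreover have "exp (c * t) * x t = exp (c * T) * x T + integral {T..t} ?k"
    "exp (c * \<tau>) * x \<tau> = exp (c * T) * x T + integral {T..\<tau>} ?k"
    by (rule delay_solutionD(2)[OF x], use T in simp)+
  ultimately show ?thesis by linarith
qed

lemma delay_solution_restrict:
  assumes "admissible F" "delay_solution F c T x" "T \<le> T'"
  shows "delay_solution F c T' x"
  unfolding delay_solution_def
proof (intro conjI allI impI)
  show "continuous_on {T' - 1..} x"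
    using assms(3) by (auto intro: continuous_on_subset[OF delay_solutionD(1)[OF assms(2)]])
qed (rule delay_solution_from[OF assms])

lemma delay_solution_shift:
  assumes "delay_solution F c T x"
  shows "delay_solution F c (T - h) (\<lambda>t. x (t + h))"
  unfolding delay_solution_def
proof (intro conjI allI impI)
  show "continuous_on {T - h - 1..} (\<lambda>t. x (t + h))"
    by (auto intro!: continuous_intros continuous_on_compose2[OF delay_solutionD(1)[OF assms]])
  fix t assume t: "T - h \<le> t"
  let ?k = "\<lambda>s. exp (c * s) * F (x (s - 1))"
  have "integral {T - h..t} (\<lambda>s. exp (c * s) * F (x (s - 1 + h)))
      = exp (- c * h) * integral {T - h..t} (\<lambda>s. ?k (s + h))"
    unfolding integral_mult_right[symmetric]
  proof (intro integral_cong)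
    fix s
    have "exp (c * s) = exp (- c * h) * exp (c * (s + h))"
      unfolding exp_add[symmetric] by (simp add: algebra_simps)
    moreover have eq: "s - 1 + h = s + h - 1" by simp
    ultimately show "exp (c * s) * F (x (s - 1 + h)) = exp (- c * h) * ?k (s + h)" unfolding eq by simp
  qed
  also have "integral {T - h..t} (\<lambda>s. ?k (s + h)) = integral {T..t + h} ?k"
    using integral_shift_Icc_real[of "T - h" t ?k h] by (simp add: o_def add.commute)
  also have "exp (- c * h) * \<dots> = exp (- c * h) * (exp (c * (t + h)) * x (t + h) - exp (c * T) * x T)"
    using delay_solutionD(2)[OF assms, of "t + h"] t by simp
  also have "\<dots> = exp (c * t) * x (t + h) - exp (c * (T - h)) * x (T - h + h)"
    by (simp add: right_diff_distrib mult.assoc[symmetric] exp_add[symmetric] distrib_left)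
  finally show "exp (c * t) * x (t + h) = exp (c * (T - h)) * x (T - h + h)
      + integral {T - h..t} (\<lambda>s. exp (c * s) * F (x (s - 1 + h)))"
    by simp
qed

text \<open>Method of steps: the integral up to s sees values only up to s - 1, so agreement spreads
  by one unit at a time.\<close>

lemma delay_solution_unique:
  assumes F: "admissible F" and x: "delay_solution F c T x" and y: "delay_solution F c T y"
    and eq: "\<And>s. T - 1 \<le> s \<Longrightarrow> s \<le> T \<Longrightarrow> x s = y s" and t: "T - 1 \<le> t"
  shows "x t = y t"
proof -
  have all: "\<forall>s. T - 1 \<le> s \<and> s \<le> T + real n \<longrightarrow> x s = y s" for n
  proof (induction n)
    case 0 then show ?case using eq by auto
  next
    case (Suc n)
    show ?case
    proof (intro allI impI)
      fix s assume s: "T - 1 \<le> s \<and> s \<le> T + real (Suc n)"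
      show "x s = y s"
      proof (cases "s \<le> T")
        case True then show ?thesis using s eq by auto
      next
        case False
        have "integral {T..s} (\<lambda>s. exp (c * s) * F (x (s - 1))) = integral {T..s} (\<lambda>s. exp (c * s) * F (y (s - 1)))"
          using Suc s by (intro integral_cong) auto
        then have "exp (c * s) * x s = exp (c * s) * y s"
          using delay_solutionD(2)[OF x, of s] delay_solutionD(2)[OF y, of s] eq[of T] False by simp
        then show ?thesis by simp
      qed
    qed
  qed
  obtain n :: nat where "t - T \<le> real n" using real_arch_simple by blast
  then show ?thesis using t all[of n] by auto
qed

text \<open>Method of steps as iteration of \<open>step\<close>, which inserts a guess into the
  integral and keeps \<phi> up to T. The n-th iterate is final up to T + n, so the iterates
  stabilize pointwise.\<close>

lemma delay_solution_exists:
  assumes F: "admissible F" and \<phi>: "continuous_on UNIV \<phi>"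
  shows "\<exists>x. delay_solution F c T x \<and> (\<forall>s\<le>T. x s = \<phi> s)"
proof -
  define step where "step X t = (if t \<le> T then \<phi> t else
      exp (- c * t) * (exp (c * T) * \<phi> T + integral {T..t} (\<lambda>s. exp (c * s) * F (X (s - 1)))))" for X t
  define X where "X n = (step ^^ n) \<phi>" for n
  have step_cont: "continuous_on UNIV (step X)" if X: "continuous_on UNIV X" for X
  proof -
    let ?r = "\<lambda>t. exp (- c * t) * (exp (c * T) * \<phi> T + integral {T..t} (\<lambda>s. exp (c * s) * F (X (s - 1))))"
    have "continuous_on {T..} ?r"
    proof -
      have "isCont (\<lambda>t. integral {T - 1..t} (\<lambda>s. exp (c * s) * F (X (s - 1)))) t" if "t \<ge> T" for t
      proof -
        have "continuous_on {T - 1..t + 1} (\<lambda>t. integral {T - 1..t} (\<lambda>s. exp (c * s) * F (X (s - 1))))"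
          by (intro indefinite_integral_continuous_1 delay_integrable[OF F, of "T - 1"])
             (auto intro: continuous_on_subset[OF X])
        then have "continuous_on {T - 1<..<t + 1} (\<lambda>t. integral {T - 1..t} (\<lambda>s. exp (c * s) * F (X (s - 1))))"
          by (rule continuous_on_subset) auto
        then show ?thesis using that by (simp add: continuous_on_eq_continuous_at)
      qed
      then have "continuous_on {T..} (\<lambda>t. integral {T - 1..t} (\<lambda>s. exp (c * s) * F (X (s - 1))))"
        by (intro continuous_at_imp_continuous_on) auto
      then have "continuous_on {T..} (\<lambda>t. integral {T - 1..t} (\<lambda>s. exp (c * s) * F (X (s - 1)))
          - integral {T - 1..T} (\<lambda>s. exp (c * s) * F (X (s - 1))))"
        by (intro continuous_intros)
      moreover have "integral {T - 1..t} (\<lambda>s. exp (c * s) * F (X (s - 1)))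
          - integral {T - 1..T} (\<lambda>s. exp (c * s) * F (X (s - 1)))
          = integral {T..t} (\<lambda>s. exp (c * s) * F (X (s - 1)))" if "t \<ge> T" for t
        using Henstock_Kurzweil_Integration.integral_combine[of "T - 1" T t "\<lambda>s. exp (c * s) * F (X (s - 1))"]
          delay_integrable[OF F, of "T - 1" X "T - 1" c t] that continuous_on_subset[OF X, of "{T - 1 - 1..}"]
        by simp
      ultimately have "continuous_on {T..} (\<lambda>t. integral {T..t} (\<lambda>s. exp (c * s) * F (X (s - 1))))"
        by (rule continuous_on_eq) auto
      then show ?thesis by (intro continuous_intros)
    qed
    then have "continuous_on ({..T} \<union> {T..}) (\<lambda>t. if t \<le> T then \<phi> t else ?r t)"
      by (intro continuous_on_If continuous_on_subset[OF \<phi>]) (auto simp: exp_minus)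
    moreover have "{..T} \<union> {T..} = UNIV" by auto
    ultimately show ?thesis by (simp add: step_def[abs_def])
  qed
  have X_cont: "continuous_on UNIV (X n)" for n
    by (induction n) (auto simp: X_def \<phi> step_cont)
  have X_Suc: "X (Suc n) t = X n t" if "t \<le> T + real n" for n t
    using that
  proof (induction n arbitrary: t)
    case 0 then show ?case by (simp add: X_def step_def)
  next
    case (Suc n)
    have "integral {T..t} (\<lambda>s. exp (c * s) * F (X (Suc n) (s - 1))) = integral {T..t} (\<lambda>s. exp (c * s) * F (X n (s - 1)))"
      using Suc by (intro integral_cong) auto
    then have "step (X (Suc n)) t = step (X n) t"
      by (simp add: step_def)
    then show ?case by (simp add: X_def)
  qed
  have X_mono: "X (n + k) t = X n t" if "t \<le> T + real n" for n k t
    by (induction k) (use that X_Suc in auto)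
  \<comment> \<open>The index is large enough for the iterate to be final at t; larger indices give
    the same value.\<close>
  define x where "x t = X (nat \<lceil>t - T\<rceil>) t" for t
  have x_eq: "x t = X n t" if "t \<le> T + real n" for t n
  proof -
    have "nat \<lceil>t - T\<rceil> \<le> n" using that by linarith
    moreover have "t \<le> T + real (nat \<lceil>t - T\<rceil>)" by linarith
    ultimately show ?thesis
      using X_mono[of t "nat \<lceil>t - T\<rceil>" "n - nat \<lceil>t - T\<rceil>"] by (simp add: x_def)
  qed
  have "isCont x t" for t
  proof -
    obtain n :: nat where n: "t - T < real n" using reals_Archimedean2 by blast
    have "isCont (X n) t" using X_cont by (simp add: continuous_on_eq_continuous_at)
    moreover have "\<forall>\<^sub>F s in nhds t. X n s = x s"
    proof -
      have "\<forall>\<^sub>F s in nhds t. s < T + real n"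
        using n by (intro eventually_nhds_in_open[of "{..<T + real n}", simplified]) auto
      then show ?thesis by eventually_elim (metis x_eq less_imp_le)
    qed
    ultimately show ?thesis by (simp add: isCont_cong)
  qed
  then have x_cont: "continuous_on S x" for S
    by (simp add: continuous_at_imp_continuous_on)
  have x_init: "x s = \<phi> s" if "s \<le> T" for s
    using x_eq[of s 0] that by (simp add: X_def)
  have "exp (c * t) * x t = exp (c * T) * x T + integral {T..t} (\<lambda>s. exp (c * s) * F (x (s - 1)))" if "t \<ge> T" for t
  proof (cases "t = T")
    case False
    obtain n :: nat where n: "t - T < real n" using reals_Archimedean2 by blast
    have "x t = step (X n) t" using n x_eq[of t "Suc n"] by (simp add: X_def)
    also have "\<dots> = exp (- c * t) * (exp (c * T) * \<phi> T + integral {T..t} (\<lambda>s. exp (c * s) * F (X n (s - 1))))"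
      using that False by (simp add: step_def)
    also have "integral {T..t} (\<lambda>s. exp (c * s) * F (X n (s - 1))) = integral {T..t} (\<lambda>s. exp (c * s) * F (x (s - 1)))"
      using n by (intro integral_cong) (auto simp: x_eq[of _ n])
    finally show ?thesis by (simp add: x_init exp_minus)
  qed auto
  then show ?thesis
    using x_cont x_init unfolding delay_solution_def by blast
qed

text \<open>Ordered feedbacks are demanded only where the delayed states are already ordered, and
  only up to T'; in this form a feedback that is monotone on part of its range can be compared. The
  second conclusion keeps the gap, weighted by exp (c t), above its initial value and so yields
  strict comparison.\<close>

lemma delay_solution_mono:
  assumes F: "admissible F" and G: "admissible G"
    and x: "delay_solution F c T x" and y: "delay_solution G c T y"
    and init: "\<And>s. T - 1 \<le> s \<Longrightarrow> s \<le> T \<Longrightarrow> x s \<le> y s"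
    and le: "\<And>s. T \<le> s \<Longrightarrow> s \<le> T' \<Longrightarrow> x (s - 1) \<le> y (s - 1) \<Longrightarrow> F (x (s - 1)) \<le> G (y (s - 1))"
    and t: "T - 1 \<le> t" "t \<le> T'"
  shows "x t \<le> y t" and "T \<le> t \<Longrightarrow> exp (c * T) * (y T - x T) \<le> exp (c * t) * (y t - x t)"
proof -
  have int: "exp (c * T) * (y T - x T) \<le> exp (c * s) * (y s - x s)"
    if "T \<le> s" "s \<le> T'" and below: "\<And>r. T - 1 \<le> r \<Longrightarrow> r \<le> s - 1 \<Longrightarrow> x r \<le> y r" for s
  proof -
    have "integral {T..s} (\<lambda>s. exp (c * s) * F (x (s - 1))) \<le> integral {T..s} (\<lambda>s. exp (c * s) * G (y (s - 1)))"
      using that delay_solutionD(1)[OF x] delay_solutionD(1)[OF y]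
      by (intro integral_le delay_integrable[OF F, of T] delay_integrable[OF G, of T])
         (auto intro!: le)
    moreover have "exp (c * s) * x s = exp (c * T) * x T + integral {T..s} (\<lambda>s. exp (c * s) * F (x (s - 1)))"
      "exp (c * s) * y s = exp (c * T) * y T + integral {T..s} (\<lambda>s. exp (c * s) * G (y (s - 1)))"
      by (rule delay_solutionD(2)[OF x] delay_solutionD(2)[OF y], use that in simp)+
    ultimately show ?thesis by (simp add: algebra_simps)
  qed
  have steps: "\<forall>s. T - 1 \<le> s \<and> s \<le> T + real n \<and> s \<le> T' \<longrightarrow> x s \<le> y s" for n
  proof (induction n)
    case 0 then show ?case using init by auto
  next
    case (Suc n)
    show ?case
    proof (intro allI impI)
      fix s assume s: "T - 1 \<le> s \<and> s \<le> T + real (Suc n) \<and> s \<le> T'"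
      show "x s \<le> y s"
      proof (cases "s \<le> T")
        case True then show ?thesis using s init by auto
      next
        case False
        have "0 \<le> exp (c * T) * (y T - x T)" using init[of T] by simp
        also have "\<dots> \<le> exp (c * s) * (y s - x s)"
          using False s Suc by (intro int) auto
        finally show ?thesis by (simp add: zero_le_mult_iff)
      qed
    qed
  qed
  have all: "\<forall>s. T - 1 \<le> s \<and> s \<le> t \<and> s \<le> T' \<longrightarrow> x s \<le> y s" for t
  proof -
    obtain n :: nat where "t - T \<le> real n" using real_arch_simple by blast
    then show ?thesis using steps[of n] by auto
  qed
  then show "x t \<le> y t" using t by auto
  show "exp (c * T) * (y T - x T) \<le> exp (c * t) * (y t - x t)" if "T \<le> t"
    using that t all[of t] by (intro int) auto
qed

lemma delay_solution_strict_mono: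
  assumes F: "admissible F" and G: "admissible G"
    and x: "delay_solution F c T x" and y: "delay_solution G c T y"
    and init: "\<And>s. T - 1 \<le> s \<Longrightarrow> s \<le> T \<Longrightarrow> x s \<le> y s" and T: "x T < y T"
    and le: "\<And>s. T \<le> s \<Longrightarrow> s \<le> T' \<Longrightarrow> x (s - 1) \<le> y (s - 1) \<Longrightarrow> F (x (s - 1)) \<le> G (y (s - 1))"
    and t: "T \<le> t" "t \<le> T'"
  shows "x t < y t"
proof -
  have "0 < exp (c * T) * (y T - x T)" using T by simp
  also have "\<dots> \<le> exp (c * t) * (y t - x t)"
    using t by (intro delay_solution_mono(2)[OF F G x y init le]) auto
  finally show ?thesis by (simp add: zero_less_mult_iff)
qed

lemma delay_solution_const:
  assumes "c \<noteq> 0" "F k = c * k"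
  shows "delay_solution F c T (\<lambda>_. k)"
  unfolding delay_solution_def
proof (intro conjI allI impI)
  fix t assume t: "T \<le> t"
  have "((\<lambda>s. exp (c * s) * F k) has_integral (exp (c * t) * k - exp (c * T) * k)) {T..t}"
    using t assms by (intro fundamental_theorem_of_calculus)
      (auto intro!: derivative_eq_intros simp flip: has_real_derivative_iff_has_vector_derivative)
  then show "exp (c * t) * k = exp (c * T) * k + integral {T..t} (\<lambda>s. exp (c * s) * F k)"
    by (metis add_diff_cancel_left' diff_add_cancel integral_unique add.commute)
qed auto

text \<open>Continuity of \<open>F\<close> at the one delayed value makes the integrand continuous
  at t, so the fundamental theorem applies there although \<open>F\<close> may jump
  elsewhere.\<close>

lemma delay_solution_deriv:
  assumes F: "admissible F" and x: "delay_solution F c T x" and t: "T < t"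
    and F_cont: "isCont F (x (t - 1))"
  shows "(x has_real_derivative - c * x t + F (x (t - 1))) (at t)"
proof -
  let ?k = "\<lambda>s. exp (c * s) * F (x (s - 1))"
  have cont: "continuous_on {T - 1<..} x"
    by (rule continuous_on_subset[OF delay_solutionD(1)[OF x]]) auto
  have "?k integrable_on {T..t + 1}"
    using delay_solutionD(1)[OF x] by (rule delay_integrable[OF F]) simp
  moreover have "isCont ?k t"
  proof -
    have "isCont x (t - 1)"
      using cont t by (auto simp: continuous_on_eq_continuous_at)
    then have "isCont (\<lambda>s. x (s - 1)) t"
      by (rule isCont_o2[where f = "\<lambda>s. s - 1" and g = x, rotated]) simp
    then have "isCont (\<lambda>s. F (x (s - 1))) t"
      by (rule isCont_o2[where f = "\<lambda>s. x (s - 1)" and g = F]) (rule F_cont)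
    then show ?thesis by (intro continuous_intros)
  qed
  ultimately have "((\<lambda>u. integral {T..u} ?k) has_vector_derivative ?k t) (at t within {T..t + 1})"
    using integral_has_vector_derivative_continuous_at[of ?k T "t + 1" t "{}"] t
    by (auto intro: continuous_at_imp_continuous_at_within)
  then have "((\<lambda>u. integral {T..u} ?k) has_real_derivative ?k t) (at t)"
    using t at_within_interior[of t "{T..t + 1}"] by (simp add: has_real_derivative_iff_has_vector_derivative)
  then have deriv: "((\<lambda>u. exp (- c * u) * (exp (c * T) * x T + integral {T..u} ?k)) has_real_derivative
      - c * exp (- c * t) * (exp (c * T) * x T + integral {T..t} ?k) + exp (- c * t) * ?k t) (at t)"
    by (auto intro!: derivative_eq_intros)
  have eq: "exp (- c * u) * (exp (c * T) * x T + integral {T..u} ?k) = x u" if "T \<le> u" for u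
  proof -
    have "exp (c * T) * x T + integral {T..u} ?k = exp (c * u) * x u"
      using delay_solutionD(2)[OF x that] by simp
    then show ?thesis by (simp add: mult.assoc[symmetric] exp_add[symmetric])
  qed
  have "exp (- c * t) * ?k t = F (x (t - 1))"
    by (simp add: mult.assoc[symmetric] exp_add[symmetric])
  then have "- c * exp (- c * t) * (exp (c * T) * x T + integral {T..t} ?k) + exp (- c * t) * ?k t
      = - c * x t + F (x (t - 1))"
    unfolding mult.assoc using eq[of t] t by simp
  with deriv have "((\<lambda>u. exp (- c * u) * (exp (c * T) * x T + integral {T..u} ?k)) has_real_derivative
      - c * x t + F (x (t - 1))) (at t)"
    by (rule DERIV_cong)
  then show ?thesis
    by (rule has_field_derivative_transform_within_open[of _ _ _ "{T<..}"]) (use t eq in auto)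
qed

section \<open>Solutions of the delay equation\<close>

lemma entire_solutionD: "entire_solution g c d x \<Longrightarrow> solution_from g c d T x"
  unfolding entire_solution_def by blast

lemma solution_from_continuous: "solution_from g c d T x \<Longrightarrow> T - 1 \<le> \<tau> \<Longrightarrow> continuous_on {\<tau>..t} x"
  unfolding solution_from_def by (auto intro: continuous_on_subset)

lemma solution_from_nonneg: "solution_from g c d T x \<Longrightarrow> T - 1 \<le> t \<Longrightarrow> 0 \<le> x t"
  unfolding solution_from_def by auto

lemma entire_solution_continuous: "entire_solution g c d x \<Longrightarrow> continuous_on S x"
proof -
  assume x: "entire_solution g c d x"
  have "isCont x t" for t
  proof -
    have "continuous_on {t - 1<..<t + 1} x"
      by (rule continuous_on_subset[OF solution_from_continuous[OF entire_solutionD[OF x, of t], of "t - 1" "t + 1"]]) auto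
    then show ?thesis by (simp add: continuous_on_eq_continuous_at)
  qed
  then show ?thesis by (simp add: continuous_at_imp_continuous_on)
qed

context pulse
begin

text \<open>Nothing is known about \<open>g\<close> at negative arguments; the truncation makes the
  feedback a function on the whole line without changing it for nonnegative states.\<close>

definition rhs :: "real \<Rightarrow> real \<Rightarrow> real"
  where "rhs d \<xi> = d * g (max 0 \<xi>)"

lemma rhs_nonneg: "0 \<le> d \<Longrightarrow> 0 \<le> rhs d \<xi>"
  by (simp add: rhs_def g_nonneg)

text \<open>On nonnegative arguments \<open>g\<close> equals its restriction to [0,1], where it is
  continuous, extended by 0. The jump at 1 does not spoil measurability.\<close>

lemma admissible_rhs: "admissible (rhs d)"
  unfolding admissible_def
proof
  let ?h = "\<lambda>\<xi>. indicator {0..1} \<xi> *\<^sub>R g \<xi>"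
  have [measurable]: "?h \<in> borel_measurable borel"
    by (rule borel_measurable_continuous_on_indicator[OF _ g_cont]) simp
  have "rhs d = (\<lambda>\<xi>. d * ?h (max 0 \<xi>))"
    by (auto simp: rhs_def fun_eq_iff indicator_def g_beyond)
  moreover have "(\<lambda>\<xi>. d * ?h (max 0 \<xi>)) \<in> borel_measurable borel" by measurable
  ultimately show "rhs d \<in> borel_measurable borel" by metis
  have "norm (rhs d \<xi>) \<le> \<bar>d\<bar>" for \<xi>
  proof -
    have "\<bar>g (max 0 \<xi>)\<bar> \<le> 1" using g_le_1[of "max 0 \<xi>"] g_nonneg[of "max 0 \<xi>"] by simp
    then show ?thesis by (simp add: rhs_def abs_mult mult_left_le)
  qed
  then show "bounded (range (rhs d))"
    by (auto simp: bounded_iff)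
qed

lemma rhs_isCont:
  assumes "\<xi> < 1" shows "isCont (rhs d) \<xi>"
proof -
  have "continuous_on {..<1} (rhs d)"
    unfolding rhs_def
    by (intro continuous_intros continuous_on_compose2[OF g_cont]) auto
  then show ?thesis using assms by (simp add: continuous_on_eq_continuous_at)
qed

lemma solution_integral_eq:
  assumes "\<And>s. T - 1 \<le> s \<Longrightarrow> 0 \<le> x s" "T \<le> \<tau>"
  shows "integral {\<tau>..t} (\<lambda>s. exp (c * s) * rhs d (x (s - 1)))
    = exp (c * t) * (d * integral {\<tau>..t} (\<lambda>s. exp (- c * (t - s)) * g (x (s - 1))))"
proof -
  have "exp (c * t) * (d * integral {\<tau>..t} (\<lambda>s. exp (- c * (t - s)) * g (x (s - 1))))
      = integral {\<tau>..t} (\<lambda>s. exp (c * t) * (d * (exp (- c * (t - s)) * g (x (s - 1)))))"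
    by simp
  also have "\<dots> = integral {\<tau>..t} (\<lambda>s. exp (c * s) * rhs d (x (s - 1)))"
  proof (rule integral_cong)
    fix s assume "s \<in> {\<tau>..t}"
    then have "rhs d (x (s - 1)) = d * g (x (s - 1))"
      using assms by (simp add: rhs_def)
    moreover have "exp (c * s) = exp (c * t) * exp (- c * (t - s))"
      unfolding exp_add[symmetric] by (simp add: algebra_simps)
    ultimately show "exp (c * t) * (d * (exp (- c * (t - s)) * g (x (s - 1)))) = exp (c * s) * rhs d (x (s - 1))"
      by simp
  qed
  finally show ?thesis by simp
qed

text \<open>The definition imposes the formula for every pair of times. By additivity of the
  integral, the pairs that start at T imply the others, and existence and comparison work with
  these.\<close>

lemma solution_from_iff:
  "solution_from g c d T x \<longleftrightarrow> delay_solution (rhs d) c T x \<and> (\<forall>t\<ge>T - 1. 0 \<le> x t)"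
proof (intro iffI conjI)
  assume x: "solution_from g c d T x"
  then show nn: "\<forall>t\<ge>T - 1. 0 \<le> x t" by (simp add: solution_from_def)
  show "delay_solution (rhs d) c T x"
    unfolding delay_solution_def
  proof (intro conjI allI impI)
    show "continuous_on {T - 1..} x" using x by (simp add: solution_from_def)
    fix t assume t: "T \<le> t"
    show "exp (c * t) * x t = exp (c * T) * x T + integral {T..t} (\<lambda>s. exp (c * s) * rhs d (x (s - 1)))"
    proof (cases "T = t")
      case False
      then have x_t: "x t = exp (- c * (t - T)) * x T + d * integral {T..t} (\<lambda>s. exp (- c * (t - s)) * g (x (s - 1)))"
        using x t unfolding solution_from_def by auto
      have "exp (c * t) * x t = exp (c * t) * exp (- c * (t - T)) * x T
          + exp (c * t) * (d * integral {T..t} (\<lambda>s. exp (- c * (t - s)) * g (x (s - 1))))"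
        by (subst x_t) (simp only: distrib_left mult.assoc)
      moreover have "exp (c * t) * exp (- c * (t - T)) = exp (c * T)"
        unfolding exp_add[symmetric] by (simp add: algebra_simps)
      ultimately show ?thesis
        using solution_integral_eq[of T x T t d] nn by simp
    qed auto
  qed
next
  assume x: "delay_solution (rhs d) c T x \<and> (\<forall>t\<ge>T - 1. 0 \<le> x t)"
  show "solution_from g c d T x"
    unfolding solution_from_def
  proof (intro conjI allI impI)
    show "continuous_on {T - 1..} x" using x by (simp add: delay_solution_def)
    show "0 \<le> x t" if "T - 1 \<le> t" for t using x that by blast
    fix \<tau> t assume t: "T \<le> \<tau> \<and> \<tau> < t"
    have "exp (c * t) * x t = exp (c * \<tau>) * x \<tau>
        + exp (c * t) * (d * integral {\<tau>..t} (\<lambda>s. exp (- c * (t - s)) * g (x (s - 1))))"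
      using delay_solution_from[OF admissible_rhs, of d c T x \<tau> t] solution_integral_eq[of T x \<tau> t d] x t by simp
    moreover have "exp (c * \<tau>) = exp (c * t) * exp (- c * (t - \<tau>))"
      unfolding exp_add[symmetric] by (simp add: algebra_simps)
    ultimately have "exp (c * t) * x t = exp (c * t) * (exp (- c * (t - \<tau>)) * x \<tau>
        + d * integral {\<tau>..t} (\<lambda>s. exp (- c * (t - s)) * g (x (s - 1))))"
      by (simp add: distrib_left mult.assoc)
    then show "x t = exp (- c * (t - \<tau>)) * x \<tau>
        + d * integral {\<tau>..t} (\<lambda>s. exp (- c * (t - s)) * g (x (s - 1)))"
      by simp
  qed
qed

lemma solution_delay: "solution_from g c d T x \<Longrightarrow> delay_solution (rhs d) c T x"
  by (simp add: solution_from_iff)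

lemma solution_from_restrict: "solution_from g c d T x \<Longrightarrow> T \<le> T' \<Longrightarrow> solution_from g c d T' x"
  unfolding solution_from_iff by (auto intro: delay_solution_restrict[OF admissible_rhs])

lemma solution_from_shift: "solution_from g c d T x \<Longrightarrow> solution_from g c d (T - h) (\<lambda>t. x (t + h))"
  unfolding solution_from_iff by (auto intro: delay_solution_shift)

lemma entire_solution_shift: "entire_solution g c d x \<Longrightarrow> entire_solution g c d (\<lambda>t. x (t + h))"
  unfolding entire_solution_def by (metis solution_from_shift add_diff_cancel_right')

lemma solution_unique:
  assumes "solution_from g c d T x" "solution_from g c d T y"
    and "\<And>s. T - 1 \<le> s \<Longrightarrow> s \<le> T \<Longrightarrow> x s = y s" "T - 1 \<le> t"
  shows "x t = y t"
  by (rule delay_solution_unique[OF admissible_rhs solution_delay[OF assms(1)] solution_delay[OF assms(2)] assms(3,4)])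

lemma solution_exists:
  assumes d: "0 \<le> d" and \<phi>: "continuous_on UNIV \<phi>" and nn: "\<And>s. 0 \<le> \<phi> s"
  obtains x where "solution_from g c d T x" "\<And>s. s \<le> T \<Longrightarrow> x s = \<phi> s"
proof -
  obtain x where x: "delay_solution (rhs d) c T x" "\<And>s. s \<le> T \<Longrightarrow> x s = \<phi> s"
    using delay_solution_exists[OF admissible_rhs \<phi>, of d c T] by blast
  have "0 \<le> x t" for t
  proof (cases "t \<le> T")
    case False
    have "0 \<le> integral {T..t} (\<lambda>s. exp (c * s) * rhs d (x (s - 1)))"
      by (intro integral_nonneg delay_integrable[OF admissible_rhs delay_solutionD(1)[OF x(1)]])
         (auto simp: rhs_nonneg d)
    then have "0 \<le> exp (c * t) * x t"
      using delay_solutionD(2)[OF x(1), of t] x(2)[of T] nn[of T] False by simp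
    then show ?thesis by (simp add: zero_le_mult_iff)
  qed (use x nn in auto)
  then show ?thesis
    using x by (intro that[of x]) (auto simp: solution_from_iff)
qed

lemma solution_exists_seg:
  assumes d: "0 \<le> d" and \<phi>: "\<phi> \<in> Cplus"
  obtains x where "solution_from g c d 0 x" "seg x 0 = \<phi>"
proof -
  have "0 \<le> extend \<phi> s" for s
    using \<phi> by (simp add: extend_def Cplus_def)
  then obtain x where x: "solution_from g c d 0 x" "\<And>s. s \<le> 0 \<Longrightarrow> x s = extend \<phi> s"
    using solution_exists[OF d continuous_on_extend] by metis
  have "seg x 0 = seg (extend \<phi>) 0"
    by (rule seg_cong) (simp add: x)
  then show ?thesis
    using x(1) by (intro that) (auto simp: seg_extend)
qed

text \<open>Two solutions with the same initial history agree from -1 on, so the segment picked by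
  the definite description is unique; autonomy moves the starting time from 0 to T.\<close>

lemma semiflow_eq:
  assumes x: "solution_from g c d T x" and t: "0 \<le> t"
  shows "semiflow g c d t (seg x T) = seg x (T + t)"
  unfolding semiflow_def
proof (rule the_equality)
  let ?x = "\<lambda>s. x (s + T)"
  have x': "solution_from g c d 0 ?x"
    using solution_from_shift[OF x, of T] by simp
  have "seg ?x 0 = seg x T" "seg ?x t = seg x (T + t)"
    by (simp_all add: seg_shift add.commute)
  then show "\<exists>y. solution_from g c d 0 y \<and> seg y 0 = seg x T \<and> seg x (T + t) = seg y t"
    using x' by metis
  fix \<psi> assume "\<exists>y. solution_from g c d 0 y \<and> seg y 0 = seg x T \<and> \<psi> = seg y t"
  then obtain y where y: "solution_from g c d 0 y" "seg y 0 = seg x T" "\<psi> = seg y t" by blast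
  have "y s = ?x s" if "- 1 \<le> s" "s \<le> 0" for s
    using seg_eqD[OF solution_from_continuous[OF y(1)] solution_from_continuous[OF x] y(2)] that
    by (simp add: add.commute)
  then have "y s = ?x s" if "-1 \<le> s" for s
    using solution_unique[OF y(1) x', of s] that by simp
  then have "seg y t = seg ?x t"
    using t by (intro seg_cong) auto
  then show "\<psi> = seg x (T + t)"
    using y by (simp add: seg_shift add.commute)
qed

lemma solution_from_cong:
  assumes "solution_from g c d T x" "\<And>s. T - 1 \<le> s \<Longrightarrow> x s = y s"
  shows "solution_from g c d T y"
proof -
  have "continuous_on {T - 1..} y"
    using assms by (auto simp: solution_from_def intro: continuous_on_eq)
  moreover have "integral {\<tau>..t} (\<lambda>s. exp (- c * (t - s)) * g (y (s - 1)))
      = integral {\<tau>..t} (\<lambda>s. exp (- c * (t - s)) * g (x (s - 1)))" if "T \<le> \<tau>" for \<tau> t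
    using that assms(2) by (intro integral_cong) auto
  ultimately show ?thesis
    using assms unfolding solution_from_def by auto
qed

text \<open>Each \<psi> n starts its own forward solution \<open>X n\<close>. By uniqueness
  \<open>X (n + k)\<close>, read k units later, equals \<open>X n\<close>, so the value at t may be
  taken from any n with t + n \<ge> -1.\<close>

lemma entire_solution_of_chain:
  fixes \<psi> :: "nat \<Rightarrow> C"
  assumes d: "0 \<le> d" and \<psi>: "\<And>n. \<psi> n \<in> Cplus" "\<And>n. \<psi> n = semiflow g c d 1 (\<psi> (Suc n))"
  obtains x where "entire_solution g c d x" "\<And>n. seg x (- real n) = \<psi> n"
proof -
  have "\<exists>X. \<forall>n. solution_from g c d 0 (X n) \<and> seg (X n) 0 = \<psi> n"
    by (rule choice) (metis solution_exists_seg[OF d] \<psi>(1))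
  then obtain X where X: "\<And>n. solution_from g c d 0 (X n)" "\<And>n. seg (X n) 0 = \<psi> n" by blast
  have one: "X (Suc n) (t + 1) = X n t" if "-1 \<le> t" for n t
  proof -
    let ?y = "\<lambda>t. X (Suc n) (t + 1)"
    have y: "solution_from g c d 0 ?y"
      using solution_from_restrict[OF solution_from_shift[OF X(1), of 1], of 0] by simp
    have "seg ?y 0 = seg (X n) 0"
      using semiflow_eq[OF X(1), of 1 "Suc n"] \<psi>(2)[of n] X(2) by (simp add: seg_shift)
    then have "?y s = X n s" if "-1 \<le> s" "s \<le> 0" for s
      using seg_eqD[OF solution_from_continuous[OF y] solution_from_continuous[OF X(1)], of 0 0 n s] that by simp
    then show ?thesis
      using solution_unique[OF y X(1), of n t] that by simp
  qed
  have many: "X (n + k) (t + real k) = X n t" if "-1 \<le> t" for n k t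
  proof (induction k)
    case (Suc k)
    then show ?case
      using one[of "t + real k" "n + k"] that by (simp add: add.commute add.left_commute)
  qed auto
  define x where "x t = X (nat \<lceil>- t\<rceil>) (t + real (nat \<lceil>- t\<rceil>))" for t
  have x_eq: "x t = X n (t + real n)" if "-1 \<le> t + real n" for n t
  proof (cases "n \<le> nat \<lceil>- t\<rceil>")
    case True
    then show ?thesis
      using many[of "t + real n" n "nat \<lceil>- t\<rceil> - n"] that by (simp add: x_def)
  next
    case False
    moreover have "-1 \<le> t + real (nat \<lceil>- t\<rceil>)" by linarith
    ultimately show ?thesis
      using many[of "t + real (nat \<lceil>- t\<rceil>)" "nat \<lceil>- t\<rceil>" "n - nat \<lceil>- t\<rceil>"] by (simp add: x_def)
  qed
  have "solution_from g c d T x" for T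
  proof -
    obtain n :: nat where n: "- T \<le> real n" using real_arch_simple by blast
    have "solution_from g c d (- real n) (\<lambda>t. X n (t + real n))"
      using solution_from_shift[OF X(1), of "real n" n] by simp
    then have "solution_from g c d T (\<lambda>t. X n (t + real n))"
      by (rule solution_from_restrict) (use n in simp)
    then show ?thesis
      by (rule solution_from_cong) (rule x_eq[symmetric], use n in linarith)
  qed
  moreover have "seg x (- real n) = \<psi> n" for n
  proof -
    have "seg x (- real n) = seg (\<lambda>t. X n (t + real n)) (- real n)"
      by (rule seg_cong) (use x_eq in auto)
    then show ?thesis by (simp add: seg_shift X(2))
  qed
  ultimately show ?thesis
    by (intro that[of x]) (auto simp: entire_solution_def)
qed

text \<open>\<open>g\<close> increases only on [0,1], so the larger solution has to stay there;
  owing to the delay this is asked only up to one unit before the final time. A larger parameter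
  pushes in the same direction, whence the two values \<open>d\<close> and
  \<open>d'\<close>.\<close>

lemma solution_compare:
  assumes x: "solution_from g c d T x" and y: "solution_from g c d' T y" and d: "0 \<le> d" "d \<le> d'"
    and init: "\<And>s. T - 1 \<le> s \<Longrightarrow> s \<le> T \<Longrightarrow> x s \<le> y s"
    and y_le: "\<And>s. T - 1 \<le> s \<Longrightarrow> s \<le> T' - 1 \<Longrightarrow> y s \<le> 1"
    and t: "T - 1 \<le> t" "t \<le> T'"
  shows "x t \<le> y t" and "x T < y T \<Longrightarrow> T \<le> t \<Longrightarrow> x t < y t"
proof -
  have le: "rhs d (x (s - 1)) \<le> rhs d' (y (s - 1))" if "T \<le> s" "s \<le> T'" "x (s - 1) \<le> y (s - 1)" for s
  proof -
    have "0 \<le> x (s - 1)" using solution_from_nonneg[OF x] that by simp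
    then have "g (x (s - 1)) \<le> g (y (s - 1))" "0 \<le> g (y (s - 1))" "0 \<le> g (x (s - 1))"
      using that y_le[of "s - 1"] by (auto intro!: g_mono g_nonneg)
    then show ?thesis
      using d \<open>0 \<le> x (s - 1)\<close> that by (auto simp: rhs_def intro!: mult_mono)
  qed
  show "x t \<le> y t"
    by (rule delay_solution_mono(1)[OF admissible_rhs admissible_rhs solution_delay[OF x] solution_delay[OF y] init le t])
  show "x t < y t" if "x T < y T" "T \<le> t"
    by (rule delay_solution_strict_mono[OF admissible_rhs admissible_rhs solution_delay[OF x] solution_delay[OF y] init that(1) le that(2) t(2)])
qed

lemma solution_deriv:
  assumes "solution_from g c d T x" "T < t" "x (t - 1) < 1"
  shows "(x has_real_derivative - c * x t + d * g (x (t - 1))) (at t)"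
proof -
  have "(x has_real_derivative - c * x t + rhs d (x (t - 1))) (at t)"
    using assms by (intro delay_solution_deriv[OF admissible_rhs solution_delay[OF assms(1)]] rhs_isCont) auto
  then show ?thesis
    using solution_from_nonneg[OF assms(1), of "t - 1"] assms by (simp add: rhs_def)
qed

text \<open>Variation of constants with the feedback replaced by a constant bound. The bound is
  asked on an open interval, so a state equal to 1 at an endpoint, where \<open>g\<close> is 1
  instead of 0, does no harm.\<close>

lemma solution_bounds:
  assumes x: "solution_from g c d T x" and d: "0 \<le> d" and t: "T \<le> \<tau>" "\<tau> \<le> t"
  shows "(\<And>s. \<tau> < s \<Longrightarrow> s < t \<Longrightarrow> g (x (s - 1)) \<le> G) \<Longrightarrow>
      x t \<le> exp (- c * (t - \<tau>)) * x \<tau> + d * G / c * (1 - exp (- c * (t - \<tau>)))"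
    and "(\<And>s. \<tau> < s \<Longrightarrow> s < t \<Longrightarrow> G \<le> g (x (s - 1))) \<Longrightarrow>
      exp (- c * (t - \<tau>)) * x \<tau> + d * G / c * (1 - exp (- c * (t - \<tau>))) \<le> x t"
proof -
  let ?k = "\<lambda>s. exp (c * s) * rhs d (x (s - 1))"
  have k: "?k integrable_on {\<tau><..<t}"
    by (subst integrable_on_open_interval_real)
       (rule delay_integrable[OF admissible_rhs delay_solutionD(1)[OF solution_delay[OF x]] t(1)])
  have eq: "exp (c * t) * x t = exp (c * \<tau>) * x \<tau> + integral {\<tau><..<t} ?k"
    using delay_solution_from[OF admissible_rhs solution_delay[OF x] t]
    by (simp add: integral_open_interval_real)
  have G: "((\<lambda>s. exp (c * s) * (d * G)) has_integral (d * G / c * (exp (c * t) - exp (c * \<tau>)))) {\<tau><..<t}"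
  proof -
    have "((\<lambda>s. exp (c * s) * (d * G)) has_integral (exp (c * t) * (d * G / c) - exp (c * \<tau>) * (d * G / c))) {\<tau>..t}"
      using t c_pos by (intro fundamental_theorem_of_calculus)
        (auto intro!: derivative_eq_intros simp flip: has_real_derivative_iff_has_vector_derivative)
    then show ?thesis
      by (simp add: has_integral_Icc_iff_Ioo algebra_simps)
  qed
  have rhs_eq: "rhs d (x (s - 1)) = d * g (x (s - 1))" if "\<tau> < s" for s
    using solution_from_nonneg[OF x, of "s - 1"] that t by (simp add: rhs_def)
  have conv: "exp (- c * (t - \<tau>)) * x \<tau> + d * G / c * (1 - exp (- c * (t - \<tau>)))
      = exp (- c * t) * (exp (c * \<tau>) * x \<tau> + d * G / c * (exp (c * t) - exp (c * \<tau>)))"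
  proof -
    have "exp (- c * (t - \<tau>)) = exp (- c * t) * exp (c * \<tau>)" "exp (- c * t) * exp (c * t) = 1"
      by (auto simp flip: exp_add simp: algebra_simps)
    then show ?thesis by (simp add: algebra_simps)
  qed
  have x_t: "x t = exp (- c * t) * (exp (c * \<tau>) * x \<tau> + integral {\<tau><..<t} ?k)"
    by (simp add: eq[symmetric] mult.assoc[symmetric] flip: exp_add)
  show "x t \<le> exp (- c * (t - \<tau>)) * x \<tau> + d * G / c * (1 - exp (- c * (t - \<tau>)))"
    if "\<And>s. \<tau> < s \<Longrightarrow> s < t \<Longrightarrow> g (x (s - 1)) \<le> G"
  proof -
    have "integral {\<tau><..<t} ?k \<le> integral {\<tau><..<t} (\<lambda>s. exp (c * s) * (d * G))"
      using that d by (intro integral_le k has_integral_integrable[OF G]) (auto simp: rhs_eq intro!: mult_left_mono)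
    then show ?thesis
      unfolding conv x_t integral_unique[OF G] by simp
  qed
  show "exp (- c * (t - \<tau>)) * x \<tau> + d * G / c * (1 - exp (- c * (t - \<tau>))) \<le> x t"
    if "\<And>s. \<tau> < s \<Longrightarrow> s < t \<Longrightarrow> G \<le> g (x (s - 1))"
  proof -
    have "integral {\<tau><..<t} (\<lambda>s. exp (c * s) * (d * G)) \<le> integral {\<tau><..<t} ?k"
      using that d by (intro integral_le k has_integral_integrable[OF G]) (auto simp: rhs_eq intro!: mult_left_mono)
    then show ?thesis
      unfolding conv x_t integral_unique[OF G] by simp
  qed
qed

lemma solution_decay:
  assumes x: "solution_from g c d T x" and d: "0 \<le> d" and t: "T \<le> \<tau>" "\<tau> \<le> t"
  shows "exp (- c * (t - \<tau>)) * x \<tau> \<le> x t"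
  using solution_bounds(2)[OF assms, of 0] solution_from_nonneg[OF x] t
  by (simp add: g_nonneg)

lemma solution_free:
  assumes x: "solution_from g c d T x" and d: "0 \<le> d" and t: "T \<le> \<tau>" "\<tau> \<le> t"
    and "\<And>s. \<tau> - 1 < s \<Longrightarrow> s < t - 1 \<Longrightarrow> 1 < x s"
  shows "x t = exp (- c * (t - \<tau>)) * x \<tau>"
  using solution_bounds(1)[OF x d t, of 0] solution_decay[OF x d t] assms(5)
  by (simp add: g_beyond)

text \<open>x t is at most a convex combination of x \<tau> and d G / c, and neither exceeds
  B.\<close>

lemma solution_le:
  assumes x: "solution_from g c d T x" and d: "0 \<le> d" and t: "T \<le> \<tau>" "\<tau> \<le> t"
    and "x \<tau> \<le> B" "\<And>s. \<tau> < s \<Longrightarrow> s < t \<Longrightarrow> g (x (s - 1)) \<le> G" "d * G \<le> c * B"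
  shows "x t \<le> B"
proof -
  have e: "exp (- c * (t - \<tau>)) \<le> 1" using t c_pos by simp
  have "d * G / c \<le> B" using assms(7) c_pos by (simp add: divide_le_eq mult.commute)
  then have "exp (- c * (t - \<tau>)) * x \<tau> + d * G / c * (1 - exp (- c * (t - \<tau>)))
      \<le> exp (- c * (t - \<tau>)) * B + B * (1 - exp (- c * (t - \<tau>)))"
    using e assms(5) by (intro add_mono mult_left_mono mult_right_mono) auto
  then show ?thesis
    using solution_bounds(1)[OF x d t assms(6)] by (simp add: algebra_simps)
qed

lemma solution_le_ratio:
  assumes x: "solution_from g c d T x" and d: "0 \<le> d" and t: "T \<le> \<tau>" "\<tau> \<le> t" and "x \<tau> \<le> d / c"
  shows "x t \<le> d / c"
  using solution_from_nonneg[OF x] t assms(5) c_pos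
  by (intro solution_le[OF x d t, of _ 1]) (auto intro: g_le_1)

text \<open>The gain rate is at most d because g \<le> 1, and the loss rate c x is at most d because
  x \<le> d / c.\<close>

lemma solution_lipschitz:
  assumes x: "solution_from g c d T x" and d: "0 \<le> d"
    and B: "\<And>s. T \<le> s \<Longrightarrow> x s \<le> d / c" and t: "T \<le> \<tau>" "T \<le> t"
  shows "\<bar>x t - x \<tau>\<bar> \<le> d * \<bar>t - \<tau>\<bar>"
proof -
  have *: "\<bar>x t - x \<tau>\<bar> \<le> d * (t - \<tau>)" if t: "T \<le> \<tau>" "\<tau> \<le> t" for \<tau> t
  proof -
    let ?e = "exp (- c * (t - \<tau>))"
    have e: "1 - ?e \<le> c * (t - \<tau>)" "?e \<le> 1"
      using exp_ge_add_one_self[of "- c * (t - \<tau>)"] t c_pos by auto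
    have nn: "0 \<le> x \<tau>" using solution_from_nonneg[OF x] t by simp
    have "x t \<le> ?e * x \<tau> + d * 1 / c * (1 - ?e)"
      using t solution_from_nonneg[OF x] by (intro solution_bounds(1)[OF x d t]) (auto intro!: g_le_1)
    moreover have "?e * x \<tau> \<le> x \<tau>" using nn e by (simp add: mult_left_le_one_le)
    moreover have "d * 1 / c * (1 - ?e) \<le> d * 1 / c * (c * (t - \<tau>))"
      using d c_pos e by (intro mult_left_mono) auto
    ultimately have 1: "x t - x \<tau> \<le> d * (t - \<tau>)" using c_pos by simp
    have "x \<tau> - x t \<le> (1 - ?e) * x \<tau>"
      using solution_decay[OF x d t] by (simp add: algebra_simps)
    also have "\<dots> \<le> c * (t - \<tau>) * (d / c)"
      using e B[of \<tau>] t nn c_pos by (intro mult_mono) auto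
    finally show ?thesis using 1 c_pos by (simp add: mult.commute)
  qed
  show ?thesis
    using *[of \<tau> t] *[of t \<tau>] t by (cases "\<tau> \<le> t") (auto simp: abs_minus_commute)
qed

end

section \<open>Compactness\<close>

text \<open>Tychonoff's theorem for a product of compact intervals.\<close>

lemma compact_pointwise_box: "compact {f :: 'i \<Rightarrow> real. \<forall>i. \<bar>f i\<bar> \<le> B}"
proof -
  have "compactin (product_topology (\<lambda>_. euclidean) UNIV) (PiE UNIV (\<lambda>_ :: 'i. {- B..B}))"
    unfolding compactin_PiE by simp
  moreover have "PiE UNIV (\<lambda>_ :: 'i. {- B..B}) = {f. \<forall>i. \<bar>f i\<bar> \<le> B}"
    by (auto simp: PiE_def Pi_def abs_le_iff minus_le_iff)
  ultimately show ?thesis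
    by (simp add: euclidean_product_topology)
qed

text \<open>The diagonal extraction of Arzela-Ascoli. Over the countable index set of the rationals
  the product space is metrizable, so compactness of the box gives a subsequence; the common
  Lipschitz constant then makes the values at every real point Cauchy.\<close>

lemma lipschitz_pointwise_subsequence:
  fixes f :: "nat \<Rightarrow> real \<Rightarrow> real"
  assumes B: "\<And>n t. \<bar>f n t\<bar> \<le> B" and L: "\<And>n s t. \<bar>f n s - f n t\<bar> \<le> L * \<bar>s - t\<bar>"
  obtains r h where "strict_mono (r :: nat \<Rightarrow> nat)" "\<And>t. (\<lambda>n. f (r n) t) \<longlonglongrightarrow> h t"
    "\<And>s t. \<bar>h s - h t\<bar> \<le> L * \<bar>s - t\<bar>"
proof -
  define F where "F n q = f n (real_of_rat q)" for n q
  have "F n \<in> {f. \<forall>i. \<bar>f i\<bar> \<le> B}" for n by (simp add: F_def B)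
  then obtain l r where r: "strict_mono (r :: nat \<Rightarrow> nat)" and l: "(F \<circ> r) \<longlonglongrightarrow> l"
    using seq_compactE[OF compact_imp_seq_compact[OF compact_pointwise_box], of F B] by metis
  have q: "(\<lambda>n. f (r n) (real_of_rat q)) \<longlonglongrightarrow> l q" for q
    using continuous_on_tendsto_compose[OF continuous_on_product_coordinates[of q] l]
    by (simp add: F_def o_def)
  have L0: "0 \<le> L" using L[of 0 0 1] by (simp add: order_trans[OF abs_ge_zero])
  have "Cauchy (\<lambda>n. f (r n) t)" for t
  proof (rule metric_CauchyI)
    fix e :: real assume e: "0 < e"
    have "t < t + e / (4 * (L + 1))" using e L0 by simp
    then obtain q where q1: "t < real_of_rat q" "real_of_rat q < t + e / (4 * (L + 1))"
      using of_rat_dense by blast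
    have "Cauchy (\<lambda>n. f (r n) (real_of_rat q))" using q by (rule LIMSEQ_imp_Cauchy)
    then obtain N where N: "\<And>m n. m \<ge> N \<Longrightarrow> n \<ge> N \<Longrightarrow> dist (f (r m) (real_of_rat q)) (f (r n) (real_of_rat q)) < e / 2"
      using e by (meson metric_CauchyD half_gt_zero)
    have near: "\<bar>f (r n) t - f (r n) (real_of_rat q)\<bar> \<le> e / 4" for n
    proof -
      have "\<bar>f (r n) t - f (r n) (real_of_rat q)\<bar> \<le> L * (e / (4 * (L + 1)))"
        using L[of "r n" t "real_of_rat q"] q1 L0
        by (smt (verit) mult_left_mono)
      also have "\<dots> \<le> e / 4" using L0 e by (simp add: field_simps)
      finally show ?thesis .
    qed
    show "\<exists>M. \<forall>m\<ge>M. \<forall>n\<ge>M. dist (f (r m) t) (f (r n) t) < e"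
    proof (intro exI allI impI)
      fix m n assume "m \<ge> N" "n \<ge> N"
      then show "dist (f (r m) t) (f (r n) t) < e"
        using near[of m] near[of n] N[of m n] unfolding dist_real_def by linarith
    qed
  qed
  then have "\<exists>h. \<forall>t. (\<lambda>n. f (r n) t) \<longlonglongrightarrow> h t"
    by (intro choice allI) (simp add: Cauchy_convergent_iff convergent_def)
  then obtain h where h: "\<And>t. (\<lambda>n. f (r n) t) \<longlonglongrightarrow> h t" by blast
  have "\<bar>h s - h t\<bar> \<le> L * \<bar>s - t\<bar>" for s t
    by (rule LIMSEQ_le_const2[OF tendsto_rabs[OF tendsto_diff[OF h h]]]) (use L in blast)
  with r h show ?thesis by (rule that)
qed

text \<open>Convergence on a finite \<delta>-net with L \<delta> \<le> e / 4 controls the whole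
  interval.\<close>

lemma lipschitz_uniform_limit:
  fixes f :: "nat \<Rightarrow> real \<Rightarrow> real"
  assumes f: "\<And>t. (\<lambda>n. f n t) \<longlonglongrightarrow> h t"
    and L: "\<And>n s t. \<bar>f n s - f n t\<bar> \<le> L * \<bar>s - t\<bar>" "\<And>s t. \<bar>h s - h t\<bar> \<le> L * \<bar>s - t\<bar>"
  shows "uniform_limit {a..b} f h sequentially"
proof (rule uniform_limitI)
  fix e :: real assume e: "0 < e"
  have L0: "0 \<le> L" using L(2)[of 0 1] by (simp add: order_trans[OF abs_ge_zero])
  define \<delta> where "\<delta> = e / (4 * (L + 1))"
  have \<delta>: "0 < \<delta>" "L * \<delta> \<le> e / 4" using e L0 by (auto simp: \<delta>_def field_simps)
  have "{a..b} \<subseteq> \<Union> ((\<lambda>t. {t - \<delta><..<t + \<delta>}) ` {a..b})" using \<delta> by auto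
  then obtain S where S: "S \<subseteq> {a..b}" "finite S" "{a..b} \<subseteq> \<Union> ((\<lambda>t. {t - \<delta><..<t + \<delta>}) ` S)"
    using compactE_image[OF compact_Icc, of "{a..b}" "\<lambda>t. {t - \<delta><..<t + \<delta>}" a b] by auto
  have "\<forall>\<^sub>F n in sequentially. \<forall>t\<in>S. dist (f n t) (h t) < e / 4"
    using S(2) e by (intro eventually_ball_finite ballI tendstoD[OF f]) auto
  then show "\<forall>\<^sub>F n in sequentially. \<forall>t\<in>{a..b}. dist (f n t) (h t) < e"
  proof eventually_elim
    case (elim n)
    show ?case
    proof
      fix t assume "t \<in> {a..b}"
      then obtain s where s: "s \<in> S" "\<bar>t - s\<bar> \<le> \<delta>" using S(3) by (force simp: abs_le_iff)
      have "L * \<bar>t - s\<bar> \<le> e / 4" using s \<delta> L0 by (meson mult_left_mono order_trans)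
      then have "\<bar>f n t - f n s\<bar> \<le> e / 4" "\<bar>h t - h s\<bar> \<le> e / 4" using L(1)[of n t s] L(2)[of t s] by linarith+
      moreover have "\<bar>f n s - h s\<bar> < e / 4" using elim s(1) by (auto simp: dist_real_def)
      ultimately show "dist (f n t) (h t) < e" using e unfolding dist_real_def by linarith
    qed
  qed
qed

text \<open>Clamping preserves the Lipschitz constant, so histories become uniformly Lipschitz
  functions on the line and the two preceding lemmas apply. Bounds and Lipschitz constant pass to
  the limit.\<close>

lemma compact_CLip:
  assumes L: "0 \<le> L" shows "compact (CLip L \<kappa>1 \<kappa>2)"
  unfolding compact_eq_seq_compact_metric
proof (rule seq_compactI)
  fix \<phi> :: "nat \<Rightarrow> C" assume \<phi>: "\<forall>n. \<phi> n \<in> CLip L \<kappa>1 \<kappa>2"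
  have p: "0 \<le> \<phi> n s" "\<kappa>1 \<le> \<phi> n s" "\<phi> n s \<le> \<kappa>2" "\<bar>\<phi> n s - \<phi> n r\<bar> \<le> L * \<bar>of_hist s - of_hist r\<bar>" for n s r
    using \<phi> by (auto simp: CLip_def Cbetween_def Cplus_def)
  have "\<bar>extend (\<phi> n) t\<bar> \<le> \<kappa>2" for n t
    using p by (simp add: extend_def)
  moreover have lip: "\<bar>extend (\<phi> n) s - extend (\<phi> n) t\<bar> \<le> L * \<bar>s - t\<bar>" for n s t
  proof -
    have "\<bar>extend (\<phi> n) s - extend (\<phi> n) t\<bar> \<le> L * \<bar>max (-1) (min 0 s) - max (-1) (min 0 t)\<bar>"
      using p(4)[of n "to_hist (max (-1) (min 0 s))" "to_hist (max (-1) (min 0 t))"]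
      by (simp add: extend_def of_hist_to_hist)
    also have "\<dots> \<le> L * \<bar>s - t\<bar>" using L by (intro mult_left_mono) (auto simp: max_def min_def)
    finally show ?thesis .
  qed
  ultimately obtain r h where r: "strict_mono (r :: nat \<Rightarrow> nat)" "\<And>t. (\<lambda>n. extend (\<phi> (r n)) t) \<longlonglongrightarrow> h t"
    and hL: "\<And>s t. \<bar>h s - h t\<bar> \<le> L * \<bar>s - t\<bar>"
    using lipschitz_pointwise_subsequence[of "\<lambda>n. extend (\<phi> n)" \<kappa>2 L] by blast
  have "continuous_on UNIV h"
    by (rule lipschitz_on_continuous_on[of L])
       (use hL L in \<open>auto simp: lipschitz_on_def dist_real_def\<close>)
  then have hc: "continuous_on S h" for S by (rule continuous_on_subset) simp
  define \<psi> :: C where "\<psi> = seg h 0"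
  have \<psi>: "\<psi> s = h (of_hist s)" for s
    unfolding \<psi>_def by (simp add: seg_apply[OF hc])
  have lim: "(\<lambda>n. \<phi> (r n) s) \<longlonglongrightarrow> \<psi> s" for s
    using r(2)[of "of_hist s"] by (simp add: \<psi>)
  have "\<psi> \<in> CLip L \<kappa>1 \<kappa>2"
    unfolding CLip_def Cbetween_def Cplus_def mem_Collect_eq
  proof (intro conjI allI)
    fix s s'
    show "0 \<le> \<psi> s" "\<kappa>1 \<le> \<psi> s" by (rule LIMSEQ_le_const[OF lim]; use p in blast)+
    show "\<psi> s \<le> \<kappa>2" by (rule LIMSEQ_le_const2[OF lim]; use p in blast)
    show "\<bar>\<psi> s - \<psi> s'\<bar> \<le> L * \<bar>of_hist s - of_hist s'\<bar>" by (simp add: \<psi> hL)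
  qed
  moreover have "(\<phi> \<circ> r) \<longlonglongrightarrow> \<psi>"
  proof (rule uniform_limit_tendsto_bcontfun)
    have u: "uniform_limit {-1..0} (\<lambda>n. extend (\<phi> (r n))) h sequentially"
      by (rule lipschitz_uniform_limit[OF r(2) lip hL])
    show "uniform_limit UNIV (\<lambda>n. apply_bcontfun ((\<phi> \<circ> r) n)) (apply_bcontfun \<psi>) sequentially"
    proof (rule uniform_limitI)
      fix e :: real assume "0 < e"
      from uniform_limitD[OF u this]
      show "\<forall>\<^sub>F n in sequentially. \<forall>s\<in>UNIV. dist ((\<phi> \<circ> r) n s) (\<psi> s) < e"
      proof eventually_elim
        case (elim n)
        show ?case
        proof
          fix s show "dist ((\<phi> \<circ> r) n s) (\<psi> s) < e"
            using elim[rule_format, of "of_hist s"] of_hist_bounds[of s] by (simp add: \<psi>)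
        qed
      qed
    qed
  qed
  ultimately show "\<exists>l\<in>CLip L \<kappa>1 \<kappa>2. \<exists>r. strict_mono r \<and> (\<phi> \<circ> r) \<longlonglongrightarrow> l"
    using r(1) by blast
qed

lemma seg_in_CLip:
  assumes "continuous_on {t - 1..t} u" "0 \<le> \<kappa>1"
    "\<And>s. t - 1 \<le> s \<Longrightarrow> s \<le> t \<Longrightarrow> \<kappa>1 \<le> u s" "\<And>s. t - 1 \<le> s \<Longrightarrow> s \<le> t \<Longrightarrow> u s \<le> \<kappa>2"
    "\<And>s r. t - 1 \<le> s \<Longrightarrow> s \<le> t \<Longrightarrow> t - 1 \<le> r \<Longrightarrow> r \<le> t \<Longrightarrow> \<bar>u s - u r\<bar> \<le> L * \<bar>s - r\<bar>"
  shows "seg u t \<in> CLip L \<kappa>1 \<kappa>2"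
proof -
  have r: "t - 1 \<le> t + of_hist s" "t + of_hist s \<le> t" for s using of_hist_bounds[of s] by auto
  have "\<bar>u (t + of_hist s) - u (t + of_hist r)\<bar> \<le> L * \<bar>of_hist s - of_hist r\<bar>" for s r
    using assms(5)[OF r r, of s r] by simp
  moreover have "0 \<le> u (t + of_hist s)" for s using assms(2) assms(3)[OF r, of s] by simp
  ultimately show ?thesis
    using r assms by (simp add: CLip_def Cbetween_def Cplus_def seg_apply)
qed

lemma seg_tendsto_const:
  fixes x :: "real \<Rightarrow> real"
  assumes x: "continuous_on UNIV x" and lim: "(x \<longlongrightarrow> k) F" and F: "F = at_top \<or> F = at_bot"
  shows "((\<lambda>t. infdist (seg x t) {const_bcontfun k}) \<longlongrightarrow> 0) F"
proof (rule tendstoI)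
  fix e :: real assume e: "0 < e"
  have 1: "\<forall>\<^sub>F t in F. dist (x t) k < e / 2" using e by (intro tendstoD[OF lim]) simp
  have "\<forall>\<^sub>F t in F. \<forall>s. t - 1 \<le> s \<and> s \<le> t \<longrightarrow> dist (x s) k < e / 2"
    using F
  proof
    assume "F = at_top"
    then obtain N where N: "\<And>t. t \<ge> N \<Longrightarrow> dist (x t) k < e / 2"
      using 1 by (auto simp: eventually_at_top_linorder)
    show ?thesis
      unfolding \<open>F = at_top\<close> eventually_at_top_linorder by (intro exI[of _ "N + 1"] allI impI N) simp
  next
    assume "F = at_bot"
    then obtain N where N: "\<And>t. t \<le> N \<Longrightarrow> dist (x t) k < e / 2"
      using 1 by (auto simp: eventually_at_bot_linorder)
    show ?thesis
      unfolding \<open>F = at_bot\<close> eventually_at_bot_linorder by (intro exI[of _ N] allI impI N) simp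
  qed
  then show "\<forall>\<^sub>F t in F. dist (infdist (seg x t) {const_bcontfun k}) 0 < e"
  proof eventually_elim
    case (elim t)
    have c: "continuous_on {t - 1..t} x" by (rule continuous_on_subset[OF x]) simp
    have "norm (seg x t - const_bcontfun k) \<le> e / 2"
      unfolding seg_minus_const[OF c]
      by (rule norm_seg_le) (use c elim in \<open>auto intro!: continuous_intros simp: dist_real_def less_imp_le\<close>)
    then show ?case using e by (simp add: dist_norm)
  qed
qed

section \<open>Extinction and persistence\<close>

context pulse_super
begin

text \<open>Strictly below the stationary point the feedback returns at most the fraction q < 1 of
  what decay removes. By superlinearity this fraction does not increase when the bound on the state
  is lowered, so the bound can be improved geometrically.\<close>

lemma extinction_below:
  assumes x: "solution_from g c d T x" and M: "M < \<xi>\<^sub>1"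
    and init: "\<And>s. T - 1 \<le> s \<Longrightarrow> s \<le> T \<Longrightarrow> x s \<le> M"
  shows "(x \<longlongrightarrow> 0) at_top"
proof -
  \<comment> \<open>M may be 0; the bound is raised to a positive level still below the stationary
    point, so that q makes sense.\<close>
  define B where "B = max M (\<xi>\<^sub>1 / 2)"
  have B: "0 < B" "B < \<xi>\<^sub>1" "M \<le> B" using M xi1_pos by (auto simp: B_def)
  define q where "q = d * g B / (c * B)"
  have q0: "0 \<le> q" using B xi1_lt_1 c_pos d_pos g_nonneg[of B] by (auto simp: q_def)
  have q1: "q < 1" using g_below_xi1[of B] B c_pos by (simp add: q_def)
  have gq: "d * g \<xi> \<le> c * (q * b)" if "0 \<le> \<xi>" "\<xi> \<le> b" "b \<le> B" for \<xi> b
  proof (cases "b = 0")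
    case False
    then have b: "0 < b" using that by simp
    have "g \<xi> \<le> g b" using that B xi1_lt_1 by (intro g_mono) auto
    also have "g b \<le> b / B * g B"
      using g_superlinear[of b "B / b"] that B b xi1_lt_1 by (simp add: field_simps)
    finally have "d * g \<xi> \<le> d * (b / B * g B)" using d_pos by (intro mult_left_mono) auto
    also have "\<dots> = c * (q * b)" using B c_pos by (simp add: q_def)
    finally show ?thesis .
  qed (use that g_0 in auto)
  have first: "x t \<le> B" if "T - 1 \<le> t" for t
  proof -
    have "\<forall>t. T - 1 \<le> t \<and> t \<le> T + real n \<longrightarrow> x t \<le> B" for n
    proof (induction n)
      case 0 then show ?case using init B by force
    next
      case (Suc n)
      show ?case
      proof (intro allI impI)
        fix t assume t: "T - 1 \<le> t \<and> t \<le> T + real (Suc n)"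
        show "x t \<le> B"
        proof (cases "t \<le> T")
          case True then show ?thesis using init t B by force
        next
          case False
          show ?thesis
          proof (rule solution_le[OF x _ order_refl, of t B "q * (c * B) / d"])
            show "g (x (s - 1)) \<le> q * (c * B) / d" if "T < s" "s < t" for s
              using gq[of "x (s - 1)" B] Suc t that solution_from_nonneg[OF x, of "s - 1"] d_pos
              by (simp add: field_simps)
            show "d * (q * (c * B) / d) \<le> c * B" using q1 q0 B c_pos d_pos by (simp add: mult_left_le_one_le)
          qed (use False init[of T] B d_pos in auto)
        qed
      qed
    qed
    moreover obtain n :: nat where "t - T \<le> real n" using real_arch_simple by blast
    ultimately show ?thesis using that by (metis diff_le_eq add.commute)
  qed
  \<comment> \<open>The midpoint of q and 1. The feedback alone would give the factor q; the
    difference pays for the transient exp (- c (t - S)) once that is below 1/2.\<close>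
  define r where "r = (1 + q) / 2"
  have r: "0 \<le> r" "r < 1" using q0 q1 by (auto simp: r_def)
  have geo: "\<forall>\<^sub>F t in at_top. x t \<le> B * r ^ n" for n
  proof (induction n)
    case 0
    then show ?case using first by (auto simp: eventually_at_top_linorder intro!: exI[of _ "T - 1"])
  next
    case (Suc n)
    let ?b = "B * r ^ n"
    have b: "0 \<le> ?b" "?b \<le> B" using B r by (auto simp: power_le_one mult_left_le)
    obtain N where N: "\<And>t. t \<ge> N \<Longrightarrow> x t \<le> ?b" using Suc by (auto simp: eventually_at_top_linorder)
    define S where "S = max T (N + 1)"
    have "\<forall>\<^sub>F t in at_top. exp (- c * (t - S)) < 1 / 2"
    proof -
      have "((\<lambda>t. exp (- c * (t - S))) \<longlongrightarrow> 0) at_top" using c_pos by real_asymp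
      then show ?thesis by (rule order_tendstoD) simp
    qed
    moreover have "\<forall>\<^sub>F t in at_top. t \<ge> S" by (rule eventually_ge_at_top)
    ultimately show ?case
    proof eventually_elim
      case (elim t)
      let ?e = "exp (- c * (t - S))"
      have "x t \<le> ?e * x S + d * (c * (q * ?b) / d) / c * (1 - ?e)"
      proof (rule solution_bounds(1)[OF x])
        show "g (x (s - 1)) \<le> c * (q * ?b) / d" if "S < s" "s < t" for s
          using gq[of "x (s - 1)" ?b] N[of "s - 1"] that solution_from_nonneg[OF x, of "s - 1"] b d_pos
          by (simp add: field_simps S_def)
      qed (use elim d_pos in \<open>auto simp: S_def\<close>)
      also have "\<dots> \<le> ?e * ?b + q * ?b * (1 - ?e)"
        using N[of S] d_pos c_pos by (auto simp: S_def intro!: mult_left_mono)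
      also have "\<dots> = q * ?b + ?e * ((1 - q) * ?b)" by (simp add: algebra_simps)
      also have "\<dots> \<le> q * ?b + 1 / 2 * ((1 - q) * ?b)"
        using elim b q1 by (intro add_left_mono mult_right_mono) auto
      also have "\<dots> = B * r ^ Suc n" by (simp add: r_def field_simps)
      finally show ?case .
    qed
  qed
  show ?thesis
  proof (rule tendstoI)
    fix e :: real assume e: "0 < e"
    have "(\<lambda>n. B * r ^ n) \<longlonglongrightarrow> B * 0" by (intro tendsto_intros LIMSEQ_power_zero) (use r in auto)
    then have "\<forall>\<^sub>F n in sequentially. B * r ^ n < e" using e by (intro order_tendstoD) auto
    then obtain n where n: "B * r ^ n < e" by (auto simp: eventually_sequentially)
    from geo[of n] eventually_ge_at_top[of "T - 1"] show "\<forall>\<^sub>F t in at_top. dist (x t) 0 < e"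
      by eventually_elim (use n solution_from_nonneg[OF x] in \<open>auto simp: dist_real_def abs_le_iff\<close>)
  qed
qed

end

section \<open>The history left by a passage through 1, and the threshold\<close>

context pulse
begin

text \<open>Time 0 is the passage through 1 and [0,1] carries the initial history, hence the
  starting time 1.\<close>

definition decay_start :: "real \<Rightarrow> (real \<Rightarrow> real) \<Rightarrow> bool"
  where "decay_start d y \<longleftrightarrow> solution_from g c d 1 y \<and> (\<forall>s\<in>{0..1}. y s = exp (- c * s))"

definition Y :: "real \<Rightarrow> real \<Rightarrow> real"
  where "Y d = (SOME y. decay_start d y)"

lemma decay_start_Y: assumes "0 \<le> d" shows "decay_start d (Y d)"
proof -
  obtain y where "solution_from g c d 1 y" "\<And>s. s \<le> 1 \<Longrightarrow> y s = exp (- c * s)"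
    by (rule solution_exists[OF assms, of "\<lambda>s. exp (- c * s)" 1]) (auto intro!: continuous_intros)
  then have "decay_start d y" by (simp add: decay_start_def)
  then have "decay_start d (SOME y. decay_start d y)" by (rule someI[of "decay_start d" y])
  then show ?thesis by (simp only: Y_def)
qed

lemma Y_solution: "0 \<le> d \<Longrightarrow> solution_from g c d 1 (Y d)"
  and Y_init: "0 \<le> d \<Longrightarrow> 0 \<le> s \<Longrightarrow> s \<le> 1 \<Longrightarrow> Y d s = exp (- c * s)"
  using decay_start_Y by (auto simp: decay_start_def)

lemma Y_unique: "0 \<le> d \<Longrightarrow> decay_start d y \<Longrightarrow> 0 \<le> t \<Longrightarrow> y t = Y d t"
  using solution_unique[of d 1 y "Y d" t] Y_solution[of d] by (auto simp: decay_start_def Y_init)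

lemma Y_le:
  assumes d: "0 \<le> d" "d \<le> d'" and le: "\<And>s. 0 < s \<Longrightarrow> s \<le> t - 1 \<Longrightarrow> Y d' s \<le> 1" and t: "0 \<le> t"
  shows "Y d t \<le> Y d' t"
proof (rule solution_compare(1)[OF Y_solution Y_solution])
  show "Y d' s \<le> 1" if "1 - 1 \<le> s" "s \<le> t - 1" for s
    using le[of s] that d Y_init[of d' 0] by (cases "s = 0") auto
  show "Y d s \<le> Y d' s" if "1 - 1 \<le> s" "s \<le> 1" for s using that d by (simp add: Y_init)
qed (use d t in auto)

text \<open>Only positive times count, since \<open>Y d 0\<close> is always 1.\<close>

definition reaching :: "real set"
  where "reaching = {d. d > c \<and> (\<exists>t>0. 1 \<le> Y d t)}"

definition critical :: real
  where "critical = Inf reaching"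

text \<open>If \<open>Y d'\<close> stayed below 1, it would dominate \<open>Y d\<close> for all
  time, although the latter returns to 1.\<close>

lemma reaching_upward: "d \<in> reaching \<Longrightarrow> d \<le> d' \<Longrightarrow> d' \<in> reaching"
proof (rule ccontr)
  assume d: "d \<in> reaching" "d \<le> d'" and not: "d' \<notin> reaching"
  then obtain t where t: "0 < t" "1 \<le> Y d t" by (auto simp: reaching_def)
  have lt: "Y d' s < 1" if "0 < s" for s
    using not d that by (force simp: reaching_def)
  have "Y d t \<le> Y d' t"
    using d c_pos t lt by (intro Y_le) (auto simp: reaching_def less_imp_le)
  then show False using lt[of t] t by simp
qed

text \<open>On (1,2) the delayed state is at least exp (- c), so the feedback is at least d g (exp
  (- c)) there, and a large d lifts \<open>Y d 2\<close> to 1.\<close>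

lemma reaching_nonempty: "reaching \<noteq> {}"
proof -
  define I where "I = exp (- 2 * c) * g (exp (- c)) "
  have I: "0 < I" using g_pos[of "exp (- c)"] c_pos by (simp add: I_def)
  define \<gamma> where "\<gamma> = g (exp (- c)) / c * (1 - exp (- c))"
  have \<gamma>: "0 < \<gamma>" using g_pos[of "exp (- c)"] c_pos by (simp add: \<gamma>_def)
  define d where "d = max (c + 1) (1 / \<gamma>)"
  have d: "0 \<le> d" "c < d" "1 / \<gamma> \<le> d" using c_pos by (auto simp: d_def)
  have "exp (- c * (2 - 1)) * Y d 1 + d * g (exp (- c)) / c * (1 - exp (- c * (2 - 1))) \<le> Y d 2"
  proof (rule solution_bounds(2)[OF Y_solution[OF d(1)] d(1)])
    fix s :: real assume s: "1 < s" "s < 2"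
    show "g (exp (- c)) \<le> g (Y d (s - 1))"
      using s c_pos d by (simp add: Y_init) (intro g_mono, auto simp: mult_left_le)
  qed auto
  moreover have "0 \<le> exp (- c * (2 - 1)) * Y d 1" using solution_from_nonneg[OF Y_solution[OF d(1)], of 1] by simp
  moreover have "1 \<le> d * \<gamma>" using d \<gamma> by (simp add: field_simps)
  ultimately have "1 \<le> Y d 2" by (simp add: \<gamma>_def)
  then have "d \<in> reaching" using d by (auto simp: reaching_def intro!: exI[of _ 2])
  then show ?thesis by blast
qed

text \<open>On [1,2] variation of constants bounds \<open>Y d\<close> by e exp (- c) + (d / c) (1 -
  e) with e between exp (- c) and 1, hence by q + (d / c - 1). For d = c this is q < 1, and g q < q.
  By continuity the bound M still satisfies d g M < c M for d close to c, and then it is never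
  exceeded.\<close>

lemma near_c_not_reaching: "\<exists>d0>c. \<forall>d. c < d \<and> d < d0 \<longrightarrow> d \<notin> reaching"
proof -
  define q where "q = 1 - exp (- c) * (1 - exp (- c))"
  have ec: "0 < exp (- c)" "exp (- c) < 1" using c_pos by auto
  have prod: "0 < exp (- c) * (1 - exp (- c))" "exp (- c) * (1 - exp (- c)) < 1"
    using ec mult_strict_mono[of "exp (- c)" 1 "1 - exp (- c)" 1] by simp_all
  have q: "0 < q" "q < 1" using prod by (auto simp: q_def)
  have lim: "((\<lambda>d. q + (d / c - 1)) \<longlongrightarrow> q + (c / c - 1)) (at_right c)"
    using c_pos by (intro tendsto_intros) auto
  then have lim': "((\<lambda>d. q + (d / c - 1)) \<longlongrightarrow> q) (at_right c)" using c_pos by simp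
  have "q * g 1 > g q * 1"
    using g_ratio_mono[of q 1] q by (simp add: field_simps)
  then have gq: "g q < q" by (simp add: g_1)
  have isc: "isCont g q"
    using g_deriv_at[of q] q DERIV_isCont by blast
  have 1: "\<forall>\<^sub>F d in at_right c. q + (d / c - 1) < 1"
    using lim' q by (intro order_tendstoD) auto
  have "((\<lambda>d. c * (q + (d / c - 1)) - d * g (q + (d / c - 1))) \<longlongrightarrow> c * q - c * g q) (at_right c)"
    by (intro tendsto_intros lim' isCont_tendsto_compose[OF isc])
  moreover have "0 < c * q - c * g q" using gq c_pos by simp
  ultimately have 2: "\<forall>\<^sub>F d in at_right c. 0 < c * (q + (d / c - 1)) - d * g (q + (d / c - 1))"
    by (rule order_tendstoD)
  from eventually_conj[OF 1 2] obtain d0 where d0: "d0 > c"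
    "\<And>d. c < d \<Longrightarrow> d < d0 \<Longrightarrow> q + (d / c - 1) < 1 \<and> 0 < c * (q + (d / c - 1)) - d * g (q + (d / c - 1))"
    using c_pos by (auto simp: eventually_at_right[of c "c + 1"])
  have "d \<notin> reaching" if d: "c < d" "d < d0" for d
  proof -
    interpret pulse_super g g' c d by unfold_locales (rule d)
    define M where "M = q + (d / c - 1)"
    have "0 < d / c - 1" using d c_pos by (simp add: field_simps)
    then have M: "0 < M" "M < 1" "d * g M < c * M" using d0(2)[OF d] q by (auto simp: M_def)
    then have "M < \<xi>\<^sub>1" using g_above_xi1[of M] xi1_eq by (cases M "\<xi>\<^sub>1" rule: linorder_cases) auto
    have on12: "Y d t \<le> M" if "1 \<le> t" "t \<le> 2" for t
    proof -
      let ?e = "exp (- c * (t - 1))"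
      have e: "exp (- c) \<le> ?e" "?e \<le> 1" using that c_pos by (auto simp: mult_left_le)
      have "Y d t \<le> ?e * Y d 1 + d * 1 / c * (1 - ?e)"
      proof (rule solution_bounds(1)[OF Y_solution])
        show "g (Y d (s - 1)) \<le> 1" if "1 < s" "s < t" for s
          using solution_from_nonneg[OF Y_solution, of d "s - 1"] that d_pos by (intro g_le_1) auto
      qed (use d_pos that in auto)
      also have "\<dots> = 1 - ?e * (1 - exp (- c)) + (d / c - 1) * (1 - ?e)"
        using d c_pos by (simp add: Y_init algebra_simps)
      also have "\<dots> \<le> 1 - exp (- c) * (1 - exp (- c)) + (d / c - 1) * 1"
        using e d c_pos ec by (intro add_mono diff_mono mult_mono) auto
      finally show ?thesis by (simp add: M_def q_def)
    qed
    have later: "Y d t \<le> M" if "2 \<le> t" for t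
    proof -
      have "\<forall>t. 1 \<le> t \<and> t \<le> 2 + real n \<longrightarrow> Y d t \<le> M" for n
      proof (induction n)
        case 0 then show ?case using on12 by auto
      next
        case (Suc n)
        show ?case
        proof (intro allI impI)
          fix t assume t: "1 \<le> t \<and> t \<le> 2 + real (Suc n)"
          show "Y d t \<le> M"
          proof (cases "t \<le> 2")
            case True then show ?thesis using on12 t by auto
          next
            case False
            show ?thesis
            proof (rule solution_le[OF Y_solution, of d 2 t M "g M"])
              show "g (Y d (s - 1)) \<le> g M" if "2 < s" "s < t" for s
                using Suc t that solution_from_nonneg[OF Y_solution, of d "s - 1"] M d_pos
                by (intro g_mono) auto
            qed (use False on12[of 2] M d_pos in auto)
          qed
        qed
      qed
      moreover obtain n :: nat where "t - 2 \<le> real n" using real_arch_simple by blast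
      ultimately show ?thesis using that by (metis diff_le_eq add.commute order_trans one_le_numeral)
    qed
    have "Y d t < 1" if "0 < t" for t
      using on12[of t] later[of t] M Y_init[of d t] d_pos c_pos that by (cases "t \<le> 1"; cases "t \<le> 2") auto
    then show ?thesis by (auto simp: reaching_def not_le)
  qed
  then show ?thesis using d0(1) by blast
qed

lemma reaching_bdd_below: "bdd_below reaching"
  by (rule bdd_belowI[of _ c]) (simp add: reaching_def)

lemma critical_gt: "c < critical"
proof -
  obtain d0 where d0: "c < d0" "\<And>d. c < d \<Longrightarrow> d < d0 \<Longrightarrow> d \<notin> reaching" using near_c_not_reaching by blast
  have "d0 \<le> critical"
    unfolding critical_def using reaching_nonempty d0
    by (intro cInf_greatest) (auto simp: reaching_def not_less[symmetric])
  then show ?thesis using d0 by simp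
qed

lemma above_critical: "critical < d \<Longrightarrow> \<exists>t>0. 1 \<le> Y d t"
proof -
  assume "critical < d"
  then obtain d1 where "d1 \<in> reaching" "d1 < d"
    unfolding critical_def using reaching_nonempty reaching_bdd_below by (auto simp: cInf_less_iff)
  then have "d \<in> reaching" using reaching_upward by (meson less_imp_le)
  then show ?thesis by (simp add: reaching_def)
qed

lemma below_critical: "c < d \<Longrightarrow> d < critical \<Longrightarrow> 0 < t \<Longrightarrow> Y d t < 1"
proof -
  assume d: "c < d" "d < critical" "0 < t"
  then have "d \<notin> reaching"
    unfolding critical_def using cInf_lower[OF _ reaching_bdd_below] by (meson not_less)
  then show ?thesis using d by (auto simp: reaching_def not_le)
qed

text \<open>A strictly larger \<open>d'\<close> improves any eventual bound \<open>\<rho> * Y d \<le> Y d'\<close> by a fixed factor, as long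
  as \<open>exp (c * t) * Y d t\<close> is unbounded; since \<open>Y d' \<le> 1\<close>, this forces \<open>Y d\<close> to vanish.\<close>

lemma Y_extinction_between:
  assumes d: "c < d" "d < d'" and lt: "\<And>t. 0 < t \<Longrightarrow> Y d' t < 1"
  shows "(Y d \<longlongrightarrow> 0) at_top"
proof -
  let ?y = "Y d" and ?z = "Y d'"
  have d0: "0 \<le> d" "0 \<le> d'" using d c_pos by auto
  note y = Y_solution[OF d0(1)] and z = Y_solution[OF d0(2)]
  have z1: "?z t \<le> 1" if "0 \<le> t" for t
    using lt[of t] Y_init[OF d0(2), of 0] that by (cases "t = 0") auto
  have yz: "?y t \<le> ?z t" if "0 \<le> t" for t
    using d d0 that z1 by (intro Y_le) auto
  have y_nn: "0 \<le> ?y t" if "0 \<le> t" for t using solution_from_nonneg[OF y] that by simp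
  define E where "E t = exp (c * t) * ?y t" for t
  have E_mono: "E s \<le> E t" if "1 \<le> s" "s \<le> t" for s t
  proof -
    have "exp (c * t) * (exp (- c * (t - s)) * ?y s) \<le> exp (c * t) * ?y t"
      by (intro mult_left_mono solution_decay[OF y d0(1) that]) auto
    moreover have "exp (c * t) * exp (- c * (t - s)) = exp (c * s)"
      unfolding exp_add[symmetric] by (simp add: algebra_simps)
    ultimately show ?thesis unfolding E_def by (metis mult.assoc)
  qed
  show ?thesis
  \<comment> \<open>\<open>E\<close> is nondecreasing. If it is bounded, \<open>Y d\<close> decays
    like exp (- c t). If not, it eventually outweighs every additive constant, which the
    amplification argument relies on.\<close>
  proof (cases "\<exists>K. \<forall>t\<ge>1. E t \<le> K")
    case True
    then obtain K where K: "\<And>t. t \<ge> 1 \<Longrightarrow> E t \<le> K" by blast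
    have "((\<lambda>t. K * exp (- c * t)) \<longlongrightarrow> 0) at_top" using c_pos by real_asymp
    then show ?thesis
    proof (rule tendsto_sandwich[OF _ _ tendsto_const, rotated 2])
      show "\<forall>\<^sub>F t in at_top. 0 \<le> ?y t"
        using eventually_ge_at_top[of 0] by eventually_elim (rule y_nn)
      show "\<forall>\<^sub>F t in at_top. ?y t \<le> K * exp (- c * t)"
        using eventually_ge_at_top[of 1]
        by eventually_elim (use K in \<open>auto simp: E_def exp_minus field_simps\<close>)
    qed
  next
    case False
    \<comment> \<open>Integrating the feedbacks multiplies a bound \<rho> by d' / d up to an
      additive loss \<open>C\<close>. Asking only for the smaller factor k leaves room to absorb
      \<open>C\<close> once \<open>E t\<close> is large, and k > 1 still makes the powers
      diverge.\<close>
    define k where "k = (1 + d' / d) / 2"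
    have k: "1 < k" "k < d' / d" using d c_pos by (auto simp: k_def field_simps)
    have grow: "\<forall>\<^sub>F t in at_top. k ^ n * ?y t \<le> ?z t" for n
    proof (induction n)
      case 0
      show ?case using eventually_ge_at_top[of 0] by eventually_elim (use yz in simp)
    next
      case (Suc n)
      define \<rho> where "\<rho> = k ^ n"
      have \<rho>: "1 \<le> \<rho>" using k by (simp add: \<rho>_def)
      obtain N where N: "\<And>t. t \<ge> N \<Longrightarrow> \<rho> * ?y t \<le> ?z t"
        using Suc by (auto simp: eventually_at_top_linorder \<rho>_def)
      define S where "S = max 1 (N + 1)"
      define C where "C = d' / d * \<rho> * E S"
      have "E S \<ge> 0" using y_nn[of S] by (simp add: E_def S_def)
      then have C0: "0 \<le> C" using \<rho> d d0 by (simp add: C_def)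
      have main: "d' / d * \<rho> * E t - C \<le> exp (c * t) * ?z t" if t: "S \<le> t" for t
      proof -
        let ?iy = "integral {S..t} (\<lambda>s. exp (c * s) * rhs d (?y (s - 1)))"
        let ?iz = "integral {S..t} (\<lambda>s. exp (c * s) * rhs d' (?z (s - 1)))"
        have S1: "1 \<le> S" by (simp add: S_def)
        have iy: "(\<lambda>s. exp (c * s) * rhs d (?y (s - 1))) integrable_on {S..t}"
          by (rule delay_integrable[OF admissible_rhs delay_solutionD(1)[OF solution_delay[OF y]] S1])
        have "d' / d * \<rho> * ?iy = integral {S..t} (\<lambda>s. d' / d * \<rho> * (exp (c * s) * rhs d (?y (s - 1))))"
          by simp
        also have "\<dots> \<le> ?iz"
        proof (rule integral_le)
          show "(\<lambda>s. d' / d * \<rho> * (exp (c * s) * rhs d (?y (s - 1)))) integrable_on {S..t}"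
            by (rule integrable_on_mult_right[OF iy])
          show "(\<lambda>s. exp (c * s) * rhs d' (?z (s - 1))) integrable_on {S..t}"
            by (rule delay_integrable[OF admissible_rhs delay_solutionD(1)[OF solution_delay[OF z]] S1])
          fix s assume s: "s \<in> {S..t}"
          then have s1: "0 \<le> s - 1" "N \<le> s - 1" by (auto simp: S_def)
          have le: "\<rho> * ?y (s - 1) \<le> ?z (s - 1)" by (rule N[OF s1(2)])
          have "\<rho> * g (?y (s - 1)) \<le> g (\<rho> * ?y (s - 1))"
            using le z1[OF s1(1)] \<rho> y_nn[OF s1(1)] by (intro g_superlinear) auto
          also have "\<dots> \<le> g (?z (s - 1))"
            using le z1[OF s1(1)] \<rho> y_nn[OF s1(1)] by (intro g_mono) auto
          finally have "d' * (\<rho> * g (?y (s - 1))) \<le> d' * g (?z (s - 1))"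
            using d0 by (intro mult_left_mono)
          moreover have "rhs d (?y (s - 1)) = d * g (?y (s - 1))" "rhs d' (?z (s - 1)) = d' * g (?z (s - 1))"
            using y_nn[OF s1(1)] solution_from_nonneg[OF z, of "s - 1"] s1 by (auto simp: rhs_def)
          ultimately show "d' / d * \<rho> * (exp (c * s) * rhs d (?y (s - 1))) \<le> exp (c * s) * rhs d' (?z (s - 1))"
            using d c_pos by simp
        qed
        finally have "d' / d * \<rho> * ?iy \<le> ?iz" .
        moreover have "E t = E S + ?iy"
          unfolding E_def by (rule delay_solution_from[OF admissible_rhs solution_delay[OF y] S1 t])
        moreover have "exp (c * t) * ?z t = exp (c * S) * ?z S + ?iz"
          by (rule delay_solution_from[OF admissible_rhs solution_delay[OF z] S1 t])
        moreover have "0 \<le> exp (c * S) * ?z S" using solution_from_nonneg[OF z, of S] S1 by simp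
        ultimately show ?thesis by (simp add: C_def algebra_simps)
      qed
      define K where "K = C / ((d' / d - k) * \<rho>)"
      obtain T1 where T1: "T1 \<ge> 1" "K < E T1" using False by (auto simp: not_le)
      show ?case
        using eventually_ge_at_top[of S] eventually_ge_at_top[of T1]
      proof eventually_elim
        case (elim t)
        have "K < E t" using T1 E_mono[of T1 t] elim by simp
        then have C_lt: "C < (d' / d - k) * \<rho> * E t"
          using k \<rho> by (simp add: K_def divide_less_eq mult.commute)
        have "exp (c * t) * (k * \<rho> * ?y t) \<le> exp (c * t) * ?z t"
        proof -
          have "k * \<rho> * E t \<le> exp (c * t) * ?z t"
            using main[OF elim(1)] C_lt unfolding left_diff_distrib by linarith
          then show ?thesis by (simp add: E_def mult_ac)
        qed
        then have "k * \<rho> * ?y t \<le> ?z t" by (rule mult_left_le_imp_le) simp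
        then show ?case by (simp add: \<rho>_def)
      qed
    qed
    show ?thesis
    proof (rule tendstoI)
      fix e :: real assume e: "0 < e"
      obtain n where n: "1 / e < k ^ n" using real_arch_pow[OF k(1)] by blast
      show "\<forall>\<^sub>F t in at_top. dist (?y t) 0 < e"
        using grow[of n] eventually_ge_at_top[of 0]
      proof eventually_elim
        case (elim t)
        have "k ^ n * ?y t \<le> 1" using elim z1[of t] by simp
        also have "1 < k ^ n * e" using n e by (simp add: field_simps)
        finally have "?y t < e" using k by simp
        then show ?case using y_nn[of t] elim by simp
      qed
    qed
  qed
qed

lemma Y_extinction: "c < d \<Longrightarrow> d < critical \<Longrightarrow> (Y d \<longlongrightarrow> 0) at_top"
  by (rule Y_extinction_between[of d "(d + critical) / 2"]) (auto intro!: below_critical)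

text \<open>A solution at 1 decays no faster than exp (- c s), so its next unit dominates the
  initial history of \<open>Y d\<close>. While it stays below 1, comparison keeps it above
  \<open>Y d\<close>, which reaches 1 at \<tau>.\<close>

lemma return_before:
  assumes d: "0 \<le> d" and x: "solution_from g c d T0 x" and T: "T0 \<le> T" "x T = 1"
    and \<tau>: "0 < \<tau>" "1 \<le> Y d \<tau>"
  shows "\<exists>t. T < t \<and> t \<le> T + \<tau> \<and> 1 \<le> x t"
proof (rule ccontr)
  assume "\<not> ?thesis"
  then have lt: "x t < 1" if "T < t" "t \<le> T + \<tau>" for t using that by force
  let ?x = "\<lambda>t. x (t + T)"
  have x': "solution_from g c d 1 ?x"
    using solution_from_restrict[OF solution_from_shift[OF x, of T], of 1] T by simp
  have "Y d \<tau> \<le> ?x \<tau>"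
  proof (rule solution_compare(1)[OF Y_solution[OF d] x' d order_refl])
    show "Y d s \<le> ?x s" if "1 - 1 \<le> s" "s \<le> 1" for s
    proof -
      have "exp (- c * (s + T - T)) * x T \<le> x (s + T)"
        by (rule solution_decay[OF x d T(1)]) (use that in simp)
      then show ?thesis using that T by (simp add: Y_init d)
    qed
    show "?x s \<le> 1" if "1 - 1 \<le> s" "s \<le> \<tau> - 1" for s
      using lt[of "s + T"] that T by (cases "s = 0") auto
  qed (use \<tau> in auto)
  then show False using lt[of "T + \<tau>"] \<tau> by (auto simp: add.commute)
qed

end

section \<open>Limit sets\<close>

context pulse
begin

text \<open>Replaces the semiflow, which is a definite description, by segments of one known
  solution; the sampling times merely shift by T.\<close>

lemma omega_limit_seg:
  assumes x: "solution_from g c d T x"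
  shows "omega_limit g c d (seg x T) = {\<zeta> \<in> Cplus. \<exists>s :: nat \<Rightarrow> real.
    filterlim s at_top sequentially \<and> (\<lambda>k. seg x (s k)) \<longlonglongrightarrow> \<zeta>}"
proof (intro set_eqI iffI)
  fix \<zeta> assume "\<zeta> \<in> omega_limit g c d (seg x T)"
  then obtain s where \<zeta>: "\<zeta> \<in> Cplus" and s: "filterlim s at_top sequentially"
    and lim: "(\<lambda>k. semiflow g c d (s k) (seg x T)) \<longlonglongrightarrow> \<zeta>"
    unfolding omega_limit_def by blast
  have "\<forall>\<^sub>F k in sequentially. semiflow g c d (s k) (seg x T) = seg x (T + s k)"
    using filterlim_at_top[THEN iffD1, OF s, rule_format, of 0]
    by eventually_elim (rule semiflow_eq[OF x])
  then have "(\<lambda>k. seg x (T + s k)) \<longlonglongrightarrow> \<zeta>" using lim by (rule Lim_transform_eventually[rotated])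
  moreover have "filterlim (\<lambda>k. T + s k) at_top sequentially"
    by (rule filterlim_tendsto_add_at_top[OF tendsto_const s])
  ultimately show "\<zeta> \<in> {\<zeta> \<in> Cplus. \<exists>s :: nat \<Rightarrow> real.
    filterlim s at_top sequentially \<and> (\<lambda>k. seg x (s k)) \<longlonglongrightarrow> \<zeta>}"
    using \<zeta> by (auto intro!: exI[of _ "\<lambda>k. T + s k"])
next
  fix \<zeta> assume "\<zeta> \<in> {\<zeta> \<in> Cplus. \<exists>s :: nat \<Rightarrow> real.
    filterlim s at_top sequentially \<and> (\<lambda>k. seg x (s k)) \<longlonglongrightarrow> \<zeta>}"
  then obtain s where \<zeta>: "\<zeta> \<in> Cplus" and s: "filterlim s at_top sequentially"
    and lim: "(\<lambda>k. seg x (s k)) \<longlonglongrightarrow> \<zeta>" by blast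
  have "\<forall>\<^sub>F k in sequentially. seg x (s k) = semiflow g c d (s k - T) (seg x T)"
    using filterlim_at_top[THEN iffD1, OF s, rule_format, of T]
    by eventually_elim (simp add: semiflow_eq[OF x])
  then have "(\<lambda>k. semiflow g c d (s k - T) (seg x T)) \<longlonglongrightarrow> \<zeta>"
    using lim by (rule Lim_transform_eventually[rotated])
  moreover have "filterlim (\<lambda>k. s k - T) at_top sequentially"
    using filterlim_tendsto_add_at_top[OF tendsto_const[of "- T"] s] by simp
  ultimately show "\<zeta> \<in> omega_limit g c d (seg x T)"
    using \<zeta> unfolding omega_limit_def by (auto intro!: exI[of _ "\<lambda>k. s k - T"])
qed

text \<open>The semiflow may be discontinuous; all four properties are drawn from compactness of a
  set that holds the forward orbit.\<close>

lemma omega_limit_properties: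
  assumes x: "solution_from g c d T x" and K: "compact K" "K \<subseteq> Cplus" and sub: "\<And>t. T \<le> t \<Longrightarrow> seg x t \<in> K"
  defines "A \<equiv> omega_limit g c d (seg x T)"
  shows "A \<noteq> {}" "compact A" "A \<subseteq> K" "((\<lambda>t. infdist (seg x t) A) \<longlongrightarrow> 0) at_top"
proof -
  have subseq: "\<exists>\<zeta> r. \<zeta> \<in> K \<and> strict_mono (r :: nat \<Rightarrow> nat) \<and> (\<lambda>k. seg x (s (r k))) \<longlonglongrightarrow> \<zeta> \<and> \<zeta> \<in> A"
    if s: "filterlim s at_top sequentially" "\<And>k. T \<le> s k" for s :: "nat \<Rightarrow> real"
  proof -
    obtain \<zeta> r where \<zeta>: "\<zeta> \<in> K" "strict_mono (r :: nat \<Rightarrow> nat)" "((\<lambda>k. seg x (s k)) \<circ> r) \<longlonglongrightarrow> \<zeta>"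
      using seq_compactE[OF compact_imp_seq_compact[OF K(1)], of "\<lambda>k. seg x (s k)"] sub s(2) by metis
    have "filterlim (\<lambda>k. s (r k)) at_top sequentially"
      by (rule filterlim_compose[OF s(1) filterlim_subseq[OF \<zeta>(2)]])
    then have "\<zeta> \<in> A"
      using \<zeta> K unfolding A_def omega_limit_seg[OF x] by (auto simp: o_def intro!: exI[of _ "\<lambda>k. s (r k)"])
    then show ?thesis using \<zeta> by (auto simp: o_def)
  qed
  have "filterlim (\<lambda>k. T + real k) at_top sequentially"
    by (intro filterlim_tendsto_add_at_top[OF tendsto_const] filterlim_real_sequentially)
  from subseq[OF this] show ne: "A \<noteq> {}" by auto
  show "A \<subseteq> K"
  proof
    fix \<zeta> assume "\<zeta> \<in> A"
    then obtain s where s: "filterlim s at_top sequentially" "(\<lambda>k. seg x (s k)) \<longlonglongrightarrow> \<zeta>"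
      unfolding A_def omega_limit_seg[OF x] by blast
    have "\<forall>\<^sub>F k in sequentially. seg x (s k) \<in> K"
      using filterlim_at_top[THEN iffD1, OF s(1), rule_format, of T] by eventually_elim (rule sub)
    then show "\<zeta> \<in> K"
      by (rule Lim_in_closed_set[OF compact_imp_closed[OF K(1)] _ _ s(2)]) simp
  qed
  have "closed A"
    unfolding closed_sequential_limits
  proof (intro allI impI)
    fix \<zeta> l assume "(\<forall>n. \<zeta> n \<in> A) \<and> \<zeta> \<longlonglongrightarrow> l"
    then have \<zeta>: "\<And>n. \<zeta> n \<in> A" "\<zeta> \<longlonglongrightarrow> l" by auto
    \<comment> \<open>A diagonal choice: the n-th time exceeds n and its segment is within 1 / (n +
      1) of the n-th limit point.\<close>
    have "\<exists>t\<ge>max T (real n). dist (seg x t) (\<zeta> n) < inverse (real (Suc n))" for n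
    proof -
      obtain s where s: "filterlim s at_top sequentially" "(\<lambda>k. seg x (s k)) \<longlonglongrightarrow> \<zeta> n"
        using \<zeta>(1)[of n] unfolding A_def omega_limit_seg[OF x] by blast
      have "\<forall>\<^sub>F k in sequentially. dist (seg x (s k)) (\<zeta> n) < inverse (real (Suc n))"
        by (rule tendstoD[OF s(2)]) simp
      moreover have "\<forall>\<^sub>F k in sequentially. max T (real n) \<le> s k"
        by (rule filterlim_at_top[THEN iffD1, OF s(1), rule_format])
      ultimately have "\<forall>\<^sub>F k in sequentially. max T (real n) \<le> s k \<and> dist (seg x (s k)) (\<zeta> n) < inverse (real (Suc n))"
        by eventually_elim simp
      then show ?thesis by (auto simp: eventually_sequentially)
    qed
    then obtain t where t: "\<And>n. max T (real n) \<le> t n" "\<And>n. dist (seg x (t n)) (\<zeta> n) < inverse (real (Suc n))"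
      by metis
    have "(\<lambda>n. dist (seg x (t n)) (\<zeta> n)) \<longlonglongrightarrow> 0"
      by (rule tendsto_sandwich[OF _ _ tendsto_const LIMSEQ_inverse_real_of_nat])
         (use t(2) in \<open>auto intro!: always_eventually less_imp_le\<close>)
    then have "(\<lambda>n. dist (seg x (t n)) (\<zeta> n) + dist (\<zeta> n) l) \<longlonglongrightarrow> 0 + 0"
      using \<zeta>(2) by (intro tendsto_add) (simp_all add: tendsto_dist_iff[symmetric])
    then have "(\<lambda>n. dist (seg x (t n)) (\<zeta> n) + dist (\<zeta> n) l) \<longlonglongrightarrow> 0" by simp
    then have "(\<lambda>n. dist (seg x (t n)) l) \<longlonglongrightarrow> 0"
      by (rule Lim_null_comparison[OF always_eventually, rotated]) (simp_all add: dist_triangle)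
    then have "(\<lambda>n. seg x (t n)) \<longlonglongrightarrow> l" by (simp add: tendsto_dist_iff[symmetric])
    moreover have "filterlim t at_top sequentially"
      by (rule filterlim_at_top_mono[OF filterlim_real_sequentially]) (use t(1) in \<open>auto intro!: always_eventually\<close>)
    moreover have "l \<in> Cplus"
      using \<open>A \<subseteq> K\<close> K \<zeta> closed_sequentially[OF compact_imp_closed[OF K(1)], of \<zeta> l] by auto
    ultimately show "l \<in> A" unfolding A_def omega_limit_seg[OF x] by blast
  qed
  then show "compact A" using K(1) \<open>A \<subseteq> K\<close> by (auto intro: compact_Int_closed[of K A] simp: Int_absorb1 dest: compact_Int_closed[of K A])
  show "((\<lambda>t. infdist (seg x t) A) \<longlongrightarrow> 0) at_top"
  proof (rule ccontr)
    assume "\<not> ?thesis"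
    then obtain e where e: "0 < e" "\<not> (\<forall>\<^sub>F t in at_top. dist (infdist (seg x t) A) 0 < e)"
      by (auto simp: tendsto_iff)
    then have "\<exists>t\<ge>max T (real n). e \<le> infdist (seg x t) A" for n
      by (auto simp: eventually_at_top_linorder not_less infdist_nonneg abs_of_nonneg)
         (metis max.bounded_iff)
    then obtain t where t: "\<And>n. max T (real n) \<le> t n" "\<And>n. e \<le> infdist (seg x (t n)) A" by metis
    have "filterlim t at_top sequentially"
      by (rule filterlim_at_top_mono[OF filterlim_real_sequentially]) (use t(1) in \<open>auto intro!: always_eventually\<close>)
    then obtain \<zeta> r where \<zeta>: "(\<lambda>k. seg x (t (r k))) \<longlonglongrightarrow> \<zeta>" "\<zeta> \<in> A"
      using subseq[of t] t(1) by auto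
    have "\<forall>\<^sub>F k in sequentially. dist (seg x (t (r k))) \<zeta> < e" by (rule tendstoD[OF \<zeta>(1) e(1)])
    then obtain k where "dist (seg x (t (r k))) \<zeta> < e" by (auto simp: eventually_sequentially)
    then have "infdist (seg x (t (r k))) A < e" using infdist_le[OF \<zeta>(2)] by (rule le_less_trans[rotated])
    then show False using t(2)[of "r k"] by simp
  qed
qed

end

section \<open>The dynamics above the unstable stationary point\<close>

context pulse_super
begin

text \<open>Keeps those data of x^+ on which the long time behaviour depends. Without the phase at 0
  and the manifold, the same lemmas apply to every \<open>plus_solution\<close> and to the orbits
  built from branches.\<close>

definition pulse_orbit :: "(real \<Rightarrow> real) \<Rightarrow> real \<Rightarrow> real \<Rightarrow> bool"
  where "pulse_orbit x t1 t2 \<longleftrightarrow> entire_solution g c d x \<and> (x \<longlongrightarrow> \<xi>\<^sub>1) at_bot \<and>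
    t1 + 1 < t2 \<and> x t1 = 1 \<and> x t2 = 1 \<and> strict_mono_on {..t1 + 1} x \<and>
    (\<forall>t\<in>{t1<..<t2}. 1 < x t) \<and> (\<forall>s\<in>{0..1}. x (t2 + s) = exp (- c * s))"

context
  fixes x t1 t2 assumes po: "pulse_orbit x t1 t2"
begin

lemma po_solution: "solution_from g c d T x"
  using po entire_solutionD by (auto simp: pulse_orbit_def)

lemma po_continuous: "continuous_on S x"
  using po entire_solution_continuous by (auto simp: pulse_orbit_def)

lemma po_after: "0 \<le> t \<Longrightarrow> x (t2 + t) = Y d t"
proof (rule Y_unique)
  show "decay_start d (\<lambda>t. x (t2 + t))"
    using po solution_from_shift[OF po_solution[of "t2 + 1"], of t2]
    by (auto simp: decay_start_def pulse_orbit_def add.commute)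
qed (use d_pos in auto)

lemma po_extinction: "d < critical \<Longrightarrow> (x \<longlongrightarrow> 0) at_top"
proof -
  assume d: "d < critical"
  have "((\<lambda>t. Y d (t - t2)) \<longlongrightarrow> 0) at_top"
    by (rule filterlim_compose[OF Y_extinction[OF d_gt d]]) real_asymp
  moreover have "\<forall>\<^sub>F t in at_top. Y d (t - t2) = x t"
    using eventually_ge_at_top[of t2]
  proof eventually_elim
    case (elim t) then show ?case using po_after[of "t - t2"] by simp
  qed
  ultimately show ?thesis by (rule Lim_transform_eventually)
qed

text \<open>Far back the solution is below 1 < d / c, and the level d / c cannot be crossed
  upwards.\<close>

lemma po_upper: "x t \<le> d / c"
proof -
  have "\<forall>\<^sub>F s in at_bot. x s < 1"
    using po xi1_lt_1 by (intro order_tendstoD) (auto simp: pulse_orbit_def)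
  then have "\<forall>\<^sub>F s in at_bot. x s < 1 \<and> s \<le> t" using eventually_le_at_bot[of t] by eventually_elim simp
  then obtain s where s: "x s < 1" "s \<le> t" by (auto simp: eventually_at_bot_linorder)
  have "1 \<le> d / c" using d_gt c_pos by simp
  then show ?thesis
    by (intro solution_le_ratio[OF po_solution[of s] _ order_refl s(2)]) (use s d_pos in auto)
qed

lemma po_early: "t \<le> t1 + 1 \<Longrightarrow> \<xi>\<^sub>1 \<le> x t"
proof (rule ccontr)
  assume t: "t \<le> t1 + 1" "\<not> \<xi>\<^sub>1 \<le> x t"
  have "\<forall>\<^sub>F s in at_bot. x t < x s"
    using po t by (intro order_tendstoD) (auto simp: pulse_orbit_def)
  then have "\<forall>\<^sub>F s in at_bot. x t < x s \<and> s < t" using eventually_gt_at_bot[of t] by eventually_elim simp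
  then obtain s where "x t < x s" "s < t" by (auto simp: eventually_at_bot_linorder)
  then show False
    using po t by (auto simp: pulse_orbit_def strict_mono_on_def) (smt (verit))
qed

lemma po_lipschitz: "\<bar>x s - x t\<bar> \<le> d * \<bar>s - t\<bar>"
  by (rule solution_lipschitz[OF po_solution[of "min s t"]]) (use d_pos po_upper in auto)

lemma po_persistence:
  assumes d: "critical < d"
  shows "\<exists>m0 m1 \<sigma>. 0 < m0 \<and> m0 < 1 \<and> 1 < m1 \<and> m1 \<le> d / c \<and> 0 < \<sigma> \<and>
    orbit x \<subseteq> CLip (2 * d) m0 m1 \<and>
    (\<forall>T\<ge>t2. \<exists>t\<in>{T..T + \<sigma>}. x t = 1) \<and>
    (let A = omega_limit g c d (seg x (t2 + 1)) in
       A \<noteq> {} \<and> compact A \<and> A \<subseteq> CLip (2 * d) m0 m1 \<and>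
       ((\<lambda>t. infdist (seg x t) A) \<longlongrightarrow> 0) at_top \<and>
       const_bcontfun 0 \<notin> A \<and> const_bcontfun \<xi>\<^sub>1 \<notin> A)"
proof -
  obtain \<tau> where \<tau>: "0 < \<tau>" "1 \<le> Y d \<tau>" using above_critical[OF d] by blast
  \<comment> \<open>\<tau> bounds the duration of an excursion below 1, and ln (d / c) / c is the
    time in which pure decay brings the largest possible value d / c down to 1. The rest covers the
    unit of delay before the feedback is off and makes the final inequality strict.\<close>
  define \<sigma> where "\<sigma> = \<tau> + 2 + ln (d / c) / c"
  have lnp: "0 \<le> ln (d / c) / c" using d_gt c_pos by (intro divide_nonneg_pos) auto
  have \<sigma>: "0 < \<sigma>" using \<tau> lnp by (simp add: \<sigma>_def)
  have x_t2: "x t2 = 1" using po by (simp add: pulse_orbit_def)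
  \<comment> \<open>S is the last time in [t2, T] with x \<ge> 1. A further such time would occur
    within \<tau> by \<open>return_before\<close>, so T lies before S + \<tau>.\<close>
  have last_hit: "\<exists>S. t2 \<le> S \<and> S \<le> T \<and> x S = 1 \<and> T < S + \<tau>"
    if T: "t2 \<le> T" and lt: "x T < 1" for T
  proof -
    define H where "H = {s \<in> {t2..T}. x s \<ge> 1}"
    have "closed H"
      unfolding H_def by (intro continuous_on_closed_Collect_le continuous_intros po_continuous)
    have "H = {t2..T} \<inter> H" by (auto simp: H_def)
    then have "compact H" using \<open>closed H\<close> by (metis compact_Icc compact_Int_closed)
    moreover have "t2 \<in> H" using x_t2 T by (simp add: H_def)
    ultimately obtain S where S: "S \<in> H" "\<And>s. s \<in> H \<Longrightarrow> s \<le> S"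
      using compact_attains_sup[of H] by blast
    have S': "t2 \<le> S" "S \<le> T" "1 \<le> x S" using S(1) by (auto simp: H_def)
    have "x S = 1"
    proof (rule ccontr)
      assume "x S \<noteq> 1"
      then have "1 < x S" using S' by simp
      then obtain s where s: "S \<le> s" "s \<le> T" "x s = 1"
        using IVT2'[of x T 1 S] lt S' po_continuous by auto
      then have "s \<in> H" using S' by (simp add: H_def)
      then have "s = S" using S(2) s by force
      then show False using s \<open>x S \<noteq> 1\<close> by simp
    qed
    moreover have "T < S + \<tau>"
    proof (rule ccontr)
      assume "\<not> T < S + \<tau>"
      moreover obtain t where t: "S < t" "t \<le> S + \<tau>" "1 \<le> x t"
        using return_before[OF _ po_solution[of S] order_refl \<open>x S = 1\<close> \<tau>] d_pos by auto
      ultimately have "t \<in> H" using S' by (simp add: H_def)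
      then show False using S(2) t(1) by force
    qed
    ultimately show ?thesis using S' by blast
  qed
  \<comment> \<open>If x (T + \<tau>) < 1, its last hit lies after T. Otherwise a missing hit forces
    x > 1 on the whole interval, hence pure decay from at most d / c, which ends below 1.\<close>
  have hit: "\<exists>t\<in>{T..T + \<sigma>}. x t = 1" if T: "t2 \<le> T" for T
  proof (rule ccontr)
    assume no: "\<not> ?thesis"
    show False
    proof (cases "x (T + \<tau>) < 1")
      case True
      obtain S where S: "t2 \<le> S" "S \<le> T + \<tau>" "x S = 1" "T + \<tau> < S + \<tau>"
        using last_hit[OF _ True] T \<tau> by auto
      have "S \<le> T + \<sigma>" using S(2) lnp by (simp add: \<sigma>_def)
      then show False using no S by auto
    next
      case False
      have big: "1 < x s" if "s \<in> {T..T + \<sigma>}" for s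
      proof (rule ccontr)
        assume "\<not> 1 < x s"
        then have s1: "x s < 1" using no that by force
        have m: "T + \<tau> \<in> {T..T + \<sigma>}" using \<tau> lnp by (auto simp: \<sigma>_def)
        have "\<exists>r. min s (T + \<tau>) \<le> r \<and> r \<le> max s (T + \<tau>) \<and> x r = 1"
        proof (cases "s \<le> T + \<tau>")
          case True
          then show ?thesis using IVT'[of x s 1 "T + \<tau>"] s1 False po_continuous by (auto simp: min_def max_def)
        next
          case False': False
          then show ?thesis using IVT2'[of x s 1 "T + \<tau>"] s1 False po_continuous by (auto simp: min_def max_def)
        qed
        then obtain r where "min s (T + \<tau>) \<le> r" "r \<le> max s (T + \<tau>)" "x r = 1" by blast
        moreover then have "r \<in> {T..T + \<sigma>}" using that m by auto
        ultimately show False using no by blast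
      qed
      let ?e = "exp (- c * (T + \<sigma> - (T + 1)))"
      have "x (T + \<sigma>) = ?e * x (T + 1)"
        using \<tau> lnp d_pos by (intro solution_free[OF po_solution[of T]] big) (auto simp: \<sigma>_def)
      also have "\<dots> \<le> ?e * (d / c)" by (intro mult_left_mono po_upper) auto
      also have "\<dots> < exp (- ln (d / c)) * (d / c)"
      proof (intro mult_strict_right_mono)
        have "- c * (T + \<sigma> - (T + 1)) = - c * (\<tau> + 1) - ln (d / c)"
          using c_pos by (simp add: \<sigma>_def field_simps)
        also have "\<dots> < - ln (d / c)" using c_pos \<tau> by simp
        finally show "?e < exp (- ln (d / c))" by simp
      qed (use c_pos d_pos in auto)
      also have "\<dots> = 1" using c_pos d_pos by (simp add: exp_minus)
      finally show False using big[of "T + \<sigma>"] \<sigma> by simp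
    qed
  qed
  \<comment> \<open>The rising part of the orbit stays above the stationary point, the first pulse
    is above 1, and any later excursion below 1 lasts less than \<tau> and falls no faster than exp
    (- c s).\<close>
  define m0 where "m0 = min \<xi>\<^sub>1 (exp (- c * \<tau>))"
  have m0: "0 < m0" "m0 < 1" using xi1_pos xi1_lt_1 by (auto simp: m0_def)
  have lower: "m0 \<le> x t" for t
  proof -
    consider "t \<le> t1 + 1" | "t1 + 1 < t" "t < t2" | "t2 \<le> t" "1 \<le> x t" | "t2 \<le> t" "x t < 1" by linarith
    then show ?thesis
    proof cases
      case 1 then show ?thesis using po_early[of t] by (simp add: m0_def)
    next
      case 2
      then have "1 < x t" using po by (auto simp: pulse_orbit_def)
      then show ?thesis using m0 by simp
    next
      case 3 then show ?thesis using m0 by simp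
    next
      case 4
      then obtain S where S: "t2 \<le> S" "S \<le> t" "x S = 1" "t < S + \<tau>" using last_hit by blast
      have "exp (- c * \<tau>) \<le> exp (- c * (t - S))" using S c_pos by simp
      also have "\<dots> \<le> x t" using solution_decay[OF po_solution[of S] _ order_refl S(2)] S(3) d_pos by simp
      finally show ?thesis by (simp add: m0_def)
    qed
  qed
  have seg_in: "seg x t \<in> CLip (2 * d) m0 (d / c)" for t
  proof (rule seg_in_CLip)
    fix s r show "\<bar>x s - x r\<bar> \<le> 2 * d * \<bar>s - r\<bar>"
      using po_lipschitz[of s r] mult_right_mono[of d "2 * d" "\<bar>s - r\<bar>"] d_pos by linarith
  qed (use m0 lower po_upper po_continuous in auto)
  have K: "compact (CLip (2 * d) m0 (d / c))" "CLip (2 * d) m0 (d / c) \<subseteq> Cplus"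
    using d_pos by (simp_all add: compact_CLip) (auto simp: CLip_def Cbetween_def)
  let ?A = "omega_limit g c d (seg x (t2 + 1))"
  note A = omega_limit_properties[OF po_solution[of "t2 + 1"] K seg_in]
  have "const_bcontfun 0 \<notin> ?A"
    using A(3) m0 by (auto simp: CLip_def Cbetween_def const_bcontfun.rep_eq)
  moreover have "const_bcontfun \<xi>\<^sub>1 \<notin> ?A"
  proof
    assume "const_bcontfun \<xi>\<^sub>1 \<in> ?A"
    then obtain s where s: "filterlim s at_top sequentially" "(\<lambda>k. seg x (s k)) \<longlonglongrightarrow> const_bcontfun \<xi>\<^sub>1"
      unfolding omega_limit_seg[OF po_solution] by blast
    obtain Kg where Kg: "0 \<le> Kg" "\<And>\<xi> \<eta>. \<xi> \<in> {0..1} \<Longrightarrow> \<eta> \<in> {0..1} \<Longrightarrow> \<bar>g \<xi> - g \<eta>\<bar> \<le> Kg * \<bar>\<xi> - \<eta>\<bar>"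
      using g_lipschitz by blast
    text \<open>Over one unit of time a deviation from \<open>\<xi>\<^sub>1\<close> grows at most by the factor \<open>L\<close>, so the
      orbit cannot reach \<open>1\<close> within time \<open>\<sigma>\<close> of a visit close to \<open>\<xi>\<^sub>1\<close>.\<close>
    define L where "L = 1 + d * Kg / c"
    have L: "1 \<le> L" using Kg d_pos c_pos by (simp add: L_def)
    have step: "\<bar>x t - \<xi>\<^sub>1\<bar> \<le> L * e"
      if e: "0 \<le> e" "e < 1 - \<xi>\<^sub>1" and near: "\<And>r. T - 1 \<le> r \<Longrightarrow> r \<le> T \<Longrightarrow> \<bar>x r - \<xi>\<^sub>1\<bar> \<le> e"
        and t: "T \<le> t" "t \<le> T + 1" for T t e
    proof -
      define E where "E = exp (- c * (t - T))"
      define W where "W = d * Kg / c * e"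
      have E: "0 \<le> E" "E \<le> 1" using t c_pos by (auto simp: E_def)
      have W: "0 \<le> W" using e d_pos c_pos Kg by (simp add: W_def)
      have gx: "\<bar>g (x (s - 1)) - g \<xi>\<^sub>1\<bar> \<le> Kg * e" if "T < s" "s < t" for s
      proof -
        have n: "\<bar>x (s - 1) - \<xi>\<^sub>1\<bar> \<le> e" using near that t by simp
        then have "x (s - 1) \<in> {0..1}" using e solution_from_nonneg[OF po_solution[of s], of "s - 1"] by auto
        then have "\<bar>g (x (s - 1)) - g \<xi>\<^sub>1\<bar> \<le> Kg * \<bar>x (s - 1) - \<xi>\<^sub>1\<bar>"
          using xi1_pos xi1_lt_1 by (intro Kg(2)) auto
        also have "\<dots> \<le> Kg * e" using n Kg(1) by (intro mult_left_mono)
        finally show ?thesis .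
      qed
      have eqs: "d * (g \<xi>\<^sub>1 + Kg * e) / c = \<xi>\<^sub>1 + W" "d * (g \<xi>\<^sub>1 - Kg * e) / c = \<xi>\<^sub>1 - W"
        using xi1_eq c_pos by (simp_all add: W_def field_simps)
      have "x t \<le> E * x T + d * (g \<xi>\<^sub>1 + Kg * e) / c * (1 - E)" unfolding E_def
        by (rule solution_bounds(1)[OF po_solution[of T] _ order_refl t(1)]) (use gx d_pos in \<open>force simp: abs_le_iff\<close>)+
      moreover have "E * x T + d * (g \<xi>\<^sub>1 - Kg * e) / c * (1 - E) \<le> x t" unfolding E_def
        by (rule solution_bounds(2)[OF po_solution[of T] _ order_refl t(1)]) (use gx d_pos in \<open>force simp: abs_le_iff\<close>)+
      ultimately have "x t - \<xi>\<^sub>1 \<le> E * (x T - \<xi>\<^sub>1) + W * (1 - E)"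
        "E * (x T - \<xi>\<^sub>1) - W * (1 - E) \<le> x t - \<xi>\<^sub>1"
        unfolding eqs by (simp_all add: algebra_simps)
      moreover have "\<bar>E * (x T - \<xi>\<^sub>1)\<bar> \<le> 1 * e"
        unfolding abs_mult using near[of T] E by (intro mult_mono) auto
      moreover have "W * (1 - E) \<le> W"
        using E W by (intro mult_left_le) auto
      moreover have "L * e = e + W" by (simp add: L_def W_def distrib_right)
      ultimately show ?thesis by (auto simp: abs_le_iff)
    qed
    \<comment> \<open>The n-fold iteration of \<open>step\<close>; the smallness condition is asked
      of the final bound and hence holds for all earlier ones.\<close>
    have iter: "\<bar>x t - \<xi>\<^sub>1\<bar> \<le> L ^ n * e"
      if e: "0 \<le> e" "L ^ n * e < 1 - \<xi>\<^sub>1" and near: "\<And>r. T - 1 \<le> r \<Longrightarrow> r \<le> T \<Longrightarrow> \<bar>x r - \<xi>\<^sub>1\<bar> \<le> e"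
        and t: "T - 1 \<le> t" "t \<le> T + real n" for T t e n
      using e t
    proof (induction n arbitrary: t)
      case 0 then show ?case using near by auto
    next
      case (Suc n)
      have le: "L ^ n * e \<le> L ^ Suc n * e" using L Suc.prems(1) by (intro mult_right_mono) auto
      have lt: "L ^ n * e < 1 - \<xi>\<^sub>1" using le Suc.prems(2) by linarith
      show ?case
      proof (cases "t \<le> T + real n")
        case True
        then have "\<bar>x t - \<xi>\<^sub>1\<bar> \<le> L ^ n * e" using Suc.IH[of t] Suc.prems lt by simp
        then show ?thesis using le by linarith
      next
        case False
        have "\<bar>x t - \<xi>\<^sub>1\<bar> \<le> L * (L ^ n * e)"
        proof (rule step)
          show "\<bar>x r - \<xi>\<^sub>1\<bar> \<le> L ^ n * e" if "T + real n - 1 \<le> r" "r \<le> T + real n" for r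
            using Suc.IH[of r] Suc.prems(1) lt that False by simp
        qed (use Suc.prems(1,3,4) lt False L in auto)
        then show ?thesis by (simp add: mult.assoc)
      qed
    qed
    obtain n :: nat where n: "\<sigma> \<le> real n" using real_arch_simple by blast
    \<comment> \<open>Chosen so that n units of growth lead only halfway from the stationary point
      to 1, while n units exceed the waiting time \<sigma> for a hit.\<close>
    define e where "e = (1 - \<xi>\<^sub>1) / (2 * L ^ n)"
    have Ln: "0 < L ^ n" using L by simp
    have "L ^ n * e = (1 - \<xi>\<^sub>1) / 2" using L by (simp add: e_def)
    then have e: "0 < e" "L ^ n * e < 1 - \<xi>\<^sub>1" using xi1_lt_1 Ln by (auto simp: e_def)
    have "\<forall>\<^sub>F k in sequentially. dist (seg x (s k)) (const_bcontfun \<xi>\<^sub>1) < e"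
      by (rule tendstoD[OF s(2) e(1)])
    moreover have "\<forall>\<^sub>F k in sequentially. t2 \<le> s k"
      by (rule filterlim_at_top[THEN iffD1, OF s(1), rule_format])
    ultimately have "\<forall>\<^sub>F k in sequentially. dist (seg x (s k)) (const_bcontfun \<xi>\<^sub>1) < e \<and> t2 \<le> s k"
      by eventually_elim simp
    then obtain k where k: "dist (seg x (s k)) (const_bcontfun \<xi>\<^sub>1) < e" "t2 \<le> s k"
      by (auto simp: eventually_sequentially)
    have near: "\<bar>x r - \<xi>\<^sub>1\<bar> \<le> e" if "s k - 1 \<le> r" "r \<le> s k" for r
    proof -
      have "norm (x r - \<xi>\<^sub>1) \<le> norm (seg (\<lambda>r. x r - \<xi>\<^sub>1) (s k))"
        using that by (intro norm_le_seg[of "s k" "\<lambda>r. x r - \<xi>\<^sub>1"] continuous_intros po_continuous)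
      also have "\<dots> \<le> e" using k(1) by (simp add: dist_norm seg_minus_const[OF po_continuous])
      finally show ?thesis by simp
    qed
    obtain t where t: "t \<in> {s k..s k + \<sigma>}" "x t = 1" using hit[OF k(2)] by blast
    have "\<bar>x t - \<xi>\<^sub>1\<bar> \<le> L ^ n * e"
      by (rule iter[of e n "s k" t]) (use e near t n in auto)
    then show False using e t xi1_lt_1 by simp
  qed
  ultimately show ?thesis
    using A m0 d_gt c_pos \<sigma> hit seg_in
    by (intro exI[of _ m0] exI[of _ "d / c"] exI[of _ \<sigma>]) (auto simp: orbit_def Let_def)
qed

text \<open>Since p > 1 on [-1, 0), the feedback is off on (0, 1) and p decays there as exp (- c s).
  So p is also a solution started from the exponential history, and uniqueness identifies it with
  the future of x.\<close>

lemma po_periodic: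
  assumes p: "entire_solution g c d p" and per: "minimal_period p \<omega>"
    and p0: "p 0 = 1" and p_gt: "\<And>t. t \<in> {-1..<0} \<Longrightarrow> 1 < p t"
  shows "(\<forall>t\<ge>t2 + 1. seg x t \<in> seg p ` {0..\<omega>}) \<and> omega_limit g c d (seg x (t2 + 1)) = seg p ` {0..\<omega>}"
proof -
  have \<omega>: "0 < \<omega>" and period: "\<And>t. p (t + \<omega>) = p t" using per by (auto simp: minimal_period_def)
  have p_sol: "solution_from g c d T p" for T by (rule entire_solutionD[OF p])
  have p_cont: "continuous_on S p" for S by (rule entire_solution_continuous[OF p])
  have "decay_start d p"
    unfolding decay_start_def
  proof (intro conjI ballI p_sol)
    fix s :: real assume s: "s \<in> {0..1}"
    have "p s = exp (- c * (s - 0)) * p 0"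
      by (rule solution_free[OF p_sol[of 0]]) (use s d_pos p_gt in auto)
    then show "p s = exp (- c * s)" using p0 by simp
  qed
  then have xp: "x (t2 + t) = p t" if "0 \<le> t" for t
    using Y_unique[of d p t] po_after[OF that] that d_pos by simp
  have seg_xp: "seg x (t2 + t) = seg p t" if "1 \<le> t" for t
  proof (rule seg_eqI)
    fix s :: real assume "-1 \<le> s" "s \<le> 0"
    then show "x (t2 + t + s) = p (t + s)" using xp[of "t + s"] that by (simp add: add.assoc)
  qed
  have per_int: "p (t + real n * \<omega>) = p t" for t n
  proof (induction n)
    case (Suc n)
    have "t + real (Suc n) * \<omega> = t + real n * \<omega> + \<omega>" by (simp add: algebra_simps)
    then show ?case using period[of "t + real n * \<omega>"] Suc by (simp only:)
  qed simp
  have seg_per: "seg p (t + real n * \<omega>) = seg p t" for t n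
  proof (rule seg_eqI)
    fix s :: real
    have "t + real n * \<omega> + s = t + s + real n * \<omega>" by simp
    then show "p (t + real n * \<omega> + s) = p (t + s)" using per_int[of "t + s" n] by (simp only:)
  qed
  have reduce: "seg p t \<in> seg p ` {0..\<omega>}" if "0 \<le> t" for t
  proof -
    define n where "n = nat \<lfloor>t / \<omega>\<rfloor>"
    have "real n \<le> t / \<omega>" "t / \<omega> < real n + 1"
      using that \<omega> by (auto simp: n_def)
    then have "t - real n * \<omega> \<in> {0..\<omega>}" using \<omega> by (auto simp: field_simps)
    moreover have "seg p t = seg p (t - real n * \<omega>)" using seg_per[of "t - real n * \<omega>" n] by simp
    ultimately show ?thesis by blast
  qed
  have in_O: "seg x t \<in> seg p ` {0..\<omega>}" if "t2 + 1 \<le> t" for t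
    using seg_xp[of "t - t2"] reduce[of "t - t2"] that by simp
  have cmp: "compact (seg p ` {0..\<omega>})"
    by (rule compact_continuous_image[OF continuous_on_subset[OF continuous_on_seg_UNIV[OF p_cont]]]) auto
  have O_plus: "seg p ` {0..\<omega>} \<subseteq> Cplus"
  proof -
    have "0 \<le> p t" for t using solution_from_nonneg[OF p_sol[of "t + 1"], of t] by simp
    then show ?thesis by (auto simp: Cplus_def seg_apply[OF p_cont])
  qed
  have "seg p ` {0..\<omega>} \<subseteq> omega_limit g c d (seg x (t2 + 1))"
  proof
    fix \<zeta> assume "\<zeta> \<in> seg p ` {0..\<omega>}"
    then obtain t where t: "0 \<le> t" "\<zeta> = seg p t" by auto
    define s where "s k = t2 + (t + real k * \<omega>)" for k
    have s_top: "filterlim s at_top sequentially"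
      unfolding s_def using \<omega> by real_asymp
    have "\<forall>\<^sub>F k in sequentially. \<zeta> = seg x (s k)"
      using filterlim_at_top[THEN iffD1, OF s_top, rule_format, of "t2 + 1"]
    proof eventually_elim
      case (elim k)
      then have "1 \<le> t + real k * \<omega>" by (simp add: s_def)
      then show ?case using seg_xp[of "t + real k * \<omega>"] seg_per[of t k] t by (simp add: s_def)
    qed
    then have "(\<lambda>k. seg x (s k)) \<longlonglongrightarrow> \<zeta>" by (rule Lim_transform_eventually[OF tendsto_const])
    then show "\<zeta> \<in> omega_limit g c d (seg x (t2 + 1))"
      unfolding omega_limit_seg[OF po_solution] using s_top O_plus \<open>\<zeta> \<in> _\<close> by blast
  qed
  moreover have "omega_limit g c d (seg x (t2 + 1)) \<subseteq> seg p ` {0..\<omega>}"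
    by (rule omega_limit_properties(3)[OF po_solution cmp O_plus in_O])
  ultimately show ?thesis using in_O by blast
qed

end

end

section \<open>Relaxation equations\<close>

lemma DERIV_upper_bound:
  fixes f f' :: "real \<Rightarrow> real"
  assumes le: "s \<le> t" and cont: "continuous_on {s..t} f"
    and der: "\<And>r. s < r \<Longrightarrow> r < t \<Longrightarrow> (f has_real_derivative f' r) (at r)"
    and bound: "\<And>r. s < r \<Longrightarrow> r < t \<Longrightarrow> f' r \<le> B"
  shows "f t - f s \<le> B * (t - s)"
proof (cases "s = t")
  case False
  then have "s < t" using le by simp
  obtain l z where z: "s < z" "z < t" "DERIV f z :> l" "f t - f s = (t - s) * l"
    using MVT[OF \<open>s < t\<close> cont] der by (force simp: real_differentiable_def)
  then have "l \<le> B" using bound[OF z(1,2)] DERIV_unique[OF z(3) der[OF z(1,2)]] by simp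
  then show ?thesis using z(4) \<open>s < t\<close> by (simp add: mult.commute mult_left_mono)
qed simp

lemma DERIV_lower_bound:
  fixes f f' :: "real \<Rightarrow> real"
  assumes le: "s \<le> t" and cont: "continuous_on {s..t} f"
    and der: "\<And>r. s < r \<Longrightarrow> r < t \<Longrightarrow> (f has_real_derivative f' r) (at r)"
    and bound: "\<And>r. s < r \<Longrightarrow> r < t \<Longrightarrow> B \<le> f' r"
  shows "B * (t - s) \<le> f t - f s"
proof -
  have "- f t - - f s \<le> - B * (t - s)"
    by (rule DERIV_upper_bound[OF le, of "\<lambda>r. - f r" "\<lambda>r. - f' r"])
       (auto intro!: continuous_intros cont DERIV_minus der simp: bound)
  then show ?thesis by simp
qed

text \<open>The equation is the autonomous linear delay equation in the variable \<open>exp (- \<lambda> * t) * u t\<close>,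
  where \<open>\<lambda>\<close> is the real characteristic root: the constants are its positive solutions.\<close>

definition relaxation :: "real \<Rightarrow> (real \<Rightarrow> real) \<Rightarrow> real \<Rightarrow> (real \<Rightarrow> real) \<Rightarrow> bool"
  where "relaxation b e T h \<longleftrightarrow> continuous_on {..T} h \<and>
    (\<forall>t<T. (h has_real_derivative b * (h (t - 1) - h t) + e t) (at t))"

text \<open>The quantity conserved when \<open>e\<close> is 0. On constants it is multiplication by
  1 + b.\<close>

definition average :: "real \<Rightarrow> (real \<Rightarrow> real) \<Rightarrow> real \<Rightarrow> real"
  where "average b h t = h t + b * integral {t - 1..t} h"

lemma relaxation_continuous: "relaxation b e T h \<Longrightarrow> t \<le> T \<Longrightarrow> continuous_on {s..t} h"
  by (auto simp: relaxation_def intro: continuous_on_subset)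

lemma relaxation_uminus: "relaxation b e T h \<Longrightarrow> relaxation b (\<lambda>t. - e t) T (\<lambda>t. - h t)"
  unfolding relaxation_def
  by (auto intro!: continuous_intros derivative_eq_intros simp: algebra_simps)

text \<open>Variation of constants for h - M at rate b: the delayed term cannot raise h - M, and of
  the present gap M - h t at least the fraction exp (- b) survives one unit.\<close>

lemma relaxation_upper:
  assumes h: "relaxation b e T h" and b: "0 < b" and t: "t + 1 \<le> T" "t \<le> s" "s \<le> t + 1"
    and M: "\<And>r. t - 1 \<le> r \<Longrightarrow> r \<le> t \<Longrightarrow> h r \<le> M" and E: "0 \<le> E" "\<And>r. t < r \<Longrightarrow> r < t + 1 \<Longrightarrow> e r \<le> E"
  shows "h s \<le> M - exp (- b) * (M - h t) + E"
proof -
  define k where "k r = exp (b * r) * (h r - M)" for r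
  have "k s - k t \<le> exp (b * s) * E * (s - t)"
  proof (rule DERIV_upper_bound)
    show "continuous_on {t..s} k"
      unfolding k_def using t by (intro continuous_intros relaxation_continuous[OF h]) auto
    fix r assume r: "t < r" "r < s"
    have "(h has_real_derivative b * (h (r - 1) - h r) + e r) (at r)"
      using h r t by (simp add: relaxation_def)
    then show "(k has_real_derivative exp (b * r) * (b * (h (r - 1) - M) + e r)) (at r)"
      unfolding k_def by (auto intro!: derivative_eq_intros simp: algebra_simps)
    have "b * (h (r - 1) - M) \<le> 0" using M[of "r - 1"] r t b by (simp add: mult_le_0_iff)
    then have "exp (b * r) * (b * (h (r - 1) - M) + e r) \<le> exp (b * r) * E"
      using E(2)[of r] r t by (intro mult_left_mono) auto
    also have "\<dots> \<le> exp (b * s) * E" using r b E by (intro mult_right_mono) auto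
    finally show "exp (b * r) * (b * (h (r - 1) - M) + e r) \<le> exp (b * s) * E" .
  qed (use t in auto)
  also have "\<dots> \<le> exp (b * s) * E" using t E by (simp add: mult_left_le)
  finally have "exp (b * s) * (h s - M) \<le> exp (b * s) * (exp (- b * (s - t)) * (h t - M) + E)"
    unfolding k_def distrib_left mult.assoc[symmetric] exp_add[symmetric] by (simp add: algebra_simps)
  then have "h s - M \<le> exp (- b * (s - t)) * (h t - M) + E" by simp
  also have "exp (- b * (s - t)) * (h t - M) \<le> exp (- b) * (h t - M)"
  proof (rule mult_right_mono_neg)
    have "b * (s - t) \<le> b * 1" using t b by (intro mult_left_mono) auto
    then show "exp (- b) \<le> exp (- b * (s - t))" by simp
  qed (use M[of t] in simp)
  finally show ?thesis by (simp add: algebra_simps)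
qed

text \<open>The one-sided estimate is used for h with its maximum and for - h with its minimum over
  the past unit. The two gaps to h t add up to the full oscillation, so the fraction exp (- b) of it
  is lost.\<close>

lemma relaxation_oscillation:
  assumes h: "relaxation b e T h" and b: "0 < b" and t: "t + 1 \<le> T"
    and E: "0 \<le> E" "\<And>r. t < r \<Longrightarrow> r < t + 1 \<Longrightarrow> \<bar>e r\<bar> \<le> E"
    and w: "\<And>s r. s \<in> {t - 1..t} \<Longrightarrow> r \<in> {t - 1..t} \<Longrightarrow> h s - h r \<le> w"
    and sr: "s \<in> {t..t + 1}" "r \<in> {t..t + 1}"
  shows "h s - h r \<le> (1 - exp (- b)) * w + 2 * E"
proof -
  have cont: "continuous_on {t - 1..t} h" using relaxation_continuous[OF h] t by simp
  obtain p where p: "p \<in> {t - 1..t}" "\<And>r. r \<in> {t - 1..t} \<Longrightarrow> h r \<le> h p"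
    using continuous_attains_sup[OF _ _ cont] by auto
  obtain q where q: "q \<in> {t - 1..t}" "\<And>r. r \<in> {t - 1..t} \<Longrightarrow> h q \<le> h r"
    using continuous_attains_inf[OF _ _ cont] by auto
  have "h s \<le> h p - exp (- b) * (h p - h t) + E"
    using sr E p(2) by (intro relaxation_upper[OF h b t]) (auto simp: abs_le_iff)
  moreover have "- h r \<le> - h q - exp (- b) * (- h q - - h t) + E"
    using sr E q(2) by (intro relaxation_upper[OF relaxation_uminus[OF h] b t]) (force simp: abs_le_iff)+
  moreover have "(1 - exp (- b)) * (h p - h q) \<le> (1 - exp (- b)) * w"
    using w[OF p(1) q(1)] b by (intro mult_left_mono) auto
  ultimately show ?thesis by (simp add: algebra_simps)
qed

lemma average_bounds:
  assumes cont: "continuous_on {t - 1..t} h" and b: "0 \<le> b"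
  shows "(\<And>s. s \<in> {t - 1..t} \<Longrightarrow> h s \<le> M) \<Longrightarrow> average b h t \<le> h t + b * M"
    and "(\<And>s. s \<in> {t - 1..t} \<Longrightarrow> m \<le> h s) \<Longrightarrow> h t + b * m \<le> average b h t"
proof -
  have int: "h integrable_on {t - 1..t}" using cont by (rule integrable_continuous_real)
  show "average b h t \<le> h t + b * M" if "\<And>s. s \<in> {t - 1..t} \<Longrightarrow> h s \<le> M"
    using integral_le[OF int integrable_const_ivl, of M] that b by (simp add: average_def mult_left_mono)
  show "h t + b * m \<le> average b h t" if "\<And>s. s \<in> {t - 1..t} \<Longrightarrow> m \<le> h s"
    using integral_le[OF integrable_const_ivl int, of m] that b by (simp add: average_def mult_left_mono)
qed

text \<open>Turns control of the oscillation and of the conserved quantity into control of h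
  itself.\<close>

lemma average_near:
  assumes cont: "continuous_on {t - 1..t} h" and b: "0 \<le> b"
    and w: "\<And>s r. s \<in> {t - 1..t} \<Longrightarrow> r \<in> {t - 1..t} \<Longrightarrow> h s - h r \<le> w" and s: "s \<in> {t - 1..t}"
  shows "\<bar>(1 + b) * h s - average b h t\<bar> \<le> (1 + b) * w"
proof -
  have "average b h t \<le> h t + b * (h s + w)"
    by (rule average_bounds(1)[OF cont b]) (use w[OF _ s] in force)
  moreover have "h t + b * (h s - w) \<le> average b h t"
    by (rule average_bounds(2)[OF cont b]) (use w[OF s] in force)
  moreover have "h t \<le> h s + w" "h s - w \<le> h t" using w[of t s] w[of s t] s by auto
  ultimately show ?thesis by (auto simp: abs_le_iff algebra_simps)
qed

text \<open>The moving integral contributes b (h t - h (t - 1)), which cancels the relaxation term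
  and leaves the perturbation.\<close>

lemma average_deriv:
  assumes h: "relaxation b e T h" and t: "t < T"
  shows "(average b h has_real_derivative e t) (at t)"
proof -
  \<comment> \<open>Any lower limit to the left of the moving window serves; it drops out of the
    difference H u - H (u - 1).\<close>
  define H where "H u = integral {t - 3..u} h" for u
  have H: "(H has_real_derivative h u) (at u)" if u: "t - 3 < u" "u < T" for u
  proof -
    have "((\<lambda>u. integral {t - 3..u} h) has_real_derivative h u) (at u within {t - 3..T})"
      using u by (intro integral_has_real_derivative relaxation_continuous[OF h]) auto
    then show ?thesis
      using u at_within_interior[of u "{t - 3..T}"] by (simp add: H_def[abs_def])
  qed
  have "((\<lambda>u. H (u - 1)) has_real_derivative h (t - 1)) (at t)"
  proof -
    have "((\<lambda>u. u - 1) has_real_derivative 1) (at t)" by (auto intro!: derivative_eq_intros)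
    then show ?thesis
      using DERIV_chain2[of H "h (t - 1)" "\<lambda>u. u - 1" t 1 UNIV] H[of "t - 1"] t by simp
  qed
  then have "((\<lambda>u. h u + b * (H u - H (u - 1))) has_real_derivative
      (b * (h (t - 1) - h t) + e t) + b * (h t - h (t - 1))) (at t)"
    using h t H[of t] by (intro DERIV_add DERIV_cmult DERIV_diff) (auto simp: relaxation_def)
  then have "((\<lambda>u. h u + b * (H u - H (u - 1))) has_real_derivative e t) (at t)"
    by (simp add: algebra_simps)
  then show ?thesis
  proof (rule has_field_derivative_transform_within_open[of _ _ _ "{t - 1<..<T}"])
    fix u assume u: "u \<in> {t - 1<..<T}"
    have "integral {t - 3..u - 1} h + integral {u - 1..u} h = integral {t - 3..u} h"
      using u by (intro Henstock_Kurzweil_Integration.integral_combine integrable_continuous_real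
          relaxation_continuous[OF h]) auto
    then have "H u - H (u - 1) = integral {u - 1..u} h" unfolding H_def by linarith
    then show "h u + b * (H u - H (u - 1)) = average b h u"
      by (simp only: average_def)
  qed (use t in auto)
qed

lemma average_continuous:
  assumes h: "relaxation b e T h"
  shows "continuous_on {s..T} (average b h)"
proof -
  have c: "continuous_on {s - 1..T} (\<lambda>u. integral {s - 1..u} h)"
    by (intro indefinite_integral_continuous_1 integrable_continuous_real relaxation_continuous[OF h]) auto
  have "continuous_on {s..T} (\<lambda>u. h u + b * (integral {s - 1..u} h - integral {s - 1..u - 1} h))"
    by (intro continuous_intros relaxation_continuous[OF h] continuous_on_subset[OF c]
        continuous_on_compose2[OF c, of "{s..T}" "\<lambda>u. u - 1"]) auto
  then show ?thesis
  proof (rule continuous_on_eq)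
    fix u assume u: "u \<in> {s..T}"
    have "integral {s - 1..u - 1} h + integral {u - 1..u} h = integral {s - 1..u} h"
      using u by (intro Henstock_Kurzweil_Integration.integral_combine integrable_continuous_real
          relaxation_continuous[OF h]) auto
    then have "integral {s - 1..u} h - integral {s - 1..u - 1} h = integral {u - 1..u} h" by linarith
    then show "h u + b * (integral {s - 1..u} h - integral {s - 1..u - 1} h) = average b h u"
      by (simp only: average_def)
  qed
qed

text \<open>Packages a self-improving estimate: iterating from any valid bound tends to the fixed
  point r / (1 - q), so the estimate holds with that constant in the limit.\<close>

lemma affine_iteration:
  fixes q r w0 :: real
  assumes q: "0 \<le> q" "q < 1" and init: "P w0" and step: "\<And>w. P w \<Longrightarrow> P (q * w + r)"
  obtains w where "\<And>n. P (w n)" "w \<longlonglongrightarrow> r / (1 - q)"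
proof -
  define w where "w n = q ^ n * (w0 - r / (1 - q)) + r / (1 - q)" for n
  have w_Suc: "w (Suc n) = q * w n + r" for n
  proof -
    have "q * (r / (1 - q)) + r = r / (1 - q)" using q by (simp add: field_simps)
    then show ?thesis by (simp add: w_def algebra_simps)
  qed
  have "P (w n)" for n
  proof (induction n)
    case 0 then show ?case using init by (simp add: w_def)
  next
    case (Suc n) then show ?case using step by (simp add: w_Suc)
  qed
  moreover have "w \<longlonglongrightarrow> 0 * (w0 - r / (1 - q)) + r / (1 - q)"
    unfolding w_def by (intro tendsto_intros LIMSEQ_power_zero) (use q in auto)
  ultimately show ?thesis using that[of w] by simp
qed

text \<open>Measured against \<sigma>^t, the oscillation contracts by \<theta> / \<sigma> < 1 per
  unit, and the average, which vanishes at 0, is controlled by integrating the perturbation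
  backwards. For small \<epsilon> the two contributions reproduce the assumed bound with half its
  constant; repetition forces h = 0.\<close>

lemma relaxation_trivial:
  fixes b \<sigma> :: real
  assumes b: "0 < b" and \<sigma>: "1 - exp (- b) < \<sigma>" "\<sigma> < 1"
  obtains \<epsilon> where "0 < \<epsilon>"
    "\<And>h e S t. relaxation b e 0 h \<Longrightarrow> (\<And>t. t < 0 \<Longrightarrow> \<bar>e t\<bar> \<le> \<epsilon> * \<bar>h (t - 1)\<bar>) \<Longrightarrow>
      (\<And>t. t \<le> 0 \<Longrightarrow> \<bar>h t\<bar> \<le> S * \<sigma> powr t) \<Longrightarrow> average b h 0 = 0 \<Longrightarrow> t \<le> 0 \<Longrightarrow> h t = 0"
proof -
  define \<theta> where "\<theta> = 1 - exp (- b)"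
  have \<theta>: "0 < \<theta>" "\<theta> < \<sigma>" using b \<sigma> by (auto simp: \<theta>_def)
  have s0: "0 < \<sigma>" using \<theta> by simp
  define \<kappa> where "\<kappa> = - ln \<sigma>"
  have \<kappa>: "0 < \<kappa>" using s0 \<sigma> by (simp add: \<kappa>_def)
  \<comment> \<open>The first summand comes from the fixed point of the recursion for the
    oscillation, the second from the integrated perturbation of the average. \<epsilon> is chosen so
    that \<epsilon> D = 1/2.\<close>
  define D where "D = 2 / (\<sigma> * \<sigma>) / (1 - \<theta> / \<sigma>) + 1 / (\<sigma> * \<kappa>)"
  have D: "0 < D" using \<theta> s0 \<kappa> by (auto simp: D_def intro!: add_pos_pos divide_pos_pos)
  define \<epsilon> where "\<epsilon> = 1 / (2 * D)"
  have \<epsilon>: "0 < \<epsilon>" using D by (simp add: \<epsilon>_def)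
  have anti: "\<sigma> powr t \<le> \<sigma> powr s" if "s \<le> t" for s t
    using that \<sigma> s0 by (intro powr_mono') auto
  have shift: "\<sigma> powr (t - 1) = \<sigma> powr t / \<sigma>" for t
    using s0 by (simp add: powr_diff)
  show ?thesis
  proof (rule that[OF \<epsilon>])
    fix h e S0 t0
    assume h: "relaxation b e 0 h" and e: "\<And>t. t < 0 \<Longrightarrow> \<bar>e t\<bar> \<le> \<epsilon> * \<bar>h (t - 1)\<bar>"
      and S0: "\<And>t. t \<le> 0 \<Longrightarrow> \<bar>h t\<bar> \<le> S0 * \<sigma> powr t" and av: "average b h 0 = 0" and t0: "(t0::real) \<le> 0"
    have improve: "\<forall>t\<le>0. \<bar>h t\<bar> \<le> (S / 2) * \<sigma> powr t" if S: "\<forall>t\<le>0. \<bar>h t\<bar> \<le> S * \<sigma> powr t" for S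
    proof -
      have S_nn: "0 \<le> S" using S[rule_format, of 0] s0 by simp
      have e_bound: "\<bar>e t\<bar> \<le> \<epsilon> * S * \<sigma> powr (t - 1)" if "t < 0" for t
        using e[OF that] S[rule_format, of "t - 1"] that \<epsilon> by (smt (verit) mult.assoc mult_left_mono)
      define P where "P w \<longleftrightarrow> (\<forall>t\<le>0. \<forall>s\<in>{t - 1..t}. \<forall>r\<in>{t - 1..t}. h s - h r \<le> w * \<sigma> powr t)" for w
      have "P (2 * S / \<sigma>)"
        unfolding P_def
      proof (intro allI impI ballI)
        fix t s r assume *: "(t::real) \<le> 0" "s \<in> {t - 1..t}" "r \<in> {t - 1..t}"
        have "\<bar>h u\<bar> \<le> S * \<sigma> powr (t - 1)" if "u \<in> {t - 1..t}" for u
          using S[rule_format, of u] that * anti[of "t - 1" u] S_nn by (smt (verit) atLeastAtMost_iff mult_left_mono)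
        from this[OF *(2)] this[OF *(3)] show "h s - h r \<le> 2 * S / \<sigma> * \<sigma> powr t"
          unfolding shift by (simp add: abs_le_iff)
      qed
      moreover have "P (\<theta> / \<sigma> * w + 2 * \<epsilon> * S / (\<sigma> * \<sigma>))" if w: "P w" for w
        unfolding P_def
      proof (intro allI impI ballI)
        fix t s r assume *: "(t::real) \<le> 0" "s \<in> {t - 1..t}" "r \<in> {t - 1..t}"
        have "h s - h r \<le> (1 - exp (- b)) * (w * \<sigma> powr (t - 1)) + 2 * (\<epsilon> * S * \<sigma> powr (t - 1 - 1))"
        proof (rule relaxation_oscillation[OF h b, of "t - 1"])
          show "\<bar>e r\<bar> \<le> \<epsilon> * S * \<sigma> powr (t - 1 - 1)" if "t - 1 < r" "r < t - 1 + 1" for r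
            using e_bound[of r] anti[of "t - 1 - 1" "r - 1"] that * \<epsilon> S_nn
            by (smt (verit) mult_left_mono mult_nonneg_nonneg)
          show "h s - h r \<le> w * \<sigma> powr (t - 1)" if "s \<in> {t - 1 - 1..t - 1}" "r \<in> {t - 1 - 1..t - 1}" for s r
            using w * that unfolding P_def by (metis add_0 diff_add_cancel le_diff_eq less_eq_real_def diff_le_eq add_mono order_trans zero_le_one)
        qed (use * \<epsilon> S_nn in auto)
        also have "\<dots> = (\<theta> / \<sigma> * w + 2 * \<epsilon> * S / (\<sigma> * \<sigma>)) * \<sigma> powr t"
          unfolding shift \<theta>_def[symmetric] by (simp add: field_simps)
        finally show "h s - h r \<le> (\<theta> / \<sigma> * w + 2 * \<epsilon> * S / (\<sigma> * \<sigma>)) * \<sigma> powr t" .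
      qed
      ultimately obtain w where w: "\<And>n. P (w n)" "w \<longlonglongrightarrow> 2 * \<epsilon> * S / (\<sigma> * \<sigma>) / (1 - \<theta> / \<sigma>)"
        using affine_iteration[of "\<theta> / \<sigma>" P "2 * S / \<sigma>" "2 * \<epsilon> * S / (\<sigma> * \<sigma>)"] \<theta> s0 by auto
      define W where "W = 2 * \<epsilon> * S / (\<sigma> * \<sigma>) / (1 - \<theta> / \<sigma>)"
      have osc: "h s - h r \<le> W * \<sigma> powr t" if "t \<le> 0" "s \<in> {t - 1..t}" "r \<in> {t - 1..t}" for t s r
        by (rule LIMSEQ_le_const[OF tendsto_mult_right[OF w(2)[folded W_def]]])
           (use w(1) that in \<open>auto simp: P_def\<close>)
      \<comment> \<open>The comparison function \<sigma>^s, scaled by \<open>?k\<close>, has a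
        derivative of size \<epsilon> S \<sigma>^(s - 1), the bound on the perturbation. Adding it
        to the average gives a nonincreasing function, subtracting it a nondecreasing one, and the
        average is 0 at time 0.\<close>
      have av_bound: "\<bar>average b h t\<bar> \<le> \<epsilon> * S / (\<sigma> * \<kappa>) * \<sigma> powr t" if t: "t \<le> 0" for t
      proof -
        let ?k = "\<epsilon> * S / (\<sigma> * \<kappa>)"
        have k: "0 \<le> ?k" using \<epsilon> S_nn s0 \<kappa> by simp
        have der: "((\<lambda>s. \<sigma> powr s) has_real_derivative - \<kappa> * \<sigma> powr r) (at r)" for r
          using s0 by (auto intro!: derivative_eq_intros simp: \<kappa>_def)
        have ke: "?k * (\<kappa> * \<sigma> powr r) = \<epsilon> * S * \<sigma> powr (r - 1)" for r
          unfolding shift using s0 \<kappa> by (simp add: field_simps)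
        have pc: "continuous_on {t..0} (\<lambda>s. \<sigma> powr s)"
          using s0 by (intro continuous_intros) auto
        have "(average b h 0 + ?k * \<sigma> powr 0) - (average b h t + ?k * \<sigma> powr t) \<le> 0 * (0 - t)"
        proof (rule DERIV_upper_bound[OF t])
          show "continuous_on {t..0} (\<lambda>s. average b h s + ?k * \<sigma> powr s)"
            by (intro continuous_intros average_continuous[OF h] pc)
          fix r assume r: "t < r" "r < 0"
          show "((\<lambda>s. average b h s + ?k * \<sigma> powr s) has_real_derivative e r - ?k * (\<kappa> * \<sigma> powr r)) (at r)"
            using DERIV_add[OF average_deriv[OF h r(2)] DERIV_cmult[OF der, of ?k]] by (rule DERIV_cong) (simp add: mult_ac)
          show "e r - ?k * (\<kappa> * \<sigma> powr r) \<le> 0"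
            unfolding ke using e_bound[OF r(2)] by simp
        qed
        moreover have "0 * (0 - t) \<le> (average b h 0 - ?k * \<sigma> powr 0) - (average b h t - ?k * \<sigma> powr t)"
        proof (rule DERIV_lower_bound[OF t])
          show "continuous_on {t..0} (\<lambda>s. average b h s - ?k * \<sigma> powr s)"
            by (intro continuous_intros average_continuous[OF h] pc)
          fix r assume r: "t < r" "r < 0"
          show "((\<lambda>s. average b h s - ?k * \<sigma> powr s) has_real_derivative e r + ?k * (\<kappa> * \<sigma> powr r)) (at r)"
            using DERIV_diff[OF average_deriv[OF h r(2)] DERIV_cmult[OF der, of ?k]] by (rule DERIV_cong) (simp add: mult_ac)
          show "0 \<le> e r + ?k * (\<kappa> * \<sigma> powr r)"
            unfolding ke using e_bound[OF r(2)] by simp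
        qed
        ultimately show ?thesis using av k s0 by (simp add: abs_le_iff)
      qed
      show ?thesis
      proof (intro allI impI)
        fix t :: real assume t: "t \<le> 0"
        have "\<bar>(1 + b) * h t - average b h t\<bar> \<le> (1 + b) * (W * \<sigma> powr t)"
          using t b osc by (intro average_near relaxation_continuous[OF h]) auto
        then have "(1 + b) * \<bar>h t\<bar> \<le> (1 + b) * (W * \<sigma> powr t) + \<epsilon> * S / (\<sigma> * \<kappa>) * \<sigma> powr t"
          using av_bound[OF t] b by (simp add: abs_mult[symmetric] abs_le_iff) linarith
        also have "\<epsilon> * S / (\<sigma> * \<kappa>) * \<sigma> powr t \<le> (1 + b) * (\<epsilon> * S / (\<sigma> * \<kappa>) * \<sigma> powr t)"
          using b \<epsilon> S_nn s0 \<kappa> mult_right_mono[of 1 "1 + b" "\<epsilon> * S / (\<sigma> * \<kappa>) * \<sigma> powr t"] by simp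
        finally have "(1 + b) * \<bar>h t\<bar> \<le> (1 + b) * ((W + \<epsilon> * S / (\<sigma> * \<kappa>)) * \<sigma> powr t)"
          by (simp add: algebra_simps)
        then have "\<bar>h t\<bar> \<le> (W + \<epsilon> * S / (\<sigma> * \<kappa>)) * \<sigma> powr t" using b by simp
        also have "W + \<epsilon> * S / (\<sigma> * \<kappa>) = \<epsilon> * S * D" by (simp add: W_def D_def distrib_left)
        also have "\<dots> = S / 2" using D by (simp add: \<epsilon>_def)
        finally show "\<bar>h t\<bar> \<le> S / 2 * \<sigma> powr t" .
      qed
    qed
    have "\<forall>t\<le>0. \<bar>h t\<bar> \<le> (S0 / 2 ^ n) * \<sigma> powr t" for n
    proof (induction n)
      case (Suc n) then show ?case using improve[OF Suc] by (simp add: mult.commute)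
    qed (use S0 in auto)
    then have "\<bar>h t0\<bar> \<le> (S0 * (1 / 2) ^ n) * \<sigma> powr t0" for n using t0 by (simp add: power_one_over)
    moreover have "(\<lambda>n. (S0 * (1 / 2) ^ n) * \<sigma> powr t0) \<longlonglongrightarrow> (S0 * 0) * \<sigma> powr t0"
      by (intro tendsto_intros LIMSEQ_power_zero) auto
    ultimately have "\<bar>h t0\<bar> \<le> 0" using LIMSEQ_le_const[of _ "S0 * 0 * \<sigma> powr t0" "\<bar>h t0\<bar>"] by auto
    then show "h t0 = 0" by simp
  qed
qed

text \<open>Positivity and the Harnack constant K take the place of the decay rate in
  \<open>relaxation_trivial\<close>. They make the average comparable to h, with a loss of at most
  the fraction \<eta> per unit, so the oscillation relative to the average contracts up to a small
  term.\<close>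

lemma relaxation_positive:
  fixes b K \<delta> :: real
  assumes b: "0 < b" and K: "1 \<le> K" and \<delta>: "0 < \<delta>"
  obtains \<epsilon> where "0 < \<epsilon>"
    "\<And>h e T t s. relaxation b e T h \<Longrightarrow> (\<And>t. t \<le> T \<Longrightarrow> 0 < h t) \<Longrightarrow>
      (\<And>t s. t \<le> T \<Longrightarrow> t - 1 \<le> s \<Longrightarrow> s \<le> t \<Longrightarrow> h s \<le> K * h t) \<Longrightarrow>
      (\<And>t. t < T \<Longrightarrow> \<bar>e t\<bar> \<le> \<epsilon> * h (t - 1)) \<Longrightarrow> t \<le> T \<Longrightarrow> t - 1 \<le> s \<Longrightarrow> s \<le> t \<Longrightarrow>
      \<bar>h s - h t\<bar> \<le> \<delta> * h t"
proof -
  define \<theta> where "\<theta> = 1 - exp (- b)"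
  have \<theta>: "0 < \<theta>" "\<theta> < 1" using b by (auto simp: \<theta>_def)
  define N where "N = (1 + b) * K"
  have N: "0 < N" using b K by (simp add: N_def)
  \<comment> \<open>Small enough that q stays below 1 and that the limit r0 / (1 - q), multiplied by
    (1 + b) K to pass from the average to h, is at most \<delta>.\<close>
  define \<eta> where "\<eta> = min ((1 - \<theta>) / 2) (\<delta> * (1 - \<theta>) / (8 * N))"
  have \<eta>: "0 < \<eta>" "\<eta> \<le> (1 - \<theta>) / 2" "\<eta> \<le> \<delta> * (1 - \<theta>) / (8 * N)"
    unfolding \<eta>_def by (rule min_less_iff_conj[THEN iffD2] min.cobounded1 min.cobounded2; use \<theta> N \<delta> in simp)+
  have \<eta>1: "\<eta> < 1 / 2" using \<eta>(2) \<theta> by simp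
  define \<epsilon> where "\<epsilon> = \<eta> / K"
  have \<epsilon>: "0 < \<epsilon>" "\<epsilon> * K = \<eta>" using \<eta> K by (auto simp: \<epsilon>_def)
  \<comment> \<open>The relative oscillation obeys w -> q w + r0; the divisor 1 - \<eta> accounts
    for the possible loss of the average within one unit.\<close>
  define q where "q = \<theta> / (1 - \<eta>)"
  define r0 where "r0 = 2 * \<eta> / (1 - \<eta>)"
  have q: "0 \<le> q" "q < 1" "(1 - \<theta>) / 2 \<le> 1 - q"
  proof -
    show "0 \<le> q" using \<theta> \<eta>1 by (simp add: q_def)
    have "2 * \<theta> \<le> (1 + \<theta>) * (1 - \<eta>)"
    proof -
      have "(1 + \<theta>) * \<eta> \<le> 2 * ((1 - \<theta>) / 2)" using \<theta> \<eta> by (intro mult_mono) auto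
      then show ?thesis by (simp add: algebra_simps)
    qed
    then have "q \<le> (1 + \<theta>) / 2" using \<eta>1 by (simp add: q_def field_simps)
    then show "(1 - \<theta>) / 2 \<le> 1 - q" by (simp add: field_simps)
    then show "q < 1" using \<theta> by simp
  qed
  have lim_le: "r0 / (1 - q) * ((1 + b) * K) \<le> \<delta>"
  proof -
    have "r0 \<le> 4 * \<eta>" using \<eta> \<eta>1 by (simp add: r0_def field_simps)
    then have "r0 / (1 - q) \<le> 4 * \<eta> / ((1 - \<theta>) / 2)"
      using q \<theta> \<eta> by (intro frac_le) auto
    also have "\<dots> \<le> 8 * (\<delta> * (1 - \<theta>) / (8 * N)) / (1 - \<theta>)"
    proof -
      have "8 * \<eta> / (1 - \<theta>) \<le> 8 * (\<delta> * (1 - \<theta>) / (8 * N)) / (1 - \<theta>)"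
        using \<eta>(3) \<theta> by (intro divide_right_mono mult_left_mono) auto
      then show ?thesis by simp
    qed
    also have "\<dots> = \<delta> / N" using \<theta> by simp
    finally show ?thesis using N unfolding N_def[symmetric] by (simp add: field_simps)
  qed
  show ?thesis
  proof (rule that[OF \<epsilon>(1)])
    fix h e T t0 s0
    assume h: "relaxation b e T h" and pos: "\<And>t. t \<le> T \<Longrightarrow> 0 < h t"
      and Kh: "\<And>t s. t \<le> T \<Longrightarrow> t - 1 \<le> s \<Longrightarrow> s \<le> t \<Longrightarrow> h s \<le> K * h t"
      and e: "\<And>t. t < T \<Longrightarrow> \<bar>e t\<bar> \<le> \<epsilon> * h (t - 1)" and t0: "(t0::real) \<le> T" "t0 - 1 \<le> s0" "s0 \<le> t0"
    have av_ge: "h t \<le> average b h t" if "t \<le> T" for t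
      using average_bounds(2)[OF relaxation_continuous[OF h that, of "t - 1"], of b 0] that b pos
      by (force intro: less_imp_le)
    have av_le: "average b h t \<le> (1 + b) * K * h t" if "t \<le> T" for t
    proof -
      have "average b h t \<le> h t + b * (K * h t)"
        using that b Kh by (intro average_bounds(1) relaxation_continuous[OF h]) auto
      moreover have "1 * h t \<le> K * h t" using K pos[OF that] by (intro mult_right_mono) auto
      ultimately show ?thesis by (simp add: algebra_simps)
    qed
    have e_bound: "\<bar>e r\<bar> \<le> \<eta> * average b h t" if "t < r" "r < t + 1" "t + 1 \<le> T" for r t
    proof -
      have "\<bar>e r\<bar> \<le> \<epsilon> * h (r - 1)" using e that by simp
      also have "\<dots> \<le> \<epsilon> * (K * h t)" using Kh[of t "r - 1"] that \<epsilon> by (intro mult_left_mono) auto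
      also have "\<dots> \<le> \<epsilon> * (K * average b h t)"
        using av_ge[of t] that \<epsilon> K by (intro mult_left_mono) auto
      finally show ?thesis using \<epsilon>(2) by (simp add: mult.assoc[symmetric])
    qed
    have av_grow: "(1 - \<eta>) * average b h t \<le> average b h (t + 1)" if "t + 1 \<le> T" for t
    proof -
      have "- (\<eta> * average b h t) * (t + 1 - t) \<le> average b h (t + 1) - average b h t"
      proof (rule DERIV_lower_bound)
        show "continuous_on {t..t + 1} (average b h)"
          by (rule continuous_on_subset[OF average_continuous[OF h, of t]]) (use that in auto)
        show "(average b h has_real_derivative e r) (at r)" if "t < r" "r < t + 1" for r
          using that \<open>t + 1 \<le> T\<close> by (intro average_deriv[OF h]) auto
        show "- (\<eta> * average b h t) \<le> e r" if "t < r" "r < t + 1" for r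
          using e_bound[OF that \<open>t + 1 \<le> T\<close>] by (simp add: abs_le_iff)
      qed simp
      then show ?thesis by (simp add: algebra_simps)
    qed
    define P where "P w \<longleftrightarrow> (0 \<le> w \<and> (\<forall>t\<le>T. \<forall>s\<in>{t - 1..t}. \<forall>r\<in>{t - 1..t}. h s - h r \<le> w * average b h t))" for w
    have "P K"
      unfolding P_def
    proof (intro conjI allI impI ballI)
      fix t s r assume *: "t \<le> T" "s \<in> {t - 1..t}" "r \<in> {t - 1..t}"
      have "h s - h r \<le> K * h t" using Kh[of t s] pos[of r] * by auto
      also have "\<dots> \<le> K * average b h t" using av_ge[of t] K * by (intro mult_left_mono) auto
      finally show "h s - h r \<le> K * average b h t" .
    qed (use K in simp)
    moreover have "P (q * w + r0)" if w: "P w" for w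
      unfolding P_def
    proof (intro conjI allI impI ballI)
      show "0 \<le> q * w + r0" using w q \<eta> \<eta>1 by (auto simp: P_def r0_def)
      fix t s r assume *: "t \<le> T" "s \<in> {t - 1..t}" "r \<in> {t - 1..t}"
      let ?L = "average b h (t - 1)"
      have L: "0 < ?L" using av_ge[of "t - 1"] pos[of "t - 1"] * by simp
      have "h s - h r \<le> (1 - exp (- b)) * (w * ?L) + 2 * (\<eta> * ?L)"
      proof (rule relaxation_oscillation[OF h b, of "t - 1"])
        show "\<bar>e r\<bar> \<le> \<eta> * ?L" if "t - 1 < r" "r < t - 1 + 1" for r
          using e_bound[of "t - 1" r] that * by simp
        show "h s - h r \<le> w * ?L" if "s \<in> {t - 1 - 1..t - 1}" "r \<in> {t - 1 - 1..t - 1}" for s r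
          using w * that unfolding P_def by simp
      qed (use * \<eta> L in auto)
      also have "\<dots> = (q * w + r0) * ((1 - \<eta>) * ?L)"
      proof -
        have "(q * w + r0) * (1 - \<eta>) = \<theta> * w + 2 * \<eta>"
          using \<eta>1 unfolding q_def r0_def by (simp add: distrib_right)
        then show ?thesis unfolding \<theta>_def[symmetric] mult.assoc[symmetric] by (simp add: distrib_right)
      qed
      also have "\<dots> \<le> (q * w + r0) * average b h t"
        using av_grow[of "t - 1"] * w q \<eta> \<eta>1 by (intro mult_left_mono) (auto simp: P_def r0_def)
      finally show "h s - h r \<le> (q * w + r0) * average b h t" .
    qed
    ultimately obtain w where w: "\<And>n. P (w n)" "w \<longlonglongrightarrow> r0 / (1 - q)"
      using affine_iteration[of q P K r0] q by auto
    define W where "W = r0 / (1 - q)"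
    have osc: "h s - h r \<le> W * average b h t" if "t \<le> T" "s \<in> {t - 1..t}" "r \<in> {t - 1..t}" for t s r
      by (rule LIMSEQ_le_const[OF tendsto_mult_right[OF w(2)[folded W_def]]])
         (use w(1) that in \<open>auto simp: P_def\<close>)
    have "W * average b h t0 \<le> W * ((1 + b) * K * h t0)"
      using av_le[OF t0(1)] q \<eta> \<eta>1 by (intro mult_left_mono) (auto simp: W_def r0_def)
    also have "\<dots> \<le> \<delta> * h t0"
      using mult_right_mono[OF lim_le, of "h t0"] pos[OF t0(1)] by (simp add: W_def mult_ac)
    finally show "\<bar>h s0 - h t0\<bar> \<le> \<delta> * h t0"
      using osc[OF t0(1), of s0 t0] osc[OF t0(1), of t0 s0] t0 by (auto simp: abs_le_iff)
  qed
qed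

section \<open>The linearization\<close>

locale linear_delay =
  fixes c a :: real
  assumes c_pos': "0 < c" and a_gt': "c < a"
begin

abbreviation "\<Lambda> \<equiv> lambda0 c a"
abbreviation "b \<equiv> \<Lambda> + c"
abbreviation "\<theta> \<equiv> 1 - exp (- b)"

lemma a_pos: "0 < a" using c_pos' a_gt' by simp

lemma char_fun_of_real: "char_fun c a (of_real l) = of_real (l + c - a * exp (- l))"
  unfolding char_fun_def by (simp flip: exp_of_real)

lemma char_strict_mono: "l < m \<Longrightarrow> l + c - a * exp (- l) < m + c - a * exp (- m)"
  using a_pos by (smt (verit) exp_less_mono mult_less_cancel_left_pos)

lemma ex1_lambda0: "\<exists>!l. 0 < l \<and> char_fun c a (of_real l) = 0"
proof -
  have "a * exp (- a) \<le> a" using a_pos by (simp add: mult_left_le)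
  then have nn: "0 \<le> a + c - a * exp (- a)" using c_pos' by linarith
  have "\<exists>l\<ge>0. l \<le> a \<and> l + c - a * exp (- l) = 0"
    by (rule IVT'[where f = "\<lambda>l. l + c - a * exp (- l)", OF _ nn]) (use a_pos a_gt' in \<open>auto intro!: continuous_intros\<close>)
  then obtain l where l: "0 \<le> l" "l \<le> a" "l + c - a * exp (- l) = 0" by blast
  then have "l \<noteq> 0" using a_gt' by auto
  with l have "0 < l \<and> char_fun c a (of_real l) = 0" unfolding char_fun_of_real by simp
  moreover have "l = m" if "char_fun c a (of_real l) = 0" "char_fun c a (of_real m) = 0" for l m
    using that char_strict_mono[of l m] char_strict_mono[of m l]
    unfolding char_fun_of_real of_real_eq_0_iff by (cases l m rule: linorder_cases) auto
  ultimately show ?thesis by blast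
qed

lemma lambda0_pos: "0 < \<Lambda>" and char_lambda0: "char_fun c a (of_real \<Lambda>) = 0"
  using theI'[OF ex1_lambda0] unfolding lambda0_def[symmetric] by auto

lemma lambda0_eq: "a * exp (- \<Lambda>) = b"
  using char_lambda0 unfolding char_fun_of_real of_real_eq_0_iff by simp

lemma b_pos: "0 < b" using lambda0_pos c_pos' by simp

lemma theta_bounds: "0 < \<theta>" "\<theta> < 1" using b_pos by auto

lemma Re_scaled: "Re (complex_of_real r * w) = r * Re w"
  by simp

lemma exp_linear_derivative:
  "((\<lambda>t. exp (z * complex_of_real t)) has_vector_derivative z * exp (z * of_real t)) (at t within S)"
  by (rule has_vector_derivative_real_field[of "\<lambda>w. exp (z * w)"]) (auto intro!: derivative_eq_intros)

text \<open>With \<mu> = z - \<Lambda>, the function Re (exp (\<mu> t)) solves the relaxation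
  equation without perturbation and has zero average. If the bound failed, its backward growth would
  be slow enough for \<open>relaxation_trivial\<close> to make it vanish, yet it is 1 at time
  0.\<close>

lemma char_roots:
  assumes z: "char_fun c a z = 0" "z \<noteq> of_real \<Lambda>"
  shows "exp (Re z) \<le> exp \<Lambda> * \<theta>"
proof (rule ccontr)
  assume "\<not> ?thesis"
  then have gt: "\<theta> < exp (Re z - \<Lambda>)" by (simp add: exp_diff field_simps)
  define \<mu> where "\<mu> = z - of_real \<Lambda>"
  have \<mu>: "\<mu> \<noteq> 0" "Re \<mu> = Re z - \<Lambda>" using z by (auto simp: \<mu>_def)
  have \<mu>_eq: "\<mu> + of_real b = of_real b * exp (- \<mu>)"
  proof -
    have "z + of_real c = of_real a * exp (- z)" using z by (simp add: char_fun_def)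
    also have "\<dots> = of_real a * (exp (- of_real \<Lambda>) * exp (- \<mu>))" by (simp add: \<mu>_def flip: exp_add)
    also have "\<dots> = of_real (a * exp (- \<Lambda>)) * exp (- \<mu>)" by (simp flip: exp_of_real)
    finally show ?thesis unfolding lambda0_eq by (simp add: \<mu>_def)
  qed
  define h where "h t = Re (exp (\<mu> * of_real t))" for t
  have der: "((\<lambda>t. exp (\<mu> * of_real t)) has_vector_derivative \<mu> * exp (\<mu> * of_real t)) (at t within S)" for t S
    by (rule exp_linear_derivative)
  have h_der: "(h has_real_derivative Re (\<mu> * exp (\<mu> * of_real t))) (at t)" for t
    unfolding h_def has_real_derivative_iff_has_vector_derivative
    by (rule bounded_linear.has_vector_derivative[OF bounded_linear_Re der])
  have h_cont: "continuous_on S h" for S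
    unfolding h_def by (intro continuous_intros)
  have "b * (h (t - 1) - h t) = Re (\<mu> * exp (\<mu> * of_real t))" for t
  proof -
    have "exp (\<mu> * of_real (t - 1)) = exp (\<mu> * of_real t) * exp (- \<mu>)"
      by (simp add: algebra_simps flip: exp_add)
    then have "of_real b * (exp (\<mu> * of_real (t - 1)) - exp (\<mu> * of_real t))
        = (of_real b * exp (- \<mu>) - of_real b) * exp (\<mu> * of_real t)"
      by (simp only:) (simp add: algebra_simps)
    also have "\<dots> = \<mu> * exp (\<mu> * of_real t)" unfolding \<mu>_eq[symmetric] by simp
    finally have "Re (of_real b * (exp (\<mu> * of_real (t - 1)) - exp (\<mu> * of_real t))) = Re (\<mu> * exp (\<mu> * of_real t))"
      by (simp only:)
    then show ?thesis unfolding h_def by (simp only: Re_scaled minus_complex.sel)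
  qed
  then have rel: "relaxation b (\<lambda>_. 0) 0 h"
    unfolding relaxation_def using h_cont h_der by simp
  \<comment> \<open>By \<mu> + b = b exp (- \<mu>), b times the integral of the exponential over
    [-1, 0] is -1, which cancels the value 1 at 0.\<close>
  have av: "average b h 0 = 0"
  proof -
    have "((\<lambda>s. exp (\<mu> * of_real s)) has_integral exp (\<mu> * of_real 0) / \<mu> - exp (\<mu> * of_real (- 1)) / \<mu>) {-1..0}"
    proof (rule fundamental_theorem_of_calculus)
      fix s :: real
      have "((\<lambda>s. exp (\<mu> * of_real s) / \<mu>) has_vector_derivative \<mu> * exp (\<mu> * of_real s) / \<mu>) (at s within {-1..0})"
        by (rule bounded_linear.has_vector_derivative[OF bounded_linear_divide exp_linear_derivative])
      then show "((\<lambda>s. exp (\<mu> * of_real s) / \<mu>) has_vector_derivative exp (\<mu> * of_real s)) (at s within {-1..0})"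
        using \<mu>(1) by simp
    qed simp
    then have "(h has_integral Re (exp (\<mu> * of_real 0) / \<mu> - exp (\<mu> * of_real (- 1)) / \<mu>)) {-1..0}"
      unfolding h_def by (rule has_integral_linear[OF _ bounded_linear_Re, unfolded o_def])
    then have int: "integral {-1..0} h = Re ((1 - exp (- \<mu>)) / \<mu>)"
      by (simp add: integral_unique diff_divide_distrib)
    have "of_real b * ((1 - exp (- \<mu>)) / \<mu>) = (of_real b - of_real b * exp (- \<mu>)) / \<mu>"
      by (simp add: algebra_simps)
    also have "\<dots> = - 1" unfolding \<mu>_eq[symmetric] using \<mu>(1) by simp
    finally have "Re (of_real b * ((1 - exp (- \<mu>)) / \<mu>)) = - 1" by simp
    then have "b * integral {-1..0} h = - 1"
      unfolding int by (simp only: Re_scaled)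
    then show ?thesis by (simp add: average_def h_def)
  qed
  \<comment> \<open>\<sigma> has to lie above \<theta>, below 1 and not above exp (Re \<mu>); the
    minimum with 1 covers roots with Re \<mu> \<ge> 0.\<close>
  obtain m where m: "\<theta> < m" "m \<le> 1" "m \<le> exp (Re \<mu>)"
    by (rule that[of "min 1 (exp (Re \<mu>))"]) (use gt theta_bounds in \<open>auto simp: \<mu>(2)\<close>)
  obtain \<sigma> where \<sigma>': "\<theta> < \<sigma>" "\<sigma> < m" using dense[OF m(1)] by blast
  have \<sigma>: "\<theta> < \<sigma>" "\<sigma> < 1" "\<sigma> \<le> exp (Re \<mu>)" "0 < \<sigma>"
    using m \<sigma>' theta_bounds by linarith+
  obtain \<epsilon> where \<epsilon>: "0 < \<epsilon>" and triv:
    "\<And>h e S t. relaxation b e 0 h \<Longrightarrow> (\<And>t. t < 0 \<Longrightarrow> \<bar>e t\<bar> \<le> \<epsilon> * \<bar>h (t - 1)\<bar>) \<Longrightarrow>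
      (\<And>t. t \<le> 0 \<Longrightarrow> \<bar>h t\<bar> \<le> S * \<sigma> powr t) \<Longrightarrow> average b h 0 = 0 \<Longrightarrow> t \<le> 0 \<Longrightarrow> h t = 0"
    using relaxation_trivial[OF b_pos \<sigma>(1,2)] by blast
  have "h 0 = 0"
  proof (rule triv[OF rel _ _ av, of 1])
    show "\<bar>h t\<bar> \<le> 1 * \<sigma> powr t" if "t \<le> 0" for t
    proof -
      have "\<bar>h t\<bar> \<le> exp (Re \<mu> * t)" unfolding h_def using abs_Re_le_cmod[of "exp (\<mu> * of_real t)"] by simp
      also have "\<dots> = exp (Re \<mu>) powr t" by (simp add: powr_def mult.commute)
      also have "\<dots> \<le> \<sigma> powr t" using \<sigma> that by (intro powr_mono2') auto
      finally show ?thesis by simp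
    qed
  qed (use \<epsilon> in auto)
  then show False by (simp add: h_def)
qed

text \<open>The coordinate of the projection onto the leading eigenspace along the rest of the spectrum.\<close>

definition coord :: "C \<Rightarrow> real"
  where "coord \<phi> = (\<phi> (to_hist 0) + a * integral {-1..0} (\<lambda>u. exp (- \<Lambda> * (1 + u)) * extend \<phi> u)) / (1 + b)"

lemma coord_integrable: "(\<lambda>u. exp (- \<Lambda> * (1 + u)) * extend \<phi> u) integrable_on {-1..0}"
  by (intro integrable_continuous_real continuous_intros continuous_on_extend)

lemma extend_linear:
  fixes \<phi> \<psi> :: C
  shows "extend (\<phi> + \<psi>) u = extend \<phi> u + extend \<psi> u" "extend (r *\<^sub>R \<phi>) u = r * extend \<phi> u"
  by (simp_all add: extend_def plus_bcontfun.rep_eq scaleR_bcontfun.rep_eq)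

lemma bounded_linear_coord: "bounded_linear coord"
proof (rule bounded_linear_intro)
  fix \<phi> \<psi> :: C and r :: real
  have "integral {-1..0} (\<lambda>u. exp (- \<Lambda> * (1 + u)) * (extend \<phi> u + extend \<psi> u))
      = integral {-1..0} (\<lambda>u. exp (- \<Lambda> * (1 + u)) * extend \<phi> u)
        + integral {-1..0} (\<lambda>u. exp (- \<Lambda> * (1 + u)) * extend \<psi> u)"
    unfolding integral_add[OF coord_integrable coord_integrable, symmetric]
    by (intro integral_cong) (simp add: ring_distribs)
  then show "coord (\<phi> + \<psi>) = coord \<phi> + coord \<psi>"
    unfolding coord_def extend_linear
    by (simp only: plus_bcontfun.rep_eq add_divide_distrib distrib_left add_ac)
  have "integral {-1..0} (\<lambda>u. exp (- \<Lambda> * (1 + u)) * (r * extend \<phi> u))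
      = r * integral {-1..0} (\<lambda>u. exp (- \<Lambda> * (1 + u)) * extend \<phi> u)"
    unfolding integral_mult_right[symmetric] by (intro integral_cong) simp
  then show "coord (r *\<^sub>R \<phi>) = r *\<^sub>R coord \<phi>"
    unfolding coord_def extend_linear by (simp add: scaleR_bcontfun.rep_eq algebra_simps)
  have "\<bar>integral {-1..0} (\<lambda>u. exp (- \<Lambda> * (1 + u)) * extend \<phi> u)\<bar> \<le> norm \<phi> * (0 - - 1)"
    unfolding real_norm_def[symmetric]
  proof (rule integral_bound)
    fix u :: real assume u: "u \<in> {-1..0}"
    have "\<bar>exp (- \<Lambda> * (1 + u))\<bar> * \<bar>extend \<phi> u\<bar> \<le> 1 * norm \<phi>"
      using u lambda0_pos norm_bounded[of \<phi>] by (intro mult_mono) (auto simp: extend_def)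
    then show "norm (exp (- \<Lambda> * (1 + u)) * extend \<phi> u) \<le> norm \<phi>" by (simp add: abs_mult)
  qed (auto intro!: continuous_intros continuous_on_extend)
  then have "a * \<bar>integral {-1..0} (\<lambda>u. exp (- \<Lambda> * (1 + u)) * extend \<phi> u)\<bar> \<le> a * norm \<phi>"
    using a_pos by (intro mult_left_mono) auto
  then have "\<bar>\<phi> (to_hist 0) + a * integral {-1..0} (\<lambda>u. exp (- \<Lambda> * (1 + u)) * extend \<phi> u)\<bar> \<le> norm \<phi> + a * norm \<phi>"
    using norm_bounded[of \<phi> "to_hist 0"] a_pos
    by (intro order_trans[OF abs_triangle_ineq] add_mono) (auto simp: abs_mult)
  then show "norm (coord \<phi>) \<le> norm \<phi> * ((1 + a) / (1 + b))"
  proof -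
    let ?X = "\<phi> (to_hist 0) + a * integral {-1..0} (\<lambda>u. exp (- \<Lambda> * (1 + u)) * extend \<phi> u)"
    have "\<bar>?X / (1 + b)\<bar> = \<bar>?X\<bar> / (1 + b)" using b_pos by (simp only: abs_divide)
    also have "\<dots> \<le> (norm \<phi> + a * norm \<phi>) / (1 + b)"
      by (rule divide_right_mono) (fact, use b_pos in simp)
    also have "\<dots> = norm \<phi> * ((1 + a) / (1 + b))" by (simp add: algebra_simps)
    finally show ?thesis by (simp only: coord_def real_norm_def)
  qed
qed

interpretation coord: bounded_linear coord by (rule bounded_linear_coord)

text \<open>Links the two descriptions: the coordinate of a segment is the conserved quantity of the
  relaxation variable, by a exp (- \<Lambda>) = b.\<close>

lemma coord_seg:
  assumes u: "continuous_on {t - 1..t} u"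
  shows "coord (seg u t) = exp (\<Lambda> * t) * average b (\<lambda>s. exp (- \<Lambda> * s) * u s) t / (1 + b)"
proof -
  let ?h = "\<lambda>s. exp (- \<Lambda> * s) * u s"
  have "integral {-1..0} (\<lambda>s. exp (- \<Lambda> * (1 + s)) * extend (seg u t) s)
      = integral {-1..0} (\<lambda>s. exp (- \<Lambda>) * exp (\<Lambda> * t) * ?h (s + t))"
  proof (rule integral_cong)
    fix s :: real assume s: "s \<in> {-1..0}"
    then have "extend (seg u t) s = u (t + s)"
      by (simp add: extend_apply seg_apply[OF u] of_hist_to_hist)
    moreover have "exp (- \<Lambda> * (1 + s)) = exp (- \<Lambda>) * exp (\<Lambda> * t) * exp (- \<Lambda> * (s + t))"
      unfolding exp_add[symmetric] by (simp add: algebra_simps)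
    ultimately show "exp (- \<Lambda> * (1 + s)) * extend (seg u t) s = exp (- \<Lambda>) * exp (\<Lambda> * t) * ?h (s + t)"
      by (simp add: add.commute)
  qed
  also have "\<dots> = exp (- \<Lambda>) * exp (\<Lambda> * t) * integral {-1..0} (\<lambda>s. ?h (s + t))"
    by (rule integral_mult_right)
  also have "integral {-1..0} (\<lambda>s. ?h (s + t)) = integral {t - 1..t} ?h"
    using integral_shift_Icc_real[of "-1" 0 ?h t] by (simp add: o_def add.commute)
  finally have "a * integral {-1..0} (\<lambda>s. exp (- \<Lambda> * (1 + s)) * extend (seg u t) s)
      = b * (exp (\<Lambda> * t) * integral {t - 1..t} ?h)"
    unfolding lambda0_eq[symmetric] by simp
  moreover have "apply_bcontfun (seg u t) (to_hist 0) = exp (\<Lambda> * t) * ?h t"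
    by (simp add: seg_apply[OF u] of_hist_to_hist mult.assoc[symmetric] flip: exp_add)
  ultimately show ?thesis
    by (simp add: coord_def average_def algebra_simps)
qed

lemma chi0_apply: "chi0 c a s = exp (\<Lambda> * of_hist s)"
  unfolding chi0_def by (subst seg_apply) (auto intro!: continuous_intros)

lemma coord_chi0: "coord (chi0 c a) = 1"
proof -
  have "coord (chi0 c a) = average b (\<lambda>s. exp (- \<Lambda> * s) * exp (\<Lambda> * s)) 0 / (1 + b)"
    unfolding chi0_def by (subst coord_seg) (auto intro!: continuous_intros)
  also have "\<dots> = 1" using b_pos by (simp add: average_def flip: exp_add)
  finally show ?thesis .
qed

lemma norm_chi0: "norm (chi0 c a) \<le> 1"
  using lambda0_pos of_hist_bounds by (intro norm_bound) (simp add: chi0_apply mult_nonneg_nonpos)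

lemma chi0_ge: "exp (- \<Lambda>) \<le> chi0 c a s"
  using lambda0_pos of_hist_bounds[of s] mult_left_mono[of "-1" "of_hist s" "\<Lambda>"] by (simp add: chi0_apply)

lemma P_space_iff: "\<phi> \<in> P_space c a \<longleftrightarrow> \<phi> = coord \<phi> *\<^sub>R chi0 c a"
  unfolding P_space_def by (auto simp: coord.scaleR coord_chi0)

subsection \<open>The resolvent and the spectral projection\<close>

text \<open>A Laplace transform of the history over [s, 0]; it is the variation of constants term of
  the resolvent.\<close>

definition lap :: "C \<Rightarrow> real \<Rightarrow> complex \<Rightarrow> complex"
  where "lap \<phi> s z = integral {s..0} (\<lambda>u. exp (- z * of_real u) * of_real (extend \<phi> u))"

text \<open>The right-hand side of the boundary condition of the generator: the resolvent function
  \<zeta> satisfies \<open>char_fun c a z\<close> times \<zeta> 0 equal to this.\<close>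

definition num :: "C \<Rightarrow> complex \<Rightarrow> complex"
  where "num \<phi> z = of_real (\<phi> (to_hist 0)) + of_real a * exp (- z) * lap \<phi> (-1) z"

lemma lap_holomorphic: "lap \<phi> s holomorphic_on UNIV"
proof -
  have "(\<lambda>z. integral (cbox s 0) (\<lambda>u. exp (- z * of_real u) * of_real (extend \<phi> u))) holomorphic_on UNIV"
  proof (rule leibniz_rule_holomorphic)
    show "((\<lambda>z. exp (- z * of_real u) * of_real (extend \<phi> u)) has_field_derivative
        - of_real u * exp (- z * of_real u) * of_real (extend \<phi> u)) (at z within UNIV)" for z :: complex and u :: real
      by (auto intro!: derivative_eq_intros)
    show "(\<lambda>u. exp (- z * of_real u) * of_real (extend \<phi> u)) integrable_on cbox s 0" for z :: complex
      by (rule integrable_continuous) (auto intro!: continuous_intros continuous_on_extend)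
    show "continuous_on (UNIV \<times> cbox s 0) (\<lambda>(z :: complex, u). - of_real u * exp (- z * of_real u) * of_real (extend \<phi> u))"
      unfolding case_prod_unfold
      by (intro continuous_intros continuous_on_compose2[OF continuous_on_extend[of UNIV \<phi>]]) auto
  qed auto
  then show ?thesis by (simp add: lap_def[abs_def])
qed

lemma char_fun_holomorphic: "char_fun c a holomorphic_on S"
  unfolding char_fun_def by (intro holomorphic_intros)

text \<open>z \<zeta> - \<zeta>' = \<phi> is a scalar linear equation, solved from the value at 0 by
  variation of constants. The boundary condition of the generator then determines that value,
  because z is not a characteristic root. The uniqueness half justifies the definite
  description.\<close>

lemma resolvent_apply:
  assumes z: "char_fun c a z \<noteq> 0"
  shows "resolvent c a z (complexify \<phi>) s
    = exp (z * of_real (of_hist s)) * (num \<phi> z / char_fun c a z + lap \<phi> (of_hist s) z)"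
proof -
  define \<Phi> where "\<Phi> u = complex_of_real (extend \<phi> u)" for u
  have \<Phi>_cont: "continuous_on S \<Phi>" for S
    unfolding \<Phi>_def by (intro continuous_intros continuous_on_extend)
  have compl: "complexify \<phi> s = \<Phi> (of_hist s)" for s
  proof -
    have "(\<lambda>s. complex_of_real (\<phi> s)) \<in> bcontfun"
      by (rule bcontfun_normI[of _ "norm \<phi>"]) (use norm_bounded[of \<phi>] in \<open>auto intro!: continuous_intros\<close>)
    then show ?thesis unfolding complexify_def \<Phi>_def by (simp add: Bcontfun_inverse)
  qed
  define k where "k u = exp (- z * of_real u) * \<Phi> u" for u :: real
  have k_cont: "continuous_on S k" for S unfolding k_def by (intro continuous_intros \<Phi>_cont)
  have lap_k: "lap \<phi> s z = integral {s..0} k" for s by (simp add: lap_def k_def[abs_def] \<Phi>_def)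
  have lap_der: "((\<lambda>s. lap \<phi> s z) has_vector_derivative - k s) (at s within {-1..0})" if "s \<in> {-1..0}" for s
    unfolding lap_k using integral_has_vector_derivative'[OF k_cont that] .
  define w where "w = num \<phi> z / char_fun c a z"
  define Z where "Z s = exp (z * of_real s) * (w + lap \<phi> s z)" for s
  have exp_der: "((\<lambda>s. exp (z * of_real s)) has_vector_derivative z * exp (z * of_real s)) (at s within S)" for s :: real and S and z :: complex
    by (rule exp_linear_derivative)
  have Z_der: "(Z has_vector_derivative z * Z s - \<Phi> s) (at s within {-1..0})" if "s \<in> {-1..0}" for s
  proof -
    have "(Z has_vector_derivative
        exp (z * of_real s) * (0 + - k s) + z * exp (z * of_real s) * (w + lap \<phi> s z)) (at s within {-1..0})"
      unfolding Z_def[abs_def]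
      by (intro has_vector_derivative_mult exp_der has_vector_derivative_add lap_der that) auto
    moreover have "exp (z * of_real s) * k s = \<Phi> s"
      by (simp add: k_def mult.assoc[symmetric] flip: exp_add)
    ultimately show ?thesis
      by (simp add: Z_def algebra_simps)
  qed
  have Z_cont: "continuous_on {0 - 1..0} Z"
    by (rule continuous_on_vector_derivative[where f' = "\<lambda>s. z * Z s - \<Phi> s"]) (use Z_der in simp)
  define \<zeta> where "\<zeta> = seg Z 0"
  have \<zeta>: "\<zeta> s = Z (of_hist s)" for s unfolding \<zeta>_def by (simp add: seg_apply[OF Z_cont])
  define \<eta> where "\<eta> = seg (\<lambda>s. z * Z s - \<Phi> s) 0"
  have \<eta>: "\<eta> s = z * Z (of_hist s) - \<Phi> (of_hist s)" for s
    unfolding \<eta>_def by (subst seg_apply) (auto intro!: continuous_intros \<Phi>_cont Z_cont[simplified])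
  have Z0: "Z 0 = w" by (simp add: Z_def lap_def)
  have Z1: "Z (-1) = exp (- z) * (w + lap \<phi> (-1) z)" by (simp add: Z_def)
  have gen: "generator c a \<zeta> \<eta>"
    unfolding generator_def
  proof
    show "\<forall>s. ((\<lambda>u. \<zeta> (to_hist u)) has_vector_derivative \<eta> s) (at (of_hist s) within {-1..0})"
    proof
      fix s
      have "(Z has_vector_derivative \<eta> s) (at (of_hist s) within {-1..0})"
        unfolding \<eta> using of_hist[of s] by (intro Z_der) auto
      then show "((\<lambda>u. \<zeta> (to_hist u)) has_vector_derivative \<eta> s) (at (of_hist s) within {-1..0})"
        by (rule has_vector_derivative_transform[rotated 2]) (use of_hist[of s] in \<open>auto simp: \<zeta> of_hist_to_hist\<close>)
    qed
    have "w * char_fun c a z = num \<phi> z" using z by (simp add: w_def)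
    then have "z * w + of_real c * w - of_real a * exp (- z) * w = \<Phi> 0 + of_real a * exp (- z) * lap \<phi> (-1) z"
      by (simp add: char_fun_def num_def algebra_simps \<Phi>_def extend_apply)
    then show "\<eta> (to_hist 0) = - of_real c * \<zeta> (to_hist 0) + of_real a * \<zeta> (to_hist (-1))"
      unfolding \<eta> \<zeta> by (simp add: of_hist_to_hist Z0 Z1 algebra_simps)
  qed
  have uniq: "\<zeta>' = \<zeta>" if ex: "\<exists>\<eta>. generator c a \<zeta>' \<eta> \<and> (\<forall>s. z * \<zeta>' s - \<eta> s = complexify \<phi> s)" for \<zeta>'
  proof -
    obtain \<eta>' where gen': "generator c a \<zeta>' \<eta>'" and eq': "\<And>s. z * \<zeta>' s - \<eta>' s = complexify \<phi> s" using ex by blast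
    have \<eta>'_eq: "\<eta>' s = z * \<zeta>' s - \<Phi> (of_hist s)" for s
      using eq'[of s] unfolding compl by (simp add: algebra_simps)
    define X where "X u = \<zeta>' (to_hist u)" for u
    have X_der: "(X has_vector_derivative z * X s - \<Phi> s) (at s within {-1..0})" if "s \<in> {-1..0}" for s
      using gen' that unfolding generator_def X_def[abs_def] \<eta>'_eq
      by (metis atLeastAtMost_iff of_hist_to_hist)
    have e_der: "((\<lambda>s. exp (- z * of_real s) * X s) has_vector_derivative - k s) (at s within {-1..0})" if "s \<in> {-1..0}" for s
    proof -
      have "((\<lambda>s. exp (- z * of_real s) * X s) has_vector_derivative
          exp (- z * of_real s) * (z * X s - \<Phi> s) + - z * exp (- z * of_real s) * X s) (at s within {-1..0})"
        by (intro has_vector_derivative_mult exp_der X_der that)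
      then show ?thesis by (simp add: k_def algebra_simps)
    qed
    have zero: "((\<lambda>s. exp (- z * of_real s) * X s - lap \<phi> s z) has_vector_derivative 0) (at s within {-1..0})"
      if "s \<in> {-1..0}" for s
      using has_vector_derivative_diff[OF e_der[OF that] lap_der[OF that]] by simp
    obtain C where C: "\<And>s. s \<in> {-1..0} \<Longrightarrow> exp (- z * of_real s) * X s - lap \<phi> s z = C"
    proof (rule has_vector_derivative_zero_constant[of "{-1..0::real}" "\<lambda>s. exp (- z * of_real s) * X s - lap \<phi> s z"])
      show "convex {-1..0::real}" by simp
    qed (use zero in blast)+
    have "C = X 0" using C[of 0] by (simp add: lap_def)
    have X_eq: "X s = exp (z * of_real s) * (X 0 + lap \<phi> s z)" if "s \<in> {-1..0}" for s
    proof -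
      have "exp (- z * of_real s) * X s = X 0 + lap \<phi> s z"
        using C[OF that] unfolding \<open>C = X 0\<close> by (simp add: algebra_simps)
      then have "exp (z * of_real s) * (exp (- z * of_real s) * X s) = exp (z * of_real s) * (X 0 + lap \<phi> s z)" by simp
      then show ?thesis by (simp add: mult.assoc[symmetric] flip: exp_add)
    qed
    have "\<eta>' (to_hist 0) = - of_real c * \<zeta>' (to_hist 0) + of_real a * \<zeta>' (to_hist (-1))"
      using gen' by (simp add: generator_def)
    then have "z * X 0 - \<Phi> 0 = - of_real c * X 0 + of_real a * X (-1)"
      unfolding \<eta>'_eq X_def by (simp add: of_hist_to_hist)
    also have "X (-1) = exp (- z) * (X 0 + lap \<phi> (-1) z)" using X_eq[of "-1"] by simp
    finally have "X 0 * char_fun c a z = num \<phi> z"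
      by (simp add: char_fun_def num_def algebra_simps \<Phi>_def extend_apply)
    then have "X 0 = w" using z by (simp add: w_def field_simps)
    show ?thesis
    proof (rule bcontfun_eqI)
      fix s
      have "\<zeta>' s = X (of_hist s)" by (simp add: X_def to_hist_of_hist)
      also have "\<dots> = Z (of_hist s)" using X_eq[of "of_hist s"] of_hist[of s] \<open>X 0 = w\<close> by (simp add: Z_def)
      finally show "\<zeta>' s = \<zeta> s" by (simp add: \<zeta>)
    qed
  qed
  have "resolvent c a z (complexify \<phi>) = \<zeta>"
    unfolding resolvent_def
  proof (rule the_equality)
    show "\<exists>\<eta>. generator c a \<zeta> \<eta> \<and> (\<forall>s. z * \<zeta> s - \<eta> s = complexify \<phi> s)"
      using gen by (auto simp: \<zeta> \<eta> compl)
  qed (rule uniq)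
  then show ?thesis by (simp add: \<zeta> Z_def w_def)
qed

text \<open>The origin of the formula for \<open>coord\<close>: dividing by 1 + b, the derivative of
  \<open>char_fun\<close> at \<Lambda>, gives the coefficient of the residue of the
  resolvent.\<close>

lemma num_lambda0: "num \<phi> (of_real \<Lambda>) = of_real ((1 + b) * coord \<phi>)"
proof -
  have "exp (- of_real \<Lambda>) * lap \<phi> (-1) (of_real \<Lambda>)
      = integral {-1..0} (\<lambda>u. complex_of_real (exp (- \<Lambda> * (1 + u)) * extend \<phi> u))"
    unfolding lap_def integral_mult_right[symmetric]
  proof (rule integral_cong)
    fix u :: real
    have "complex_of_real (exp (- \<Lambda> * (1 + u))) = exp (- of_real \<Lambda>) * exp (- of_real \<Lambda> * of_real u)"
      unfolding exp_of_real[symmetric] exp_add[symmetric] by (simp add: algebra_simps)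
    then show "exp (- of_real \<Lambda>) * (exp (- of_real \<Lambda> * of_real u) * of_real (extend \<phi> u))
        = complex_of_real (exp (- \<Lambda> * (1 + u)) * extend \<phi> u)"
      by (simp only: of_real_mult mult.assoc)
  qed
  also have "\<dots> = of_real (integral {-1..0} (\<lambda>u. exp (- \<Lambda> * (1 + u)) * extend \<phi> u))"
    using integral_linear[OF coord_integrable bounded_linear_of_real] by (simp add: o_def)
  finally have "num \<phi> (of_real \<Lambda>) = of_real (\<phi> (to_hist 0)) + of_real a *
      of_real (integral {-1..0} (\<lambda>u. exp (- \<Lambda> * (1 + u)) * extend \<phi> u))"
    by (simp only: num_def mult.assoc)
  then show ?thesis using b_pos by (simp add: coord_def)
qed

text \<open>The resolvent is \<open>G\<close> divided by z - \<Lambda> with \<open>G\<close>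
  holomorphic on the disc, so Cauchy's formula evaluates the contour integral as \<open>G\<close> at
  \<Lambda>, where the term with \<open>lap\<close> drops out.\<close>

lemma spectral_proj_eq:
  assumes r: "0 < r" and iso: "\<And>z. z \<in> cball (of_real \<Lambda>) r \<Longrightarrow> char_fun c a z = 0 \<Longrightarrow> z = of_real \<Lambda>"
  shows "spectral_proj c a r (complexify \<phi>) s = of_real (coord \<phi> * exp (\<Lambda> * of_hist s))"
proof -
  let ?l = "complex_of_real \<Lambda>"
  \<comment> \<open>\<open>char_fun\<close> with its zero at \<Lambda> divided out. Its value there
    is 1 + a exp (- \<Lambda>) = 1 + b, so the zero is simple, and isolation keeps \<open>k\<close>
    nonzero on the disc.\<close>
  define k where "k z = (if z = ?l then deriv (char_fun c a) ?l else (char_fun c a z - char_fun c a ?l) / (z - ?l))" for z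
  have k_hol: "k holomorphic_on UNIV"
    unfolding k_def by (rule pole_lemma[OF char_fun_holomorphic]) simp
  have "(char_fun c a has_field_derivative 1 + of_real a * exp (- ?l)) (at ?l)"
    unfolding char_fun_def by (auto intro!: derivative_eq_intros)
  then have "deriv (char_fun c a) ?l = 1 + of_real a * exp (- ?l)" by (rule DERIV_imp_deriv)
  also have "\<dots> = of_real (1 + a * exp (- \<Lambda>))" by (simp flip: exp_of_real)
  finally have kl: "k ?l = of_real (1 + b)" unfolding lambda0_eq by (simp add: k_def)
  have char_k: "char_fun c a z = (z - ?l) * k z" for z
    using char_lambda0 by (simp add: k_def)
  have b0: "complex_of_real (1 + b) \<noteq> 0" using b_pos by (metis of_real_eq_0_iff add_pos_pos less_irrefl zero_less_one)
  have k_nz: "k z \<noteq> 0" if "z \<in> cball ?l r" for z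
    using iso[OF that] char_k[of z] kl b0 by (cases "z = ?l") auto
  define G where "G z = exp (z * of_real (of_hist s)) * (num \<phi> z / k z + (z - ?l) * lap \<phi> (of_hist s) z)" for z
  have cancel: "e * (n / q + w * i) / w = e * (n / (w * q) + i)" if "w \<noteq> 0" for e n q w i :: complex
    using that by (simp add: add_divide_distrib distrib_left mult.commute)
  have G_hol: "G holomorphic_on cball ?l r"
    unfolding G_def num_def
    by (intro holomorphic_intros holomorphic_on_subset[OF k_hol] holomorphic_on_subset[OF lap_holomorphic]) (use k_nz in auto)
  have "((\<lambda>z. G z / (z - ?l)) has_contour_integral (2 * of_real pi * \<i> * G ?l)) (circlepath ?l r)"
    by (rule Cauchy_integral_circlepath_simple[OF G_hol]) (use r in simp)
  then have "((\<lambda>z. resolvent c a z (complexify \<phi>) s) has_contour_integral (2 * of_real pi * \<i> * G ?l)) (circlepath ?l r)"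
  proof (rule has_contour_integral_eq)
    fix z assume "z \<in> path_image (circlepath ?l r)"
    then have "z \<in> sphere ?l r" using r by simp
    then have z: "z \<in> cball ?l r" "z \<noteq> ?l" using r by auto
    then have nz: "char_fun c a z \<noteq> 0" using iso by auto
    have "z - ?l \<noteq> 0" using z by simp
    then show "G z / (z - ?l) = resolvent c a z (complexify \<phi>) s"
      unfolding resolvent_apply[OF nz] G_def char_k by (rule cancel)
  qed
  then have "contour_integral (circlepath ?l r) (\<lambda>z. resolvent c a z (complexify \<phi>) s) = 2 * of_real pi * \<i> * G ?l"
    by (rule contour_integral_unique)
  moreover have "G ?l = of_real (coord \<phi> * exp (\<Lambda> * of_hist s))"
    unfolding G_def kl num_lambda0 using b0 by (simp flip: exp_of_real)
  ultimately show ?thesis by (simp add: spectral_proj_def)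
qed

lemma Q_space_iff: "\<phi> \<in> Q_space c a \<longleftrightarrow> coord \<phi> = 0"
proof
  assume "\<phi> \<in> Q_space c a"
  then obtain r where "0 < r" and "\<And>z. z \<in> cball (of_real \<Lambda>) r \<Longrightarrow> char_fun c a z = 0 \<Longrightarrow> z = of_real \<Lambda>"
    and "\<And>s. spectral_proj c a r (complexify \<phi>) s = 0"
    unfolding Q_space_def by blast
  then have "complex_of_real (coord \<phi> * exp (\<Lambda> * of_hist (to_hist 0))) = 0"
    using spectral_proj_eq[of r \<phi> "to_hist 0"] by simp
  then show "coord \<phi> = 0" by simp
next
  assume 0: "coord \<phi> = 0"
  \<comment> \<open>Membership in Q asks for an isolating circle. Every other root has real part at
    most ln (\<theta> exp \<Lambda>) < \<Lambda>, and r is half of this gap.\<close>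
  have "\<exists>r>0. \<forall>z\<in>cball (of_real \<Lambda>) r. char_fun c a z = 0 \<longrightarrow> z = of_real \<Lambda>"
  proof -
    have "\<theta> * exp \<Lambda> < exp \<Lambda>" using theta_bounds by simp
    then have "ln (\<theta> * exp \<Lambda>) < \<Lambda>"
      using theta_bounds by (simp add: ln_mult_pos)
    define r where "r = (\<Lambda> - ln (\<theta> * exp \<Lambda>)) / 2"
    have r: "0 < r" "ln (\<theta> * exp \<Lambda>) < \<Lambda> - r" using \<open>_ < \<Lambda>\<close> by (auto simp: r_def field_simps)
    have "z = of_real \<Lambda>" if z: "z \<in> cball (of_real \<Lambda>) r" "char_fun c a z = 0" for z
    proof (rule ccontr)
      assume "z \<noteq> of_real \<Lambda>"
      then have "exp (Re z) \<le> \<theta> * exp \<Lambda>" using char_roots[OF z(2)] by (simp add: mult.commute)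
      also have "\<dots> = exp (ln (\<theta> * exp \<Lambda>))" using theta_bounds by (simp only: exp_ln mult_pos_pos exp_gt_zero)
      finally have "Re z < \<Lambda> - r" using r by simp
      moreover have "\<bar>Re (of_real \<Lambda> - z)\<bar> \<le> r"
        using z(1) abs_Re_le_cmod[of "of_real \<Lambda> - z"] by (simp add: dist_norm)
      ultimately show False by simp
    qed
    then show ?thesis using r by blast
  qed
  then show "\<phi> \<in> Q_space c a"
    unfolding Q_space_def using spectral_proj_eq[of _ \<phi>] 0 by force
qed

end

section \<open>The leading unstable set\<close>

sublocale pulse_super \<subseteq> lin: linear_delay c "d * g' (xi1 g c d)"
  by unfold_locales (use c_pos a_gt in auto)

context linear_delay
begin

interpretation coord: bounded_linear coord by (rule bounded_linear_coord)

text \<open>All weights in \<open>coord\<close> are positive, so the coordinate respects the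
  pointwise order.\<close>

lemma coord_pos:
  fixes \<phi> :: C
  assumes "\<And>s. 0 < \<phi> s" shows "0 < coord \<phi>"
proof -
  have "0 \<le> integral {-1..0} (\<lambda>u. exp (- \<Lambda> * (1 + u)) * extend \<phi> u)"
    by (rule integral_nonneg[OF coord_integrable]) (simp add: extend_def less_imp_le[OF assms])
  then have "0 < \<phi> (to_hist 0) + a * integral {-1..0} (\<lambda>u. exp (- \<Lambda> * (1 + u)) * extend \<phi> u)"
    using assms a_pos by (intro add_pos_nonneg) auto
  then show ?thesis using b_pos by (simp add: coord_def)
qed

lemma coord_less:
  fixes \<phi> \<psi> :: C
  shows "(\<And>s. \<phi> s < \<psi> s) \<Longrightarrow> coord \<phi> < coord \<psi>"
  using coord_pos[of "\<psi> - \<phi>"] by (simp add: minus_bcontfun.rep_eq coord.diff)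

end

lemma convex_scaleR_mem:
  assumes "convex S" "0 \<in> S" "x \<in> S" "0 \<le> r" "r \<le> 1" shows "r *\<^sub>R x \<in> S"
  using convexD_alt[OF assms(1,2,3), of r] assms by simp

text \<open>\<sigma> = 1 and \<sigma> = -1 stand for lying above and below, so that both branches
  share one argument.\<close>

definition side :: "real \<Rightarrow> real \<Rightarrow> C \<Rightarrow> bool"
  where "side \<xi> \<sigma> \<psi> \<longleftrightarrow> (\<forall>r. 0 < \<sigma> * (\<psi> r - \<xi>))"

context pulse_super
begin

interpretation coord: bounded_linear lin.coord by (rule lin.bounded_linear_coord)

lemma strictly_below_iff: "\<psi> \<lless> e\<^sub>1 \<longleftrightarrow> side \<xi>\<^sub>1 (- 1) \<psi>" "e\<^sub>1 \<lless> \<psi> \<longleftrightarrow> side \<xi>\<^sub>1 1 \<psi>"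
  by (auto simp: strictly_below_def side_def const_bcontfun.rep_eq)

lemma entire_solution_nonneg: "entire_solution g c d x \<Longrightarrow> 0 \<le> x t"
  using solution_from_nonneg[OF entire_solutionD[of g c d x "t + 1"], of t] by simp

lemma solution_Cplus: "entire_solution g c d x \<Longrightarrow> seg x t \<in> Cplus"
  by (simp add: Cplus_def seg_apply[OF entire_solution_continuous] entire_solution_nonneg)

text \<open>Little-o of \<beta>^t as t tends to minus infinity: the continuous-time form of the
  condition that the scaled backward sequence tends to 0.\<close>

definition fast_decay :: "real \<Rightarrow> (real \<Rightarrow> real) \<Rightarrow> bool"
  where "fast_decay \<beta> x \<longleftrightarrow> (\<forall>\<epsilon>>0. \<forall>\<^sub>F t in at_bot. norm (seg x t - e\<^sub>1) \<le> \<epsilon> * \<beta> powr t)"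

lemma fast_decay_limit:
  assumes \<beta>: "1 < \<beta>" and x: "entire_solution g c d x" and fd: "fast_decay \<beta> x"
  shows "((\<lambda>t. seg x t - e\<^sub>1) \<longlongrightarrow> 0) at_bot" "(x \<longlongrightarrow> \<xi>\<^sub>1) at_bot"
proof -
  have ev: "\<forall>\<^sub>F t in at_bot. norm (seg x t - e\<^sub>1) \<le> \<epsilon>" if "0 < \<epsilon>" for \<epsilon>
  proof -
    have "\<forall>\<^sub>F t in at_bot. norm (seg x t - e\<^sub>1) \<le> \<epsilon> * \<beta> powr t" using fd that by (simp add: fast_decay_def)
    then show ?thesis using eventually_le_at_bot[of 0]
    proof eventually_elim
      case (elim t)
      have "\<beta> powr t \<le> \<beta> powr 0" using \<beta> elim by (intro powr_mono) auto
      then have "\<epsilon> * \<beta> powr t \<le> \<epsilon>" using that \<beta> by simp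
      then show ?case using elim by simp
    qed
  qed
  show "((\<lambda>t. seg x t - e\<^sub>1) \<longlongrightarrow> 0) at_bot"
  proof (rule tendstoI)
    fix \<epsilon> :: real assume "0 < \<epsilon>"
    then have "\<forall>\<^sub>F t in at_bot. norm (seg x t - e\<^sub>1) \<le> \<epsilon> / 2" by (intro ev) simp
    then show "\<forall>\<^sub>F t in at_bot. dist (seg x t - e\<^sub>1) 0 < \<epsilon>"
      by eventually_elim (use \<open>0 < \<epsilon>\<close> in simp)
  qed
  show "(x \<longlongrightarrow> \<xi>\<^sub>1) at_bot"
  proof (rule tendstoI)
    fix \<epsilon> :: real assume "0 < \<epsilon>"
    then have "\<forall>\<^sub>F t in at_bot. norm (seg x t - e\<^sub>1) \<le> \<epsilon> / 2" by (intro ev) simp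
    then show "\<forall>\<^sub>F t in at_bot. dist (x t) \<xi>\<^sub>1 < \<epsilon>"
    proof eventually_elim
      case (elim t)
      have "norm (x t - \<xi>\<^sub>1) \<le> norm (seg (\<lambda>t. x t - \<xi>\<^sub>1) t)"
        by (rule norm_le_seg) (auto intro!: continuous_intros entire_solution_continuous[OF x])
      then show ?case using elim \<open>0 < \<epsilon>\<close>
        by (simp add: seg_minus_const[OF entire_solution_continuous[OF x]] dist_norm)
    qed
  qed
qed

context
  fixes \<beta> :: real and NP NQ :: "C set"
  assumes \<beta>: "1 < \<beta>" and NP: "convex NP" "0 \<in> NP" and NQ: "convex NQ" "0 \<in> NQ"
begin

lemma sum_set_scale:
  assumes "\<phi> \<in> sum_set NP NQ" "0 \<le> r" "r \<le> 1" shows "r *\<^sub>R \<phi> \<in> sum_set NP NQ"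
proof -
  obtain p q where "p \<in> NP" "q \<in> NQ" "\<phi> = p + q" using assms(1) by (auto simp: sum_set_def)
  then show ?thesis
    using convex_scaleR_mem[OF NP, of p r] convex_scaleR_mem[OF NQ, of q r] assms
    by (auto simp: sum_set_def scaleR_right_distrib)
qed

text \<open>The backward sequence glues to an entire solution. Convex neighbourhoods of 0 and
  \<beta> > 1 are enough, so the lemma is available already while a leading setup is being
  constructed.\<close>

lemma convex_W_chain:
  assumes \<psi>: "\<psi> \<in> Wu_loc g c d \<beta> NP NQ"
  obtains x where "entire_solution g c d x" "seg x 0 = \<psi>" "\<And>n. seg x (- real n) \<in> Wu_loc g c d \<beta> NP NQ" "fast_decay \<beta> x"
    "\<And>n. (\<beta> ^ n) *\<^sub>R (seg x (- real n) - e\<^sub>1) \<in> sum_set NP NQ"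
proof -
  obtain \<Phi> :: "int \<Rightarrow> C" where \<psi>_eq: "\<psi> = e\<^sub>1 + \<Phi> 0"
    and flow: "\<And>k. k < 0 \<Longrightarrow> e\<^sub>1 + \<Phi> k \<in> Cplus" "\<And>k. k < 0 \<Longrightarrow> e\<^sub>1 + \<Phi> (k + 1) = semiflow g c d 1 (e\<^sub>1 + \<Phi> k)"
    and N: "\<And>k. k \<le> 0 \<Longrightarrow> (\<beta> powi (- k)) *\<^sub>R \<Phi> k \<in> sum_set NP NQ"
    and lim: "((\<lambda>k. (\<beta> powi (- k)) *\<^sub>R \<Phi> k) \<longlongrightarrow> 0) at_bot"
    using \<psi> unfolding Wu_loc_def Let_def by blast
  \<comment> \<open>A tail of the backward sequence is admissible again: shifting by k multiplies
    the scaled terms by \<beta>^k \<le> 1, and convex neighbourhoods of 0 absorb such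
    factors.\<close>
  have in_W: "e\<^sub>1 + \<Phi> k \<in> Wu_loc g c d \<beta> NP NQ" if k: "k \<le> 0" for k
    unfolding Wu_loc_def Let_def
  proof (intro imageI CollectI conjI exI[of _ "\<lambda>j. \<Phi> (j + k)"] allI impI)
    have pw: "(\<beta> powi (- j)) *\<^sub>R \<Phi> (j + k) = (\<beta> powi k) *\<^sub>R ((\<beta> powi (- (j + k))) *\<^sub>R \<Phi> (j + k))" for j
      using \<beta> by (simp add: power_int_add[symmetric])
    have le1: "\<beta> powi k \<le> 1" using \<beta> k power_int_increasing[of k 0 \<beta>] by simp
    show *: "(\<beta> powi (- j)) *\<^sub>R \<Phi> (j + k) \<in> sum_set NP NQ" if "j \<le> 0" for j
      unfolding pw using that k \<beta> le1 by (intro sum_set_scale N) auto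
    show "\<Phi> k \<in> sum_set NP NQ" using *[of 0] by simp
    have "filterlim (\<lambda>j. j + k) at_bot at_bot"
      unfolding filterlim_at_bot
    proof
      fix Z show "\<forall>\<^sub>F j in at_bot. j + k \<le> Z"
        using eventually_le_at_bot[of "Z - k"] by eventually_elim simp
    qed
    then have "((\<lambda>j. (\<beta> powi k) *\<^sub>R ((\<beta> powi (- (j + k))) *\<^sub>R \<Phi> (j + k))) \<longlongrightarrow> (\<beta> powi k) *\<^sub>R 0) at_bot"
      by (intro tendsto_scaleR tendsto_const filterlim_compose[OF lim])
    then show "((\<lambda>j. (\<beta> powi (- j)) *\<^sub>R \<Phi> (j + k)) \<longlongrightarrow> 0) at_bot" by (simp only: pw) simp
    show "e\<^sub>1 + \<Phi> (j + k) \<in> Cplus" if "j < 0" for j using flow(1)[of "j + k"] that k by simp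
    show "e\<^sub>1 + \<Phi> (j + 1 + k) = semiflow g c d 1 (e\<^sub>1 + \<Phi> (j + k))" if "j < 0" for j
      using flow(2)[of "j + k"] that k by (simp add: add_ac)
  qed simp
  define \<Psi> where "\<Psi> n = e\<^sub>1 + \<Phi> (- int n)" for n
  have step: "\<Psi> n = semiflow g c d 1 (\<Psi> (Suc n))" for n
    using flow(2)[of "- int (Suc n)"] by (simp add: \<Psi>_def)
  have plus: "\<Psi> n \<in> Cplus" for n
  proof (cases n)
    case 0
    have "\<Psi> 1 \<in> Cplus" using flow(1)[of "- 1"] by (simp add: \<Psi>_def)
    then obtain y where y: "solution_from g c d 0 y" "seg y 0 = \<Psi> 1"
      using solution_exists_seg[of d "\<Psi> 1"] d_pos by auto
    have "\<Psi> 0 = seg y 1" using step[of 0] semiflow_eq[OF y(1), of 1] y(2) by simp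
    moreover have "seg y 1 \<in> Cplus"
      using solution_from_nonneg[OF y(1)] of_hist_bounds
      by (simp add: Cplus_def seg_apply[OF solution_from_continuous[OF y(1)]]) (smt (verit))
    ultimately show ?thesis using 0 by simp
  qed (use flow(1) in \<open>simp add: \<Psi>_def\<close>)
  obtain x where x: "entire_solution g c d x" "\<And>n. seg x (- real n) = \<Psi> n"
    using entire_solution_of_chain[of d \<Psi>] plus step d_pos by (metis less_imp_le)
  have x_cont: "continuous_on S x" for S by (rule entire_solution_continuous[OF x(1)])
  have "fast_decay \<beta> x"
    unfolding fast_decay_def
  proof (intro allI impI)
    fix \<epsilon> :: real assume \<epsilon>: "0 < \<epsilon>"
    \<comment> \<open>The reserve factor \<beta> pays for the passage to noninteger times: for - t
      in [n, n + 1) the history at t is covered by those at - n and - n - 1, and \<beta>^(- n) \<le>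
      \<beta> \<beta>^t.\<close>
    have "\<forall>\<^sub>F k in at_bot. dist ((\<beta> powi (- k)) *\<^sub>R \<Phi> k) 0 < \<epsilon> / \<beta>"
      using \<beta> \<epsilon> by (intro tendstoD[OF lim]) auto
    then obtain N where N: "\<And>k. k \<le> N \<Longrightarrow> norm ((\<beta> powi (- k)) *\<^sub>R \<Phi> k) < \<epsilon> / \<beta>"
      by (auto simp: eventually_at_bot_linorder)
    have seg_bound: "norm (seg x (- real n) - e\<^sub>1) \<le> \<epsilon> / \<beta> * \<beta> powr (- real n)" if "- int n \<le> N" for n
    proof -
      have "norm (\<Phi> (- int n)) * \<beta> ^ n \<le> \<epsilon> / \<beta>"
        using N[OF that] \<beta> by (simp add: mult.commute)
      then have "norm (\<Phi> (- int n)) \<le> \<epsilon> / \<beta> / \<beta> ^ n" using \<beta> by (subst pos_le_divide_eq) auto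
      then show ?thesis using \<beta> by (simp add: x(2) \<Psi>_def powr_minus powr_realpow divide_inverse)
    qed
    show "\<forall>\<^sub>F t in at_bot. norm (seg x t - e\<^sub>1) \<le> \<epsilon> * \<beta> powr t"
      using eventually_le_at_bot[of "min 0 (of_int N - 1)"]
    proof eventually_elim
      case (elim t)
      define n where "n = nat \<lfloor>- t\<rfloor>"
      have n: "real n \<le> - t" "- t < real n + 1" using elim by (auto simp: n_def)
      have "real_of_int (- int n) \<le> of_int N" using n elim by simp
      then have nN: "- int n \<le> N" by linarith
      have le: "\<beta> powr (- real n) \<le> \<beta> * \<beta> powr t" "\<beta> powr (- real (Suc n)) \<le> \<beta> * \<beta> powr t"
      proof -
        have "\<beta> * \<beta> powr t = \<beta> powr (t + 1)" using \<beta> by (simp add: powr_add)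
        then show "\<beta> powr (- real n) \<le> \<beta> * \<beta> powr t" "\<beta> powr (- real (Suc n)) \<le> \<beta> * \<beta> powr t"
          using n \<beta> by (auto intro!: powr_mono)
      qed
      have b1: "norm (seg x (- real n) - e\<^sub>1) \<le> \<epsilon> * \<beta> powr t"
        using seg_bound[OF nN] mult_left_mono[OF le(1), of "\<epsilon> / \<beta>"] \<epsilon> \<beta> by simp
      have b2: "norm (seg x (- real (Suc n)) - e\<^sub>1) \<le> \<epsilon> * \<beta> powr t"
        using seg_bound[of "Suc n"] nN mult_left_mono[OF le(2), of "\<epsilon> / \<beta>"] \<epsilon> \<beta> by simp
      show ?case
        unfolding seg_minus_const[OF x_cont]
      proof (rule norm_seg_le)
        fix s assume s: "t - 1 \<le> s" "s \<le> t"
        show "norm (x s - \<xi>\<^sub>1) \<le> \<epsilon> * \<beta> powr t"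
        proof (cases "s \<le> - real (Suc n)")
          case True
          have "norm (x s - \<xi>\<^sub>1) \<le> norm (seg (\<lambda>s. x s - \<xi>\<^sub>1) (- real (Suc n)))"
            using s n True by (intro norm_le_seg[of "- real (Suc n)" "\<lambda>s. x s - \<xi>\<^sub>1"] continuous_intros x_cont) auto
          then show ?thesis using b2 unfolding seg_minus_const[OF x_cont] by simp
        next
          case False
          have "norm (x s - \<xi>\<^sub>1) \<le> norm (seg (\<lambda>s. x s - \<xi>\<^sub>1) (- real n))"
            using s n False by (intro norm_le_seg[of "- real n" "\<lambda>s. x s - \<xi>\<^sub>1"] continuous_intros x_cont) auto
          then show ?thesis using b1 unfolding seg_minus_const[OF x_cont] by simp
        qed
      qed (intro continuous_intros x_cont)
    qed
  qed
  moreover have "seg x 0 = \<psi>" using x(2)[of 0] by (simp add: \<Psi>_def \<psi>_eq)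
  moreover have "(\<beta> ^ n) *\<^sub>R (seg x (- real n) - e\<^sub>1) \<in> sum_set NP NQ" for n
    using N[of "- int n"] by (simp add: x(2) \<Psi>_def)
  moreover have "seg x (- real n) \<in> Wu_loc g c d \<beta> NP NQ" for n unfolding x(2) \<Psi>_def by (rule in_W) simp
  ultimately show ?thesis using x(1) that by blast
qed

end

section \<open>Consequences of a leading setup\<close>

context
  fixes \<beta> NP NQ assumes lead: "leading_setup g g' c d \<beta> NP NQ"
begin

abbreviation "W \<equiv> Wu_loc g c d \<beta> NP NQ"

lemma setup_basic: "1 < \<beta>" "convex NP" "0 \<in> NP" "convex NQ" "0 \<in> NQ"
    "openin (top_of_set (P_space c a)) NP" "openin (top_of_set (Q_space c a)) NQ"
    "\<psi> \<in> W \<Longrightarrow> \<psi> \<noteq> e\<^sub>1 \<Longrightarrow> \<psi> \<lless> e\<^sub>1 \<or> e\<^sub>1 \<lless> \<psi>"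
  using lead unfolding leading_setup_def Let_def by blast+

lemma setup_graph:
  obtains w :: "C \<Rightarrow> C" and Dw :: "C \<Rightarrow> C \<Rightarrow>\<^sub>L C" where "w ` NP \<subseteq> NQ"
    "\<And>\<phi>. \<phi> \<in> NP \<Longrightarrow> (w has_derivative blinfun_apply (Dw \<phi>)) (at \<phi> within NP)"
    "continuous_on NP Dw" "w 0 = 0" "\<And>p. p \<in> P_space c a \<Longrightarrow> blinfun_apply (Dw 0) p = 0"
    "W = {e\<^sub>1 + (\<phi> + w \<phi>) | \<phi>. \<phi> \<in> NP}"
  using lead unfolding leading_setup_def Let_def by blast

lemma NP_subset: "NP \<subseteq> P_space c a" and NQ_subset: "NQ \<subseteq> Q_space c a"
  using setup_basic(6,7) openin_imp_subset by blast+

text \<open>Split \<phi> into its leading component and the rest; boundedness of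
  \<open>coord\<close> makes both small with \<phi>.\<close>

lemma sum_set_neighbourhood: "\<exists>\<epsilon>>0. \<forall>\<phi>. norm \<phi> < \<epsilon> \<longrightarrow> \<phi> \<in> sum_set NP NQ"
proof -
  obtain e1 where e1: "0 < e1" "ball 0 e1 \<inter> P_space c a \<subseteq> NP"
    using setup_basic(3,6) unfolding openin_contains_ball by blast
  obtain e2 where e2: "0 < e2" "ball 0 e2 \<inter> Q_space c a \<subseteq> NQ"
    using setup_basic(5,7) unfolding openin_contains_ball by blast
  obtain K where K: "0 < K" "\<And>\<phi>. norm (lin.coord \<phi>) \<le> norm \<phi> * K"
    using coord.pos_bounded by blast
  define \<epsilon> where "\<epsilon> = min e1 e2 / (1 + K)"
  have \<epsilon>: "0 < \<epsilon>" "\<epsilon> * (1 + K) = min e1 e2" using e1 e2 K by (auto simp: \<epsilon>_def)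
  have "\<phi> \<in> sum_set NP NQ" if \<phi>: "norm \<phi> < \<epsilon>" for \<phi>
  proof -
    define p where "p = lin.coord \<phi> *\<^sub>R chi0 c a"
    have "norm p \<le> norm (lin.coord \<phi>) * 1"
      unfolding p_def norm_scaleR using lin.norm_chi0 by (intro mult_mono) auto
    also have "\<dots> \<le> norm \<phi> * K" using K by simp
    finally have p: "norm p \<le> norm \<phi> * K" .
    have lt: "norm \<phi> * (1 + K) < min e1 e2"
      unfolding \<epsilon>(2)[symmetric] using \<phi> K by (intro mult_strict_right_mono) auto
    have "norm (\<phi> - p) \<le> norm \<phi> + norm p" by (rule norm_triangle_ineq4)
    then have "norm p < e1" "norm (\<phi> - p) < e2"
      using lt p norm_ge_zero[of \<phi>] unfolding distrib_left min_less_iff_conj by linarith+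
    moreover have "p \<in> P_space c a" by (auto simp: p_def P_space_def)
    moreover have "\<phi> - p \<in> Q_space c a"
      unfolding lin.Q_space_iff by (simp add: p_def coord.diff coord.scaleR lin.coord_chi0)
    ultimately have "p \<in> NP" "\<phi> - p \<in> NQ" using e1 e2 by auto
    then show ?thesis unfolding sum_set_def by force
  qed
  then show ?thesis using \<epsilon>(1) by blast
qed

lemma W_chain:
  assumes "\<psi> \<in> W"
  obtains x where "entire_solution g c d x" "seg x 0 = \<psi>" "\<And>n. seg x (- real n) \<in> W" "fast_decay \<beta> x"
  by (rule convex_W_chain[OF setup_basic(1-5) assms]) (rule that)

text \<open>Converse of \<open>W_chain\<close>: far back, the deviations at integer shifts remain in
  a small ball inside the neighbourhood even after scaling, and they form the required backward
  sequence.\<close>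

lemma fast_decay_in_W:
  assumes x: "entire_solution g c d x" and fd: "fast_decay \<beta> x"
  shows "\<forall>\<^sub>F t in at_bot. seg x t \<in> W"
proof -
  have \<beta>: "1 < \<beta>" by (rule setup_basic)
  obtain \<epsilon> where \<epsilon>: "0 < \<epsilon>" "\<And>\<phi>. norm \<phi> < \<epsilon> \<Longrightarrow> \<phi> \<in> sum_set NP NQ" using sum_set_neighbourhood by blast
  have "\<forall>\<^sub>F t in at_bot. norm (seg x t - e\<^sub>1) \<le> \<epsilon> / 2 * \<beta> powr t"
    using fd \<epsilon>(1) unfolding fast_decay_def by (meson half_gt_zero)
  then obtain T where T: "\<And>t. t \<le> T \<Longrightarrow> norm (seg x t - e\<^sub>1) \<le> \<epsilon> / 2 * \<beta> powr t"
    by (auto simp: eventually_at_bot_linorder)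
  show ?thesis
    using eventually_le_at_bot[of "min T 0"]
  proof eventually_elim
    case (elim t)
    define \<Phi> where "\<Phi> k = seg x (t + of_int k) - e\<^sub>1" for k :: int
    have pw: "\<beta> powi (- k) * \<beta> powr (t + of_int k) = \<beta> powr t" for k
    proof -
      have "\<beta> powi (- k) = \<beta> powr of_int (- k)" by (rule powr_real_of_int'[symmetric]) (use \<beta> in auto)
      then show ?thesis using \<beta> by (simp add: powr_add[symmetric])
    qed
    have bt: "\<beta> powr t \<le> 1" using powr_mono[of t 0 \<beta>] \<beta> elim by simp
    have scaled: "norm ((\<beta> powi (- k)) *\<^sub>R \<Phi> k) \<le> \<delta>"
      if "norm (\<Phi> k) \<le> \<delta> * \<beta> powr (t + of_int k)" "0 < \<delta>" for k \<delta>
    proof -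
      have "norm ((\<beta> powi (- k)) *\<^sub>R \<Phi> k) = \<beta> powi (- k) * norm (\<Phi> k)" using \<beta> by simp
      also have "\<dots> \<le> \<beta> powi (- k) * (\<delta> * \<beta> powr (t + of_int k))"
        using that \<beta> by (intro mult_left_mono) auto
      also have "\<dots> = \<delta> * \<beta> powr t" using pw[of k] by (metis mult.left_commute)
      also have "\<dots> \<le> \<delta>" using bt that by simp
      finally show ?thesis .
    qed
    have inN: "(\<beta> powi (- k)) *\<^sub>R \<Phi> k \<in> sum_set NP NQ" if "k \<le> 0" for k
    proof (rule \<epsilon>(2))
      have "norm ((\<beta> powi (- k)) *\<^sub>R \<Phi> k) \<le> \<epsilon> / 2"
        using T[of "t + of_int k"] that elim \<epsilon>(1) by (intro scaled) (auto simp: \<Phi>_def)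
      then show "norm ((\<beta> powi (- k)) *\<^sub>R \<Phi> k) < \<epsilon>" using \<epsilon>(1) by simp
    qed
    have "e\<^sub>1 + \<Phi> 0 \<in> W"
      unfolding Wu_loc_def Let_def
    proof (intro imageI CollectI conjI exI[of _ \<Phi>] allI impI)
      show "\<Phi> 0 \<in> sum_set NP NQ" using inN[of 0] by simp
      show "e\<^sub>1 + \<Phi> k \<in> Cplus" for k by (simp add: \<Phi>_def solution_Cplus[OF x])
      show "e\<^sub>1 + \<Phi> (k + 1) = semiflow g c d 1 (e\<^sub>1 + \<Phi> k)" for k
        using semiflow_eq[OF entire_solutionD[OF x], of 1 "t + of_int k"] by (simp add: \<Phi>_def add_ac)
      show "((\<lambda>k. (\<beta> powi (- k)) *\<^sub>R \<Phi> k) \<longlongrightarrow> 0) at_bot"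
      proof (rule tendstoI)
        fix \<delta> :: real assume \<delta>: "0 < \<delta>"
        have "\<forall>\<^sub>F s in at_bot. norm (seg x s - e\<^sub>1) \<le> \<delta> / 2 * \<beta> powr s"
          using fd \<delta> unfolding fast_decay_def by (meson half_gt_zero)
        then obtain S where S: "\<And>s. s \<le> S \<Longrightarrow> norm (seg x s - e\<^sub>1) \<le> \<delta> / 2 * \<beta> powr s"
          by (auto simp: eventually_at_bot_linorder)
        show "\<forall>\<^sub>F k in at_bot. dist ((\<beta> powi (- k)) *\<^sub>R \<Phi> k) 0 < \<delta>"
          using eventually_le_at_bot[of "\<lfloor>S - t\<rfloor>"]
        proof eventually_elim
          case (elim k)
          then have "t + of_int k \<le> S" by linarith
          then have "norm ((\<beta> powi (- k)) *\<^sub>R \<Phi> k) \<le> \<delta> / 2"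
            using S[of "t + of_int k"] \<delta> by (intro scaled) (auto simp: \<Phi>_def)
          then show ?case using \<delta> by simp
        qed
      qed
    qed (use inN in auto)
    then show ?case by (simp add: \<Phi>_def)
  qed
qed

text \<open>\<open>w\<close> maps into Q, where the coordinate vanishes, so the coordinate of a
  point determines its base point on the line P.\<close>

lemma W_coord_inj:
  assumes "\<psi> \<in> W" "\<psi>' \<in> W" "lin.coord (\<psi> - e\<^sub>1) = lin.coord (\<psi>' - e\<^sub>1)"
  shows "\<psi> = \<psi>'"
proof -
  obtain w :: "C \<Rightarrow> C" and Dw :: "C \<Rightarrow> C \<Rightarrow>\<^sub>L C" where w: "w ` NP \<subseteq> NQ"
    "\<And>\<phi>. \<phi> \<in> NP \<Longrightarrow> (w has_derivative blinfun_apply (Dw \<phi>)) (at \<phi> within NP)"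
    "continuous_on NP Dw" "w 0 = 0" "\<And>p. p \<in> P_space c a \<Longrightarrow> blinfun_apply (Dw 0) p = 0"
    and W: "W = {e\<^sub>1 + (\<phi> + w \<phi>) | \<phi>. \<phi> \<in> NP}" by (rule setup_graph) (rule that)
  have graph: "\<phi> = lin.coord (e\<^sub>1 + (\<phi> + w \<phi>) - e\<^sub>1) *\<^sub>R chi0 c a" if "\<phi> \<in> NP" for \<phi>
  proof -
    have "lin.coord (w \<phi>) = 0" using w(1) that NQ_subset lin.Q_space_iff by blast
    moreover have "\<phi> = lin.coord \<phi> *\<^sub>R chi0 c a" using that NP_subset lin.P_space_iff by blast
    ultimately show ?thesis by (simp add: coord.add)
  qed
  obtain \<phi> \<phi>' where "\<phi> \<in> NP" "\<psi> = e\<^sub>1 + (\<phi> + w \<phi>)" "\<phi>' \<in> NP" "\<psi>' = e\<^sub>1 + (\<phi>' + w \<phi>')"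
    using assms(1,2) unfolding W by blast
  then show ?thesis using graph[of \<phi>] graph[of \<phi>'] assms(3) by metis
qed

text \<open>Since Dw vanishes on P at 0, w is Lipschitz near 0 with constant exp (- \<Lambda>) / 2
  in the coordinate, while \<chi>0 is at least exp (- \<Lambda>) pointwise. So points of the set
  near the stationary point are ordered like their coordinates, and both sides are occupied.\<close>

lemma W_order: "\<exists>r>0. \<forall>\<psi>\<in>W. \<forall>\<psi>'\<in>W. \<bar>lin.coord (\<psi> - e\<^sub>1)\<bar> < r \<and> \<bar>lin.coord (\<psi>' - e\<^sub>1)\<bar> < r \<and>
    lin.coord (\<psi> - e\<^sub>1) < lin.coord (\<psi>' - e\<^sub>1) \<longrightarrow> (\<forall>s. \<psi> s < \<psi>' s)"
  and W_nonempty: "0 \<noteq> (\<sigma>::real) \<Longrightarrow> \<exists>\<psi>\<in>W. side \<xi>\<^sub>1 \<sigma> \<psi>"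
proof -
  let ?X = "chi0 c a"
  let ?m = "exp (- lambda0 c a)"
  obtain w :: "C \<Rightarrow> C" and Dw :: "C \<Rightarrow> C \<Rightarrow>\<^sub>L C" where w: "w ` NP \<subseteq> NQ"
    "\<And>\<phi>. \<phi> \<in> NP \<Longrightarrow> (w has_derivative blinfun_apply (Dw \<phi>)) (at \<phi> within NP)"
    "continuous_on NP Dw" "w 0 = 0" "\<And>p. p \<in> P_space c a \<Longrightarrow> blinfun_apply (Dw 0) p = 0"
    "W = {e\<^sub>1 + (\<phi> + w \<phi>) | \<phi>. \<phi> \<in> NP}" by (rule setup_graph) (rule that)
  obtain e1 where e1: "0 < e1" "ball 0 e1 \<inter> P_space c a \<subseteq> NP"
    using setup_basic(3,6) unfolding openin_contains_ball by blast
  have P: "r *\<^sub>R ?X \<in> P_space c a" for r by (auto simp: P_space_def)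
  have in_NP: "r *\<^sub>R ?X \<in> NP" if "\<bar>r\<bar> < e1" for r
  proof -
    have "norm (r *\<^sub>R ?X) \<le> \<bar>r\<bar> * 1" unfolding norm_scaleR using lin.norm_chi0 by (intro mult_left_mono) auto
    then show ?thesis using e1 P that by auto
  qed
  obtain \<delta> where \<delta>: "0 < \<delta>" "\<And>\<phi>. \<phi> \<in> NP \<Longrightarrow> dist \<phi> 0 < \<delta> \<Longrightarrow> dist (Dw \<phi>) (Dw 0) < ?m / 2"
    using w(3) setup_basic(3) unfolding continuous_on_iff by (metis half_gt_zero exp_gt_zero)
  define r0 where "r0 = min e1 \<delta>"
  have r0: "0 < r0" using e1 \<delta> by (simp add: r0_def)
  have Dw_small: "norm (blinfun_apply (Dw (r *\<^sub>R ?X)) ?X) \<le> ?m / 2" if "\<bar>r\<bar> < r0" for r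
  proof -
    have "norm (r *\<^sub>R ?X) \<le> \<bar>r\<bar> * 1" unfolding norm_scaleR using lin.norm_chi0 by (intro mult_left_mono) auto
    then have "norm (Dw (r *\<^sub>R ?X) - Dw 0) \<le> ?m / 2"
      using \<delta>(2)[of "r *\<^sub>R ?X"] in_NP[of r] that by (simp add: r0_def dist_norm)
    moreover have "blinfun_apply (Dw (r *\<^sub>R ?X)) ?X = blinfun_apply (Dw (r *\<^sub>R ?X) - Dw 0) ?X"
      using w(5)[OF P[of 1]] by (simp add: blinfun.diff_left)
    moreover have "norm (blinfun_apply (Dw (r *\<^sub>R ?X) - Dw 0) ?X) \<le> norm (Dw (r *\<^sub>R ?X) - Dw 0) * 1"
      using lin.norm_chi0 by (intro order_trans[OF norm_blinfun] mult_left_mono) auto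
    ultimately show ?thesis by simp
  qed
  have lip: "norm (w (r *\<^sub>R ?X) - w (q *\<^sub>R ?X)) \<le> ?m / 2 * \<bar>r - q\<bar>" if "\<bar>r\<bar> < r0" "\<bar>q\<bar> < r0" for r q
  proof -
    let ?S = "{- r0<..<r0}"
    have "norm (w (r *\<^sub>R ?X) - w (q *\<^sub>R ?X)) \<le> ?m / 2 * norm (r - q)"
    proof (rule differentiable_bound[where S = ?S and f = "\<lambda>r. w (r *\<^sub>R ?X)"
          and f' = "\<lambda>r h. blinfun_apply (Dw (r *\<^sub>R ?X)) (h *\<^sub>R ?X)"])
      fix t assume t: "t \<in> ?S"
      show "((\<lambda>r. w (r *\<^sub>R ?X)) has_derivative (\<lambda>h. blinfun_apply (Dw (t *\<^sub>R ?X)) (h *\<^sub>R ?X))) (at t within ?S)"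
      proof (rule has_derivative_in_compose2[where t = NP and g' = "\<lambda>\<phi>. blinfun_apply (Dw \<phi>)"])
        show "(\<lambda>r. r *\<^sub>R ?X) ` ?S \<subseteq> NP" using in_NP by (auto simp: r0_def abs_less_iff)
      qed (use t w(2) in \<open>auto intro!: derivative_eq_intros\<close>)
      show "onorm (\<lambda>h. blinfun_apply (Dw (t *\<^sub>R ?X)) (h *\<^sub>R ?X)) \<le> ?m / 2"
      proof (rule onorm_bound)
        fix h :: real
        have "norm (blinfun_apply (Dw (t *\<^sub>R ?X)) (h *\<^sub>R ?X)) = \<bar>h\<bar> * norm (blinfun_apply (Dw (t *\<^sub>R ?X)) ?X)"
          by (simp add: blinfun.scaleR_right)
        also have "\<dots> \<le> \<bar>h\<bar> * (?m / 2)" using Dw_small[of t] t by (intro mult_left_mono) auto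
        finally show "norm (blinfun_apply (Dw (t *\<^sub>R ?X)) (h *\<^sub>R ?X)) \<le> ?m / 2 * norm h" by (simp add: mult.commute)
      qed simp
    qed (use that in auto)
    then show ?thesis by simp
  qed
  have cw: "lin.coord (w \<phi>) = 0" if "\<phi> \<in> NP" for \<phi>
    using w(1) that NQ_subset lin.Q_space_iff by blast
  have less: "r * ?X s + w (r *\<^sub>R ?X) s < q * ?X s + w (q *\<^sub>R ?X) s" if "\<bar>r\<bar> < r0" "\<bar>q\<bar> < r0" "r < q" for r q s
  proof -
    have "\<bar>w (r *\<^sub>R ?X) s - w (q *\<^sub>R ?X) s\<bar> \<le> norm (w (r *\<^sub>R ?X) - w (q *\<^sub>R ?X))"
      using norm_bounded[of "w (r *\<^sub>R ?X) - w (q *\<^sub>R ?X)" s] by (simp add: minus_bcontfun.rep_eq)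
    also have "\<dots> \<le> ?m / 2 * \<bar>r - q\<bar>" by (rule lip[OF that(1,2)])
    also have "\<dots> < ?m * (q - r)" using that(3) by simp
    also have "\<dots> \<le> ?X s * (q - r)" using lin.chi0_ge[of s] that(3) by (intro mult_right_mono) auto
    finally show ?thesis by (simp add: algebra_simps)
  qed
  show "\<exists>r>0. \<forall>\<psi>\<in>W. \<forall>\<psi>'\<in>W. \<bar>lin.coord (\<psi> - e\<^sub>1)\<bar> < r \<and> \<bar>lin.coord (\<psi>' - e\<^sub>1)\<bar> < r \<and>
    lin.coord (\<psi> - e\<^sub>1) < lin.coord (\<psi>' - e\<^sub>1) \<longrightarrow> (\<forall>s. \<psi> s < \<psi>' s)"
  proof (intro exI[of _ r0] conjI r0 ballI impI allI)
    fix \<psi> \<psi>' s assume W: "\<psi> \<in> W" "\<psi>' \<in> W"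
      and c: "\<bar>lin.coord (\<psi> - e\<^sub>1)\<bar> < r0 \<and> \<bar>lin.coord (\<psi>' - e\<^sub>1)\<bar> < r0 \<and> lin.coord (\<psi> - e\<^sub>1) < lin.coord (\<psi>' - e\<^sub>1)"
    obtain \<phi> \<phi>' where \<phi>: "\<phi> \<in> NP" "\<psi> = e\<^sub>1 + (\<phi> + w \<phi>)" "\<phi>' \<in> NP" "\<psi>' = e\<^sub>1 + (\<phi>' + w \<phi>')"
      using W unfolding w(6) by blast
    have co: "lin.coord (\<psi> - e\<^sub>1) = lin.coord \<phi>" "lin.coord (\<psi>' - e\<^sub>1) = lin.coord \<phi>'"
      using \<phi> cw by (auto simp: coord.add)
    have "\<phi> = lin.coord \<phi> *\<^sub>R ?X" "\<phi>' = lin.coord \<phi>' *\<^sub>R ?X" using \<phi> NP_subset lin.P_space_iff by blast+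
    moreover have "\<psi> s = \<xi>\<^sub>1 + (\<phi> s + w \<phi> s)" "\<psi>' s = \<xi>\<^sub>1 + (\<phi>' s + w \<phi>' s)"
      using \<phi> by (auto simp: plus_bcontfun.rep_eq const_bcontfun.rep_eq)
    ultimately show "\<psi> s < \<psi>' s"
      using less[of "lin.coord \<phi>" "lin.coord \<phi>'" s] c unfolding co by (metis add_strict_left_mono real_scaleR_def scaleR_bcontfun.rep_eq)
  qed
  show "\<exists>\<psi>\<in>W. side \<xi>\<^sub>1 \<sigma> \<psi>" if \<sigma>: "0 \<noteq> \<sigma>"
  proof -
    define r where "r = sgn \<sigma> * (r0 / 2)"
    have r: "\<bar>r\<bar> < r0" using \<sigma> r0 by (simp add: r_def abs_mult)
    have "r *\<^sub>R ?X \<in> NP" using in_NP r by (simp add: r0_def)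
    then have "e\<^sub>1 + (r *\<^sub>R ?X + w (r *\<^sub>R ?X)) \<in> W" unfolding w(6) by blast
    moreover have "side \<xi>\<^sub>1 \<sigma> (e\<^sub>1 + (r *\<^sub>R ?X + w (r *\<^sub>R ?X)))"
      unfolding side_def
    proof
      fix s
      have val: "(e\<^sub>1 + (r *\<^sub>R ?X + w (r *\<^sub>R ?X))) s - \<xi>\<^sub>1 = r * ?X s + w (r *\<^sub>R ?X) s"
        by (simp add: plus_bcontfun.rep_eq const_bcontfun.rep_eq scaleR_bcontfun.rep_eq)
      have z: "0 * ?X s + w (0 *\<^sub>R ?X) s = 0" using w(4) by (simp add: zero_bcontfun.rep_eq)
      show "0 < \<sigma> * ((e\<^sub>1 + (r *\<^sub>R ?X + w (r *\<^sub>R ?X))) s - \<xi>\<^sub>1)"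
      proof (cases "0 < \<sigma>")
        case True
        then have "0 < r" using r0 by (simp add: r_def)
        then show ?thesis unfolding val using less[of 0 r s] z r r0 True by simp
      next
        case False
        then have "r < 0" using r0 \<sigma> by (simp add: r_def)
        then show ?thesis unfolding val using less[of r 0 s] z r r0 False \<sigma> by (simp add: mult_neg_neg)
      qed
    qed
    ultimately show ?thesis by blast
  qed
qed

end

end

section \<open>The two unstable orbits\<close>

context pulse_super
begin

interpretation coord: bounded_linear lin.coord by (rule lin.bounded_linear_coord)

lemma coord_side: "side \<xi>\<^sub>1 \<sigma> \<psi> \<Longrightarrow> 0 < \<sigma> * lin.coord (\<psi> - e\<^sub>1)"
proof -
  assume "side \<xi>\<^sub>1 \<sigma> \<psi>"
  then have "0 < lin.coord (\<sigma> *\<^sub>R (\<psi> - e\<^sub>1))"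
    by (intro lin.coord_pos) (simp add: side_def scaleR_bcontfun.rep_eq minus_bcontfun.rep_eq const_bcontfun.rep_eq)
  then show ?thesis by (simp add: coord.scaleR)
qed

lemma entire_solution_tendsto_left:
  assumes "entire_solution g c d x" shows "(x \<longlongrightarrow> x t) (at_left t)"
proof -
  have "isCont x t" using entire_solution_continuous[OF assms, of UNIV] by (simp add: continuous_on_eq_continuous_at)
  then show ?thesis by (simp add: isCont_def filterlim_at_split)
qed

context
  fixes \<beta> NP NQ assumes lead: "leading_setup g g' c d \<beta> NP NQ"
begin

abbreviation "V \<equiv> Wu_loc g c d \<beta> NP NQ"

definition Wside :: "real \<Rightarrow> C set"
  where "Wside \<sigma> = {semiflow g c d t \<psi> | t \<psi>. 0 \<le> t \<and> \<psi> \<in> V \<and> side \<xi>\<^sub>1 \<sigma> \<psi>}"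

lemma Wu_minus_eq: "Wu_minus g c d \<beta> NP NQ = Wside (- 1)"
  and Wu_plus_eq: "Wu_plus g c d \<beta> NP NQ = Wside 1"
  by (simp_all only: Wu_minus_def Wu_plus_def Wside_def strictly_below_iff)

lemma beta_gt: "1 < \<beta>" by (rule setup_basic(1)[OF lead])

definition branch :: "real \<Rightarrow> (real \<Rightarrow> real) \<Rightarrow> bool"
  where "branch \<sigma> x \<longleftrightarrow> entire_solution g c d x \<and> fast_decay \<beta> x \<and> (\<forall>t\<le>0. 0 < \<sigma> * (x t - \<xi>\<^sub>1))"

text \<open>Consecutive histories share an endpoint: the right end of the one at - n - 1 is the left
  end of the one at - n. As each history lies wholly on one side of the stationary point, the side
  is inherited backwards.\<close>

lemma branch_exists:
  assumes \<psi>: "\<psi> \<in> V" "side \<xi>\<^sub>1 \<sigma> \<psi>" and \<sigma>: "\<sigma> = 1 \<or> \<sigma> = - 1"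
  obtains x where "branch \<sigma> x" "seg x 0 = \<psi>"
proof -
  obtain x where x: "entire_solution g c d x" "seg x 0 = \<psi>" "\<And>n. seg x (- real n) \<in> V" "fast_decay \<beta> x"
    by (rule W_chain[OF lead \<psi>(1)]) (rule that)
  have x_cont: "continuous_on S x" for S by (rule entire_solution_continuous[OF x(1)])
  have val: "seg x t s = x (t + of_hist s)" for t s by (rule seg_apply[OF x_cont])
  have sides: "side \<xi>\<^sub>1 \<sigma> (seg x (- real n))" for n
  proof (induction n)
    case 0 then show ?case using x(2) \<psi>(2) by simp
  next
    case (Suc n)
    have end_val: "seg x (- real (Suc n)) (to_hist 0) = seg x (- real n) (to_hist (- 1))"
      unfolding val by (simp add: of_hist_to_hist algebra_simps)
    have pos: "0 < \<sigma> * (seg x (- real (Suc n)) (to_hist 0) - \<xi>\<^sub>1)"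
      using Suc unfolding end_val side_def by blast
    then have "seg x (- real (Suc n)) \<noteq> e\<^sub>1" by (auto simp: const_bcontfun.rep_eq)
    then have "side \<xi>\<^sub>1 (- 1) (seg x (- real (Suc n))) \<or> side \<xi>\<^sub>1 1 (seg x (- real (Suc n)))"
      using setup_basic(8)[OF lead x(3)] unfolding strictly_below_iff by blast
    then show ?case
    proof
      assume s: "side \<xi>\<^sub>1 (- 1) (seg x (- real (Suc n)))"
      then have "0 < - 1 * (seg x (- real (Suc n)) (to_hist 0) - \<xi>\<^sub>1)" unfolding side_def by blast
      then have "\<sigma> \<noteq> 1" using pos by auto
      then show ?thesis using s \<sigma> by simp
    next
      assume s: "side \<xi>\<^sub>1 1 (seg x (- real (Suc n)))"
      then have "0 < 1 * (seg x (- real (Suc n)) (to_hist 0) - \<xi>\<^sub>1)" unfolding side_def by blast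
      then have "\<sigma> \<noteq> - 1" using pos by auto
      then show ?thesis using s \<sigma> by simp
    qed
  qed
  have "0 < \<sigma> * (x t - \<xi>\<^sub>1)" if "t \<le> 0" for t
  proof -
    define n where "n = nat \<lfloor>- t\<rfloor>"
    have n: "real n \<le> - t" "- t < real n + 1" using that by (auto simp: n_def)
    have "0 < \<sigma> * (seg x (- real n) (to_hist (t + real n)) - \<xi>\<^sub>1)" using sides unfolding side_def by blast
    moreover have "seg x (- real n) (to_hist (t + real n)) = x t"
      unfolding val using n by (simp add: of_hist_to_hist)
    ultimately show ?thesis by simp
  qed
  then show ?thesis using x that unfolding branch_def by blast
qed

lemma branch_seg:
  assumes "branch \<sigma> x"
  shows "entire_solution g c d x" "\<forall>\<^sub>F t in at_bot. seg x t \<in> V" "t \<le> 0 \<Longrightarrow> side \<xi>\<^sub>1 \<sigma> (seg x t)"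
    "((\<lambda>t. lin.coord (seg x t - e\<^sub>1)) \<longlongrightarrow> 0) at_bot" "(x \<longlongrightarrow> \<xi>\<^sub>1) at_bot"
    "continuous_on UNIV (\<lambda>t. lin.coord (seg x t - e\<^sub>1))"
proof -
  show x: "entire_solution g c d x" using assms by (simp add: branch_def)
  have fd: "fast_decay \<beta> x" using assms by (simp add: branch_def)
  show "\<forall>\<^sub>F t in at_bot. seg x t \<in> V" by (rule fast_decay_in_W[OF lead x fd])
  show "side \<xi>\<^sub>1 \<sigma> (seg x t)" if "t \<le> 0"
    unfolding side_def seg_apply[OF entire_solution_continuous[OF x]]
  proof
    fix r
    have "t + of_hist r \<le> 0" using that of_hist_bounds[of r] by simp
    then show "0 < \<sigma> * (x (t + of_hist r) - \<xi>\<^sub>1)" using assms by (simp add: branch_def)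
  qed
  show "((\<lambda>t. lin.coord (seg x t - e\<^sub>1)) \<longlongrightarrow> 0) at_bot"
    using coord.tendsto[OF fast_decay_limit(1)[OF beta_gt x fd]] by (simp add: coord.zero)
  show "(x \<longlongrightarrow> \<xi>\<^sub>1) at_bot" by (rule fast_decay_limit(2)[OF beta_gt x fd])
  show "continuous_on UNIV (\<lambda>t. lin.coord (seg x t - e\<^sub>1))"
    by (intro coord.continuous_on continuous_intros continuous_on_seg_UNIV entire_solution_continuous[OF x])
qed

text \<open>Near \<open>\<xi>\<^sub>1\<close> the set is a graph over a line, and both orbits move continuously towards \<open>\<xi>\<^sub>1\<close>
  along it, so they meet.\<close>

lemma branches_meet:
  assumes x: "branch \<sigma> x" and y: "branch \<sigma> y" and \<sigma>: "\<sigma> = 1 \<or> \<sigma> = - 1"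
  shows "\<exists>t\<le>0. \<exists>t'\<le>0. \<forall>r\<ge>-1. x (t + r) = y (t' + r)"
proof -
  define \<rho> where "\<rho> u t = \<sigma> * lin.coord (seg u t - e\<^sub>1)" for u t
  have cont: "continuous_on S (\<rho> u)" if "branch \<sigma> u" for u S
    unfolding \<rho>_def by (intro continuous_intros continuous_on_subset[OF branch_seg(6)[OF that]]) auto
  have pos: "0 < \<rho> u t" if "branch \<sigma> u" "t \<le> 0" for u t
    unfolding \<rho>_def by (intro coord_side branch_seg(3) that)
  obtain T where T: "\<And>t. t \<le> T \<Longrightarrow> seg x t \<in> V" using branch_seg(2)[OF x] by (auto simp: eventually_at_bot_linorder)
  obtain T' where T': "\<And>t. t \<le> T' \<Longrightarrow> seg y t \<in> V" using branch_seg(2)[OF y] by (auto simp: eventually_at_bot_linorder)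
  \<comment> \<open>A coordinate value small enough to be attained by both orbits while they are
    inside the set; continuity and the limit 0 give the two times.\<close>
  define m where "m = min (\<rho> x (min T 0)) (\<rho> y (min T' 0))"
  have m: "0 < m" using pos[OF x] pos[OF y] by (simp add: m_def)
  have attain: "\<exists>t\<le>S. \<rho> u t = m" if u: "branch \<sigma> u" and S: "S \<le> 0" "m \<le> \<rho> u S" for u S
  proof -
    have "((\<rho> u) \<longlongrightarrow> \<sigma> * 0) at_bot" unfolding \<rho>_def by (intro tendsto_intros branch_seg(4)[OF u])
    then have "\<forall>\<^sub>F t in at_bot. \<rho> u t < m" using m by (intro order_tendstoD) auto
    then have "\<forall>\<^sub>F t in at_bot. \<rho> u t < m \<and> t \<le> S" using eventually_le_at_bot[of S] by eventually_elim simp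
    then obtain s where "\<rho> u s < m" "s \<le> S" by (auto simp: eventually_at_bot_linorder)
    then show ?thesis using IVT'[of "\<rho> u" s m S] S cont[OF u] by force
  qed
  obtain t where t: "t \<le> min T 0" "\<rho> x t = m" using attain[OF x, of "min T 0"] by (auto simp: m_def)
  obtain t' where t': "t' \<le> min T' 0" "\<rho> y t' = m" using attain[OF y, of "min T' 0"] by (auto simp: m_def)
  have "lin.coord (seg x t - e\<^sub>1) = lin.coord (seg y t' - e\<^sub>1)"
    using t t' \<sigma> by (auto simp: \<rho>_def)
  then have eq: "seg x t = seg y t'" using T T' t t' by (intro W_coord_inj[OF lead]) auto
  have x_sol: "solution_from g c d (t - t) (\<lambda>r. x (r + t))" and y_sol: "solution_from g c d (t' - t') (\<lambda>r. y (r + t'))"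
    by (intro solution_from_shift entire_solutionD branch_seg(1)[OF x] branch_seg(1)[OF y])+
  have "x (r + t) = y (r + t')" if "-1 \<le> r" for r
  proof (rule solution_unique[of d 0 "\<lambda>r. x (r + t)" "\<lambda>r. y (r + t')"])
    show "x (s + t) = y (s + t')" if "0 - 1 \<le> s" "s \<le> 0" for s
      using seg_eqD[OF entire_solution_continuous[OF branch_seg(1)[OF x]] entire_solution_continuous[OF branch_seg(1)[OF y]] eq, of s] that
      by (simp add: add.commute)
  qed (use x_sol y_sol that in auto)
  then have "\<forall>r\<ge>-1. x (t + r) = y (t' + r)" by (simp add: add.commute)
  moreover have "t \<le> 0" "t' \<le> 0" using t t' by auto
  ultimately show ?thesis by blast
qed

text \<open>Any two branches on one side meet and therefore agree up to a time shift, so all of them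
  trace out the same orbit.\<close>

lemma Wside_orbit:
  assumes \<sigma>: "\<sigma> = 1 \<or> \<sigma> = - 1"
  obtains x where "branch \<sigma> x" "Wside \<sigma> = orbit x"
proof -
  obtain \<psi> where "\<psi> \<in> V" "side \<xi>\<^sub>1 \<sigma> \<psi>" using W_nonempty[OF lead, of \<sigma>] \<sigma> by auto
  then obtain x where x: "branch \<sigma> x" "seg x 0 = \<psi>" using branch_exists \<sigma> by blast
  note x_ent = branch_seg(1)[OF x(1)]
  have "Wside \<sigma> \<subseteq> orbit x"
  proof
    fix \<zeta> assume "\<zeta> \<in> Wside \<sigma>"
    then obtain t \<psi>' where t: "0 \<le> t" "\<zeta> = semiflow g c d t \<psi>'" "\<psi>' \<in> V" "side \<xi>\<^sub>1 \<sigma> \<psi>'" by (auto simp: Wside_def)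
    obtain y where y: "branch \<sigma> y" "seg y 0 = \<psi>'" using branch_exists t \<sigma> by blast
    obtain t1 t2 where m: "t1 \<le> 0" "\<And>r. r \<ge> -1 \<Longrightarrow> y (t1 + r) = x (t2 + r)"
      using branches_meet[OF y(1) x(1) \<sigma>] by blast
    have "\<zeta> = seg y t"
      using semiflow_eq[OF entire_solutionD[OF branch_seg(1)[OF y(1)]], of t 0] y(2) t by simp
    also have "\<dots> = seg x (t2 + (t - t1))"
    proof (rule seg_eqI)
      fix s :: real assume "-1 \<le> s" "s \<le> 0"
      then show "y (t + s) = x (t2 + (t - t1) + s)" using m(2)[of "t - t1 + s"] m(1) t(1) by (simp add: algebra_simps)
    qed
    finally show "\<zeta> \<in> orbit x" by (simp add: orbit_def)
  qed
  moreover have "orbit x \<subseteq> Wside \<sigma>"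
  proof
    fix \<zeta> assume "\<zeta> \<in> orbit x"
    then obtain t where t: "\<zeta> = seg x t" by (auto simp: orbit_def)
    obtain T where T: "\<And>t. t \<le> T \<Longrightarrow> seg x t \<in> V" using branch_seg(2)[OF x(1)] by (auto simp: eventually_at_bot_linorder)
    define s where "s = min t (min T 0)"
    have "\<zeta> = semiflow g c d (t - s) (seg x s)"
      using semiflow_eq[OF entire_solutionD[OF x_ent], of "t - s" s] t by (simp add: s_def)
    moreover have "seg x s \<in> V" "side \<xi>\<^sub>1 \<sigma> (seg x s)" "0 \<le> t - s"
      using T branch_seg(3)[OF x(1)] by (auto simp: s_def)
    ultimately show "\<zeta> \<in> Wside \<sigma>" unfolding Wside_def by blast
  qed
  ultimately show ?thesis using that x(1) by blast
qed

lemma Wu_minus_connects: "connects g c d (Wu_minus g c d \<beta> NP NQ) {e\<^sub>1} {const_bcontfun 0}"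
proof -
  obtain x where x: "branch (- 1) x" "Wside (- 1) = orbit x" using Wside_orbit[of "- 1"] by auto
  note x_ent = branch_seg(1)[OF x(1)]
  have cont: "continuous_on {-1..0} x" by (rule entire_solution_continuous[OF x_ent])
  \<comment> \<open>Compactness turns pointwise inequality into a uniform gap below the stationary
    point, as \<open>extinction_below\<close> requires.\<close>
  obtain s where s: "s \<in> {-1..0}" "\<And>t. t \<in> {-1..0} \<Longrightarrow> x t \<le> x s"
    using continuous_attains_sup[OF _ _ cont] by auto
  have "x s < \<xi>\<^sub>1" using x(1) s(1) by (auto simp: branch_def)
  then have "(x \<longlongrightarrow> 0) at_top"
    by (rule extinction_below[OF entire_solutionD[OF x_ent, of 0]]) (use s in auto)
  then show ?thesis
    unfolding connects_def Wu_minus_eq orbit_connects_def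
    using x x_ent seg_tendsto_const[OF entire_solution_continuous[OF x_ent]] branch_seg(5)[OF x(1)] by blast
qed

text \<open>Near the stationary point segments are ordered like their coordinates, and this order
  persists forward. So if the coordinate failed to grow from t to t + h, it would fail to grow over
  h at all earlier times as well, and its value at t would be bounded by values at t - n h, which
  tend to 0. But it is positive.\<close>

lemma branch_increasing:
  assumes x: "branch 1 x"
  obtains T where "T \<le> 0" "\<And>t. t \<le> T \<Longrightarrow> x t < 1" "\<And>r h. 0 < h \<Longrightarrow> r + h \<le> T \<Longrightarrow> x r < x (r + h)"
proof -
  note x_ent = branch_seg(1)[OF x]
  define \<rho> where "\<rho> t = lin.coord (seg x t - e\<^sub>1)" for t
  obtain r0 where r0: "0 < r0" and order: "\<And>\<psi> \<psi>' s. \<psi> \<in> V \<Longrightarrow> \<psi>' \<in> V \<Longrightarrow> \<bar>lin.coord (\<psi> - e\<^sub>1)\<bar> < r0 \<Longrightarrow>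
      \<bar>lin.coord (\<psi>' - e\<^sub>1)\<bar> < r0 \<Longrightarrow> lin.coord (\<psi> - e\<^sub>1) < lin.coord (\<psi>' - e\<^sub>1) \<Longrightarrow> \<psi> s < \<psi>' s"
    using W_order[OF lead] by blast
  have lim: "(\<rho> \<longlongrightarrow> 0) at_bot" unfolding \<rho>_def by (rule branch_seg(4)[OF x])
  have "\<forall>\<^sub>F t in at_bot. dist (\<rho> t) 0 < r0" by (rule tendstoD[OF lim r0])
  moreover have "\<forall>\<^sub>F t in at_bot. x t < 1" using branch_seg(5)[OF x] xi1_lt_1 by (rule order_tendstoD)
  ultimately have "\<forall>\<^sub>F t in at_bot. seg x t \<in> V \<and> \<bar>\<rho> t\<bar> < r0 \<and> x t < 1"
    using branch_seg(2)[OF x] by eventually_elim simp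
  then obtain T0 where T0: "\<And>t. t \<le> T0 \<Longrightarrow> seg x t \<in> V \<and> \<bar>\<rho> t\<bar> < r0 \<and> x t < 1"
    by (auto simp: eventually_at_bot_linorder)
  define T where "T = min T0 0"
  have T: "T \<le> 0" "\<And>t. t \<le> T \<Longrightarrow> seg x t \<in> V" "\<And>t. t \<le> T \<Longrightarrow> \<bar>\<rho> t\<bar> < r0" "\<And>t. t \<le> T \<Longrightarrow> x t < 1"
    using T0 by (auto simp: T_def)
  have val: "seg x t s = x (t + of_hist s)" for t s by (rule seg_apply[OF entire_solution_continuous[OF x_ent]])
  have segless: "seg x t s < seg x t' s" if "\<rho> t < \<rho> t'" "t \<le> T" "t' \<le> T" for t t' s
    using that T by (intro order) (auto simp: \<rho>_def)
  have less: "x (t + r) < x (t' + r)" if "\<rho> t < \<rho> t'" "t \<le> T" "t' \<le> T" "-1 \<le> r" "r \<le> 0" for t t' r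
    using segless[OF that(1-3), of "to_hist r"] that by (simp add: val of_hist_to_hist)
  have up: "\<rho> t < \<rho> (t + h)" if h: "0 < h" and t: "t + h \<le> T" for t h
  proof (rule ccontr)
    assume not: "\<not> \<rho> t < \<rho> (t + h)"
    have backwards: "\<rho> (s + h) \<le> \<rho> s" if s: "s \<le> t" for s
    proof (rule ccontr)
      assume "\<not> \<rho> (s + h) \<le> \<rho> s"
      then have lt: "x (s + r) < x (s + h + r)" if "-1 \<le> r" "r \<le> 0" for r
        using less[of s "s + h" r] that s h t by auto
      have "x q < x (q + h)" if q: "s \<le> q" "q \<le> t" for q
      proof (rule solution_compare(2)[OF entire_solutionD[OF x_ent, of s] entire_solutionD[OF entire_solution_shift[OF x_ent, of h], of s]])
        show "x q \<le> x (q + h)" if "s - 1 \<le> q" "q \<le> s" for q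
          using lt[of "q - s"] that by (simp add: algebra_simps)
        show "x (q + h) \<le> 1" if "s - 1 \<le> q" "q \<le> t - 1" for q
          using T(4)[of "q + h"] that t by simp
        show "x s < x (s + h)" using lt[of 0] by simp
      qed (use q d_pos in auto)
      moreover have "x q < x (q + h)" if q: "s - 1 \<le> q" "q \<le> s" for q
        using lt[of "q - s"] that by (simp add: algebra_simps)
      ultimately have all: "x q < x (q + h)" if "s - 1 \<le> q" "q \<le> t" for q
        using that by (cases "s \<le> q") auto
      have "\<rho> t < \<rho> (t + h)"
        unfolding \<rho>_def
      proof (rule lin.coord_less)
        fix r
        show "apply_bcontfun (seg x t - e\<^sub>1) r < apply_bcontfun (seg x (t + h) - e\<^sub>1) r"
          using all[of "t + of_hist r"] of_hist_bounds[of r] s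
          by (simp add: minus_bcontfun.rep_eq val add_ac)
      qed
      then show False using not by simp
    qed
    have "\<rho> t \<le> \<rho> (t - real n * h)" for n
    proof (induction n)
      case (Suc n)
      have "\<rho> (t - real (Suc n) * h + h) \<le> \<rho> (t - real (Suc n) * h)"
        by (rule backwards) (use h in simp)
      moreover have eq: "t - real (Suc n) * h + h = t - real n * h" by (simp add: algebra_simps)
      ultimately show ?case using Suc unfolding eq by linarith
    qed simp
    moreover have "filterlim (\<lambda>n. t - real n * h) at_bot sequentially" using h by real_asymp
    then have "(\<lambda>n. \<rho> (t - real n * h)) \<longlonglongrightarrow> 0" by (rule filterlim_compose[OF lim])
    ultimately have "\<rho> t \<le> 0" by (intro LIMSEQ_le_const) auto
    moreover have "0 < 1 * \<rho> t"
      unfolding \<rho>_def by (intro coord_side branch_seg(3)[OF x]) (use t h T(1) in simp)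
    ultimately show False by simp
  qed
  show ?thesis
  proof (rule that[OF T(1) T(4)])
    fix r h :: real assume "0 < h" "r + h \<le> T"
    then show "x r < x (r + h)" using less[OF up, of h r 0] by simp
  qed
qed

text \<open>The shift by h is a solution that lies above x far in the past. Comparison carries the
  order forward while the shifted state one unit earlier is at most 1, hence up to S + 1.\<close>

lemma branch_monotone:
  assumes x: "branch 1 x" and below: "\<And>t. t < S \<Longrightarrow> x t \<le> 1" and h: "0 < h" and r: "r + h \<le> S + 1"
  shows "x r < x (r + h)"
proof -
  note x_ent = branch_seg(1)[OF x]
  obtain T where T: "T \<le> 0" "\<And>t. t \<le> T \<Longrightarrow> x t < 1" "\<And>r h. 0 < h \<Longrightarrow> r + h \<le> T \<Longrightarrow> x r < x (r + h)"
    using branch_increasing[OF x] by blast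
  define s where "s = min r (T - h)"
  have cS: "x S \<le> 1"
  proof (rule tendsto_upperbound[of x "x S" "at_left S"])
    show "(x \<longlongrightarrow> x S) (at_left S)"
      by (rule entire_solution_tendsto_left[OF x_ent])
    show "\<forall>\<^sub>F t in at_left S. x t \<le> 1" using below by (auto simp: eventually_at_filter)
  qed auto
  show ?thesis
  proof (rule solution_compare(2)[OF entire_solutionD[OF x_ent, of s] entire_solutionD[OF entire_solution_shift[OF x_ent, of h], of s]])
    show "x q \<le> x (q + h)" if "s - 1 \<le> q" "q \<le> s" for q
      using T(3)[of h q] that h by (simp add: s_def)
    show "x (q + h) \<le> 1" if "s - 1 \<le> q" "q \<le> r - 1" for q
      using below[of "q + h"] cS that r by (cases "q + h = S") auto
    show "x s < x (s + h)" using T(3)[of h s] h by (simp add: s_def)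
  qed (use d_pos in \<open>auto simp: s_def\<close>)
qed

text \<open>A branch that stayed below 1 would increase to a supremum l. The feedback ratio along it
  is at least Q > 1, its value at time 0 being above the stationary point, so following the feedback
  for long gives Q x \<le> l and thus Q l \<le> l.\<close>

lemma branch_hits:
  assumes x: "branch 1 x"
  obtains t1 where "x t1 = 1" "\<And>t. t < t1 \<Longrightarrow> x t < 1"
proof -
  note x_ent = branch_seg(1)[OF x]
  obtain T where T: "T \<le> 0" "\<And>t. t \<le> T \<Longrightarrow> x t < 1" "\<And>r h. 0 < h \<Longrightarrow> r + h \<le> T \<Longrightarrow> x r < x (r + h)"
    using branch_increasing[OF x] by blast
  have "\<exists>t. 1 \<le> x t"
  proof (rule ccontr)
    assume "\<not> ?thesis"
    then have lt: "x t < 1" for t by (simp add: not_le)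
    have mono: "x r < x (r + h)" if "0 < h" for r h
      using branch_monotone[OF x, of "r + h" h r] lt that by (simp add: less_imp_le)
    define l where "l = Sup (range x)"
    have bdd: "bdd_above (range x)" using lt by (auto intro!: bdd_aboveI[of _ 1] less_imp_le)
    have le_l: "x t \<le> l" for t unfolding l_def using bdd by (intro cSup_upper) auto
    define m where "m = x 0"
    have m: "\<xi>\<^sub>1 < m" "m < 1" using x lt by (auto simp: m_def branch_def)
    define Q where "Q = d * g m / (c * m)"
    have Q: "1 < Q" using g_above_xi1[of m] m xi1_pos c_pos by (simp add: Q_def)
    have gQ: "Q * \<xi> \<le> d * g \<xi> / c" if "m \<le> \<xi>" "\<xi> < 1" for \<xi>
    proof -
      have "g m / m \<le> g \<xi> / \<xi>" using g_ratio_mono[of m \<xi>] that m xi1_pos by (cases "m = \<xi>") auto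
      then have "d / c * (g m / m) \<le> d / c * (g \<xi> / \<xi>)" using d_pos c_pos by (intro mult_left_mono) auto
      then have "d / c * (g m / m) * \<xi> \<le> d / c * (g \<xi> / \<xi>) * \<xi>" using that m xi1_pos by (intro mult_right_mono) auto
      then show ?thesis using that m xi1_pos by (simp add: Q_def mult.commute)
    qed
    have step: "Q * x s \<le> l" if s: "0 \<le> s" for s
    proof -
      have ms: "m \<le> x s" using mono[of s 0] s by (cases "s = 0") (auto simp: m_def)
      have "(\<lambda>n. Q * x s * (1 - exp (- c * real n))) \<longlonglongrightarrow> Q * x s * (1 - 0)"
        by (intro tendsto_intros) (use c_pos in real_asymp)
      moreover have "Q * x s * (1 - exp (- c * real n)) \<le> l" for n
      proof -
        let ?E = "exp (- c * (s + 1 + real n - (s + 1)))"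
        have "?E * x (s + 1) + d * g (x s) / c * (1 - ?E) \<le> x (s + 1 + real n)"
        proof (rule solution_bounds(2)[OF entire_solutionD[OF x_ent, of s]])
          show "g (x s) \<le> g (x (q - 1))" if "s + 1 < q" "q < s + 1 + real n" for q
            using mono[of "q - 1 - s" s] that lt[of "q - 1"] ms m xi1_pos
            by (intro g_mono) auto
        qed (use d_pos in auto)
        moreover have "Q * x s * (1 - ?E) \<le> d * g (x s) / c * (1 - ?E)"
          using gQ[OF ms lt] c_pos by (intro mult_right_mono) auto
        moreover have "0 \<le> ?E * x (s + 1)" using entire_solution_nonneg[OF x_ent] by simp
        ultimately show ?thesis using le_l[of "s + 1 + real n"] by simp
      qed
      ultimately show ?thesis using LIMSEQ_le_const2[of _ "Q * x s * (1 - 0)" l] by auto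
    qed
    have "x t \<le> l / Q" for t
    proof -
      have "x t \<le> x (max t 0)" using mono[of "- t" t] by (cases t "0::real" rule: linorder_cases) auto
      also have "\<dots> \<le> l / Q" using step[of "max t 0"] Q by (simp add: field_simps)
      finally show ?thesis .
    qed
    then have "l \<le> l / Q" unfolding l_def by (intro cSup_least) auto
    moreover have "0 < l" using le_l[of 0] m xi1_pos by (simp add: m_def)
    ultimately show False using Q by (simp add: field_simps)
  qed
  then obtain t' where t': "1 \<le> x t'" by blast
  define H where "H = {t \<in> {T..t'}. 1 \<le> x t}"
  have "closed H"
    unfolding H_def by (intro continuous_on_closed_Collect_le continuous_intros entire_solution_continuous[OF x_ent])
  moreover have "H = {T..t'} \<inter> H" by (auto simp: H_def)
  ultimately have "compact H" by (metis compact_Icc compact_Int_closed)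
  moreover have "t' \<in> H" using t' T(2)[of t'] by (force simp: H_def)
  ultimately obtain t1 where t1: "t1 \<in> H" "\<And>t. t \<in> H \<Longrightarrow> t1 \<le> t" using compact_attains_inf[of H] by blast
  have lt: "x t < 1" if "t < t1" for t
  proof (rule ccontr)
    assume "\<not> x t < 1"
    then have "T < t" using T(2)[of t] by force
    then have "t \<in> H" using \<open>\<not> x t < 1\<close> that t1(1) by (auto simp: H_def)
    then show False using t1(2) that by force
  qed
  have "x t1 \<le> 1"
  proof (rule tendsto_upperbound[of x "x t1" "at_left t1"])
    show "(x \<longlongrightarrow> x t1) (at_left t1)"
      by (rule entire_solution_tendsto_left[OF x_ent])
    show "\<forall>\<^sub>F t in at_left t1. x t \<le> 1" using lt by (auto simp: eventually_at_filter less_imp_le)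
  qed auto
  then have "x t1 = 1" using t1(1) by (simp add: H_def)
  then show ?thesis using lt that by blast
qed

text \<open>Growth lasts until t1 + 1 because the delayed state is at most 1 until then. Afterwards
  the feedback is off for as long as x > 1, so decay brings x back to 1; t2 is the first return, and
  the unit above 1 before it produces the exponential.\<close>

lemma branch_pulse_orbit:
  assumes x: "branch 1 x"
  obtains t1 t2 where "pulse_orbit x t1 t2"
proof -
  note x_ent = branch_seg(1)[OF x]
  have cont: "continuous_on S x" for S by (rule entire_solution_continuous[OF x_ent])
  obtain t1 where t1: "x t1 = 1" "\<And>t. t < t1 \<Longrightarrow> x t < 1" using branch_hits[OF x] by blast
  have mono: "x r < x s" if "r < s" "s \<le> t1 + 1" for r s
    using branch_monotone[OF x, of t1 "s - r" r] t1(2) that by (simp add: less_imp_le)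
  have gt: "1 < x t" if "t1 < t" "t \<le> t1 + 1" for t using mono[of t1 t] t1(1) that by simp
  have "\<exists>t>t1 + 1. x t \<le> 1"
  proof (rule ccontr)
    assume "\<not> ?thesis"
    then have big: "1 < x t" if "t1 < t" for t using gt[of t] that by (cases "t \<le> t1 + 1") (auto simp: not_le)
    have "x (t1 + 1 + real n) = exp (- c * (t1 + 1 + real n - (t1 + 1))) * x (t1 + 1)" for n
      by (rule solution_free[OF entire_solutionD[OF x_ent, of "t1 + 1"]]) (use big d_pos in auto)
    then have "1 < exp (- c * real n) * x (t1 + 1)" for n using big[of "t1 + 1 + real n"] by simp
    moreover have "(\<lambda>n. exp (- c * real n) * x (t1 + 1)) \<longlonglongrightarrow> 0 * x (t1 + 1)"
      by (intro tendsto_intros) (use c_pos in real_asymp)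
    ultimately have "1 \<le> 0 * x (t1 + 1)" by (intro LIMSEQ_le_const) (auto intro: less_imp_le)
    then show False by simp
  qed
  then obtain t' where t': "t1 + 1 < t'" "x t' \<le> 1" by blast
  define H where "H = {t \<in> {t1 + 1..t'}. x t \<le> 1}"
  have "closed H"
    unfolding H_def by (intro continuous_on_closed_Collect_le continuous_intros cont)
  moreover have "H = {t1 + 1..t'} \<inter> H" by (auto simp: H_def)
  ultimately have "compact H" by (metis compact_Icc compact_Int_closed)
  moreover have "t' \<in> H" using t' by (simp add: H_def)
  ultimately obtain t2 where t2: "t2 \<in> H" "\<And>t. t \<in> H \<Longrightarrow> t2 \<le> t" using compact_attains_inf[of H] by blast
  have t2_gt: "t1 + 1 < t2" using t2(1) gt[of "t1 + 1"] by (cases "t2 = t1 + 1") (auto simp: H_def)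
  have big: "1 < x t" if "t1 < t" "t < t2" for t
  proof (cases "t \<le> t1 + 1")
    case True then show ?thesis using gt that by simp
  next
    case False
    then show ?thesis using t2(1) t2(2)[of t] that by (force simp: H_def)
  qed
  have "1 \<le> x t2"
  proof (rule tendsto_lowerbound[of x "x t2" "at_left t2"])
    show "(x \<longlongrightarrow> x t2) (at_left t2)"
      by (rule entire_solution_tendsto_left[OF x_ent])
    have "\<forall>\<^sub>F t in at_left t2. t1 < t" using t2_gt by (intro eventually_at_leftI[of t1]) auto
    moreover have "\<forall>\<^sub>F t in at_left t2. t < t2" by (auto simp: eventually_at_filter)
    ultimately show "\<forall>\<^sub>F t in at_left t2. 1 \<le> x t"
      by eventually_elim (rule less_imp_le[OF big])
  qed auto
  then have xt2: "x t2 = 1" using t2(1) by (simp add: H_def)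
  have "x (t2 + s) = exp (- c * s)" if "s \<in> {0..1}" for s
    using solution_free[OF entire_solutionD[OF x_ent, of t2], of t2 "t2 + s"] big t2_gt that d_pos xt2 by simp
  then have "pulse_orbit x t1 t2"
    unfolding pulse_orbit_def strict_mono_on_def
    using x_ent branch_seg(5)[OF x] t2_gt t1(1) xt2 mono big by auto
  then show ?thesis by (rule that)
qed

lemma Wu_plus_pulse_orbit:
  obtains x t1 t2 where "pulse_orbit x t1 t2" "Wu_plus g c d \<beta> NP NQ = orbit x"
proof -
  obtain x where x: "branch 1 x" "Wside 1 = orbit x" using Wside_orbit[of 1] by auto
  then show ?thesis using branch_pulse_orbit that unfolding Wu_plus_eq by metis
qed

lemma Wu_plus_connects:
  assumes "d < critical"
  shows "connects g c d (Wu_plus g c d \<beta> NP NQ) {e\<^sub>1} {const_bcontfun 0}"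
proof -
  obtain x t1 t2 where x: "pulse_orbit x t1 t2" "Wu_plus g c d \<beta> NP NQ = orbit x" by (rule Wu_plus_pulse_orbit)
  have "entire_solution g c d x" "(x \<longlongrightarrow> \<xi>\<^sub>1) at_bot" using x(1) by (auto simp: pulse_orbit_def)
  then show ?thesis
    unfolding connects_def orbit_connects_def
    using x(2) seg_tendsto_const[OF po_continuous[OF x(1)]] po_extinction[OF x(1) assms] by blast
qed

lemma plus_solution_exists:
  "\<exists>\<kappa> x t1 t2. 0 < \<kappa> \<and> \<kappa> < 1 - \<xi>\<^sub>1 \<and> plus_solution g c d (Wu_plus g c d \<beta> NP NQ) \<kappa> x t1 t2"
proof -
  obtain x t1 t2 where po: "pulse_orbit x t1 t2" and V: "Wu_plus g c d \<beta> NP NQ = orbit x" by (rule Wu_plus_pulse_orbit)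
  \<comment> \<open>The shift moves the first hit of 1 to time 1: then t1 + 1 = 2 > 0, and time 0
    falls into the rising part strictly between the stationary point and 1.\<close>
  define y where "y t = x (t + (t1 - 1))" for t
  have mono: "x r < x s" if "r < s" "s \<le> t1 + 1" for r s
    using po that by (auto simp: pulse_orbit_def strict_mono_on_def)
  have "\<xi>\<^sub>1 \<le> x (t1 - 2)" "x (t1 - 2) < x (t1 - 1)" "x (t1 - 1) < x t1"
    using po_early[OF po, of "t1 - 2"] mono by auto
  then have y0: "\<xi>\<^sub>1 < y 0" "y 0 < 1" using po by (auto simp: y_def pulse_orbit_def)
  have "filterlim (\<lambda>t. t + (t1 - 1)) at_bot at_bot" by real_asymp
  moreover have "(x \<longlongrightarrow> \<xi>\<^sub>1) at_bot" using po by (simp add: pulse_orbit_def)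
  ultimately have lim: "(y \<longlongrightarrow> \<xi>\<^sub>1) at_bot" unfolding y_def by (rule filterlim_compose[rotated])
  have "orbit x = orbit y"
  proof
    show "orbit x \<subseteq> orbit y"
    proof
      fix \<psi> assume "\<psi> \<in> orbit x"
      then obtain t where "\<psi> = seg x t" by (auto simp: orbit_def)
      then have "\<psi> = seg y (t - (t1 - 1))" by (simp add: y_def[abs_def] seg_shift)
      then show "\<psi> \<in> orbit y" by (simp add: orbit_def)
    qed
    show "orbit y \<subseteq> orbit x" by (auto simp: orbit_def y_def[abs_def] seg_shift)
  qed
  moreover have "entire_solution g c d y"
    unfolding y_def[abs_def] using po by (intro entire_solution_shift) (simp add: pulse_orbit_def)
  ultimately have "plus_solution g c d (Wu_plus g c d \<beta> NP NQ) (y 0 - \<xi>\<^sub>1) y 1 (t2 - (t1 - 1))"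
    unfolding plus_solution_def using V lim po mono
    by (auto simp: y_def pulse_orbit_def strict_mono_on_def add_ac)
  then show ?thesis using y0 by (intro exI[of _ "y 0 - \<xi>\<^sub>1"]) auto
qed

end

end

section \<open>Monotone orbits leaving an equilibrium\<close>

lemma delay_solution_bounds:
  assumes F: "admissible F" and x: "delay_solution F c T x" and c: "0 < c" and t: "T \<le> \<tau>" "\<tau> \<le> t"
  shows "(\<And>s. \<tau> \<le> s \<Longrightarrow> s \<le> t \<Longrightarrow> F (x (s - 1)) \<le> G) \<Longrightarrow>
      x t \<le> exp (- c * (t - \<tau>)) * x \<tau> + G / c * (1 - exp (- c * (t - \<tau>)))"
    and "(\<And>s. \<tau> \<le> s \<Longrightarrow> s \<le> t \<Longrightarrow> G \<le> F (x (s - 1))) \<Longrightarrow>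
      exp (- c * (t - \<tau>)) * x \<tau> + G / c * (1 - exp (- c * (t - \<tau>))) \<le> x t"
proof -
  let ?k = "\<lambda>s. exp (c * s) * F (x (s - 1))"
  have k: "?k integrable_on {\<tau>..t}"
    by (rule delay_integrable[OF F delay_solutionD(1)[OF x] t(1)])
  have eq: "exp (c * t) * x t = exp (c * \<tau>) * x \<tau> + integral {\<tau>..t} ?k"
    by (rule delay_solution_from[OF F x t])
  have G: "((\<lambda>s. exp (c * s) * G) has_integral (exp (c * t) * (G / c) - exp (c * \<tau>) * (G / c))) {\<tau>..t}"
    using t c by (intro fundamental_theorem_of_calculus)
      (auto intro!: derivative_eq_intros simp flip: has_real_derivative_iff_has_vector_derivative)
  have conv: "exp (c * t) * (exp (- c * (t - \<tau>)) * x \<tau> + G / c * (1 - exp (- c * (t - \<tau>))))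
      = exp (c * \<tau>) * x \<tau> + (exp (c * t) * (G / c) - exp (c * \<tau>) * (G / c))"
  proof -
    have e: "exp (c * t) * exp (- c * (t - \<tau>)) = exp (c * \<tau>)"
      by (simp add: algebra_simps flip: exp_add)
    show ?thesis
      unfolding e[symmetric] by (simp add: algebra_simps)
  qed
  have cancel: "y \<le> z" if "exp (c * t) * y \<le> exp (c * t) * z" for y z using that by simp
  show "x t \<le> exp (- c * (t - \<tau>)) * x \<tau> + G / c * (1 - exp (- c * (t - \<tau>)))"
    if "\<And>s. \<tau> \<le> s \<Longrightarrow> s \<le> t \<Longrightarrow> F (x (s - 1)) \<le> G"
  proof (rule cancel)
    have "integral {\<tau>..t} ?k \<le> integral {\<tau>..t} (\<lambda>s. exp (c * s) * G)"
      using that by (intro integral_le k has_integral_integrable[OF G]) auto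
    then show "exp (c * t) * x t \<le> exp (c * t) * (exp (- c * (t - \<tau>)) * x \<tau> + G / c * (1 - exp (- c * (t - \<tau>))))"
      unfolding conv eq integral_unique[OF G] by simp
  qed
  show "exp (- c * (t - \<tau>)) * x \<tau> + G / c * (1 - exp (- c * (t - \<tau>))) \<le> x t"
    if "\<And>s. \<tau> \<le> s \<Longrightarrow> s \<le> t \<Longrightarrow> G \<le> F (x (s - 1))"
  proof (rule cancel)
    have "integral {\<tau>..t} (\<lambda>s. exp (c * s) * G) \<le> integral {\<tau>..t} ?k"
      using that by (intro integral_le k has_integral_integrable[OF G]) auto
    then show "exp (c * t) * (exp (- c * (t - \<tau>)) * x \<tau> + G / c * (1 - exp (- c * (t - \<tau>)))) \<le> exp (c * t) * x t"
      unfolding conv eq integral_unique[OF G] by simp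
  qed
qed

text \<open>What both branches have in common: 0 is stationary and positive deviations up to
  \<kappa> are amplified. Monotonicity, Lipschitz continuity and boundedness are global because the
  intended feedback is truncated.\<close>

locale escape =
  fixes F :: "real \<Rightarrow> real" and c \<kappa> K B :: real
  assumes c: "0 < c" and \<kappa>: "0 < \<kappa>" and mono_F: "mono F" and F_0: "F 0 = 0"
    and F_gt: "\<And>v. 0 < v \<Longrightarrow> v \<le> \<kappa> \<Longrightarrow> c * v < F v"
    and F_lipschitz: "\<And>v w. \<bar>F v - F w\<bar> \<le> K * \<bar>v - w\<bar>" and F_bounded: "\<And>v. \<bar>F v\<bar> \<le> B"
begin

lemma F_cont: "isCont F v"
proof -
  have K: "0 \<le> K" using F_lipschitz[of 0 1] by (simp add: order_trans[OF abs_ge_zero])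
  have "continuous_on UNIV F"
    by (rule lipschitz_on_continuous_on[of K]) (use K F_lipschitz in \<open>auto simp: lipschitz_on_def dist_real_def\<close>)
  then show ?thesis by (simp add: continuous_on_eq_continuous_at)
qed

lemma K_nonneg: "0 \<le> K" using F_lipschitz[of 0 1] by (simp add: order_trans[OF abs_ge_zero])

lemma adm: "admissible F"
  unfolding admissible_def bounded_iff using F_cont F_bounded
  by (auto intro!: borel_measurable_continuous_onI continuous_at_imp_continuous_on)

lemma F_le: "0 \<le> v \<Longrightarrow> F v \<le> K * v"
  using F_lipschitz[of v 0] F_0 by simp

lemma kappa_lt: "\<kappa> < B / c"
  using F_gt[of \<kappa>] F_bounded[of \<kappa>] \<kappa> c by (simp add: field_simps)

text \<open>The constant \<open>\<epsilon>\<close> is a strict subsolution.\<close>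

lemma start:
  assumes \<epsilon>: "0 < \<epsilon>" "\<epsilon> < \<kappa>"
  obtains X \<tau> where "delay_solution F c 0 X" "\<And>t. t \<le> 0 \<Longrightarrow> X t = \<epsilon>" "mono X" "X \<tau> = \<kappa>" "0 \<le> \<tau>"
    "\<And>t. X t \<le> B / c" "\<And>n. X (real n) \<le> \<epsilon> * (1 + K / c) ^ n"
proof -
  obtain X where X: "delay_solution F c 0 X" "\<And>s. s \<le> 0 \<Longrightarrow> X s = \<epsilon>"
    using delay_solution_exists[OF adm, of "\<lambda>_. \<epsilon>" c 0] by auto
  have const: "delay_solution (\<lambda>_. c * \<epsilon>) c 0 (\<lambda>_. \<epsilon>)"
    by (rule delay_solution_const) (use c in auto)
  have ge: "\<epsilon> \<le> X t" for t
  proof (cases "t \<le> 0")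
    case False
    show ?thesis
    proof (rule delay_solution_mono(1)[OF _ adm const X(1)])
      show "admissible (\<lambda>_. c * \<epsilon>)" by (auto simp: admissible_def bounded_iff)
      show "c * \<epsilon> \<le> F (X (s - 1))" if "\<epsilon> \<le> X (s - 1)" for s
        using monoD[OF mono_F that] F_gt[of \<epsilon>] \<epsilon> by simp
    qed (use X(2) False in auto)
  qed (use X in simp)
  \<comment> \<open>X never falls below its constant initial value, so it starts below each of its
    forward shifts and stays below.\<close>
  have shift: "X t \<le> X (t + h)" if "0 \<le> h" for t h
  proof (cases "t \<le> 0")
    case True then show ?thesis using X(2) ge by simp
  next
    case False
    have "delay_solution F c (0 - h) (\<lambda>t. X (t + h))" by (rule delay_solution_shift[OF X(1)])
    then have "delay_solution F c 0 (\<lambda>t. X (t + h))"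
      by (rule delay_solution_restrict[OF adm]) (use that in simp)
    then show ?thesis
      by (rule delay_solution_mono(1)[OF adm adm X(1)])
         (use X(2) ge False in \<open>auto intro: monoD[OF mono_F]\<close>)
  qed
  have mono: "mono X" using shift[of "_ - _"] by (intro monoI) (metis add.commute diff_add_cancel diff_ge_0_iff_ge shift)
  have cont: "continuous_on {0..t} X" for t by (rule continuous_on_subset[OF delay_solutionD(1)[OF X(1)]]) auto
  \<comment> \<open>Otherwise X increases to a supremum l with F (X s) \<le> c l, while F v - c v is
    at least some \<mu> > 0 on [\<epsilon>, \<kappa>]. Then X \<le> l - \<mu> / c, which is
    absurd.\<close>
  have "\<exists>t\<ge>0. \<kappa> \<le> X t"
  proof (rule ccontr)
    assume "\<not> ?thesis"
    then have lt: "X t < \<kappa>" if "0 \<le> t" for t using that by force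
    have lt: "X t < \<kappa>" for t using lt[of t] X(2)[of t] \<epsilon> by (cases "0 \<le> t") auto
    have "continuous_on {\<epsilon>..\<kappa>} (\<lambda>v. F v - c * v)"
      by (intro continuous_intros continuous_at_imp_continuous_on ballI F_cont)
    then obtain v0 where v0: "v0 \<in> {\<epsilon>..\<kappa>}" "\<And>v. v \<in> {\<epsilon>..\<kappa>} \<Longrightarrow> F v0 - c * v0 \<le> F v - c * v"
      using continuous_attains_inf[of "{\<epsilon>..\<kappa>}" "\<lambda>v. F v - c * v"] \<epsilon> by auto
    define \<mu> where "\<mu> = F v0 - c * v0"
    have \<mu>: "0 < \<mu>" using F_gt[of v0] v0(1) \<epsilon> by (simp add: \<mu>_def)
    define l where "l = Sup (range X)"
    have le_l: "X t \<le> l" for t unfolding l_def using lt by (intro cSup_upper) (auto intro!: bdd_aboveI[of _ \<kappa>] less_imp_le)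
    have step: "F (X s) / c \<le> l" if s: "0 \<le> s" for s
    proof -
      have "(\<lambda>n. F (X s) / c * (1 - exp (- c * real n))) \<longlonglongrightarrow> F (X s) / c * (1 - 0)"
        by (intro tendsto_intros) (use c in real_asymp)
      moreover have "F (X s) / c * (1 - exp (- c * real n)) \<le> l" for n
      proof -
        have "exp (- c * (s + 1 + real n - (s + 1))) * X (s + 1) + F (X s) / c * (1 - exp (- c * (s + 1 + real n - (s + 1)))) \<le> X (s + 1 + real n)"
          by (rule delay_solution_bounds(2)[OF adm X(1) c]) (use s in \<open>auto intro!: monoD[OF mono_F] monoD[OF mono]\<close>)
        moreover have "0 \<le> exp (- c * (s + 1 + real n - (s + 1))) * X (s + 1)" using ge[of "s + 1"] \<epsilon> by simp
        ultimately show ?thesis using le_l[of "s + 1 + real n"] by simp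
      qed
      ultimately show ?thesis using LIMSEQ_le_const2[of _ "F (X s) / c * (1 - 0)" l] by auto
    qed
    have "X s \<le> l - \<mu> / c" for s
    proof -
      have m: "X s \<le> X (max s 0)" by (rule monoD[OF mono]) simp
      have "\<mu> \<le> F (X (max s 0)) - c * X (max s 0)"
        unfolding \<mu>_def using v0(2)[of "X (max s 0)"] ge lt by (simp add: less_imp_le)
      moreover have "F (X (max s 0)) \<le> l * c" using step[of "max s 0"] c by (simp add: field_simps)
      ultimately have "c * X (max s 0) \<le> c * (l - \<mu> / c)" using c by (simp add: algebra_simps)
      then show ?thesis using m c by simp
    qed
    then have "l \<le> l - \<mu> / c" unfolding l_def by (intro cSup_least) auto
    then show False using \<mu> c by (simp add: field_simps)
  qed
  then obtain t where t: "0 \<le> t" "\<kappa> \<le> X t" by blast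
  then obtain \<tau> where \<tau>: "0 \<le> \<tau>" "X \<tau> = \<kappa>"
    using IVT'[of X 0 \<kappa> t] X(2)[of 0] \<epsilon> cont by auto
  have upper: "X t \<le> B / c" for t
  proof (cases "t \<le> 0")
    case True then show ?thesis using X(2) kappa_lt \<epsilon> by simp
  next
    case False
    let ?E = "exp (- c * (t - 0))"
    have "X t \<le> ?E * X 0 + B / c * (1 - ?E)"
      by (rule delay_solution_bounds(1)[OF adm X(1) c]) (use False F_bounded in \<open>auto simp: abs_le_iff\<close>)
    also have "\<dots> \<le> ?E * (B / c) + B / c * (1 - ?E)"
      using X(2)[of 0] kappa_lt \<epsilon> by (intro add_right_mono mult_left_mono) auto
    finally show ?thesis by (simp add: algebra_simps)
  qed
  \<comment> \<open>The growth per unit of time is at most the factor 1 + K / c; this later bounds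
    the time needed to reach \<kappa> from below.\<close>
  have "X (real n) \<le> \<epsilon> * (1 + K / c) ^ n" for n
  proof (induction n)
    case 0 then show ?case using X(2) by simp
  next
    case (Suc n)
    let ?b = "\<epsilon> * (1 + K / c) ^ n" and ?E = "exp (- c * (real (Suc n) - real n))"
    have b: "0 \<le> ?b" using \<epsilon> c K_nonneg by simp
    have "X (real (Suc n)) \<le> ?E * X (real n) + K * ?b / c * (1 - ?E)"
    proof (rule delay_solution_bounds(1)[OF adm X(1) c])
      show "F (X (s - 1)) \<le> K * ?b" if "real n \<le> s" "s \<le> real (Suc n)" for s
      proof -
        have "F (X (s - 1)) \<le> K * X (s - 1)" using ge[of "s - 1"] \<epsilon> by (intro F_le) simp
        also have "\<dots> \<le> K * ?b"
          using monoD[OF mono, of "s - 1" "real n"] that Suc K_nonneg by (intro mult_left_mono) auto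
        finally show ?thesis .
      qed
    qed auto
    also have "\<dots> \<le> 1 * ?b + K * ?b / c * 1"
      using Suc b c K_nonneg ge[of "real n"] \<epsilon> by (intro add_mono mult_mono) auto
    finally show ?case by (simp add: algebra_simps)
  qed
  then show ?thesis using that X mono \<tau> upper by blast
qed

text \<open>Solutions from ever smaller constants need ever longer to reach \<kappa>. Shifted so
  that they reach it at time 0, they are uniformly bounded and Lipschitz and live on longer and
  longer past intervals; a pointwise limit is an entire solution, and dominated convergence keeps
  the equation.\<close>

lemma backward_orbit:
  obtains y where "\<And>T. delay_solution F c T y" "mono y" "y 0 = \<kappa>" "\<And>t. 0 < y t" "(y \<longlongrightarrow> 0) at_bot"
proof -
  \<comment> \<open>So small that after n units the n-th solution is still at most \<kappa> /
    2.\<close>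
  define \<epsilon> where "\<epsilon> n = \<kappa> / (2 * (1 + K / c) ^ n)" for n :: nat
  have Kc: "1 \<le> 1 + K / c" using K_nonneg c by simp
  then have pw: "1 \<le> (1 + K / c) ^ n" for n by (rule one_le_power)
  have \<epsilon>: "0 < \<epsilon> n" "\<epsilon> n < \<kappa>" for n
  proof -
    have "0 < (1 + K / c) ^ n" using pw[of n] by linarith
    then show "0 < \<epsilon> n" using \<kappa> by (simp add: \<epsilon>_def)
    show "\<epsilon> n < \<kappa>" using \<kappa> pw[of n] by (simp add: \<epsilon>_def field_simps)
  qed
  have "\<exists>y. \<forall>n. delay_solution F c (- real n) (y n) \<and> mono (y n) \<and> y n 0 = \<kappa> \<and> (\<forall>t. 0 \<le> y n t \<and> y n t \<le> B / c)
      \<and> (\<forall>s t. \<bar>y n s - y n t\<bar> \<le> B * \<bar>s - t\<bar>)"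
  proof (rule choice, rule allI)
    fix n
    obtain X \<tau> where X: "delay_solution F c 0 X" "\<And>t. t \<le> 0 \<Longrightarrow> X t = \<epsilon> n" "mono X" "X \<tau> = \<kappa>" "0 \<le> \<tau>"
      "\<And>t. X t \<le> B / c" "\<And>m. X (real m) \<le> \<epsilon> n * (1 + K / c) ^ m"
      by (rule start[OF \<epsilon>[of n]]) (rule that)
    have "X (real n) \<le> \<kappa> / 2"
    proof -
      have "1 + K / c \<noteq> 0" using Kc by linarith
      then show ?thesis using X(7)[of n] by (simp add: \<epsilon>_def)
    qed
    then have \<tau>n: "real n \<le> \<tau>" using monoD[OF X(3), of \<tau> "real n"] X(4) \<kappa> by (cases "real n \<le> \<tau>") auto
    have ge: "0 \<le> X t" for t
      using monoD[OF X(3), of "min t 0" t] X(2)[of "min t 0"] \<epsilon>(1)[of n] by simp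
    have lip: "\<bar>X s - X t\<bar> \<le> B * \<bar>s - t\<bar>" if "s \<le> t" for s t
    proof -
      define s' where "s' = max s 0"
      define t' where "t' = max t 0"
      have "X t' - X s' \<le> B * (t' - s')"
      proof (rule DERIV_upper_bound)
        show "s' \<le> t'" using that by (simp add: s'_def t'_def)
        show "continuous_on {s'..t'} X"
          by (rule continuous_on_subset[OF delay_solutionD(1)[OF X(1)]]) (auto simp: s'_def)
        fix r assume r: "s' < r" "r < t'"
        show "(X has_real_derivative - c * X r + F (X (r - 1))) (at r)"
          by (rule delay_solution_deriv[OF adm X(1)]) (use r F_cont in \<open>auto simp: s'_def\<close>)
        have "0 \<le> c * X r" using c ge by simp
        then show "- c * X r + F (X (r - 1)) \<le> B" using F_bounded[of "X (r - 1)"] by (simp add: abs_le_iff)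
      qed
      moreover have "X s = X s'" using X(2)[of s] X(2)[of 0] by (simp add: s'_def max_def)
      moreover have "X t = X t'" using X(2)[of t] X(2)[of 0] by (simp add: t'_def max_def)
      moreover have "B * (t' - s') \<le> B * (t - s)"
        using that F_bounded[of 0] by (intro mult_left_mono) (auto simp: s'_def t'_def)
      ultimately show ?thesis using monoD[OF X(3) that] that by simp
    qed
    have "delay_solution F c (0 - \<tau>) (\<lambda>t. X (t + \<tau>))" by (rule delay_solution_shift[OF X(1)])
    then have "delay_solution F c (- real n) (\<lambda>t. X (t + \<tau>))"
      by (rule delay_solution_restrict[OF adm]) (use \<tau>n in simp)
    moreover have "mono (\<lambda>t. X (t + \<tau>))" using X(3) by (auto simp: mono_def)
    moreover have "\<bar>X (s + \<tau>) - X (t + \<tau>)\<bar> \<le> B * \<bar>s - t\<bar>" for s t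
      using lip[of "s + \<tau>" "t + \<tau>"] lip[of "t + \<tau>" "s + \<tau>"] by (cases "s \<le> t") (auto simp: abs_minus_commute)
    ultimately show "\<exists>y. delay_solution F c (- real n) y \<and> mono y \<and> y 0 = \<kappa> \<and> (\<forall>t. 0 \<le> y t \<and> y t \<le> B / c)
      \<and> (\<forall>s t. \<bar>y s - y t\<bar> \<le> B * \<bar>s - t\<bar>)"
      using X ge by (intro exI[of _ "\<lambda>t. X (t + \<tau>)"]) auto
  qed
  then obtain y where y: "\<And>n. delay_solution F c (- real n) (y n)" "\<And>n. mono (y n)" "\<And>n. y n 0 = \<kappa>"
    "\<And>n t. 0 \<le> y n t" "\<And>n t. y n t \<le> B / c" "\<And>n s t. \<bar>y n s - y n t\<bar> \<le> B * \<bar>s - t\<bar>" by blast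
  have "\<bar>y n t\<bar> \<le> B / c" for n t using y(4,5)[of n t] by simp
  then obtain r z where r: "strict_mono (r :: nat \<Rightarrow> nat)" and lim: "\<And>t. (\<lambda>n. y (r n) t) \<longlonglongrightarrow> z t"
    and zL: "\<And>s t. \<bar>z s - z t\<bar> \<le> B * \<bar>s - t\<bar>"
    using lipschitz_pointwise_subsequence[of y "B / c" B] y(6) by blast
  have B: "0 \<le> B" using F_bounded[of 0] by (simp add: order_trans[OF abs_ge_zero])
  have z_cont: "continuous_on S z" for S
    by (rule continuous_on_subset[OF lipschitz_on_continuous_on[of B UNIV]])
       (use zL B in \<open>auto simp: lipschitz_on_def dist_real_def\<close>)
  have z_mono: "mono z"
  proof (rule monoI)
    fix s t :: real assume "s \<le> t"
    then show "z s \<le> z t" by (intro LIMSEQ_le[OF lim lim]) (auto intro: monoD[OF y(2)])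
  qed
  have z0: "z 0 = \<kappa>" using LIMSEQ_unique[OF lim[of 0]] y(3) by simp
  have z_nn: "0 \<le> z t" for t by (rule LIMSEQ_le_const[OF lim]) (use y(4) in blast)
  have z_sol: "delay_solution F c T z" for T
    unfolding delay_solution_def
  proof (intro conjI allI impI z_cont)
    fix t assume t: "T \<le> t"
    have "(\<lambda>n. integral {T..t} (\<lambda>s. exp (c * s) * F (y (r n) (s - 1)))) \<longlonglongrightarrow> integral {T..t} (\<lambda>s. exp (c * s) * F (z (s - 1)))"
    proof (rule dominated_convergence(2))
      show "(\<lambda>s. exp (c * s) * F (y (r n) (s - 1))) integrable_on {T..t}" for n
      proof (rule delay_integrable[OF adm _ order_refl])
        show "continuous_on {T - 1..} (y (r n))"
          by (rule continuous_on_subset[OF lipschitz_on_continuous_on[of B UNIV]])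
             (use y(6) B in \<open>auto simp: lipschitz_on_def dist_real_def\<close>)
      qed
      show "(\<lambda>s. exp (c * s) * B) integrable_on {T..t}" by (intro integrable_continuous_real continuous_intros)
      show "norm (exp (c * s) * F (y (r n) (s - 1))) \<le> exp (c * s) * B" for n s
        using F_bounded by (simp add: abs_mult)
      show "(\<lambda>n. exp (c * s) * F (y (r n) (s - 1))) \<longlonglongrightarrow> exp (c * s) * F (z (s - 1))" for s
        by (intro tendsto_intros isCont_tendsto_compose[OF F_cont] lim)
    qed
    then have rhs_lim: "(\<lambda>n. exp (c * T) * y (r n) T + integral {T..t} (\<lambda>s. exp (c * s) * F (y (r n) (s - 1))))
        \<longlonglongrightarrow> exp (c * T) * z T + integral {T..t} (\<lambda>s. exp (c * s) * F (z (s - 1)))"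
      by (intro tendsto_intros lim)
    have lhs_lim: "(\<lambda>n. exp (c * t) * y (r n) t) \<longlonglongrightarrow> exp (c * t) * z t" by (intro tendsto_intros lim)
    have eq: "\<forall>\<^sub>F n in sequentially. exp (c * T) * y (r n) T + integral {T..t} (\<lambda>s. exp (c * s) * F (y (r n) (s - 1)))
        = exp (c * t) * y (r n) t"
    proof -
      obtain N :: nat where N: "- T \<le> real N" using real_arch_simple by blast
      show ?thesis
      proof (rule eventually_sequentiallyI[of N])
        fix n assume "N \<le> n"
        then have "N \<le> r n" using seq_suble[OF r, of n] by simp
        then have "- real (r n) \<le> T" using N by linarith
        then show "exp (c * T) * y (r n) T + integral {T..t} (\<lambda>s. exp (c * s) * F (y (r n) (s - 1)))
            = exp (c * t) * y (r n) t"
          using delay_solution_from[OF adm y(1)[of "r n"] _ t] by simp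
      qed
    qed
    show "exp (c * t) * z t = exp (c * T) * z T + integral {T..t} (\<lambda>s. exp (c * s) * F (z (s - 1)))"
      by (rule LIMSEQ_unique[OF lhs_lim Lim_transform_eventually[OF rhs_lim eq]])
  qed
  \<comment> \<open>A zero would by monotonicity extend to the whole past, and forward uniqueness
    would then give z 0 = 0 instead of \<kappa>.\<close>
  have z_pos: "0 < z t" for t
  proof (rule ccontr)
    assume "\<not> 0 < z t"
    then have zero: "z s = 0" if "s \<le> t" for s
      using monoD[OF z_mono that] z_nn[of s] z_nn[of t] by simp
    have "z 0 = 0"
    proof (cases "0 \<le> t")
      case False
      show ?thesis
        by (rule delay_solution_unique[OF adm z_sol[of t] delay_solution_const[of c F 0 t]])
           (use c F_0 zero False in auto)
    qed (rule zero)
    then show False using z0 \<kappa> by simp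
  qed
  \<comment> \<open>The limit at minus infinity. If it were positive, the feedback would exceed F l
    throughout, so F l \<le> c l, against \<open>F_gt\<close>.\<close>
  define l where "l = Inf (range z)"
  have bdd: "bdd_below (range z)" using z_nn by (auto intro!: bdd_belowI[of _ 0])
  have l_le: "l \<le> z t" for t unfolding l_def using bdd by (intro cInf_lower) auto
  have l_nn: "0 \<le> l" unfolding l_def using z_nn by (intro cInf_greatest) auto
  have "l = 0"
  proof (rule ccontr)
    assume "l \<noteq> 0"
    then have l: "0 < l" "l \<le> \<kappa>" using l_nn l_le[of 0] z0 by auto
    have "F l / c \<le> z t" for t
    proof -
      have "(\<lambda>n. F l / c * (1 - exp (- c * real n))) \<longlonglongrightarrow> F l / c * (1 - 0)"
        by (intro tendsto_intros) (use c in real_asymp)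
      moreover have "F l / c * (1 - exp (- c * real n)) \<le> z t" for n
      proof -
        have "exp (- c * (t - (t - real n))) * z (t - real n) + F l / c * (1 - exp (- c * (t - (t - real n)))) \<le> z t"
          by (rule delay_solution_bounds(2)[OF adm z_sol[of "t - real n"] c]) (auto intro!: monoD[OF mono_F] l_le)
        moreover have "0 \<le> exp (- c * (t - (t - real n))) * z (t - real n)" using z_nn by simp
        ultimately show ?thesis by simp
      qed
      ultimately show ?thesis using LIMSEQ_le_const2[of _ "F l / c * (1 - 0)" "z t"] by auto
    qed
    then have "F l / c \<le> l" unfolding l_def by (intro cInf_greatest) auto
    then show False using F_gt[OF l] c by (simp add: field_simps)
  qed
  have "(z \<longlongrightarrow> 0) at_bot"
  proof (rule tendstoI)
    fix e :: real assume "0 < e"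
    then have "Inf (range z) < e" using \<open>l = 0\<close> by (simp add: l_def)
    then obtain s where s: "z s < e" using cInf_less_iff[OF _ bdd, of e] by auto
    show "\<forall>\<^sub>F t in at_bot. dist (z t) 0 < e"
      using eventually_le_at_bot[of s]
    proof eventually_elim
      case (elim t)
      then show ?case using monoD[OF z_mono elim] s z_nn[of t] by simp
    qed
  qed
  then show ?thesis using that z_sol z_mono z0 z_pos by blast
qed

end

section \<open>Asymptotic shape of the leaving orbits\<close>

context linear_delay
begin

interpretation coord: bounded_linear coord by (rule bounded_linear_coord)

text \<open>h = exp (- \<Lambda> t) v obeys the relaxation equation with a perturbation proportional
  to A - a, small far back. Since exp (c t) v does not decrease, exp (c + \<Lambda>) is a Harnack
  constant, and \<open>relaxation_positive\<close> makes h nearly constant over unit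
  intervals.\<close>

lemma positive_ratio:
  assumes cont: "continuous_on {..T} v" and pos: "\<And>t. t \<le> T \<Longrightarrow> 0 < v t"
    and der: "\<And>t. t < T \<Longrightarrow> (v has_real_derivative - c * v t + A t * v (t - 1)) (at t)"
    and A: "(A \<longlongrightarrow> a) at_bot" and \<delta>: "0 < \<delta>"
  shows "\<forall>\<^sub>F t in at_bot. \<forall>s\<in>{-1..0}. \<bar>v (t + s) - exp (\<Lambda> * s) * v t\<bar> \<le> \<delta> * v t"
proof -
  define K where "K = exp (c + \<Lambda>)"
  have K: "1 \<le> K" using c_pos' lambda0_pos by (simp add: K_def)
  obtain \<epsilon> where \<epsilon>: "0 < \<epsilon>" and rel: "\<And>h e T t s. relaxation b e T h \<Longrightarrow> (\<And>t. t \<le> T \<Longrightarrow> 0 < h t) \<Longrightarrow>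
      (\<And>t s. t \<le> T \<Longrightarrow> t - 1 \<le> s \<Longrightarrow> s \<le> t \<Longrightarrow> h s \<le> K * h t) \<Longrightarrow>
      (\<And>t. t < T \<Longrightarrow> \<bar>e t\<bar> \<le> \<epsilon> * h (t - 1)) \<Longrightarrow> t \<le> T \<Longrightarrow> t - 1 \<le> s \<Longrightarrow> s \<le> t \<Longrightarrow>
      \<bar>h s - h t\<bar> \<le> \<delta> * h t"
    using relaxation_positive[OF b_pos K \<delta>] by blast
  \<comment> \<open>The bound a keeps A positive, for the monotonicity of exp (c t) v; the bound
    \<epsilon> exp \<Lambda> compensates the factor exp (- \<Lambda>) in the perturbation.\<close>
  have "\<forall>\<^sub>F t in at_bot. dist (A t) a < min a (\<epsilon> * exp \<Lambda>)"
    using a_pos \<epsilon> by (intro tendstoD[OF A]) auto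
  then have "\<forall>\<^sub>F t in at_bot. dist (A t) a < min a (\<epsilon> * exp \<Lambda>) \<and> t \<le> T"
    using eventually_le_at_bot[of T] by eventually_elim simp
  then obtain T1 where T1: "\<And>t. t \<le> T1 \<Longrightarrow> \<bar>A t - a\<bar> < min a (\<epsilon> * exp \<Lambda>) \<and> t \<le> T"
    by (auto simp: eventually_at_bot_linorder dist_real_def)
  have T1T: "T1 \<le> T" using T1[of T1] by simp
  define h where "h t = exp (- \<Lambda> * t) * v t" for t
  define e where "e t = (A t - a) * exp (- \<Lambda>) * h (t - 1)" for t
  have hpos: "0 < h t" if "t \<le> T1" for t using pos T1T that by (simp add: h_def)
  have rx: "relaxation b e T1 h"
    unfolding relaxation_def
  proof (intro conjI allI impI)
    show "continuous_on {..T1} h"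
      unfolding h_def using T1T by (intro continuous_intros continuous_on_subset[OF cont]) auto
    fix t assume t: "t < T1"
    have "(h has_real_derivative exp (- \<Lambda> * t) * (- c * v t + A t * v (t - 1)) - \<Lambda> * exp (- \<Lambda> * t) * v t) (at t)"
      unfolding h_def using t T1T by (auto intro!: derivative_eq_intros der)
    moreover have "exp (- \<Lambda> * t) * (- c * v t + A t * v (t - 1)) - \<Lambda> * exp (- \<Lambda> * t) * v t
        = b * (h (t - 1) - h t) + e t"
    proof -
      have "exp (- \<Lambda> * t) * v (t - 1) = exp (- \<Lambda>) * h (t - 1)"
        unfolding h_def mult.assoc[symmetric] exp_add[symmetric] by (simp add: algebra_simps)
      then have "exp (- \<Lambda> * t) * (- c * v t + A t * v (t - 1)) - \<Lambda> * exp (- \<Lambda> * t) * v t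
          = A t * (exp (- \<Lambda>) * h (t - 1)) - b * h t"
        by (simp add: h_def algebra_simps)
      also have "\<dots> = a * exp (- \<Lambda>) * h (t - 1) - b * h t + e t" by (simp add: e_def algebra_simps)
      finally show ?thesis unfolding lambda0_eq by (simp add: algebra_simps)
    qed
    ultimately show "(h has_real_derivative b * (h (t - 1) - h t) + e t) (at t)" by (simp only:)
  qed
  have Kh: "h s \<le> K * h t" if t: "t \<le> T1" "t - 1 \<le> s" "s \<le> t" for t s
  proof -
    have "0 * (t - s) \<le> exp (c * t) * v t - exp (c * s) * v s"
    proof (rule DERIV_lower_bound[OF t(3)])
      show "continuous_on {s..t} (\<lambda>t. exp (c * t) * v t)"
        using t T1T by (intro continuous_intros continuous_on_subset[OF cont]) auto
      fix r assume r: "s < r" "r < t"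
      show "((\<lambda>t. exp (c * t) * v t) has_real_derivative exp (c * r) * (A r * v (r - 1))) (at r)"
        using r t T1T by (auto intro!: derivative_eq_intros der simp: algebra_simps)
      show "0 \<le> exp (c * r) * (A r * v (r - 1))"
        using T1[of r] pos[of "r - 1"] r t T1T by (auto simp: zero_le_mult_iff)
    qed
    then have "exp (c * s) * v s \<le> exp (c * t) * v t" by simp
    then have "exp (- (c + \<Lambda>) * s) * (exp (c * s) * v s) \<le> exp (- (c + \<Lambda>) * s) * (exp (c * t) * v t)" by simp
    then have "h s \<le> exp ((c + \<Lambda>) * (t - s)) * h t"
      unfolding h_def mult.assoc[symmetric] exp_add[symmetric] by (simp add: algebra_simps)
    also have "\<dots> \<le> K * h t"
    proof (rule mult_right_mono)
      have "(c + \<Lambda>) * (t - s) \<le> (c + \<Lambda>) * 1" using t c_pos' lambda0_pos by (intro mult_left_mono) auto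
      then show "exp ((c + \<Lambda>) * (t - s)) \<le> K" by (simp add: K_def)
    qed (use hpos[OF t(1)] in simp)
    finally show ?thesis .
  qed
  have e_bound: "\<bar>e t\<bar> \<le> \<epsilon> * h (t - 1)" if t: "t < T1" for t
  proof -
    have "\<bar>e t\<bar> = \<bar>A t - a\<bar> * exp (- \<Lambda>) * h (t - 1)" using hpos[of "t - 1"] t by (simp add: e_def abs_mult)
    also have "\<dots> \<le> (\<epsilon> * exp \<Lambda>) * exp (- \<Lambda>) * h (t - 1)"
      using T1[of t] t hpos[of "t - 1"] by (intro mult_right_mono) auto
    also have "\<dots> = \<epsilon> * h (t - 1)" by (simp add: mult.assoc[symmetric] exp_minus)
    finally show ?thesis .
  qed
  show ?thesis
    using eventually_le_at_bot[of T1]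
  proof eventually_elim
    case (elim t)
    show ?case
    proof
      fix s :: real assume s: "s \<in> {-1..0}"
      have "\<bar>h (t + s) - h t\<bar> \<le> \<delta> * h t"
        by (rule rel[OF rx hpos Kh e_bound elim]) (use s in auto)
      then have "exp (\<Lambda> * (t + s)) * \<bar>h (t + s) - h t\<bar> \<le> exp (\<Lambda> * (t + s)) * (\<delta> * h t)" by simp
      moreover have "exp (\<Lambda> * (t + s)) * \<bar>h (t + s) - h t\<bar> = \<bar>v (t + s) - exp (\<Lambda> * s) * v t\<bar>"
      proof -
        have "exp (\<Lambda> * (t + s)) * (h (t + s) - h t) = v (t + s) - exp (\<Lambda> * s) * v t"
          unfolding h_def right_diff_distrib mult.assoc[symmetric] exp_add[symmetric] by (simp add: algebra_simps)
        then show ?thesis by (metis abs_exp_cancel abs_mult)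
      qed
      moreover have "exp (\<Lambda> * (t + s)) * (\<delta> * h t) = exp (\<Lambda> * s) * (\<delta> * v t)"
      proof -
        have "exp (\<Lambda> * (t + s)) * h t = exp (\<Lambda> * s) * v t"
          unfolding h_def mult.assoc[symmetric] exp_add[symmetric] by (simp add: algebra_simps)
        then show ?thesis by (metis mult.left_commute)
      qed
      moreover have "exp (\<Lambda> * s) * (\<delta> * v t) \<le> 1 * (\<delta> * v t)"
        using s lambda0_pos \<delta> pos[of t] elim T1T by (intro mult_right_mono) (auto simp: mult_nonneg_nonpos)
      ultimately show "\<bar>v (t + s) - exp (\<Lambda> * s) * v t\<bar> \<le> \<delta> * v t" by simp
    qed
  qed
qed

lemma seg_ratio_limit:
  assumes cont: "continuous_on UNIV v" and pos: "\<And>t. t \<le> T \<Longrightarrow> 0 < v t"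
    and der: "\<And>t. t < T \<Longrightarrow> (v has_real_derivative - c * v t + A t * v (t - 1)) (at t)"
    and A: "(A \<longlongrightarrow> a) at_bot"
  shows "((\<lambda>t. (1 / v t) *\<^sub>R seg v t) \<longlongrightarrow> chi0 c a) at_bot"
proof (rule tendstoI)
  fix \<epsilon> :: real assume \<epsilon>: "0 < \<epsilon>"
  have "\<forall>\<^sub>F t in at_bot. \<forall>s\<in>{-1..0}. \<bar>v (t + s) - exp (\<Lambda> * s) * v t\<bar> \<le> \<epsilon> / 2 * v t"
    by (rule positive_ratio[OF continuous_on_subset[OF cont] pos der A]) (use \<epsilon> in auto)
  then show "\<forall>\<^sub>F t in at_bot. dist ((1 / v t) *\<^sub>R seg v t) (chi0 c a) < \<epsilon>"
    using eventually_le_at_bot[of T]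
  proof eventually_elim
    case (elim t)
    have vt: "0 < v t" by (rule pos[OF elim(2)])
    have "norm ((1 / v t) *\<^sub>R seg v t - chi0 c a) \<le> \<epsilon> / 2"
    proof (rule norm_bound)
      fix s
      let ?s = "of_hist s"
      have eq: "((1 / v t) *\<^sub>R seg v t - chi0 c a) s = (v (t + ?s) - exp (\<Lambda> * ?s) * v t) / v t"
        using vt by (simp add: minus_bcontfun.rep_eq scaleR_bcontfun.rep_eq chi0_apply
            seg_apply[OF continuous_on_subset[OF cont]] diff_divide_distrib)
      have "\<bar>v (t + ?s) - exp (\<Lambda> * ?s) * v t\<bar> \<le> \<epsilon> / 2 * v t" using elim(1) of_hist_bounds[of s] by simp
      then show "norm (((1 / v t) *\<^sub>R seg v t - chi0 c a) s) \<le> \<epsilon> / 2"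
        unfolding eq using vt by (simp add: abs_divide field_simps)
    qed
    then show ?case using \<epsilon> by (simp add: dist_norm)
  qed
qed

end

text \<open>Uniform continuity of v on a compact interval makes the difference quotients converge
  uniformly over the history interval.\<close>

lemma seg_has_vector_derivative:
  fixes y v :: "real \<Rightarrow> real"
  assumes der: "\<And>t. (y has_real_derivative v t) (at t)" and cont: "continuous_on UNIV v"
  shows "(seg y has_vector_derivative seg v t) (at t)"
  unfolding has_vector_derivative_def has_derivative_at_alt
proof (intro conjI allI impI)
  show "bounded_linear (\<lambda>h. h *\<^sub>R seg v t)" by (rule bounded_linear_scaleR_left)
  fix e :: real assume e: "0 < e"
  have y_cont: "continuous_on S y" for S
    using der by (auto intro!: continuous_at_imp_continuous_on DERIV_isCont)
  have "uniformly_continuous_on {t - 2..t + 1} v"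
    by (intro compact_uniformly_continuous continuous_on_subset[OF cont]) auto
  then obtain \<delta> where \<delta>: "0 < \<delta>"
    "\<And>p q. p \<in> {t - 2..t + 1} \<Longrightarrow> q \<in> {t - 2..t + 1} \<Longrightarrow> dist p q < \<delta> \<Longrightarrow> dist (v p) (v q) < e"
    unfolding uniformly_continuous_on_def using e by metis
  show "\<exists>\<delta>>0. \<forall>s. norm (s - t) < \<delta> \<longrightarrow> norm (seg y s - seg y t - (s - t) *\<^sub>R seg v t) \<le> e * norm (s - t)"
  proof (intro exI[of _ "min \<delta> 1"] conjI allI impI)
    fix s assume "norm (s - t) < min \<delta> 1"
    then have s: "\<bar>s - t\<bar> < \<delta>" "\<bar>s - t\<bar> < 1" by auto
    show "norm (seg y s - seg y t - (s - t) *\<^sub>R seg v t) \<le> e * norm (s - t)"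
    proof (rule norm_bound)
      fix r
      let ?r = "of_hist r"
      have "norm ((\<lambda>p. y (p + ?r) - p * v (t + ?r)) s - (\<lambda>p. y (p + ?r) - p * v (t + ?r)) t) \<le> e * norm (s - t)"
      proof (rule field_differentiable_bound[where S = "closed_segment s t" and f' = "\<lambda>p. v (p + ?r) - v (t + ?r)"])
        fix p assume p: "p \<in> closed_segment s t"
        have 1: "((\<lambda>p. y (p + ?r)) has_real_derivative v (p + ?r)) (at p)"
          using DERIV_shift[of y "v (p + ?r)" p ?r] der by simp
        have 2: "((\<lambda>p. p * v (t + ?r)) has_real_derivative v (t + ?r)) (at p)"
          by (rule DERIV_cmult_right[OF DERIV_ident, simplified])
        show "((\<lambda>p. y (p + ?r) - p * v (t + ?r)) has_field_derivative v (p + ?r) - v (t + ?r)) (at p within closed_segment s t)"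
          by (rule has_field_derivative_at_within[OF DERIV_diff[OF 1 2]])
        have "\<bar>p - t\<bar> \<le> \<bar>s - t\<bar>" using p by (auto simp: closed_segment_eq_real_ivl split: if_splits)
        then have "p + ?r \<in> {t - 2..t + 1}" "t + ?r \<in> {t - 2..t + 1}" "dist (p + ?r) (t + ?r) < \<delta>"
          using s of_hist_bounds[of r] by (auto simp: dist_real_def abs_le_iff)
        from \<delta>(2)[OF this] show "norm (v (p + ?r) - v (t + ?r)) \<le> e" by (simp add: dist_real_def)
      qed auto
      then show "norm ((seg y s - seg y t - (s - t) *\<^sub>R seg v t) r) \<le> e * norm (s - t)"
        by (simp add: minus_bcontfun.rep_eq scaleR_bcontfun.rep_eq seg_apply[OF y_cont]
            seg_apply[OF continuous_on_subset[OF cont]] algebra_simps)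
    qed
  qed (use \<delta> in auto)
qed

section \<open>Parametrization of an orbit by its leading coordinate\<close>

context linear_delay
begin

interpretation coord: bounded_linear coord by (rule bounded_linear_coord)

text \<open>The coordinate R of the orbit increases, since its derivative is the coordinate of the
  positive velocity segments, so time can be replaced by the coordinate through the inverse S.
  Segments of y and of v are both asymptotically proportional to \<chi>0; normalizing each by its
  own coordinate gives the tangent \<chi>0 at the endpoint.\<close>

lemma half_curve:
  fixes y v :: "real \<Rightarrow> real" and T :: real
  defines "R \<equiv> \<lambda>t. coord (seg y t)" and "R' \<equiv> \<lambda>t. coord (seg v t)"
  assumes der: "\<And>t. (y has_real_derivative v t) (at t)" and v_cont: "continuous_on UNIV v"
    and y_pos: "\<And>t. t \<le> T \<Longrightarrow> 0 < y t" and v_pos: "\<And>t. t \<le> T \<Longrightarrow> 0 < v t"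
    and y_lim: "(y \<longlongrightarrow> 0) at_bot"
    and y_ratio: "((\<lambda>t. (1 / y t) *\<^sub>R seg y t) \<longlongrightarrow> chi0 c a) at_bot"
    and v_ratio: "((\<lambda>t. (1 / v t) *\<^sub>R seg v t) \<longlongrightarrow> chi0 c a) at_bot"
  obtains S where
    "\<And>t. t < T \<Longrightarrow> 0 < R t \<and> R t < R T \<and> S (R t) = t"
    "\<And>r. 0 < r \<Longrightarrow> r < R T \<Longrightarrow> S r < T \<and> R (S r) = r"
    "\<And>r. 0 < r \<Longrightarrow> r < R T \<Longrightarrow>
      ((\<lambda>r. seg y (S r)) has_vector_derivative (1 / R' (S r)) *\<^sub>R seg v (S r)) (at r)"
    "continuous_on {0<..<R T} (\<lambda>r. (1 / R' (S r)) *\<^sub>R seg v (S r))"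
    "((\<lambda>r. (1 / R' (S r)) *\<^sub>R seg v (S r)) \<longlongrightarrow> chi0 c a) (at_right 0)"
    "((\<lambda>r. (1 / r) *\<^sub>R seg y (S r)) \<longlongrightarrow> chi0 c a) (at_right 0)"
    "filterlim S at_bot (at_right 0)" "0 < R T"
proof -
  have y_cont: "continuous_on S y" for S
    using der by (auto intro!: continuous_at_imp_continuous_on DERIV_isCont)
  have v_cont': "continuous_on S v" for S by (rule continuous_on_subset[OF v_cont]) simp
  have R_pos: "0 < R t" and R'_pos: "0 < R' t" if "t \<le> T" for t
  proof -
    have "t + of_hist s \<le> T" for s using of_hist_bounds[of s] that by linarith
    then show "0 < R t" "0 < R' t"
      unfolding R_def R'_def by (auto intro!: coord_pos y_pos v_pos simp: seg_apply[OF y_cont] seg_apply[OF v_cont'])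
  qed
  have R_der: "(R has_real_derivative R' t) (at t)" for t
    unfolding R_def R'_def has_real_derivative_iff_has_vector_derivative
    by (rule coord.has_vector_derivative[OF seg_has_vector_derivative[OF der v_cont]])
  have R_cont: "continuous_on S R" for S
    using R_der by (auto intro!: continuous_at_imp_continuous_on DERIV_isCont)
  have R_less: "R s < R t" if "s < t" "t \<le> T" for s t
  proof (rule DERIV_pos_imp_increasing_open[where f = R and a = s and b = t])
    show "\<exists>l. (R has_real_derivative l) (at r) \<and> 0 < l" if "s < r" "r < t" for r
      using R_der[of r] R'_pos[of r] that \<open>t \<le> T\<close> by auto
  qed (use that R_cont in auto)
  have R_lim: "(R \<longlongrightarrow> 0) at_bot"
  proof -
    have "((\<lambda>t. coord (y t *\<^sub>R ((1 / y t) *\<^sub>R seg y t))) \<longlongrightarrow> coord (0 *\<^sub>R chi0 c a)) at_bot"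
      by (intro coord.tendsto tendsto_scaleR y_lim y_ratio)
    then have "((\<lambda>t. coord (y t *\<^sub>R ((1 / y t) *\<^sub>R seg y t))) \<longlongrightarrow> 0) at_bot" by (simp add: coord.zero)
    moreover have "\<forall>\<^sub>F t in at_bot. coord (y t *\<^sub>R ((1 / y t) *\<^sub>R seg y t)) = R t"
      using eventually_le_at_bot[of T]
    proof eventually_elim
      case (elim t) then show ?case using y_pos[OF elim] by (simp add: R_def)
    qed
    ultimately show ?thesis by (rule Lim_transform_eventually)
  qed
  define S where "S = inv_into {..<T} R"
  have inj: "inj_on R {..<T}"
  proof (rule inj_onI)
    fix s t assume "s \<in> {..<T}" "t \<in> {..<T}" "R s = R t"
    then show "s = t" using R_less[of s t] R_less[of t s] by (cases s t rule: linorder_cases) auto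
  qed
  have onto: "\<exists>t<T. R t = r" if r: "0 < r" "r < R T" for r
  proof -
    have "\<forall>\<^sub>F t in at_bot. R t < r" using R_lim r(1) by (rule order_tendstoD)
    then have "\<forall>\<^sub>F t in at_bot. R t < r \<and> t \<le> T" using eventually_le_at_bot[of T] by eventually_elim simp
    then obtain s where s: "R s < r" "s \<le> T" by (auto simp: eventually_at_bot_linorder)
    then obtain t where "s \<le> t" "t \<le> T" "R t = r" using IVT'[of R s r T] r R_cont by (auto intro: less_imp_le)
    then have "t < T" using r by (cases "t = T") auto
    then show ?thesis using \<open>R t = r\<close> by blast
  qed
  have SR: "S (R t) = t" if "t < T" for t unfolding S_def using inj that by simp
  have S: "S r < T" "R (S r) = r" if r: "0 < r" "r < R T" for r
  proof -
    obtain t where "t < T" "R t = r" using onto[OF r] by blast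
    then show "S r < T" "R (S r) = r" using SR[of t] by auto
  qed
  have S_cont: "isCont S r" if r: "0 < r" "r < R T" for r
  proof -
    have "isCont S (R (S r))"
    proof (rule isCont_inverse_function[where f = R and g = S and x = "S r" and d = "(T - S r) / 2"])
      show "0 < (T - S r) / 2" using S(1)[OF r] by simp
      show "S (R z) = z" if "\<bar>z - S r\<bar> \<le> (T - S r) / 2" for z
      proof (rule SR)
        have "0 < T - S r" using S(1)[OF r] by simp
        then have "(T - S r) / 2 < T - S r" by simp
        with abs_le_D1[OF that] have "z - S r < T - S r" by (rule le_less_trans)
        then show "z < T" by simp
      qed
      show "isCont R z" for z using R_der by (rule DERIV_isCont)
    qed
    then show ?thesis using S(2)[OF r] by simp
  qed
  have S_der: "(S has_real_derivative 1 / R' (S r)) (at r)" if r: "0 < r" "r < R T" for r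
  proof -
    have "(S has_real_derivative inverse (R' (S r))) (at r)"
    proof (rule DERIV_inverse_function[where f = R])
      show "(R has_real_derivative R' (S r)) (at (S r))" by (rule R_der)
      show "R' (S r) \<noteq> 0" using R'_pos[of "S r"] S(1)[OF r] by simp
      show "R (S q) = q" if "0 < q" "q < R T" for q using S(2) that by simp
    qed (use r S_cont in auto)
    then show ?thesis by (simp add: inverse_eq_divide)
  qed
  have S_bot: "filterlim S at_bot (at_right 0)"
    unfolding filterlim_at_bot
  proof
    fix Z
    define Z' where "Z' = min Z (T - 1)"
    have "0 < R Z'" "R Z' < R T" using R_pos[of Z'] R_less[of Z' T] by (auto simp: Z'_def)
    have "\<forall>\<^sub>F r in at_right 0. 0 < r \<and> r < R Z'"
      using \<open>0 < R Z'\<close> by (auto simp: eventually_at_right intro!: exI[of _ "R Z'"])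
    then show "\<forall>\<^sub>F r in at_right 0. S r \<le> Z"
    proof eventually_elim
      case (elim r)
      have "S r < T" "R (S r) = r" using S[of r] elim \<open>R Z' < R T\<close> by auto
      then have "S r \<le> Z'" using R_less[of Z' "S r"] elim by (cases "S r \<le> Z'") auto
      then show ?case by (simp add: Z'_def)
    qed
  qed
  have normalized: "((\<lambda>t. (1 / coord (seg u t)) *\<^sub>R seg u t) \<longlongrightarrow> chi0 c a) at_bot"
    if u: "((\<lambda>t. (1 / u t) *\<^sub>R seg u t) \<longlongrightarrow> chi0 c a) at_bot" and u_pos: "\<And>t. t \<le> T \<Longrightarrow> 0 < u t" for u :: "real \<Rightarrow> real"
  proof -
    have "((\<lambda>t. (1 / coord ((1 / u t) *\<^sub>R seg u t)) *\<^sub>R ((1 / u t) *\<^sub>R seg u t)) \<longlongrightarrow> (1 / coord (chi0 c a)) *\<^sub>R chi0 c a) at_bot"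
      by (intro tendsto_intros u coord.tendsto) (simp add: coord_chi0)
    moreover have "\<forall>\<^sub>F t in at_bot. (1 / coord ((1 / u t) *\<^sub>R seg u t)) *\<^sub>R ((1 / u t) *\<^sub>R seg u t) = (1 / coord (seg u t)) *\<^sub>R seg u t"
      using eventually_le_at_bot[of T]
    proof eventually_elim
      case (elim t) then show ?case using u_pos[OF elim] by (simp add: coord.scaleR)
    qed
    ultimately show ?thesis by (simp add: coord_chi0 Lim_transform_eventually)
  qed
  show ?thesis
  proof (rule that[of S])
    show "0 < R t \<and> R t < R T \<and> S (R t) = t" if "t < T" for t using R_pos R_less SR that by auto
    show "S r < T \<and> R (S r) = r" if "0 < r" "r < R T" for r using S that by simp
    show "((\<lambda>r. seg y (S r)) has_vector_derivative (1 / R' (S r)) *\<^sub>R seg v (S r)) (at r)" if r: "0 < r" "r < R T" for r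
      using vector_diff_chain_at[of S "1 / R' (S r)" r "seg y" "seg v (S r)"] S_der[OF r] seg_has_vector_derivative[OF der v_cont]
      by (simp add: o_def has_real_derivative_iff_has_vector_derivative)
    have Sc: "continuous_on {0<..<R T} S" using S_cont by (auto intro: continuous_at_imp_continuous_on)
    have vS: "continuous_on {0<..<R T} (\<lambda>r. seg v (S r))"
      by (rule continuous_on_compose2[OF continuous_on_seg_UNIV[OF v_cont] Sc]) simp
    have nz: "coord (seg v (S r)) \<noteq> 0" if "r \<in> {0<..<R T}" for r
      using R'_pos[of "S r"] S(1)[of r] that unfolding R'_def by auto
    show "continuous_on {0<..<R T} (\<lambda>r. (1 / R' (S r)) *\<^sub>R seg v (S r))"
      unfolding R'_def by (intro continuous_intros vS coord.continuous_on ballI nz)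
    show "((\<lambda>r. (1 / R' (S r)) *\<^sub>R seg v (S r)) \<longlongrightarrow> chi0 c a) (at_right 0)"
      unfolding R'_def by (rule filterlim_compose[OF normalized[OF v_ratio v_pos] S_bot])
    have "((\<lambda>r. (1 / coord (seg y (S r))) *\<^sub>R seg y (S r)) \<longlongrightarrow> chi0 c a) (at_right 0)"
      by (rule filterlim_compose[OF normalized[OF y_ratio y_pos] S_bot])
    moreover have "\<forall>\<^sub>F r in at_right 0. (1 / coord (seg y (S r))) *\<^sub>R seg y (S r) = (1 / r) *\<^sub>R seg y (S r)"
    proof -
      have "\<forall>\<^sub>F r in at_right 0. 0 < r \<and> r < R T"
        using R_pos[of T] by (auto simp: eventually_at_right intro!: exI[of _ "R T"])
      then show ?thesis by eventually_elim (use S(2) in \<open>simp add: R_def\<close>)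
    qed
    ultimately show "((\<lambda>r. (1 / r) *\<^sub>R seg y (S r)) \<longlongrightarrow> chi0 c a) (at_right 0)" by (rule Lim_transform_eventually)
    show "filterlim S at_bot (at_right 0)" by (rule S_bot)
    show "0 < R T" using R_pos[of T] by simp
  qed
qed

end

section \<open>The orbits leaving the stationary point\<close>

context pulse_super
begin

interpretation coord: bounded_linear lin.coord by (rule lin.bounded_linear_coord)

definition \<kappa>\<^sub>0 :: real where "\<kappa>\<^sub>0 = min \<xi>\<^sub>1 (1 - \<xi>\<^sub>1) / 2"

text \<open>The equation in the variable \<open>\<sigma> * (x - \<xi>\<^sub>1)\<close>, frozen outside \<open>[0, \<kappa>\<^sub>0]\<close>.\<close>

definition dev :: "real \<Rightarrow> real \<Rightarrow> real"
  where "dev \<sigma> v = \<sigma> * (d * g (\<xi>\<^sub>1 + \<sigma> * max 0 (min \<kappa>\<^sub>0 v)) - c * \<xi>\<^sub>1)"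

lemma kappa0_pos: "0 < \<kappa>\<^sub>0" using xi1_pos xi1_lt_1 by (simp add: \<kappa>\<^sub>0_def)

lemma kappa0_range:
  assumes "\<sigma> = 1 \<or> \<sigma> = - 1" "0 \<le> v" "v \<le> \<kappa>\<^sub>0"
  shows "0 < \<xi>\<^sub>1 + \<sigma> * v" "\<xi>\<^sub>1 + \<sigma> * v < 1"
  using assms xi1_pos xi1_lt_1 by (auto simp: \<kappa>\<^sub>0_def min_def split: if_splits)

lemma dev_eq: "0 \<le> v \<Longrightarrow> v \<le> \<kappa>\<^sub>0 \<Longrightarrow> dev \<sigma> v = \<sigma> * (d * g (\<xi>\<^sub>1 + \<sigma> * v) - c * \<xi>\<^sub>1)"
  by (simp add: dev_def)

lemma escape_dev:
  assumes \<sigma>: "\<sigma> = 1 \<or> \<sigma> = - 1"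
  shows "\<exists>K B. escape (dev \<sigma>) c \<kappa>\<^sub>0 K B"
proof -
  obtain Kg where Kg: "0 \<le> Kg" "\<And>\<xi> \<eta>. \<xi> \<in> {0..1} \<Longrightarrow> \<eta> \<in> {0..1} \<Longrightarrow> \<bar>g \<xi> - g \<eta>\<bar> \<le> Kg * \<bar>\<xi> - \<eta>\<bar>"
    using g_lipschitz by blast
  have rng: "\<xi>\<^sub>1 + \<sigma> * max 0 (min \<kappa>\<^sub>0 v) \<in> {0..1}" for v
    using kappa0_range[OF \<sigma>, of "max 0 (min \<kappa>\<^sub>0 v)"] kappa0_pos by auto
  have \<sigma>1: "\<bar>\<sigma>\<bar> = 1" using \<sigma> by auto
  have "escape (dev \<sigma>) c \<kappa>\<^sub>0 (d * Kg) (d + c)"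
  proof
    show "mono (dev \<sigma>)"
    proof (rule monoI)
      fix v w :: real assume vw: "v \<le> w"
      let ?v = "max 0 (min \<kappa>\<^sub>0 v)" and ?w = "max 0 (min \<kappa>\<^sub>0 w)"
      have le: "?v \<le> ?w" using vw by auto
      from \<sigma> show "dev \<sigma> v \<le> dev \<sigma> w"
      proof
        assume s: "\<sigma> = 1"
        have "g (\<xi>\<^sub>1 + \<sigma> * ?v) \<le> g (\<xi>\<^sub>1 + \<sigma> * ?w)" using rng[of v] rng[of w] le s by (intro g_mono) auto
        then show ?thesis using d_pos s by (simp add: dev_def)
      next
        assume s: "\<sigma> = - 1"
        have "g (\<xi>\<^sub>1 + \<sigma> * ?w) \<le> g (\<xi>\<^sub>1 + \<sigma> * ?v)" using rng[of v] rng[of w] le s by (intro g_mono) auto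
        then show ?thesis using d_pos s by (simp add: dev_def)
      qed
    qed
    show "dev \<sigma> 0 = 0" using xi1_eq kappa0_pos by (simp add: dev_def)
    show "c * v < dev \<sigma> v" if v: "0 < v" "v \<le> \<kappa>\<^sub>0" for v
      using \<sigma>
    proof
      assume s: "\<sigma> = 1"
      have "c * (\<xi>\<^sub>1 + v) < d * g (\<xi>\<^sub>1 + v)"
        using v kappa0_range[OF \<sigma>, of v] s by (intro g_above_xi1) auto
      then show ?thesis using v s by (simp add: dev_eq algebra_simps)
    next
      assume s: "\<sigma> = - 1"
      have "d * g (\<xi>\<^sub>1 - v) < c * (\<xi>\<^sub>1 - v)"
        using v kappa0_range[OF \<sigma>, of v] s by (intro g_below_xi1) auto
      then show ?thesis using v s by (simp add: dev_eq algebra_simps)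
    qed
    show "\<bar>dev \<sigma> v - dev \<sigma> w\<bar> \<le> d * Kg * \<bar>v - w\<bar>" for v w
    proof -
      let ?v = "max 0 (min \<kappa>\<^sub>0 v)" and ?w = "max 0 (min \<kappa>\<^sub>0 w)"
      have "dev \<sigma> v - dev \<sigma> w = \<sigma> * d * (g (\<xi>\<^sub>1 + \<sigma> * ?v) - g (\<xi>\<^sub>1 + \<sigma> * ?w))"
        by (simp add: dev_def algebra_simps)
      then have "\<bar>dev \<sigma> v - dev \<sigma> w\<bar> = d * \<bar>g (\<xi>\<^sub>1 + \<sigma> * ?v) - g (\<xi>\<^sub>1 + \<sigma> * ?w)\<bar>"
        using \<sigma>1 d_pos by (simp add: abs_mult)
      also have "\<dots> \<le> d * (Kg * \<bar>(\<xi>\<^sub>1 + \<sigma> * ?v) - (\<xi>\<^sub>1 + \<sigma> * ?w)\<bar>)"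
        using d_pos by (intro mult_left_mono Kg(2) rng) auto
      also have "\<bar>(\<xi>\<^sub>1 + \<sigma> * ?v) - (\<xi>\<^sub>1 + \<sigma> * ?w)\<bar> = \<bar>?v - ?w\<bar>"
        using \<sigma> by (elim disjE) (simp_all only:, simp_all add: abs_minus_commute)
      also have "d * (Kg * \<bar>?v - ?w\<bar>) \<le> d * (Kg * \<bar>v - w\<bar>)"
        using d_pos Kg(1) by (intro mult_left_mono) auto
      finally show ?thesis by simp
    qed
    show "\<bar>dev \<sigma> v\<bar> \<le> d + c" for v
    proof -
      let ?G = "g (\<xi>\<^sub>1 + \<sigma> * max 0 (min \<kappa>\<^sub>0 v))"
      have G: "0 \<le> ?G" "?G \<le> 1" using rng[of v] by (auto intro: g_nonneg g_le_1)
      have "\<bar>dev \<sigma> v\<bar> = \<bar>d * ?G - c * \<xi>\<^sub>1\<bar>" using \<sigma>1 by (simp add: dev_def abs_mult)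
      moreover have "0 \<le> d * ?G" "d * ?G \<le> d" using G d_pos by (auto simp: mult_left_le)
      moreover have "0 \<le> c * \<xi>\<^sub>1" "c * \<xi>\<^sub>1 \<le> c" using xi1_pos xi1_lt_1 c_pos by (auto simp: mult_left_le)
      ultimately show ?thesis by (simp add: abs_le_iff)
    qed
  qed (use c_pos kappa0_pos in auto)
  then show ?thesis by blast
qed

text \<open>The truncated feedback \<open>dev\<close> is genuine only for deviations in
  [0, \<open>\<kappa>\<^sub>0\<close>], thus up to time 0. From there the true equation is solved
  forward and the two pieces are joined.\<close>

lemma deviation_entire_solution:
  assumes \<sigma>: "\<sigma> = 1 \<or> \<sigma> = - 1" and adm: "admissible (dev \<sigma>)"
    and y: "\<And>T. delay_solution (dev \<sigma>) c T y" and y_rng: "\<And>t. t \<le> 0 \<Longrightarrow> 0 \<le> y t \<and> y t \<le> \<kappa>\<^sub>0"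
    and y_cont: "continuous_on UNIV y"
  obtains x where "entire_solution g c d x" "\<And>t. t \<le> 0 \<Longrightarrow> x t = \<xi>\<^sub>1 + \<sigma> * y t"
proof -
  have \<phi>_cont: "continuous_on UNIV (\<lambda>s. \<xi>\<^sub>1 + \<sigma> * y (min s 0))"
    by (intro continuous_intros continuous_on_compose2[OF y_cont]) auto
  have \<phi>_pos: "0 \<le> \<xi>\<^sub>1 + \<sigma> * y (min s 0)" for s
    using kappa0_range(1)[OF \<sigma>, of "y (min s 0)"] y_rng[of "min s 0"] by simp
  obtain x where x: "solution_from g c d 0 x" "\<And>s. s \<le> 0 \<Longrightarrow> x s = \<xi>\<^sub>1 + \<sigma> * y (min s 0)"
    using solution_exists[OF less_imp_le[OF d_pos] \<phi>_cont \<phi>_pos, of 0] by blast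
  have xy: "x s = \<xi>\<^sub>1 + \<sigma> * y s" if "s \<le> 0" for s using x(2)[OF that] that by simp
  have nn: "0 \<le> x t" for t
    using solution_from_nonneg[OF x(1), of t] x(2)[of t] \<phi>_pos[of t] by (cases "t \<le> 0") auto
  have x_cont: "continuous_on UNIV x"
  proof -
    have "continuous_on {..0} x"
      by (rule continuous_on_eq[OF continuous_on_subset[OF \<phi>_cont]]) (use x(2) in auto)
    moreover have "continuous_on {0..} x"
      by (rule continuous_on_subset[of "{0 - 1..}"]) (use x(1) in \<open>auto simp: solution_from_def\<close>)
    ultimately have "continuous_on ({..0} \<union> {0..}) x" by (intro continuous_on_closed_Un) auto
    moreover have "{..0::real} \<union> {0..} = UNIV" by auto
    ultimately show ?thesis by simp
  qed
  let ?k = "\<lambda>s. exp (c * s) * rhs d (x (s - 1))"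
  have k_int: "?k integrable_on {T..t}" for T t
    by (rule delay_integrable[OF admissible_rhs continuous_on_subset[OF x_cont] order_refl]) simp
  have early: "exp (c * t) * x t = exp (c * T) * x T + integral {T..t} ?k" if t: "T \<le> t" "t \<le> 0" for T t
  proof -
    let ?m = "\<lambda>s. exp (c * s) * dev \<sigma> (y (s - 1))"
    have "integral {T..t} ?k = integral {T..t} (\<lambda>s. exp (c * s) * (c * \<xi>\<^sub>1) + \<sigma> * ?m s)"
    proof (rule integral_cong)
      fix s assume s: "s \<in> {T..t}"
      have "\<sigma> * dev \<sigma> (y (s - 1)) = d * g (\<xi>\<^sub>1 + \<sigma> * y (s - 1)) - c * \<xi>\<^sub>1"
        using \<sigma> y_rng[of "s - 1"] s t by (auto simp: dev_eq)
      moreover have "rhs d (x (s - 1)) = d * g (\<xi>\<^sub>1 + \<sigma> * y (s - 1))"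
        using xy[of "s - 1"] nn[of "s - 1"] s t by (simp add: rhs_def)
      ultimately have "rhs d (x (s - 1)) = c * \<xi>\<^sub>1 + \<sigma> * dev \<sigma> (y (s - 1))" by simp
      then show "?k s = exp (c * s) * (c * \<xi>\<^sub>1) + \<sigma> * ?m s" by (simp add: distrib_left mult.left_commute)
    qed
    also have "\<dots> = integral {T..t} (\<lambda>s. exp (c * s) * (c * \<xi>\<^sub>1)) + integral {T..t} (\<lambda>s. \<sigma> * ?m s)"
    proof (rule integral_add)
      show "(\<lambda>s. exp (c * s) * (c * \<xi>\<^sub>1)) integrable_on {T..t}" by (intro integrable_continuous_real continuous_intros)
      show "(\<lambda>s. \<sigma> * ?m s) integrable_on {T..t}"
        by (intro integrable_on_mult_right delay_integrable[OF adm continuous_on_subset[OF y_cont] order_refl]) simp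
    qed
    also have "integral {T..t} (\<lambda>s. \<sigma> * ?m s) = \<sigma> * (exp (c * t) * y t - exp (c * T) * y T)"
      using delay_solutionD(2)[OF y t(1)] by simp
    also have "integral {T..t} (\<lambda>s. exp (c * s) * (c * \<xi>\<^sub>1)) = exp (c * t) * \<xi>\<^sub>1 - exp (c * T) * \<xi>\<^sub>1"
      using delay_solutionD(2)[OF delay_solution_const[of c "\<lambda>_. c * \<xi>\<^sub>1" \<xi>\<^sub>1 T] t(1)] c_pos by simp
    finally show ?thesis using t xy[of t] xy[of T] by (simp add: algebra_simps)
  qed
  have "solution_from g c d T x" for T
    unfolding solution_from_iff
  proof (intro conjI allI impI nn)
    show "delay_solution (rhs d) c T x"
    proof (cases "0 \<le> T")
      case True
      then show ?thesis by (rule delay_solution_restrict[OF admissible_rhs solution_delay[OF x(1)]])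
    next
      case False
      show ?thesis
        unfolding delay_solution_def
      proof (intro conjI allI impI continuous_on_subset[OF x_cont])
        fix t assume t: "T \<le> t"
        show "exp (c * t) * x t = exp (c * T) * x T + integral {T..t} ?k"
        proof (cases "t \<le> 0")
          case True then show ?thesis by (rule early[OF t])
        next
          case pos: False
          have "integral {T..0} ?k + integral {0..t} ?k = integral {T..t} ?k"
            using False pos by (intro Henstock_Kurzweil_Integration.integral_combine k_int) auto
          moreover have "exp (c * 0) * x 0 = exp (c * T) * x T + integral {T..0} ?k"
            using False by (intro early) auto
          moreover have "exp (c * t) * x t = exp (c * 0) * x 0 + integral {0..t} ?k"
            using pos by (intro delay_solutionD(2)[OF solution_delay[OF x(1)]]) auto
          ultimately show ?thesis by simp
        qed
      qed simp
    qed
  qed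
  then show ?thesis using that xy by (auto simp: entire_solution_def)
qed

text \<open>The deviation y and its velocity v both solve v' = - c v + A v (t - 1) with a
  coefficient tending to a: for y it is a difference quotient of the feedback, for v its derivative
  along the orbit. Both are eventually positive, so both have the shape of \<chi>0.\<close>

lemma signed_orbit:
  assumes \<sigma>: "\<sigma> = 1 \<or> \<sigma> = - 1"
  obtains x y v T where "entire_solution g c d x" "\<And>t. t \<le> 0 \<Longrightarrow> x t = \<xi>\<^sub>1 + \<sigma> * y t" "mono y" "\<And>t. 0 < y t"
    "(y \<longlongrightarrow> 0) at_bot" "\<And>t. (y has_real_derivative v t) (at t)" "continuous_on UNIV v" "\<And>t. t \<le> T \<Longrightarrow> 0 < v t"
    "T \<le> 0" "((\<lambda>t. (1 / y t) *\<^sub>R seg y t) \<longlongrightarrow> chi0 c a) at_bot" "((\<lambda>t. (1 / v t) *\<^sub>R seg v t) \<longlongrightarrow> chi0 c a) at_bot"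
proof -
  obtain K B where "escape (dev \<sigma>) c \<kappa>\<^sub>0 K B" using escape_dev[OF \<sigma>] by blast
  then interpret esc: escape "dev \<sigma>" c \<kappa>\<^sub>0 K B .
  obtain y where y: "\<And>T. delay_solution (dev \<sigma>) c T y" "mono y" "y 0 = \<kappa>\<^sub>0" "\<And>t. 0 < y t" "(y \<longlongrightarrow> 0) at_bot"
    by (rule esc.backward_orbit) (rule that)
  define v where "v t = - c * y t + dev \<sigma> (y (t - 1))" for t
  have y_der: "(y has_real_derivative v t) (at t)" for t
    unfolding v_def by (rule delay_solution_deriv[OF esc.adm y(1)[of "t - 1"]]) (auto intro: esc.F_cont)
  have y_cont: "continuous_on S y" for S
    using y_der by (auto intro!: continuous_at_imp_continuous_on DERIV_isCont)
  have dev_cont: "continuous_on S (dev \<sigma>)" for S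
    by (intro continuous_at_imp_continuous_on ballI esc.F_cont)
  have v_cont: "continuous_on UNIV v"
    unfolding v_def by (intro continuous_intros y_cont continuous_on_compose2[OF dev_cont[of UNIV]] continuous_on_compose2[OF y_cont[of UNIV]]) auto
  have y_rng: "0 \<le> y t \<and> y t \<le> \<kappa>\<^sub>0" if "t \<le> 0" for t
    using y(4)[of t] monoD[OF y(2) that] y(3) by simp
  obtain x where x: "entire_solution g c d x" "\<And>t. t \<le> 0 \<Longrightarrow> x t = \<xi>\<^sub>1 + \<sigma> * y t"
    using deviation_entire_solution[OF \<sigma> esc.adm y(1) y_rng y_cont] by blast
  have "\<forall>\<^sub>F t in at_bot. y t < \<kappa>\<^sub>0" using y(5) kappa0_pos by (rule order_tendstoD)
  then have "\<forall>\<^sub>F t in at_bot. y t < \<kappa>\<^sub>0 \<and> t \<le> 0" using eventually_le_at_bot[of 0] by eventually_elim simp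
  then obtain T where T: "\<And>t. t \<le> T \<Longrightarrow> y t < \<kappa>\<^sub>0" "T \<le> 0" by (auto simp: eventually_at_bot_linorder)
  have shift_bot: "filterlim (\<lambda>t. t - 1) at_bot (at_bot :: real filter)" by real_asymp
  have y1: "((\<lambda>t. y (t - 1)) \<longlongrightarrow> 0) at_bot" by (rule filterlim_compose[OF y(5) shift_bot])
  have arg_lim: "((\<lambda>t. \<xi>\<^sub>1 + \<sigma> * y (t - 1)) \<longlongrightarrow> \<xi>\<^sub>1) at_bot"
    using tendsto_add[OF tendsto_const tendsto_mult[OF tendsto_const y1], of \<xi>\<^sub>1 \<sigma>] by simp
  define A1 where "A1 t = dev \<sigma> (y (t - 1)) / y (t - 1)" for t
  define A2 where "A2 t = d * g' (\<xi>\<^sub>1 + \<sigma> * y (t - 1))" for t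
  have A1_lim: "(A1 \<longlongrightarrow> a) at_bot"
  proof -
    have "((\<lambda>w. (g w - g \<xi>\<^sub>1) / (w - \<xi>\<^sub>1)) \<longlongrightarrow> g' \<xi>\<^sub>1) (at \<xi>\<^sub>1)"
      using g_deriv_at[OF xi1_pos xi1_lt_1] by (simp add: has_field_derivative_iff)
    moreover have "filterlim (\<lambda>t. \<xi>\<^sub>1 + \<sigma> * y (t - 1)) (at \<xi>\<^sub>1) at_bot"
      unfolding filterlim_at using arg_lim y(4) \<sigma> by (auto intro!: always_eventually) (metis less_irrefl)+
    ultimately have "((\<lambda>t. (g (\<xi>\<^sub>1 + \<sigma> * y (t - 1)) - g \<xi>\<^sub>1) / (\<xi>\<^sub>1 + \<sigma> * y (t - 1) - \<xi>\<^sub>1)) \<longlongrightarrow> g' \<xi>\<^sub>1) at_bot"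
      by (rule filterlim_compose)
    then have "((\<lambda>t. d * ((g (\<xi>\<^sub>1 + \<sigma> * y (t - 1)) - g \<xi>\<^sub>1) / (\<xi>\<^sub>1 + \<sigma> * y (t - 1) - \<xi>\<^sub>1))) \<longlongrightarrow> a) at_bot"
      by (intro tendsto_intros)
    moreover have "\<forall>\<^sub>F t in at_bot. d * ((g (\<xi>\<^sub>1 + \<sigma> * y (t - 1)) - g \<xi>\<^sub>1) / (\<xi>\<^sub>1 + \<sigma> * y (t - 1) - \<xi>\<^sub>1)) = A1 t"
      using eventually_le_at_bot[of 0]
    proof eventually_elim
      case (elim t)
      have "dev \<sigma> (y (t - 1)) = \<sigma> * (d * (g (\<xi>\<^sub>1 + \<sigma> * y (t - 1)) - g \<xi>\<^sub>1))"
        using y_rng[of "t - 1"] elim xi1_eq by (simp add: dev_eq right_diff_distrib)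
      then show ?case using \<sigma> y(4)[of "t - 1"] by (auto simp: A1_def)
    qed
    ultimately show ?thesis by (rule Lim_transform_eventually)
  qed
  have g'_isCont: "isCont g' \<xi>\<^sub>1"
  proof -
    have "continuous_on {0<..<1} g'" by (rule continuous_on_subset[OF g'_cont]) auto
    then show ?thesis using xi1_pos xi1_lt_1 by (simp add: continuous_on_eq_continuous_at)
  qed
  have A2_lim: "(A2 \<longlongrightarrow> a) at_bot"
    unfolding A2_def by (intro tendsto_intros isCont_tendsto_compose[OF g'_isCont] arg_lim)
  have y_der': "(y has_real_derivative - c * y t + A1 t * y (t - 1)) (at t)" for t
    using y_der[of t] y(4)[of "t - 1"] by (simp add: v_def A1_def)
  have v_der: "(v has_real_derivative - c * v t + A2 t * v (t - 1)) (at t)" if t: "t < T" for t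
  proof -
    have w: "0 < y (t - 1)" "y (t - 1) < \<kappa>\<^sub>0" using y(4) T(1)[of "t - 1"] t by auto
    have "((\<lambda>w. \<sigma> * (d * g (\<xi>\<^sub>1 + \<sigma> * w) - c * \<xi>\<^sub>1)) has_real_derivative \<sigma> * (d * (g' (\<xi>\<^sub>1 + \<sigma> * y (t - 1)) * \<sigma>))) (at (y (t - 1)))"
    proof -
      have "((\<lambda>w. g (\<xi>\<^sub>1 + \<sigma> * w)) has_real_derivative g' (\<xi>\<^sub>1 + \<sigma> * y (t - 1)) * \<sigma>) (at (y (t - 1)))"
      proof (rule DERIV_chain2[where f = g and g = "\<lambda>w. \<xi>\<^sub>1 + \<sigma> * w"])
        show "(g has_real_derivative g' (\<xi>\<^sub>1 + \<sigma> * y (t - 1))) (at (\<xi>\<^sub>1 + \<sigma> * y (t - 1)))"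
          using kappa0_range[OF \<sigma>, of "y (t - 1)"] w by (intro g_deriv_at) auto
        show "((\<lambda>w. \<xi>\<^sub>1 + \<sigma> * w) has_real_derivative \<sigma>) (at (y (t - 1)))" by (auto intro!: derivative_eq_intros)
      qed
      then show ?thesis by (auto intro!: derivative_eq_intros)
    qed
    then have "(dev \<sigma> has_real_derivative \<sigma> * (d * (g' (\<xi>\<^sub>1 + \<sigma> * y (t - 1)) * \<sigma>))) (at (y (t - 1)))"
      by (rule has_field_derivative_transform_within_open[of _ _ _ "{0<..<\<kappa>\<^sub>0}"]) (use w in \<open>auto simp: dev_eq\<close>)
    moreover have "\<sigma> * (d * (g' (\<xi>\<^sub>1 + \<sigma> * y (t - 1)) * \<sigma>)) = A2 t" using \<sigma> by (auto simp: A2_def)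
    moreover have "((\<lambda>t. y (t - 1)) has_real_derivative v (t - 1)) (at t)"
      using DERIV_shift[of y "v (t - 1)" t "- 1"] y_der[of "t - 1"] by simp
    ultimately have "((\<lambda>t. dev \<sigma> (y (t - 1))) has_real_derivative A2 t * v (t - 1)) (at t)"
      using DERIV_chain2[of "dev \<sigma>" "A2 t" "\<lambda>t. y (t - 1)" t "v (t - 1)" UNIV] by simp
    then show ?thesis
      unfolding v_def[abs_def] by (auto intro!: derivative_eq_intros y_der simp: v_def)
  qed
  have v_nn: "0 \<le> v t" for t
  proof (rule ccontr)
    assume "\<not> 0 \<le> v t"
    then obtain \<delta> where \<delta>: "0 < \<delta>" "\<And>h. 0 < h \<Longrightarrow> h < \<delta> \<Longrightarrow> y (t + h) < y t"
      using DERIV_neg_dec_right[OF y_der[of t]] by auto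
    have "y (t + \<delta> / 2) < y t" using \<delta>(1) by (intro \<delta>(2)) auto
    moreover have "y t \<le> y (t + \<delta> / 2)" using \<delta>(1) by (intro monoD[OF y(2)]) auto
    ultimately show False by simp
  qed
  \<comment> \<open>exp (c t) v is nondecreasing and nonnegative, so a zero of v extends to the
    whole past. Then y would be constant there, although it is positive and tends to 0.\<close>
  have v_pos: "0 < v t" if t: "t \<le> T" for t
  proof (rule ccontr)
    assume "\<not> 0 < v t"
    then have v0: "v t = 0" using v_nn[of t] by simp
    have vz: "v s = 0" if s: "s \<le> t" for s
    proof -
      have "0 * (t - s) \<le> exp (c * t) * v t - exp (c * s) * v s"
      proof (rule DERIV_lower_bound[OF s])
        show "continuous_on {s..t} (\<lambda>t. exp (c * t) * v t)"
          by (intro continuous_intros continuous_on_subset[OF v_cont]) auto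
        fix r assume r: "s < r" "r < t"
        show "((\<lambda>t. exp (c * t) * v t) has_real_derivative exp (c * r) * (A2 r * v (r - 1))) (at r)"
          using r t by (auto intro!: derivative_eq_intros v_der simp: algebra_simps)
        have "0 < g' (\<xi>\<^sub>1 + \<sigma> * y (r - 1))"
          using kappa0_range[OF \<sigma>, of "y (r - 1)"] y_rng[of "r - 1"] r t T(2) by (intro g'_pos) auto
        then show "0 \<le> exp (c * r) * (A2 r * v (r - 1))" using d_pos v_nn by (simp add: A2_def)
      qed
      then have "exp (c * s) * v s \<le> 0" using v0 by simp
      then show ?thesis using v_nn[of s] by (simp add: mult_le_0_iff)
    qed
    have yc: "y s = y t" if st: "s \<le> t" for s
    proof -
      have "y t - y s \<le> 0 * (t - s)"
        by (rule DERIV_upper_bound[OF st y_cont y_der]) (simp add: vz)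
      then show ?thesis using monoD[OF y(2) st] by simp
    qed
    have "\<forall>\<^sub>F s in at_bot. y s = y t"
      using eventually_le_at_bot[of t] by (rule eventually_mono) (rule yc)
    then have "(y \<longlongrightarrow> y t) at_bot" by (rule tendsto_eventually)
    then have "y t = 0" by (rule tendsto_unique[OF trivial_limit_at_bot_linorder _ y(5)])
    then show False using y(4)[of t] by simp
  qed
  have r1: "((\<lambda>t. (1 / y t) *\<^sub>R seg y t) \<longlongrightarrow> chi0 c a) at_bot"
    by (rule lin.seg_ratio_limit[OF y_cont y(4) y_der' A1_lim])
  have r2: "((\<lambda>t. (1 / v t) *\<^sub>R seg v t) \<longlongrightarrow> chi0 c a) at_bot"
    by (rule lin.seg_ratio_limit[OF v_cont v_pos v_der A2_lim])
  show ?thesis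
    by (rule that[OF x y(2,4,5) y_der v_cont v_pos T(2) r1 r2])
qed

text \<open>The difference of the two solutions, times exp (- \<Lambda> t), satisfies the relaxation
  equation with a perturbation that is small because \<open>g'\<close> is nearly constant close to
  the stationary point. Equal coordinates at 0 mean zero average, and the bound by \<beta>^t is slow
  enough for \<open>relaxation_trivial\<close>.\<close>

lemma backward_unique:
  assumes \<beta>: "exp (lambda0 c a) * (1 - exp (- (lambda0 c a + c))) < \<beta>" "\<beta> < exp (lambda0 c a)"
  obtains \<delta>\<^sub>0 where "0 < \<delta>\<^sub>0"
    "\<And>x x' S t. entire_solution g c d x \<Longrightarrow> entire_solution g c d x' \<Longrightarrow>
      (\<And>t. t \<le> 0 \<Longrightarrow> \<bar>x t - \<xi>\<^sub>1\<bar> \<le> \<delta>\<^sub>0) \<Longrightarrow> (\<And>t. t \<le> 0 \<Longrightarrow> \<bar>x' t - \<xi>\<^sub>1\<bar> \<le> \<delta>\<^sub>0) \<Longrightarrow>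
      (\<And>t. t \<le> 0 \<Longrightarrow> \<bar>x t - x' t\<bar> \<le> S * \<beta> powr t) \<Longrightarrow> lin.coord (seg x 0 - seg x' 0) = 0 \<Longrightarrow>
      t \<le> 0 \<Longrightarrow> x t = x' t"
proof -
  let ?\<Lambda> = "lambda0 c a"
  let ?b = "?\<Lambda> + c"
  have \<beta>0: "0 < \<beta>" using \<beta>(1) lin.theta_bounds(1) by (meson less_trans mult_pos_pos exp_gt_zero)
  \<comment> \<open>The rate \<beta> seen after division by the leading exponential; the two bounds
    on \<beta> become \<theta> < \<sigma> < 1.\<close>
  define \<sigma> where "\<sigma> = \<beta> * exp (- ?\<Lambda>)"
  have \<sigma>: "1 - exp (- ?b) < \<sigma>" "\<sigma> < 1"
    using \<beta> by (simp_all add: \<sigma>_def exp_minus field_simps)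
  obtain \<epsilon> where \<epsilon>: "0 < \<epsilon>" and triv: "\<And>h e S t. relaxation ?b e 0 h \<Longrightarrow>
      (\<And>t. t < 0 \<Longrightarrow> \<bar>e t\<bar> \<le> \<epsilon> * \<bar>h (t - 1)\<bar>) \<Longrightarrow>
      (\<And>t. t \<le> 0 \<Longrightarrow> \<bar>h t\<bar> \<le> S * \<sigma> powr t) \<Longrightarrow> average ?b h 0 = 0 \<Longrightarrow> t \<le> 0 \<Longrightarrow> h t = 0"
    using relaxation_trivial[OF lin.b_pos \<sigma>] by blast
  have g'_isCont: "isCont g' \<xi>\<^sub>1"
  proof -
    have "continuous_on {0<..<1} g'" by (rule continuous_on_subset[OF g'_cont]) auto
    then show ?thesis using xi1_pos xi1_lt_1 by (simp add: continuous_on_eq_continuous_at)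
  qed
  define \<epsilon>' where "\<epsilon>' = \<epsilon> * exp ?\<Lambda> / d"
  have \<epsilon>': "0 < \<epsilon>'" "d * \<epsilon>' = \<epsilon> * exp ?\<Lambda>" using \<epsilon> d_pos by (auto simp: \<epsilon>'_def)
  obtain s where s: "0 < s" "\<And>\<xi>. dist \<xi> \<xi>\<^sub>1 < s \<Longrightarrow> dist (g' \<xi>) (g' \<xi>\<^sub>1) < \<epsilon>'"
    using g'_isCont \<epsilon>'(1) unfolding continuous_at_eps_delta by blast
  \<comment> \<open>Keeps both solutions inside (0,1), where the equation is differentiable, and
    inside the interval on which \<open>g'\<close> varies by less than \<epsilon>'.\<close>
  define \<delta>\<^sub>0 where "\<delta>\<^sub>0 = min (s / 2) (min \<xi>\<^sub>1 (1 - \<xi>\<^sub>1) / 2)"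
  have \<delta>\<^sub>0: "0 < \<delta>\<^sub>0" "\<delta>\<^sub>0 < s" "\<delta>\<^sub>0 < \<xi>\<^sub>1" "\<delta>\<^sub>0 < 1 - \<xi>\<^sub>1"
    using s(1) xi1_pos xi1_lt_1 by (auto simp: \<delta>\<^sub>0_def min_def)
  have g_close: "\<bar>g \<xi> - g \<eta> - g' \<xi>\<^sub>1 * (\<xi> - \<eta>)\<bar> \<le> \<epsilon>' * \<bar>\<xi> - \<eta>\<bar>"
    if "\<bar>\<xi> - \<xi>\<^sub>1\<bar> \<le> \<delta>\<^sub>0" "\<bar>\<eta> - \<xi>\<^sub>1\<bar> \<le> \<delta>\<^sub>0" for \<xi> \<eta>
  proof -
    have "norm ((\<lambda>\<xi>. g \<xi> - g' \<xi>\<^sub>1 * \<xi>) \<xi> - (\<lambda>\<xi>. g \<xi> - g' \<xi>\<^sub>1 * \<xi>) \<eta>) \<le> \<epsilon>' * norm (\<xi> - \<eta>)"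
    proof (rule field_differentiable_bound[where S = "{\<xi>\<^sub>1 - \<delta>\<^sub>0..\<xi>\<^sub>1 + \<delta>\<^sub>0}" and f' = "\<lambda>\<xi>. g' \<xi> - g' \<xi>\<^sub>1"])
      fix z assume z: "z \<in> {\<xi>\<^sub>1 - \<delta>\<^sub>0..\<xi>\<^sub>1 + \<delta>\<^sub>0}"
      have 1: "(g has_real_derivative g' z) (at z)" using z \<delta>\<^sub>0 by (intro g_deriv_at) auto
      have 2: "((\<lambda>\<xi>. g' \<xi>\<^sub>1 * \<xi>) has_real_derivative g' \<xi>\<^sub>1) (at z)" by (auto intro!: derivative_eq_intros)
      show "((\<lambda>\<xi>. g \<xi> - g' \<xi>\<^sub>1 * \<xi>) has_field_derivative g' z - g' \<xi>\<^sub>1) (at z within {\<xi>\<^sub>1 - \<delta>\<^sub>0..\<xi>\<^sub>1 + \<delta>\<^sub>0})"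
        by (rule has_field_derivative_at_within[OF DERIV_diff[OF 1 2]])
      have "dist z \<xi>\<^sub>1 < s" using z \<delta>\<^sub>0 by (auto simp: dist_real_def abs_less_iff)
      from s(2)[OF this] show "norm (g' z - g' \<xi>\<^sub>1) \<le> \<epsilon>'" by (simp add: dist_real_def)
    qed (use that in \<open>auto simp: abs_le_iff\<close>)
    then show ?thesis by (simp add: algebra_simps)
  qed
  show ?thesis
  proof (rule that[OF \<delta>\<^sub>0(1)])
    fix x x' S t0
    assume x: "entire_solution g c d x" and x': "entire_solution g c d x'"
      and near: "\<And>t. t \<le> 0 \<Longrightarrow> \<bar>x t - \<xi>\<^sub>1\<bar> \<le> \<delta>\<^sub>0" and near': "\<And>t. t \<le> 0 \<Longrightarrow> \<bar>x' t - \<xi>\<^sub>1\<bar> \<le> \<delta>\<^sub>0"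
      and S: "\<And>t. t \<le> 0 \<Longrightarrow> \<bar>x t - x' t\<bar> \<le> S * \<beta> powr t"
      and co: "lin.coord (seg x 0 - seg x' 0) = 0" and t0: "(t0 :: real) \<le> 0"
    have xc: "continuous_on U x" and xc': "continuous_on U x'" for U
      by (rule entire_solution_continuous[OF x] entire_solution_continuous[OF x'])+
    define u where "u t = x t - x' t" for t
    have u_cont: "continuous_on U u" for U unfolding u_def by (intro continuous_intros xc xc')
    define h where "h t = exp (- ?\<Lambda> * t) * u t" for t
    define \<eta> where "\<eta> t = d * (g (x (t - 1)) - g (x' (t - 1))) - a * u (t - 1)" for t
    define e where "e t = exp (- ?\<Lambda> * t) * \<eta> t" for t
    have prev: "exp (- ?\<Lambda> * t) * u (t - 1) = exp (- ?\<Lambda>) * h (t - 1)" for t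
      unfolding h_def mult.assoc[symmetric] exp_add[symmetric] by (simp add: algebra_simps)
    have rel: "relaxation ?b e 0 h"
      unfolding relaxation_def
    proof (intro conjI allI impI)
      show "continuous_on {..0} h" unfolding h_def by (intro continuous_intros u_cont)
      fix t :: real assume t: "t < 0"
      have lt: "x (t - 1) < 1" "x' (t - 1) < 1" using near[of "t - 1"] near'[of "t - 1"] t \<delta>\<^sub>0 by (auto simp: abs_le_iff)
      have "(u has_real_derivative (- c * x t + d * g (x (t - 1))) - (- c * x' t + d * g (x' (t - 1)))) (at t)"
        unfolding u_def
        by (intro DERIV_diff solution_deriv[OF entire_solutionD[OF x, of "t - 1"]] solution_deriv[OF entire_solutionD[OF x', of "t - 1"]] lt) auto
      then have u_der: "(u has_real_derivative - c * u t + a * u (t - 1) + \<eta> t) (at t)"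
        by (rule DERIV_cong) (simp add: u_def \<eta>_def algebra_simps)
      have "(h has_real_derivative exp (- ?\<Lambda> * t) * (- c * u t + a * u (t - 1) + \<eta> t) - ?\<Lambda> * exp (- ?\<Lambda> * t) * u t) (at t)"
        unfolding h_def by (auto intro!: derivative_eq_intros u_der)
      moreover have "exp (- ?\<Lambda> * t) * (- c * u t + a * u (t - 1) + \<eta> t) - ?\<Lambda> * exp (- ?\<Lambda> * t) * u t
          = ?b * (h (t - 1) - h t) + e t"
      proof -
        have "exp (- ?\<Lambda> * t) * (- c * u t + a * u (t - 1) + \<eta> t) - ?\<Lambda> * exp (- ?\<Lambda> * t) * u t
            = a * (exp (- ?\<Lambda> * t) * u (t - 1)) - ?b * h t + e t"
          by (simp add: h_def e_def algebra_simps)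
        also have "a * (exp (- ?\<Lambda> * t) * u (t - 1)) = ?b * h (t - 1)"
          unfolding prev lin.lambda0_eq[symmetric] by simp
        finally show ?thesis by (simp add: right_diff_distrib)
      qed
      ultimately show "(h has_real_derivative ?b * (h (t - 1) - h t) + e t) (at t)" by (simp only:)
    qed
    have e_bound: "\<bar>e t\<bar> \<le> \<epsilon> * \<bar>h (t - 1)\<bar>" if t: "t < 0" for t
    proof -
      have "\<bar>g (x (t - 1)) - g (x' (t - 1)) - g' \<xi>\<^sub>1 * u (t - 1)\<bar> \<le> \<epsilon>' * \<bar>u (t - 1)\<bar>"
        unfolding u_def using near[of "t - 1"] near'[of "t - 1"] t by (intro g_close) auto
      then have "d * \<bar>g (x (t - 1)) - g (x' (t - 1)) - g' \<xi>\<^sub>1 * u (t - 1)\<bar> \<le> d * (\<epsilon>' * \<bar>u (t - 1)\<bar>)"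
        using d_pos by (intro mult_left_mono) auto
      moreover have "\<eta> t = d * (g (x (t - 1)) - g (x' (t - 1)) - g' \<xi>\<^sub>1 * u (t - 1))"
        by (simp add: \<eta>_def algebra_simps)
      ultimately have "\<bar>\<eta> t\<bar> \<le> \<epsilon> * exp ?\<Lambda> * \<bar>u (t - 1)\<bar>"
        using d_pos \<epsilon>'(2) by (simp add: abs_mult mult.assoc[symmetric])
      then have "exp (- ?\<Lambda> * t) * \<bar>\<eta> t\<bar> \<le> exp (- ?\<Lambda> * t) * (\<epsilon> * exp ?\<Lambda> * \<bar>u (t - 1)\<bar>)" by simp
      also have "\<dots> = \<epsilon> * exp ?\<Lambda> * \<bar>exp (- ?\<Lambda> * t) * u (t - 1)\<bar>" by (simp add: abs_mult)
      also have "\<dots> = \<epsilon> * \<bar>h (t - 1)\<bar>" unfolding prev by (simp add: abs_mult exp_minus)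
      finally show ?thesis by (simp add: e_def abs_mult)
    qed
    have h_bound: "\<bar>h t\<bar> \<le> S * \<sigma> powr t" if t: "t \<le> 0" for t
    proof -
      have "\<bar>h t\<bar> \<le> exp (- ?\<Lambda> * t) * (S * \<beta> powr t)" using S[OF t] by (simp add: h_def u_def abs_mult)
      moreover have "exp (- ?\<Lambda> * t) = exp (- ?\<Lambda>) powr t" by (simp add: powr_def mult.commute)
      moreover have "\<sigma> powr t = \<beta> powr t * exp (- ?\<Lambda>) powr t" unfolding \<sigma>_def by (rule powr_mult)
      ultimately show ?thesis by (simp add: mult_ac)
    qed
    have "seg x 0 - seg x' 0 = seg u 0"
      unfolding u_def[abs_def] seg_diff[OF xc xc'] by simp
    then have avg: "average ?b h 0 = 0"
      using co lin.coord_seg[OF u_cont, of 0] lin.b_pos unfolding h_def[abs_def] by simp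
    have "h t0 = 0" by (rule triv[OF rel e_bound h_bound avg t0])
    then show "x t0 = x' t0" by (simp add: h_def u_def)
  qed
qed

end

section \<open>Existence of the leading unstable manifold\<close>

text \<open>The lower half enters as - m (- r), which reverses the sign twice in its derivative.
  Thus both halves leave 0 with the common tangent v, and the joined curve is C^1 there.\<close>

lemma glue_half_curves:
  fixes p p' m m' :: "real \<Rightarrow> 'e::real_normed_vector"
  assumes p: "\<And>r. 0 < r \<Longrightarrow> r < r\<^sub>0 \<Longrightarrow> (p has_vector_derivative p' r) (at r)" "continuous_on {0<..<r\<^sub>0} p'"
      "(p' \<longlongrightarrow> v) (at_right 0)" "((\<lambda>r. (1 / r) *\<^sub>R p r) \<longlongrightarrow> v) (at_right 0)"
    and m: "\<And>r. 0 < r \<Longrightarrow> r < r\<^sub>0 \<Longrightarrow> (m has_vector_derivative m' r) (at r)" "continuous_on {0<..<r\<^sub>0} m'"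
      "(m' \<longlongrightarrow> v) (at_right 0)" "((\<lambda>r. (1 / r) *\<^sub>R m r) \<longlongrightarrow> v) (at_right 0)"
  defines "G \<equiv> \<lambda>r. if 0 < r then p r else if r < 0 then - m (- r) else 0"
    and "G' \<equiv> \<lambda>r. if 0 < r then p' r else if r < 0 then m' (- r) else v"
  shows "\<bar>r\<bar> < r\<^sub>0 \<Longrightarrow> (G has_vector_derivative G' r) (at r)"
    and "continuous_on {-r\<^sub>0<..<r\<^sub>0} G'"
proof -
  have pos: "\<forall>\<^sub>F r in at_right (0::real). 0 < r" by (simp add: eventually_at_right_less)
  have left: "(h \<longlongrightarrow> v) (at_left 0)" if "((\<lambda>r. h (- r)) \<longlongrightarrow> v) (at_right 0)" for h :: "real \<Rightarrow> 'e"
    using that by (simp add: filterlim_at_left_to_right)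
  show "(G has_vector_derivative G' r) (at r)" if r: "\<bar>r\<bar> < r\<^sub>0" for r
  proof -
    consider "0 < r" | "r < 0" | "r = 0" by linarith
    then show ?thesis
    proof cases
      case 1
      then have "(p has_vector_derivative G' r) (at r)" using p(1)[of r] r by (simp add: G'_def)
      then show ?thesis
        by (rule has_vector_derivative_transform_within_open[of _ _ _ "{0<..}"]) (use 1 in \<open>auto simp: G_def\<close>)
    next
      case 2
      have "(uminus has_vector_derivative - 1) (at r)" by (auto intro!: derivative_eq_intros)
      moreover have "(m has_vector_derivative m' (- r)) (at (- r))" using 2 r by (intro m(1)) auto
      ultimately have "((m \<circ> uminus) has_vector_derivative - 1 *\<^sub>R m' (- r)) (at r)" by (rule vector_diff_chain_at)
      then have "((\<lambda>r. - (m \<circ> uminus) r) has_vector_derivative - (- 1 *\<^sub>R m' (- r))) (at r)"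
        by (rule has_vector_derivative_minus)
      then have "((\<lambda>r. - (m \<circ> uminus) r) has_vector_derivative G' r) (at r)" using 2 by (simp add: G'_def)
      then show ?thesis
        by (rule has_vector_derivative_transform_within_open[of _ _ _ "{..<0}"]) (use 2 in \<open>auto simp: G_def\<close>)
    next
      case 3
      have "((\<lambda>r. (1 / r) *\<^sub>R G r) \<longlongrightarrow> v) (at 0)"
        unfolding filterlim_at_split
      proof
        show "((\<lambda>r. (1 / r) *\<^sub>R G r) \<longlongrightarrow> v) (at_right 0)"
          by (rule Lim_transform_eventually[OF p(4)]) (use pos in \<open>eventually_elim, simp add: G_def\<close>)
        show "((\<lambda>r. (1 / r) *\<^sub>R G r) \<longlongrightarrow> v) (at_left 0)"
          by (rule left, rule Lim_transform_eventually[OF m(4)]) (use pos in \<open>eventually_elim, simp add: G_def\<close>)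
      qed
      from tendsto_norm_zero[OF LIM_zero[OF this]]
      have "((\<lambda>r. norm ((1 / r) *\<^sub>R G r - v)) \<longlongrightarrow> 0) (at 0)" .
      then have "((\<lambda>r. norm ((G r - G 0) - (r - 0) *\<^sub>R v) / norm (r - 0)) \<longlongrightarrow> 0) (at 0)"
      proof (rule Lim_transform_eventually)
        have "norm ((1 / r) *\<^sub>R G r - v) = norm ((G r - G 0) - (r - 0) *\<^sub>R v) / norm (r - 0)" if "r \<noteq> 0" for r
        proof -
          have "(1 / r) *\<^sub>R G r - v = (1 / r) *\<^sub>R (G r - r *\<^sub>R v)" using that by (simp add: scaleR_diff_right)
          then show ?thesis by (simp add: G_def)
        qed
        then show "\<forall>\<^sub>F r in at 0. norm ((1 / r) *\<^sub>R G r - v) = norm ((G r - G 0) - (r - 0) *\<^sub>R v) / norm (r - 0)"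
          by (auto simp: eventually_at_filter)
      qed
      then have "(G has_vector_derivative v) (at 0)"
        unfolding has_vector_derivative_def has_derivative_iff_norm by (auto intro: bounded_linear_scaleR_left)
      then show ?thesis using 3 by (simp add: G'_def)
    qed
  qed
  have "(G' \<longlongrightarrow> G' r) (at r)" if r: "\<bar>r\<bar> < r\<^sub>0" for r
  proof -
    consider "0 < r" | "r < 0" | "r = 0" by linarith
    then show ?thesis
    proof cases
      case 1
      then have "isCont p' r" using p(2) r by (simp add: continuous_on_eq_continuous_at)
      then have "(p' \<longlongrightarrow> G' r) (at r)" using 1 by (simp add: isCont_def G'_def)
      then show ?thesis
        by (rule Lim_transform_within_open[of _ _ _ _ "{0<..}"]) (use 1 in \<open>auto simp: G'_def\<close>)
    next
      case 2
      then have "isCont m' (- r)" using m(2) r by (simp add: continuous_on_eq_continuous_at)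
      then have "isCont (\<lambda>r. m' (- r)) r"
        by (intro isCont_o2[where f = uminus and g = m']) (auto intro!: continuous_intros)
      then have "((\<lambda>r. m' (- r)) \<longlongrightarrow> G' r) (at r)" using 2 by (simp add: isCont_def G'_def)
      then show ?thesis
        by (rule Lim_transform_within_open[of _ _ _ _ "{..<0}"]) (use 2 in \<open>auto simp: G'_def\<close>)
    next
      case 3
      have "(G' \<longlongrightarrow> v) (at 0)"
        unfolding filterlim_at_split
      proof
        show "(G' \<longlongrightarrow> v) (at_right 0)"
          by (rule Lim_transform_eventually[OF p(3)]) (use pos in \<open>eventually_elim, simp add: G'_def\<close>)
        show "(G' \<longlongrightarrow> v) (at_left 0)"
          by (rule left, rule Lim_transform_eventually[OF m(3)]) (use pos in \<open>eventually_elim, simp add: G'_def\<close>)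
      qed
      then show ?thesis using 3 by (simp add: G'_def)
    qed
  qed
  then show "continuous_on {-r\<^sub>0<..<r\<^sub>0} G'"
    by (intro continuous_at_imp_continuous_on) (auto simp: isCont_def)
qed

section \<open>The unstable curve through the stationary point\<close>

context pulse_super
begin

interpretation coord: bounded_linear lin.coord by (rule lin.bounded_linear_coord)

lemma bounded_linear_apply_bcontfun: "bounded_linear (\<lambda>\<phi> :: C. \<phi> s)"
proof (rule bounded_linear_intro[where K = 1])
  show "norm (\<phi> s) \<le> norm \<phi> * 1" for \<phi> :: C using norm_bounded[of \<phi> s] by simp
qed (simp_all add: plus_bcontfun.rep_eq scaleR_bcontfun.rep_eq)

text \<open>Parametrizes one leaving orbit by its coordinate and records its own backward history:
  the segments n units earlier are again points of the curve, with parameters shrinking faster than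
  \<beta>^(- n).\<close>

lemma unstable_branch:
  assumes \<sigma>: "\<sigma> = 1 \<or> \<sigma> = - 1" and \<beta>: "1 < \<beta>" "\<beta> < exp (lambda0 c a)" and \<delta>: "0 < \<delta>"
  obtains r\<^sub>0 \<rho> and p p' :: "real \<Rightarrow> C" where "0 < r\<^sub>0" "0 \<le> \<rho>" "\<rho> < 1"
    "\<And>r s. 0 < r \<Longrightarrow> r < r\<^sub>0 \<Longrightarrow> lin.coord (p r) = r \<and> 0 < p r s"
    "\<And>r. 0 < r \<Longrightarrow> r < r\<^sub>0 \<Longrightarrow> (p has_vector_derivative p' r) (at r)"
    "continuous_on {0<..<r\<^sub>0} p'" "(p' \<longlongrightarrow> chi0 c a) (at_right 0)"
    "((\<lambda>r. (1 / r) *\<^sub>R p r) \<longlongrightarrow> chi0 c a) (at_right 0)"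
    "\<And>r. 0 < r \<Longrightarrow> r < r\<^sub>0 \<Longrightarrow> \<exists>x K. entire_solution g c d x \<and> seg x 0 = e\<^sub>1 + \<sigma> *\<^sub>R p r \<and>
      (\<forall>t\<le>0. \<bar>x t - \<xi>\<^sub>1\<bar> \<le> \<delta> \<and> \<bar>x t - \<xi>\<^sub>1\<bar> \<le> K * \<beta> powr t) \<and>
      (\<forall>n. \<exists>s. 0 < s \<and> s \<le> r \<and> \<beta> ^ n * s \<le> \<rho> ^ n * r \<and> seg x (- real n) - e\<^sub>1 = \<sigma> *\<^sub>R p s)"
proof -
  let ?\<Lambda> = "lambda0 c a"
  obtain x y v T where x: "entire_solution g c d x" "\<And>t. t \<le> 0 \<Longrightarrow> x t = \<xi>\<^sub>1 + \<sigma> * y t"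
    and y: "mono y" "\<And>t. 0 < y t" "(y \<longlongrightarrow> 0) at_bot" "\<And>t. (y has_real_derivative v t) (at t)"
    and v: "continuous_on UNIV v" "\<And>t. t \<le> T \<Longrightarrow> 0 < v t" and T: "T \<le> 0"
    and yr: "((\<lambda>t. (1 / y t) *\<^sub>R seg y t) \<longlongrightarrow> chi0 c a) at_bot"
    and vr: "((\<lambda>t. (1 / v t) *\<^sub>R seg v t) \<longlongrightarrow> chi0 c a) at_bot"
    by (rule signed_orbit[OF \<sigma>]) (rule that)
  have y_cont: "continuous_on U y" for U
    using y(4) by (auto intro!: continuous_at_imp_continuous_on DERIV_isCont)
  have "exp (- ?\<Lambda>) < 1 / \<beta>" using \<beta> by (simp add: exp_minus field_simps)
  \<comment> \<open>Far back, one unit of backward time multiplies the deviation by nearly exp (-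
    \<Lambda>), hence by less than q. Since q \<beta> < 1, scaling by \<beta> per step still leaves
    geometric decay; \<rho> is q \<beta>.\<close>
  then obtain q where q: "exp (- ?\<Lambda>) < q" "q < 1 / \<beta>" using dense by blast
  have q0: "0 < q" using q(1) exp_gt_zero[of "- ?\<Lambda>"] by linarith
  have q1: "q * \<beta> < 1" using q(2) \<beta>(1) by (simp add: field_simps)
  have qle: "q \<le> 1" using q1 q0 \<beta>(1) by (meson less_eq_real_def less_trans mult_le_cancel_left1 not_less order_less_le_trans)
  have "((\<lambda>t. ((1 / y t) *\<^sub>R seg y t) (to_hist (- 1))) \<longlongrightarrow> chi0 c a (to_hist (- 1))) at_bot"
    by (intro bounded_linear.tendsto[OF bounded_linear_apply_bcontfun] yr)
  then have "((\<lambda>t. y (t - 1) / y t) \<longlongrightarrow> exp (- ?\<Lambda>)) at_bot"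
    by (simp add: scaleR_bcontfun.rep_eq seg_apply[OF y_cont] lin.chi0_apply of_hist_to_hist)
  then have "\<forall>\<^sub>F t in at_bot. y (t - 1) / y t < q" using q(1) by (rule order_tendstoD)
  moreover have "\<forall>\<^sub>F t in at_bot. y t < \<delta>" using y(3) \<delta> by (rule order_tendstoD)
  ultimately have "\<forall>\<^sub>F t in at_bot. y (t - 1) / y t < q \<and> y t < \<delta> \<and> t \<le> T"
    using eventually_le_at_bot[of T] by eventually_elim simp
  then obtain T1 where T1: "\<And>t. t \<le> T1 \<Longrightarrow> y (t - 1) / y t < q \<and> y t < \<delta> \<and> t \<le> T"
    by (auto simp: eventually_at_bot_linorder)
  have step: "y (t - 1) < q * y t" if "t \<le> T1" for t
    using T1[OF that] y(2)[of t] by (simp add: pos_divide_less_eq)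
  have T1T: "T1 \<le> T" using T1[of T1] by simp
  let ?R = "\<lambda>t. lin.coord (seg y t)" and ?R' = "\<lambda>t. lin.coord (seg v t)"
  have v_pos: "0 < v t" if "t \<le> T1" for t using v(2)[of t] that T1T by simp
  obtain S where S: "\<And>t. t < T1 \<Longrightarrow> 0 < ?R t \<and> ?R t < ?R T1 \<and> S (?R t) = t"
    "\<And>r. 0 < r \<Longrightarrow> r < ?R T1 \<Longrightarrow> S r < T1 \<and> ?R (S r) = r"
    and p_der: "\<And>r. 0 < r \<Longrightarrow> r < ?R T1 \<Longrightarrow>
      ((\<lambda>r. seg y (S r)) has_vector_derivative (1 / ?R' (S r)) *\<^sub>R seg v (S r)) (at r)"
    and p'_cont: "continuous_on {0<..<?R T1} (\<lambda>r. (1 / ?R' (S r)) *\<^sub>R seg v (S r))"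
    and p'_lim: "((\<lambda>r. (1 / ?R' (S r)) *\<^sub>R seg v (S r)) \<longlongrightarrow> chi0 c a) (at_right 0)"
    and p_lim: "((\<lambda>r. (1 / r) *\<^sub>R seg y (S r)) \<longlongrightarrow> chi0 c a) (at_right 0)"
    and "filterlim S at_bot (at_right 0)" and R_pos: "0 < ?R T1"
    by (rule lin.half_curve[where T = T1, OF y(4) v(1) y(2) v_pos y(3) yr vr], assumption, rule that)
  have powers: "y (t - real n) \<le> q ^ n * y t \<and> ?R (t - real n) \<le> q ^ n * ?R t" if t: "t \<le> T1" for t n
  proof (induction n)
    case 0 show ?case by simp
  next
    case (Suc n)
    let ?t = "t - real n"
    have tn: "?t \<le> T1" using t by simp
    have "lin.coord (seg y (?t - 1)) < lin.coord (q *\<^sub>R seg y ?t)"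
    proof (rule lin.coord_less)
      fix s
      have "?t + of_hist s \<le> T1" using tn of_hist_bounds(2)[of s] by linarith
      from step[OF this] show "seg y (?t - 1) s < (q *\<^sub>R seg y ?t) s"
        by (simp add: seg_apply[OF y_cont] scaleR_bcontfun.rep_eq algebra_simps)
    qed
    then have 1: "?R (?t - 1) \<le> q * ?R ?t" by (simp add: coord.scaleR)
    have 2: "y (?t - 1) \<le> q * y ?t" using step[OF tn] by simp
    have "q * ?R ?t \<le> q * (q ^ n * ?R t)" "q * y ?t \<le> q * (q ^ n * y t)"
      using Suc.IH q0 by (auto intro: mult_left_mono)
    moreover have "t - real (Suc n) = ?t - 1" by simp
    ultimately show ?case using 1 2 by (simp only: power_Suc mult.assoc) linarith
  qed
  have seg_x: "seg x t - e\<^sub>1 = \<sigma> *\<^sub>R seg y t" if "t \<le> 0" for t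
  proof -
    have "x (t + of_hist s) = \<xi>\<^sub>1 + \<sigma> * y (t + of_hist s)" for s
      using of_hist_bounds(2)[of s] that by (intro x(2)) linarith
    then show ?thesis
      by (intro bcontfun_eqI) (simp add: seg_apply[OF y_cont] seg_apply[OF entire_solution_continuous[OF x(1)]]
        scaleR_bcontfun.rep_eq minus_bcontfun.rep_eq const_bcontfun.rep_eq)
  qed
  have chain: "\<exists>x K. entire_solution g c d x \<and> seg x 0 = e\<^sub>1 + \<sigma> *\<^sub>R seg y (S r) \<and>
      (\<forall>t\<le>0. \<bar>x t - \<xi>\<^sub>1\<bar> \<le> \<delta> \<and> \<bar>x t - \<xi>\<^sub>1\<bar> \<le> K * \<beta> powr t) \<and>
      (\<forall>n. \<exists>s. 0 < s \<and> s \<le> r \<and> \<beta> ^ n * s \<le> (q * \<beta>) ^ n * r \<and> seg x (- real n) - e\<^sub>1 = \<sigma> *\<^sub>R seg y (S s))"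
    if r: "0 < r" "r < ?R T1" for r
  proof (intro exI conjI allI impI)
    let ?\<tau> = "S r"
    have \<tau>: "?\<tau> < T1" "?\<tau> \<le> 0" "?R ?\<tau> = r" using S(2)[OF r] T1T T by auto
    show "entire_solution g c d (\<lambda>t. x (t + ?\<tau>))" by (rule entire_solution_shift[OF x(1)])
    show "seg (\<lambda>t. x (t + ?\<tau>)) 0 = e\<^sub>1 + \<sigma> *\<^sub>R seg y ?\<tau>"
      using seg_x[OF \<tau>(2)] unfolding seg_shift by (simp add: algebra_simps)
    fix t :: real assume t: "t \<le> 0"
    have dist: "\<bar>x (t + ?\<tau>) - \<xi>\<^sub>1\<bar> = y (t + ?\<tau>)"
      using x(2)[of "t + ?\<tau>"] t \<tau>(2) \<sigma> y(2)[of "t + ?\<tau>"] by auto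
    show "\<bar>x (t + ?\<tau>) - \<xi>\<^sub>1\<bar> \<le> \<delta>" unfolding dist using T1[of "t + ?\<tau>"] t \<tau>(1) by simp
    define n where "n = nat \<lfloor>- t\<rfloor>"
    have n: "real n \<le> - t" "- t < real n + 1" using t by (auto simp: n_def)
    have "y (t + ?\<tau>) \<le> y (?\<tau> - real n)" using n(1) by (intro monoD[OF y(1)]) simp
    also have "\<dots> \<le> q ^ n * y ?\<tau>" using powers[of ?\<tau> n] \<tau>(1) by simp
    also have "\<dots> \<le> (1 / \<beta>) ^ n * y ?\<tau>"
      using q q0 less_imp_le[OF y(2)[of ?\<tau>]] by (intro mult_right_mono power_mono) auto
    also have "(1 / \<beta>) ^ n = \<beta> powr (- real n)" using \<beta>(1) by (simp add: powr_minus powr_realpow power_divide inverse_eq_divide)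
    also have "\<beta> powr (- real n) * y ?\<tau> \<le> \<beta> powr (1 + t) * y ?\<tau>"
      using n(2) \<beta>(1) less_imp_le[OF y(2)[of ?\<tau>]] by (intro mult_right_mono powr_mono) auto
    also have "\<dots> = (\<beta> * y ?\<tau>) * \<beta> powr t" using \<beta>(1) by (simp add: powr_add)
    finally show "\<bar>x (t + ?\<tau>) - \<xi>\<^sub>1\<bar> \<le> (\<beta> * y ?\<tau>) * \<beta> powr t" unfolding dist .
  next
    let ?\<tau> = "S r"
    have \<tau>: "?\<tau> < T1" "?\<tau> \<le> 0" "?R ?\<tau> = r" using S(2)[OF r] T1T T by auto
    fix n
    let ?s = "?R (?\<tau> - real n)"
    have s: "0 < ?s" "S ?s = ?\<tau> - real n" using S(1)[of "?\<tau> - real n"] \<tau>(1) by auto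
    have le: "?s \<le> q ^ n * r" using powers[of ?\<tau> n] \<tau> by simp
    have "q ^ n * r \<le> 1 * r" using q0 qle r by (intro mult_right_mono power_le_one) auto
    then show "?s \<le> r" using le by simp
    show "\<beta> ^ n * ?s \<le> (q * \<beta>) ^ n * r"
      using mult_left_mono[OF le, of "\<beta> ^ n"] \<beta>(1) by (simp add: power_mult_distrib mult_ac)
    show "seg (\<lambda>t. x (t + ?\<tau>)) (- real n) - e\<^sub>1 = \<sigma> *\<^sub>R seg y (S ?s)"
      unfolding seg_shift s(2) using seg_x[of "?\<tau> - real n"] \<tau>(2) by (simp add: algebra_simps)
    show "0 < ?s" by (rule s(1))
  qed
  have pos: "lin.coord (seg y (S r)) = r \<and> 0 < seg y (S r) s" if "0 < r" "r < ?R T1" for r s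
    using S(2)[OF that] y(2) by (simp add: seg_apply[OF y_cont])
  have q\<beta>: "0 \<le> q * \<beta>" using q0 \<beta>(1) by simp
  show ?thesis
    by (rule that[OF R_pos q\<beta> q1 pos p_der p'_cont p'_lim p_lim chain])
qed

lemma constant_solution: "entire_solution g c d (\<lambda>_. \<xi>\<^sub>1)"
proof -
  have "rhs d \<xi>\<^sub>1 = c * \<xi>\<^sub>1" using xi1_pos xi1_eq by (simp add: rhs_def)
  then show ?thesis
    unfolding entire_solution_def solution_from_iff
    using c_pos xi1_pos by (auto intro!: delay_solution_const)
qed

text \<open>Collects what the two inclusions between curve and manifold need: backward points on the
  curve whose parameters beat \<beta>^(- n) geometrically, and a backward orbit to which
  \<open>backward_unique\<close> applies.\<close>

definition unstable_chain :: "real \<Rightarrow> real \<Rightarrow> real \<Rightarrow> (real \<Rightarrow> C) \<Rightarrow> real \<Rightarrow> bool"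
  where "unstable_chain \<beta> \<delta> \<rho> G r \<longleftrightarrow> (\<exists>x K. entire_solution g c d x \<and> seg x 0 = e\<^sub>1 + G r \<and>
    (\<forall>t\<le>0. \<bar>x t - \<xi>\<^sub>1\<bar> \<le> \<delta> \<and> \<bar>x t - \<xi>\<^sub>1\<bar> \<le> K * \<beta> powr t) \<and>
    (\<forall>n. \<exists>s. \<bar>s\<bar> \<le> \<bar>r\<bar> \<and> \<beta> ^ n * \<bar>s\<bar> \<le> \<rho> ^ n * \<bar>r\<bar> \<and> seg x (- real n) - e\<^sub>1 = G s))"

lemma unstable_curve:
  assumes \<beta>: "1 < \<beta>" "\<beta> < exp (lambda0 c a)" and \<delta>: "0 < \<delta>"
  obtains r\<^sub>0 \<rho> and G G' :: "real \<Rightarrow> C" where "0 < r\<^sub>0" "0 \<le> \<rho>" "\<rho> < 1" "G 0 = 0" "G' 0 = chi0 c a"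
    "\<And>r. \<bar>r\<bar> < r\<^sub>0 \<Longrightarrow> lin.coord (G r) = r"
    "\<And>r. \<bar>r\<bar> < r\<^sub>0 \<Longrightarrow> (G has_vector_derivative G' r) (at r)"
    "continuous_on {-r\<^sub>0<..<r\<^sub>0} G'"
    "\<And>r. \<bar>r\<bar> < r\<^sub>0 \<Longrightarrow> unstable_chain \<beta> \<delta> \<rho> G r"
    "\<And>r. \<bar>r\<bar> < r\<^sub>0 \<Longrightarrow> r \<noteq> 0 \<Longrightarrow> e\<^sub>1 + G r \<lless> e\<^sub>1 \<or> e\<^sub>1 \<lless> e\<^sub>1 + G r"
proof -
  obtain r\<^sub>p \<rho>\<^sub>p p p' where rp: "0 < r\<^sub>p" "0 \<le> \<rho>\<^sub>p" "\<rho>\<^sub>p < 1"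
    and p_pos: "\<And>r s. 0 < r \<Longrightarrow> r < r\<^sub>p \<Longrightarrow> lin.coord (p r) = r \<and> 0 < p r s"
    and p: "\<And>r. 0 < r \<Longrightarrow> r < r\<^sub>p \<Longrightarrow> (p has_vector_derivative p' r) (at r)"
      "continuous_on {0<..<r\<^sub>p} p'" "(p' \<longlongrightarrow> chi0 c a) (at_right 0)"
      "((\<lambda>r. (1 / r) *\<^sub>R p r) \<longlongrightarrow> chi0 c a) (at_right 0)"
    and p_chain: "\<And>r. 0 < r \<Longrightarrow> r < r\<^sub>p \<Longrightarrow> \<exists>x K. entire_solution g c d x \<and> seg x 0 = e\<^sub>1 + 1 *\<^sub>R p r \<and>
      (\<forall>t\<le>0. \<bar>x t - \<xi>\<^sub>1\<bar> \<le> \<delta> \<and> \<bar>x t - \<xi>\<^sub>1\<bar> \<le> K * \<beta> powr t) \<and>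
      (\<forall>n. \<exists>s. 0 < s \<and> s \<le> r \<and> \<beta> ^ n * s \<le> \<rho>\<^sub>p ^ n * r \<and> seg x (- real n) - e\<^sub>1 = 1 *\<^sub>R p s)"
    by (rule unstable_branch[of 1, OF _ \<beta> \<delta>], simp, rule that)
  obtain r\<^sub>m \<rho>\<^sub>m m m' where rm: "0 < r\<^sub>m" "0 \<le> \<rho>\<^sub>m" "\<rho>\<^sub>m < 1"
    and m_pos: "\<And>r s. 0 < r \<Longrightarrow> r < r\<^sub>m \<Longrightarrow> lin.coord (m r) = r \<and> 0 < m r s"
    and m: "\<And>r. 0 < r \<Longrightarrow> r < r\<^sub>m \<Longrightarrow> (m has_vector_derivative m' r) (at r)"
      "continuous_on {0<..<r\<^sub>m} m'" "(m' \<longlongrightarrow> chi0 c a) (at_right 0)"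
      "((\<lambda>r. (1 / r) *\<^sub>R m r) \<longlongrightarrow> chi0 c a) (at_right 0)"
    and m_chain: "\<And>r. 0 < r \<Longrightarrow> r < r\<^sub>m \<Longrightarrow> \<exists>x K. entire_solution g c d x \<and> seg x 0 = e\<^sub>1 + (- 1) *\<^sub>R m r \<and>
      (\<forall>t\<le>0. \<bar>x t - \<xi>\<^sub>1\<bar> \<le> \<delta> \<and> \<bar>x t - \<xi>\<^sub>1\<bar> \<le> K * \<beta> powr t) \<and>
      (\<forall>n. \<exists>s. 0 < s \<and> s \<le> r \<and> \<beta> ^ n * s \<le> \<rho>\<^sub>m ^ n * r \<and> seg x (- real n) - e\<^sub>1 = (- 1) *\<^sub>R m s)"
    by (rule unstable_branch[of "- 1", OF _ \<beta> \<delta>], simp, rule that)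
  define r\<^sub>0 where "r\<^sub>0 = min r\<^sub>p r\<^sub>m"
  define \<rho> where "\<rho> = max \<rho>\<^sub>p \<rho>\<^sub>m"
  have r0: "0 < r\<^sub>0" "r\<^sub>0 \<le> r\<^sub>p" "r\<^sub>0 \<le> r\<^sub>m" and \<rho>: "0 \<le> \<rho>" "\<rho> < 1" "\<rho>\<^sub>p \<le> \<rho>" "\<rho>\<^sub>m \<le> \<rho>"
    using rp rm by (auto simp: r\<^sub>0_def \<rho>_def)
  define G where "G = (\<lambda>r. if 0 < r then p r else if r < 0 then - m (- r) else 0)"
  define G' where "G' = (\<lambda>r. if 0 < r then p' r else if r < 0 then m' (- r) else chi0 c a)"
  have p'c: "continuous_on {0<..<r\<^sub>0} p'" by (rule continuous_on_subset[OF p(2)]) (use r0 in auto)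
  have m'c: "continuous_on {0<..<r\<^sub>0} m'" by (rule continuous_on_subset[OF m(2)]) (use r0 in auto)
  have p1: "(p has_vector_derivative p' r) (at r)" if "0 < r" "r < r\<^sub>0" for r using that r0 by (intro p(1)) auto
  have m1: "(m has_vector_derivative m' r) (at r)" if "0 < r" "r < r\<^sub>0" for r using that r0 by (intro m(1)) auto
  have G_der: "(G has_vector_derivative G' r) (at r)" if r: "\<bar>r\<bar> < r\<^sub>0" for r
    unfolding G_def G'_def
    by (rule glue_half_curves(1)[OF _ p'c p(3,4) _ m'c m(3,4) r]) (auto intro: p1 m1)
  have G'_cont: "continuous_on {-r\<^sub>0<..<r\<^sub>0} G'"
    unfolding G'_def
    by (rule glue_half_curves(2)[OF _ p'c p(3,4) _ m'c m(3,4)]) (auto intro: p1 m1)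
  have shrink: "\<beta> ^ n * \<bar>s\<bar> \<le> \<rho> ^ n * \<bar>r\<bar>" if "\<beta> ^ n * \<bar>s\<bar> \<le> q ^ n * \<bar>r\<bar>" "0 \<le> q" "q \<le> \<rho>" for n q r s
  proof -
    have "q ^ n * \<bar>r\<bar> \<le> \<rho> ^ n * \<bar>r\<bar>" using that by (intro mult_right_mono power_mono) auto
    then show ?thesis using that(1) by linarith
  qed
  have coord: "lin.coord (G r) = r" if "\<bar>r\<bar> < r\<^sub>0" for r
    using p_pos[of r] m_pos[of "- r"] that r0 by (auto simp: G_def coord.zero coord.neg)
  have chain: "unstable_chain \<beta> \<delta> \<rho> G r" if r: "\<bar>r\<bar> < r\<^sub>0" for r
  proof -
    consider "0 < r" | "r < 0" | "r = 0" by linarith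
    then show ?thesis
    proof cases
      case 1
      obtain x K where x: "entire_solution g c d x" "seg x 0 = e\<^sub>1 + 1 *\<^sub>R p r"
        "\<forall>t\<le>0. \<bar>x t - \<xi>\<^sub>1\<bar> \<le> \<delta> \<and> \<bar>x t - \<xi>\<^sub>1\<bar> \<le> K * \<beta> powr t"
        "\<And>n. \<exists>s. 0 < s \<and> s \<le> r \<and> \<beta> ^ n * s \<le> \<rho>\<^sub>p ^ n * r \<and> seg x (- real n) - e\<^sub>1 = 1 *\<^sub>R p s"
        using p_chain[of r] 1 r r0 by auto
      have "\<exists>s. \<bar>s\<bar> \<le> \<bar>r\<bar> \<and> \<beta> ^ n * \<bar>s\<bar> \<le> \<rho> ^ n * \<bar>r\<bar> \<and> seg x (- real n) - e\<^sub>1 = G s" for n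
      proof -
        obtain s where s: "0 < s" "s \<le> r" "\<beta> ^ n * s \<le> \<rho>\<^sub>p ^ n * r" "seg x (- real n) - e\<^sub>1 = 1 *\<^sub>R p s"
          using x(4)[of n] by blast
        have "\<beta> ^ n * \<bar>s\<bar> \<le> \<rho> ^ n * \<bar>r\<bar>" by (rule shrink[of n s \<rho>\<^sub>p]) (use s 1 rp \<rho> in auto)
        then show ?thesis using s 1 by (intro exI[of _ s]) (auto simp: G_def)
      qed
      moreover have "seg x 0 = e\<^sub>1 + G r" using x(2) 1 by (simp add: G_def)
      ultimately show ?thesis unfolding unstable_chain_def using x(1,3) by blast
    next
      case 2
      obtain x K where x: "entire_solution g c d x" "seg x 0 = e\<^sub>1 + (- 1) *\<^sub>R m (- r)"
        "\<forall>t\<le>0. \<bar>x t - \<xi>\<^sub>1\<bar> \<le> \<delta> \<and> \<bar>x t - \<xi>\<^sub>1\<bar> \<le> K * \<beta> powr t"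
        "\<And>n. \<exists>s. 0 < s \<and> s \<le> - r \<and> \<beta> ^ n * s \<le> \<rho>\<^sub>m ^ n * (- r) \<and> seg x (- real n) - e\<^sub>1 = (- 1) *\<^sub>R m s"
        using m_chain[of "- r"] 2 r r0 by auto
      have "\<exists>s. \<bar>s\<bar> \<le> \<bar>r\<bar> \<and> \<beta> ^ n * \<bar>s\<bar> \<le> \<rho> ^ n * \<bar>r\<bar> \<and> seg x (- real n) - e\<^sub>1 = G s" for n
      proof -
        obtain s where s: "0 < s" "s \<le> - r" "\<beta> ^ n * s \<le> \<rho>\<^sub>m ^ n * (- r)" "seg x (- real n) - e\<^sub>1 = (- 1) *\<^sub>R m s"
          using x(4)[of n] by blast
        have "\<beta> ^ n * \<bar>- s\<bar> \<le> \<rho> ^ n * \<bar>r\<bar>" by (rule shrink[of n "- s" \<rho>\<^sub>m]) (use s 2 rm \<rho> in auto)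
        then show ?thesis using s 2 by (intro exI[of _ "- s"]) (auto simp: G_def)
      qed
      moreover have "seg x 0 = e\<^sub>1 + G r" using x(2) 2 by (simp add: G_def)
      ultimately show ?thesis unfolding unstable_chain_def using x(1,3) by blast
    next
      \<comment> \<open>At r = 0 the backward orbit is the stationary solution itself.\<close>
      case 3
      have "seg (\<lambda>_. \<xi>\<^sub>1) t = e\<^sub>1" for t
        by (rule bcontfun_eqI) (simp add: seg_apply const_bcontfun.rep_eq)
      then show ?thesis
        unfolding unstable_chain_def 3
        using \<delta> by (intro exI[of _ "\<lambda>_. \<xi>\<^sub>1"] exI[of _ 0] conjI constant_solution) (auto simp: G_def intro!: exI[of _ 0])
    qed
  qed
  have order: "e\<^sub>1 + G r \<lless> e\<^sub>1 \<or> e\<^sub>1 \<lless> e\<^sub>1 + G r" if "\<bar>r\<bar> < r\<^sub>0" "r \<noteq> 0" for r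
  proof (cases "0 < r")
    case True
    then show ?thesis using p_pos[of r] that r0 by (auto simp: strictly_below_def G_def plus_bcontfun.rep_eq)
  next
    case False
    then show ?thesis using m_pos[of "- r"] that r0
      by (auto simp: strictly_below_def G_def plus_bcontfun.rep_eq uminus_bcontfun.rep_eq)
  qed
  have "G 0 = 0" "G' 0 = chi0 c a" by (simp_all add: G_def G'_def)
  from that[OF r0(1) \<rho>(1,2) this coord G_der G'_cont chain order] show ?thesis .
qed

end

section \<open>The unstable curve as an admissible leading unstable manifold\<close>

context pulse_super
begin

interpretation coord: bounded_linear lin.coord by (rule lin.bounded_linear_coord)

text \<open>The neighbourhoods are chosen so that the set is the curve \<open>G\<close> over |r| <
  \<open>r\<^sub>1\<close>. Curve points have admissible backward sequences by
  \<open>unstable_chain\<close>; any other candidate has the coordinate of some curve point, and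
  \<open>backward_unique\<close> identifies the two.\<close>

lemma leading_setup_exists: "\<exists>\<beta> NP NQ. leading_setup g g' c d \<beta> NP NQ"
proof -
  let ?\<Lambda> = "lambda0 c a"
  let ?\<chi> = "chi0 c a"
  let ?\<theta> = "1 - exp (- (?\<Lambda> + c))"
  have "exp ?\<Lambda> * ?\<theta> < exp ?\<Lambda>" by simp
  then have "max 1 (exp ?\<Lambda> * ?\<theta>) < exp ?\<Lambda>" using lin.lambda0_pos by simp
  \<comment> \<open>Above exp \<Lambda> \<theta>, so that \<beta> dominates all other roots and
    backward uniqueness holds; below exp \<Lambda>, so that the leaving orbits decay fast enough to
    belong to the set.\<close>
  then obtain \<beta> where "max 1 (exp ?\<Lambda> * ?\<theta>) < \<beta>" and \<beta>2: "\<beta> < exp ?\<Lambda>" using dense by blast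
  then have \<beta>: "1 < \<beta>" and \<beta>1: "exp ?\<Lambda> * ?\<theta> < \<beta>" by auto
  show ?thesis
  proof (rule backward_unique[OF \<beta>1 \<beta>2])
    fix \<delta> :: real assume \<delta>: "0 < \<delta>" and unique:
      "\<And>x x' S t. entire_solution g c d x \<Longrightarrow> entire_solution g c d x' \<Longrightarrow>
        (\<And>t. t \<le> 0 \<Longrightarrow> \<bar>x t - \<xi>\<^sub>1\<bar> \<le> \<delta>) \<Longrightarrow> (\<And>t. t \<le> 0 \<Longrightarrow> \<bar>x' t - \<xi>\<^sub>1\<bar> \<le> \<delta>) \<Longrightarrow>
        (\<And>t. t \<le> 0 \<Longrightarrow> \<bar>x t - x' t\<bar> \<le> S * \<beta> powr t) \<Longrightarrow> lin.coord (seg x 0 - seg x' 0) = 0 \<Longrightarrow>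
        t \<le> 0 \<Longrightarrow> x t = x' t"
    obtain r\<^sub>0 \<rho> G G' where r0: "0 < r\<^sub>0" and \<rho>: "0 \<le> \<rho>" "\<rho> < 1" and G0: "G 0 = 0" "G' 0 = ?\<chi>"
      and G_coord: "\<And>r. \<bar>r\<bar> < r\<^sub>0 \<Longrightarrow> lin.coord (G r) = r"
      and G_der: "\<And>r. \<bar>r\<bar> < r\<^sub>0 \<Longrightarrow> (G has_vector_derivative G' r) (at r)"
      and G'_cont: "continuous_on {-r\<^sub>0<..<r\<^sub>0} G'"
      and chain: "\<And>r. \<bar>r\<bar> < r\<^sub>0 \<Longrightarrow> unstable_chain \<beta> \<delta> \<rho> G r"
      and order: "\<And>r. \<bar>r\<bar> < r\<^sub>0 \<Longrightarrow> r \<noteq> 0 \<Longrightarrow> e\<^sub>1 + G r \<lless> e\<^sub>1 \<or> e\<^sub>1 \<lless> e\<^sub>1 + G r"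
      by (rule unstable_curve[OF \<beta> \<beta>2 \<delta>]) (rule that)
    define q where "q r = G r - r *\<^sub>R ?\<chi>" for r
    define q' where "q' r = G' r - ?\<chi>" for r
    have q_der: "(q has_vector_derivative q' r) (at r)" if "\<bar>r\<bar> < r\<^sub>0" for r
      unfolding q_def[abs_def] q'_def
      by (intro has_vector_derivative_diff G_der[OF that]) (auto intro!: derivative_eq_intros)
    have "(q has_derivative (\<lambda>h. h *\<^sub>R q' 0)) (at 0)"
      using q_der[of 0] r0 by (simp add: has_vector_derivative_def)
    \<comment> \<open>q and its derivative vanish at 0, so near 0 the Q-component of a curve point
      is at most its coordinate; this keeps scaled points inside both neighbourhoods.\<close>
    then have "\<exists>s>0. \<forall>r. norm (r - 0) < s \<longrightarrow> norm (q r - q 0 - (r - 0) *\<^sub>R q' 0) \<le> 1 * norm (r - 0)"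
      unfolding has_derivative_at_alt by (elim conjE allE[of _ 1]) simp
    then obtain s where s: "0 < s" "\<And>r. \<bar>r\<bar> < s \<Longrightarrow> norm (q r) \<le> \<bar>r\<bar>"
      by (auto simp: q_def q'_def G0)
    \<comment> \<open>The half of \<delta> enters because elements of \<open>sum_set NP NQ\<close>
      have norm up to 2 \<open>r\<^sub>1\<close>, and \<delta> bounds the deviations allowed in
      \<open>backward_unique\<close>.\<close>
    define r\<^sub>1 where "r\<^sub>1 = min (min r\<^sub>0 s) (\<delta> / 2)"
    have r1: "0 < r\<^sub>1" "r\<^sub>1 \<le> r\<^sub>0" "r\<^sub>1 \<le> s" "2 * r\<^sub>1 \<le> \<delta>" using r0 s \<delta> by (auto simp: r\<^sub>1_def)
    have q_norm: "norm (q r) \<le> \<bar>r\<bar>" if "\<bar>r\<bar> < r\<^sub>1" for r using s(2)[of r] that r1 by simp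
    have G_eq: "G r = r *\<^sub>R ?\<chi> + q r" for r by (simp add: q_def)
    have q_coord: "lin.coord (q r) = 0" if "\<bar>r\<bar> < r\<^sub>1" for r
      using G_coord[of r] that r1 by (simp add: q_def coord.diff coord.scaleR lin.coord_chi0)
    define NP where "NP = P_space c a \<inter> lin.coord -` {-r\<^sub>1<..<r\<^sub>1}"
    define NQ where "NQ = Q_space c a \<inter> ball 0 r\<^sub>1"
    have NP_iff: "\<phi> \<in> NP \<longleftrightarrow> \<phi> = lin.coord \<phi> *\<^sub>R ?\<chi> \<and> \<bar>lin.coord \<phi>\<bar> < r\<^sub>1" for \<phi>
      unfolding NP_def by (auto simp: lin.P_space_iff[symmetric])
    have NQ_iff: "\<phi> \<in> NQ \<longleftrightarrow> lin.coord \<phi> = 0 \<and> norm \<phi> < r\<^sub>1" for \<phi>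
      by (simp add: NQ_def lin.Q_space_iff)
    have NP_convex: "convex NP"
      unfolding NP_def
    proof (intro convex_Int convex_linear_vimage bounded_linear.linear[OF lin.bounded_linear_coord] convex_real_interval)
      show "convex (P_space c a)"
      proof (rule convexI)
        fix \<phi> \<psi> and u v :: real assume "\<phi> \<in> P_space c a" "\<psi> \<in> P_space c a"
        then obtain r s where "\<phi> = r *\<^sub>R ?\<chi>" "\<psi> = s *\<^sub>R ?\<chi>" by (auto simp: P_space_def)
        then have "u *\<^sub>R \<phi> + v *\<^sub>R \<psi> = (u * r + v * s) *\<^sub>R ?\<chi>" by (simp add: scaleR_left_distrib)
        then show "u *\<^sub>R \<phi> + v *\<^sub>R \<psi> \<in> P_space c a" by (auto simp: P_space_def)
      qed
    qed
    have NQ_convex: "convex NQ"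
      unfolding NQ_def
      by (intro convex_Int convex_ball) (auto simp: convex_def lin.Q_space_iff coord.add coord.scaleR)
    have NP0: "0 \<in> NP" and NQ0: "0 \<in> NQ" using r1 by (auto simp: NP_iff NQ_iff coord.zero)
    have NP_open: "openin (top_of_set (P_space c a)) NP"
      unfolding NP_def by (intro openin_open_Int open_vimage open_greaterThanLessThan coord.continuous_on continuous_on_id)
    have NQ_open: "openin (top_of_set (Q_space c a)) NQ"
      unfolding NQ_def by (intro openin_open_Int open_ball)
    have sum_setI: "\<phi> \<in> sum_set NP NQ"
      if "\<bar>lin.coord \<phi>\<bar> < r\<^sub>1" "norm (\<phi> - lin.coord \<phi> *\<^sub>R ?\<chi>) < r\<^sub>1" for \<phi>
    proof -
      have "lin.coord \<phi> *\<^sub>R ?\<chi> \<in> NP" "\<phi> - lin.coord \<phi> *\<^sub>R ?\<chi> \<in> NQ"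
        using that by (auto simp: NP_iff NQ_iff coord.diff coord.scaleR lin.coord_chi0)
      then show ?thesis unfolding sum_set_def by force
    qed
    have sum_setD: "\<bar>lin.coord \<phi>\<bar> < r\<^sub>1 \<and> norm \<phi> \<le> 2 * r\<^sub>1" if \<phi>: "\<phi> \<in> sum_set NP NQ" for \<phi>
    proof -
      obtain p q where pq: "p \<in> NP" "q \<in> NQ" "\<phi> = p + q" using \<phi> by (auto simp: sum_set_def)
      have p: "p = lin.coord p *\<^sub>R ?\<chi>" "\<bar>lin.coord p\<bar> < r\<^sub>1" and q: "lin.coord q = 0" "norm q < r\<^sub>1"
        using pq by (auto simp only: NP_iff NQ_iff)
      have "norm p = \<bar>lin.coord p\<bar> * norm ?\<chi>" using p(1) by (metis norm_scaleR)
      also have "\<dots> \<le> \<bar>lin.coord p\<bar>" using lin.norm_chi0 by (simp add: mult_left_le)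
      finally have "norm \<phi> \<le> 2 * r\<^sub>1" using norm_triangle_ineq[of p q] p(2) q(2) pq(3) by simp
      then show ?thesis using p(2) q(1) pq(3) by (simp add: coord.add)
    qed
    define W where "W = Wu_loc g c d \<beta> NP NQ"
    have W_eq: "W = {e\<^sub>1 + G r | r. \<bar>r\<bar> < r\<^sub>1}"
    proof (intro equalityI subsetI)
      fix \<psi> assume "\<psi> \<in> {e\<^sub>1 + G r | r. \<bar>r\<bar> < r\<^sub>1}"
      then obtain r where r: "\<bar>r\<bar> < r\<^sub>1" "\<psi> = e\<^sub>1 + G r" by blast
      obtain x where x: "entire_solution g c d x" "seg x 0 = e\<^sub>1 + G r" and steps:
        "\<And>n. \<exists>s. \<bar>s\<bar> \<le> \<bar>r\<bar> \<and> \<beta> ^ n * \<bar>s\<bar> \<le> \<rho> ^ n * \<bar>r\<bar> \<and> seg x (- real n) - e\<^sub>1 = G s"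
        using chain[of r] r(1) r1(2) unfolding unstable_chain_def by auto
      define \<Phi> where "\<Phi> k = seg x (real_of_int k) - e\<^sub>1" for k
      \<comment> \<open>The n-th backward point is \<open>G s\<close> with \<beta>^n |s| \<le>
        \<rho>^n |r|. Its leading component and its Q-component after scaling are both at most this,
        which gives membership and the decay at once.\<close>
      have scaled: "(\<beta> powi (- k)) *\<^sub>R \<Phi> k \<in> sum_set NP NQ \<and>
          norm ((\<beta> powi (- k)) *\<^sub>R \<Phi> k) \<le> \<rho> ^ nat (- k) * (2 * \<bar>r\<bar>)" if k: "k \<le> 0" for k
      proof -
        define n where "n = nat (- k)"
        have kn: "k = - int n" using k by (simp add: n_def)
        obtain s where s: "\<bar>s\<bar> \<le> \<bar>r\<bar>" "\<beta> ^ n * \<bar>s\<bar> \<le> \<rho> ^ n * \<bar>r\<bar>" "seg x (- real n) - e\<^sub>1 = G s"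
          using steps by blast
        have \<Phi>: "(\<beta> powi (- k)) *\<^sub>R \<Phi> k = (\<beta> ^ n) *\<^sub>R G s" using s(3) by (simp add: kn \<Phi>_def)
        have sr: "\<bar>s\<bar> < r\<^sub>1" using s(1) r(1) by simp
        have co: "lin.coord ((\<beta> ^ n) *\<^sub>R G s) = \<beta> ^ n * s"
          using G_coord[of s] sr r1(2) by (simp add: coord.scaleR)
        have "\<rho> ^ n * \<bar>r\<bar> \<le> 1 * \<bar>r\<bar>" using \<rho> by (intro mult_right_mono power_le_one) auto
        then have bound: "\<beta> ^ n * \<bar>s\<bar> < r\<^sub>1" using s(2) r(1) by simp
        have abs: "\<bar>\<beta> ^ n * s\<bar> = \<beta> ^ n * \<bar>s\<bar>" using \<beta> by (simp add: abs_mult)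
        have "(\<beta> ^ n) *\<^sub>R G s - (\<beta> ^ n * s) *\<^sub>R ?\<chi> = (\<beta> ^ n) *\<^sub>R q s" by (simp add: q_def scaleR_diff_right)
        moreover have nq: "norm ((\<beta> ^ n) *\<^sub>R q s) \<le> \<beta> ^ n * \<bar>s\<bar>" using q_norm[OF sr] \<beta> by simp
        ultimately have mem: "(\<beta> ^ n) *\<^sub>R G s \<in> sum_set NP NQ"
          using bound by (intro sum_setI) (simp_all add: co abs)
        have split: "(\<beta> ^ n) *\<^sub>R G s = (\<beta> ^ n * s) *\<^sub>R ?\<chi> + (\<beta> ^ n) *\<^sub>R q s" by (simp add: q_def scaleR_diff_right)
        have chi_le: "norm ((\<beta> ^ n * s) *\<^sub>R ?\<chi>) \<le> \<beta> ^ n * \<bar>s\<bar>"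
          using lin.norm_chi0 by (simp only: norm_scaleR real_norm_def abs) (intro mult_left_le, use \<beta> in auto)
        have "norm ((\<beta> ^ n) *\<^sub>R G s) \<le> \<beta> ^ n * \<bar>s\<bar> + \<beta> ^ n * \<bar>s\<bar>"
          unfolding split by (rule order_trans[OF norm_triangle_ineq add_mono[OF chi_le nq]])
        then have "norm ((\<beta> ^ n) *\<^sub>R G s) \<le> \<rho> ^ n * (2 * \<bar>r\<bar>)" using s(2) by linarith
        then show ?thesis using mem unfolding \<Phi> n_def by blast
      qed
      have "filterlim (\<lambda>k::int. nat (- k)) sequentially at_bot"
        unfolding filterlim_at_top
      proof
        fix Z show "\<forall>\<^sub>F k in at_bot. Z \<le> nat (- k)"
          using eventually_le_at_bot[of "- int Z"] by eventually_elim simp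
      qed
      then have "((\<lambda>k. \<rho> ^ nat (- k) * (2 * \<bar>r\<bar>)) \<longlongrightarrow> 0 * (2 * \<bar>r\<bar>)) at_bot"
        using \<rho> by (intro tendsto_mult tendsto_const filterlim_compose[OF LIMSEQ_power_zero]) simp_all
      then have bound_lim: "((\<lambda>k. \<rho> ^ nat (- k) * (2 * \<bar>r\<bar>)) \<longlongrightarrow> 0) at_bot" by (simp only: mult_zero_left)
      have "\<forall>\<^sub>F k in at_bot. norm ((\<beta> powi (- k)) *\<^sub>R \<Phi> k) \<le> \<rho> ^ nat (- k) * (2 * \<bar>r\<bar>)"
        using eventually_le_at_bot[of 0] by (rule eventually_mono) (rule conjunct2[OF scaled])
      then have lim: "((\<lambda>k. (\<beta> powi (- k)) *\<^sub>R \<Phi> k) \<longlongrightarrow> 0) at_bot"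
        by (rule Lim_null_comparison[OF _ bound_lim])
      have \<Phi>0: "\<Phi> 0 = G r" using x(2) by (simp add: \<Phi>_def)
      show "\<psi> \<in> W"
        unfolding W_def Wu_loc_def Let_def r(2)
      proof (intro imageI CollectI conjI exI[of _ \<Phi>] allI impI lim \<Phi>0)
        show "(\<beta> powi (- k)) *\<^sub>R \<Phi> k \<in> sum_set NP NQ" if "k \<le> 0" for k using scaled[OF that] by blast
        show "G r \<in> sum_set NP NQ" using scaled[of 0] \<Phi>0 by simp
        show "e\<^sub>1 + \<Phi> k \<in> Cplus" for k using solution_Cplus[OF x(1)] by (simp add: \<Phi>_def)
        show "e\<^sub>1 + \<Phi> (k + 1) = semiflow g c d 1 (e\<^sub>1 + \<Phi> k)" for k
          using semiflow_eq[OF entire_solutionD[OF x(1)], of 1 "real_of_int k"] by (simp add: \<Phi>_def)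
      qed
    next
      fix \<psi> assume "\<psi> \<in> W"
      then have "\<psi> \<in> Wu_loc g c d \<beta> NP NQ" by (simp add: W_def)
      then obtain x where x: "entire_solution g c d x" "seg x 0 = \<psi>"
        and mem: "\<And>n. (\<beta> ^ n) *\<^sub>R (seg x (- real n) - e\<^sub>1) \<in> sum_set NP NQ"
        by (rule convex_W_chain[OF \<beta> NP_convex NP0 NQ_convex NQ0]) (rule that)
      have x_near: "\<bar>x t - \<xi>\<^sub>1\<bar> \<le> 2 * r\<^sub>1 * \<beta> powr (- real n)" if "- real n - 1 \<le> t" "t \<le> - real n" for t n
      proof -
        have "norm (x t - \<xi>\<^sub>1) \<le> norm (seg (\<lambda>t. x t - \<xi>\<^sub>1) (- real n))"
          by (rule norm_le_seg) (use that in \<open>auto intro!: continuous_intros entire_solution_continuous[OF x(1)]\<close>)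
        also have "\<dots> = norm (seg x (- real n) - e\<^sub>1)" by (simp add: seg_minus_const[OF entire_solution_continuous[OF x(1)]])
        finally have 1: "\<bar>x t - \<xi>\<^sub>1\<bar> \<le> norm (seg x (- real n) - e\<^sub>1)" by simp
        have "\<beta> ^ n * norm (seg x (- real n) - e\<^sub>1) \<le> 2 * r\<^sub>1"
          using sum_setD[OF mem[of n]] \<beta> by simp
        then have "norm (seg x (- real n) - e\<^sub>1) \<le> 2 * r\<^sub>1 / \<beta> ^ n"
          using \<beta> by (subst pos_le_divide_eq) (auto simp: mult.commute)
        with 1 show ?thesis using \<beta> by (simp add: powr_minus powr_realpow divide_inverse)
      qed
      have x_bound: "\<bar>x t - \<xi>\<^sub>1\<bar> \<le> \<delta> \<and> \<bar>x t - \<xi>\<^sub>1\<bar> \<le> 2 * r\<^sub>1 * \<beta> * \<beta> powr t" if t: "t \<le> 0" for t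
      proof -
        define n where "n = nat \<lfloor>- t\<rfloor>"
        have n: "real n \<le> - t" "- t < real n + 1" using t by (auto simp: n_def)
        have x_n: "\<bar>x t - \<xi>\<^sub>1\<bar> \<le> 2 * r\<^sub>1 * \<beta> powr (- real n)" by (rule x_near) (use n in auto)
        have "\<beta> powr (- real n) \<le> \<beta> powr 0" using \<beta> by (intro powr_mono) auto
        then have "2 * r\<^sub>1 * \<beta> powr (- real n) \<le> 2 * r\<^sub>1 * 1" using r1(1) \<beta> by (intro mult_left_mono) auto
        moreover have "\<beta> powr (- real n) \<le> \<beta> powr (1 + t)" using \<beta> n by (intro powr_mono) auto
        then have "2 * r\<^sub>1 * \<beta> powr (- real n) \<le> 2 * r\<^sub>1 * (\<beta> * \<beta> powr t)"
          using r1(1) \<beta> by (intro mult_left_mono) (auto simp: powr_add)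
        ultimately show ?thesis using x_n r1(4) by (simp add: mult.assoc)
      qed
      \<comment> \<open>The only curve parameter that can match \<psi>; its size is admissible
        because \<psi> deviates by an element of the sum of the neighbourhoods.\<close>
      define r where "r = lin.coord (seg x 0 - e\<^sub>1)"
      have r: "\<bar>r\<bar> < r\<^sub>1" using sum_setD[OF mem[of 0]] by (simp add: r_def)
      obtain x' K where x': "entire_solution g c d x'" "seg x' 0 = e\<^sub>1 + G r"
        and x'_bound: "\<And>t. t \<le> 0 \<Longrightarrow> \<bar>x' t - \<xi>\<^sub>1\<bar> \<le> \<delta> \<and> \<bar>x' t - \<xi>\<^sub>1\<bar> \<le> K * \<beta> powr t"
        using chain[of r] r r1(2) unfolding unstable_chain_def by auto
      have "x t = x' t" if "t \<le> 0" for t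
      proof (rule unique[OF x(1) x'(1) _ _ _ _ that])
        show "\<bar>x t - x' t\<bar> \<le> (2 * r\<^sub>1 * \<beta> + K) * \<beta> powr t" if "t \<le> 0" for t
        proof -
          have "\<bar>x t - x' t\<bar> \<le> \<bar>x t - \<xi>\<^sub>1\<bar> + \<bar>x' t - \<xi>\<^sub>1\<bar>" by linarith
          then show ?thesis using x_bound[OF that] x'_bound[OF that] by (simp add: distrib_right)
        qed
        have "seg x 0 - seg x' 0 = (seg x 0 - e\<^sub>1) - G r" using x'(2) by simp
        then show "lin.coord (seg x 0 - seg x' 0) = 0"
          using G_coord[of r] r r1(2) by (simp only: coord.diff[of "seg x 0 - e\<^sub>1"] r_def[symmetric])
      qed (use x_bound x'_bound in blast)+
      then have "seg x 0 = seg x' 0" by (intro seg_cong) auto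
      then show "\<psi> \<in> {e\<^sub>1 + G r | r. \<bar>r\<bar> < r\<^sub>1}" using x(2) x'(2) r by auto
    qed
    define w where "w \<phi> = q (lin.coord \<phi>)" for \<phi>
    \<comment> \<open>The derivative along the line P, extended to the whole space by composing with
      \<open>coord\<close>.\<close>
    define Dw where "Dw \<phi> = blinfun_scaleR_left (q' (lin.coord \<phi>)) o\<^sub>L Blinfun lin.coord" for \<phi>
    have Dw_apply: "blinfun_apply (Dw \<phi>) h = lin.coord h *\<^sub>R q' (lin.coord \<phi>)" for \<phi> h
      by (simp add: Dw_def bounded_linear_Blinfun_apply[OF lin.bounded_linear_coord])
    have w_NQ: "w ` NP \<subseteq> NQ"
    proof (intro image_subsetI)
      fix \<phi> assume "\<phi> \<in> NP"
      then have "\<bar>lin.coord \<phi>\<bar> < r\<^sub>1" by (simp only: NP_iff)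
      then show "w \<phi> \<in> NQ" using q_norm[of "lin.coord \<phi>"] by (simp add: NQ_iff w_def q_coord)
    qed
    have w_der: "(w has_derivative blinfun_apply (Dw \<phi>)) (at \<phi> within NP)" if "\<phi> \<in> NP" for \<phi>
    proof -
      have "\<bar>lin.coord \<phi>\<bar> < r\<^sub>0" using that r1(2) by (auto simp only: NP_iff)
      then have 1: "(q has_derivative (\<lambda>h. h *\<^sub>R q' (lin.coord \<phi>))) (at (lin.coord \<phi>))"
        using q_der by (simp add: has_vector_derivative_def)
      have "((q \<circ> lin.coord) has_derivative ((\<lambda>h. h *\<^sub>R q' (lin.coord \<phi>)) \<circ> lin.coord)) (at \<phi>)"
        by (rule diff_chain_at[OF bounded_linear_imp_has_derivative[OF lin.bounded_linear_coord] 1])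
      moreover have "q \<circ> lin.coord = w" "(\<lambda>h. h *\<^sub>R q' (lin.coord \<phi>)) \<circ> lin.coord = blinfun_apply (Dw \<phi>)"
        by (auto simp: w_def Dw_apply)
      ultimately show ?thesis by (simp add: has_derivative_at_withinI)
    qed
    have Dw_cont: "continuous_on NP Dw"
    proof -
      have q'_cont: "continuous_on {-r\<^sub>0<..<r\<^sub>0} q'" unfolding q'_def by (intro continuous_intros G'_cont)
      have "continuous_on NP (\<lambda>\<phi>. q' (lin.coord \<phi>))"
      proof (rule continuous_on_compose2[OF q'_cont coord.continuous_on[OF continuous_on_id]])
        show "lin.coord ` NP \<subseteq> {-r\<^sub>0<..<r\<^sub>0}" using r1(2) by (auto simp: NP_def)
      qed
      then show ?thesis
        unfolding Dw_def[abs_def]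
        by (intro bounded_linear.continuous_on[OF bounded_bilinear.bounded_linear_left[OF bounded_bilinear_blinfun_compose]]
          bounded_linear.continuous_on[OF bounded_linear_blinfun_scaleR_left])
    qed
    have W_graph: "W = {e\<^sub>1 + (\<phi> + w \<phi>) | \<phi>. \<phi> \<in> NP}"
      unfolding W_eq
    proof (intro equalityI subsetI)
      fix \<psi> assume "\<psi> \<in> {e\<^sub>1 + G r | r. \<bar>r\<bar> < r\<^sub>1}"
      then obtain r where r: "\<bar>r\<bar> < r\<^sub>1" "\<psi> = e\<^sub>1 + G r" by blast
      have co: "lin.coord (r *\<^sub>R ?\<chi>) = r" by (simp add: coord.scaleR lin.coord_chi0)
      have "r *\<^sub>R ?\<chi> \<in> NP" using r(1) by (simp add: NP_iff co)
      moreover have "\<psi> = e\<^sub>1 + (r *\<^sub>R ?\<chi> + w (r *\<^sub>R ?\<chi>))" using r(2) by (simp add: w_def co G_eq)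
      ultimately show "\<psi> \<in> {e\<^sub>1 + (\<phi> + w \<phi>) | \<phi>. \<phi> \<in> NP}" by blast
    next
      fix \<psi> assume "\<psi> \<in> {e\<^sub>1 + (\<phi> + w \<phi>) | \<phi>. \<phi> \<in> NP}"
      then obtain \<phi> where \<phi>: "\<phi> \<in> NP" "\<psi> = e\<^sub>1 + (\<phi> + w \<phi>)" by blast
      have co: "\<phi> = lin.coord \<phi> *\<^sub>R ?\<chi>" "\<bar>lin.coord \<phi>\<bar> < r\<^sub>1" using \<phi>(1) by (auto simp only: NP_iff)
      have "\<psi> = e\<^sub>1 + (lin.coord \<phi> *\<^sub>R ?\<chi> + q (lin.coord \<phi>))" unfolding \<phi>(2) w_def using co(1) by simp
      then have "\<psi> = e\<^sub>1 + G (lin.coord \<phi>)" by (simp add: G_eq)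
      then show "\<psi> \<in> {e\<^sub>1 + G r | r. \<bar>r\<bar> < r\<^sub>1}" using co(2) by blast
    qed
    have W_sides: "\<psi> \<lless> e\<^sub>1 \<or> e\<^sub>1 \<lless> \<psi>" if \<psi>: "\<psi> \<in> W" "\<psi> \<noteq> e\<^sub>1" for \<psi>
    proof -
      obtain r where r: "\<bar>r\<bar> < r\<^sub>1" "\<psi> = e\<^sub>1 + G r" using \<psi>(1) unfolding W_eq by blast
      then have "r \<noteq> 0" using \<psi>(2) G0(1) by auto
      then show ?thesis unfolding r(2) using r(1) r1(2) by (intro order) auto
    qed
    have roots: "exp (Re z) < \<beta>" if "char_fun c a z = 0" "z \<noteq> of_real ?\<Lambda>" for z
      using lin.char_roots[OF that] \<beta>1 by linarith
    have w0: "w 0 = 0" by (simp add: w_def coord.zero q_def G0)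
    have Dw0: "blinfun_apply (Dw 0) p = 0" for p by (simp add: Dw_apply coord.zero q'_def G0)
    have "\<exists>(w :: C \<Rightarrow> C) (Dw :: C \<Rightarrow> C \<Rightarrow>\<^sub>L C). w ` NP \<subseteq> NQ \<and>
        (\<forall>\<phi>\<in>NP. (w has_derivative blinfun_apply (Dw \<phi>)) (at \<phi> within NP)) \<and> continuous_on NP Dw \<and> w 0 = 0 \<and>
        (\<forall>p\<in>P_space c a. blinfun_apply (Dw 0) p = 0) \<and> W = {e\<^sub>1 + (\<phi> + w \<phi>) | \<phi>. \<phi> \<in> NP}"
      using w_NQ w_der Dw_cont w0 Dw0 W_graph by (intro exI[of _ w] exI[of _ Dw]) simp
    then have "leading_setup g g' c d \<beta> NP NQ"
      unfolding leading_setup_def Let_def W_def[symmetric]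
      using \<beta> \<beta>2 roots NP_open NP_convex NP0 NQ_open NQ_convex NQ0 W_sides by blast
    then show ?thesis by blast
  qed
qed

lemma plus_solution_pulse_orbit:
  "plus_solution g c d M \<kappa> x t1 t2 \<Longrightarrow> pulse_orbit x t1 t2 \<and> M = orbit x"
  unfolding plus_solution_def pulse_orbit_def by blast

end

text \<open>Shows that the alternatives below and above the threshold exclude each other: values
  bounded below by m0 keep the orbit at distance at least m0 from 0.\<close>

lemma persistent_not_extinct:
  assumes con: "connects g c d W S {const_bcontfun 0}" and W: "W \<subseteq> CLip L m0 m1" and m0: "0 < m0"
  shows False
proof -
  obtain x where x: "W = orbit x" "((\<lambda>t. infdist (seg x t) {const_bcontfun 0 :: C}) \<longlongrightarrow> 0) at_top"
    using con unfolding connects_def orbit_connects_def by blast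
  have "\<forall>\<^sub>F t in at_top. infdist (seg x t) {const_bcontfun 0 :: C} < m0" using x(2) m0 by (rule order_tendstoD)
  then obtain t where t: "infdist (seg x t) {const_bcontfun 0 :: C} < m0" by (meson eventually_happens trivial_limit_at_top_linorder)
  have "seg x t \<in> CLip L m0 m1" using W x(1) by (auto simp: orbit_def)
  then have "m0 \<le> seg x t (to_hist 0)" by (simp add: CLip_def Cbetween_def)
  also have "\<dots> \<le> dist (seg x t (to_hist 0)) ((const_bcontfun 0 :: C) (to_hist 0))"
    by (simp add: const_bcontfun.rep_eq)
  also have "\<dots> \<le> dist (seg x t) (const_bcontfun 0 :: C)" by (rule dist_bounded)
  finally show False using t by simp
qed

theorem theorem1p1:
  fixes g g' :: "real \<Rightarrow> real" and c :: real
  assumes g: "nonlinearity g g'"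
    and c: "c > 0"
  shows
    "(\<forall>d>c. \<forall>\<beta> NP NQ. leading_setup g g' c d \<beta> NP NQ \<longrightarrow>
        connects g c d (Wu_minus g c d \<beta> NP NQ) {const_bcontfun (xi1 g c d)} {const_bcontfun 0})
     \<and>
     (\<exists>!dstar. dstar > c \<and>
        (\<forall>d \<beta> NP NQ. c < d \<and> d < dstar \<and> leading_setup g g' c d \<beta> NP NQ \<longrightarrow>
           connects g c d (Wu_plus g c d \<beta> NP NQ) {const_bcontfun (xi1 g c d)} {const_bcontfun 0})
        \<and>
        (\<forall>d \<beta> NP NQ \<kappa> xp t1 t2.
           d > dstar \<and> leading_setup g g' c d \<beta> NP NQ \<and> 0 < \<kappa> \<and> \<kappa> < 1 - xi1 g c d \<and>
           plus_solution g c d (Wu_plus g c d \<beta> NP NQ) \<kappa> xp t1 t2 \<longrightarrow>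
           (\<exists>m0 m1 \<sigma>. 0 < m0 \<and> m0 < 1 \<and> 1 < m1 \<and> m1 \<le> d / c \<and> 0 < \<sigma> \<and>
              Wu_plus g c d \<beta> NP NQ \<subseteq> CLip (2 * d) m0 m1 \<and>
              (\<forall>T\<ge>t2. \<exists>t\<in>{T..T + \<sigma>}. xp t = 1) \<and>
              (let A = omega_limit g c d (seg xp (t2 + 1)) in
                 A \<noteq> {} \<and> compact A \<and> A \<subseteq> CLip (2 * d) m0 m1 \<and>
                 ((\<lambda>t. infdist (seg xp t) A) \<longlongrightarrow> 0) at_top \<and>
                 const_bcontfun 0 \<notin> A \<and> const_bcontfun (xi1 g c d) \<notin> A)))
        \<and>
        (\<forall>d \<beta> NP NQ \<kappa> xp t1 t2 p \<omega>p.
           d > dstar \<and> leading_setup g g' c d \<beta> NP NQ \<and> 0 < \<kappa> \<and> \<kappa> < 1 - xi1 g c d \<and>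
           plus_solution g c d (Wu_plus g c d \<beta> NP NQ) \<kappa> xp t1 t2 \<and>
           entire_solution g c d p \<and> (\<forall>t. p t > 0) \<and> minimal_period p \<omega>p \<and>
           p 0 = 1 \<and> (\<forall>t\<in>{-1..<0}. p t > 1) \<and>
           (\<forall>t\<in>{0<..\<omega>p}. (p t, p (t - 1)) \<noteq> (1, the_inv_into {0..1} g (c / d))) \<longrightarrow>
           (let \<O> = seg p ` {0..\<omega>p} in
              (\<forall>t\<ge>t2 + 1. seg xp t \<in> \<O>) \<and>
              omega_limit g c d (seg xp (t2 + 1)) = \<O>)))"
proof -
  interpret pulse g g' c using g c by unfold_locales
  have ps: "pulse_super g g' c d" if "c < d" for d using that by unfold_locales
  let ?I = "\<lambda>dstar. \<forall>d \<beta> NP NQ. c < d \<and> d < dstar \<and> leading_setup g g' c d \<beta> NP NQ \<longrightarrow>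
    connects g c d (Wu_plus g c d \<beta> NP NQ) {const_bcontfun (xi1 g c d)} {const_bcontfun 0}"
  have I: "?I critical" using pulse_super.Wu_plus_connects[OF ps] by blast
  have super: "c < d" if "critical < d" for d using that critical_gt by simp
  have II: "\<exists>m0 m1 \<sigma>. 0 < m0 \<and> m0 < 1 \<and> 1 < m1 \<and> m1 \<le> d / c \<and> 0 < \<sigma> \<and>
      Wu_plus g c d \<beta> NP NQ \<subseteq> CLip (2 * d) m0 m1 \<and>
      (\<forall>T\<ge>t2. \<exists>t\<in>{T..T + \<sigma>}. xp t = 1) \<and>
      (let A = omega_limit g c d (seg xp (t2 + 1)) in
         A \<noteq> {} \<and> compact A \<and> A \<subseteq> CLip (2 * d) m0 m1 \<and>
         ((\<lambda>t. infdist (seg xp t) A) \<longlongrightarrow> 0) at_top \<and>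
         const_bcontfun 0 \<notin> A \<and> const_bcontfun (xi1 g c d) \<notin> A)"
    if d: "critical < d" and plus: "plus_solution g c d (Wu_plus g c d \<beta> NP NQ) \<kappa> xp t1 t2"
    for d \<beta> NP NQ \<kappa> xp t1 t2
  proof -
    note po = pulse_super.plus_solution_pulse_orbit[OF ps[OF super[OF d]] plus]
    show ?thesis
      using pulse_super.po_persistence[OF ps[OF super[OF d]] conjunct1[OF po] d]
      unfolding conjunct2[OF po] .
  qed
  have III: "(\<forall>t\<ge>t2 + 1. seg xp t \<in> seg p ` {0..\<omega>p}) \<and> omega_limit g c d (seg xp (t2 + 1)) = seg p ` {0..\<omega>p}"
    if d: "critical < d" and plus: "plus_solution g c d (Wu_plus g c d \<beta> NP NQ) \<kappa> xp t1 t2"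
      and p: "entire_solution g c d p" "minimal_period p \<omega>p" "p 0 = 1" "\<forall>t\<in>{-1..<0}. p t > 1"
    for d \<beta> NP NQ \<kappa> xp t1 t2 p \<omega>p
    by (rule pulse_super.po_periodic[OF ps[OF super[OF d]]
        conjunct1[OF pulse_super.plus_solution_pulse_orbit[OF ps[OF super[OF d]] plus]] p(1,2,3)])
      (use p(4) in blast)
  \<comment> \<open>Of the persistence property only a positive lower bound on the set is extracted;
    this already contradicts extinction.\<close>
  have unique: "e = critical"
    if e: "c < e" "?I e" and persist: "\<And>d \<beta> NP NQ \<kappa> xp t1 t2. e < d \<Longrightarrow> leading_setup g g' c d \<beta> NP NQ \<Longrightarrow>
      0 < \<kappa> \<Longrightarrow> \<kappa> < 1 - xi1 g c d \<Longrightarrow> plus_solution g c d (Wu_plus g c d \<beta> NP NQ) \<kappa> xp t1 t2 \<Longrightarrow>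
      \<exists>L m0 m1. 0 < m0 \<and> Wu_plus g c d \<beta> NP NQ \<subseteq> CLip L m0 m1" for e
  proof (rule ccontr)
    assume ne: "e \<noteq> critical"
    \<comment> \<open>At the midpoint one of the two candidate thresholds predicts extinction and
      the other persistence. A leading setup and a solution x^+ exist for this parameter, so the
      predictions are not vacuous and clash.\<close>
    define d where "d = (e + critical) / 2"
    have cd: "c < d" using e(1) critical_gt by (simp add: d_def)
    obtain \<beta> NP NQ where lead: "leading_setup g g' c d \<beta> NP NQ"
      using pulse_super.leading_setup_exists[OF ps[OF cd]] by blast
    obtain \<kappa> x t1 t2 where plus: "0 < \<kappa>" "\<kappa> < 1 - xi1 g c d" "plus_solution g c d (Wu_plus g c d \<beta> NP NQ) \<kappa> x t1 t2"
      using pulse_super.plus_solution_exists[OF ps[OF cd] lead] by blast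
    consider "e < d" "d < critical" | "d < e" "critical < d" using ne by (auto simp: d_def neq_iff)
    then show False
    proof cases
      case 1
      obtain L m0 m1 where "0 < m0" "Wu_plus g c d \<beta> NP NQ \<subseteq> CLip L m0 m1"
        using persist[OF 1(1) lead plus] by blast
      moreover have "connects g c d (Wu_plus g c d \<beta> NP NQ) {const_bcontfun (xi1 g c d)} {const_bcontfun 0}"
        using I cd 1(2) lead by blast
      ultimately show False using persistent_not_extinct by blast
    next
      case 2
      obtain m0 m1 where "0 < m0" "Wu_plus g c d \<beta> NP NQ \<subseteq> CLip (2 * d) m0 m1"
        using II[OF 2(2) plus(3)] by blast
      moreover have "connects g c d (Wu_plus g c d \<beta> NP NQ) {const_bcontfun (xi1 g c d)} {const_bcontfun 0}"
        using e(2) cd 2(1) lead by blast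
      ultimately show False using persistent_not_extinct by blast
    qed
  qed
  show ?thesis (is "?minus \<and> (\<exists>!dstar. ?threshold dstar)")
  proof
    show ?minus using pulse_super.Wu_minus_connects[OF ps] by blast
    show "\<exists>!dstar. ?threshold dstar"
    proof (rule ex1I[where P = ?threshold and a = critical])
      show "?threshold critical"
      proof (intro conjI allI impI, goal_cases)
        case 1
        show ?case by (rule critical_gt)
      next
        case (2 d \<beta> NP NQ)
        then show ?case using I by blast
      next
        case (3 d \<beta> NP NQ \<kappa> xp t1 t2)
        then show ?case by (elim conjE) (rule II)
      next
        case (4 d \<beta> NP NQ \<kappa> xp t1 t2 p \<omega>p)
        then show ?case unfolding Let_def by (elim conjE) (rule III)
      qed
    next
      fix e assume e: "?threshold e"
      note e1 = conjunct1[OF e] and e2 = conjunct1[OF conjunct2[OF e]]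
        and e3 = conjunct1[OF conjunct2[OF conjunct2[OF e]]]
      show "e = critical"
      proof (rule unique[OF e1 e2])
        fix d \<beta> NP NQ \<kappa> xp t1 t2
        assume "e < d" "leading_setup g g' c d \<beta> NP NQ" "0 < \<kappa>" "\<kappa> < 1 - xi1 g c d"
          "plus_solution g c d (Wu_plus g c d \<beta> NP NQ) \<kappa> xp t1 t2"
        then show "\<exists>L m0 m1. 0 < m0 \<and> Wu_plus g c d \<beta> NP NQ \<subseteq> CLip L m0 m1"
          using e3[THEN spec, of d, THEN spec, of \<beta>, THEN spec, of NP, THEN spec, of NQ, THEN spec, of \<kappa>,
            THEN spec, of xp, THEN spec, of t1, THEN spec, of t2] by blast
      qed
    qed
  qed
qed

end
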